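(* For $b=1,\dots,d$ let $V_b$ be the vector representation of $U_q(\mathfrak{gl}_{N_b})$, of dimension $N_b$, and let $M_b$ be a module in the category $\mathcal{O}$ for $U_q(\mathfrak{gl}_{N_b})$. Let $A=U_q(\mathfrak{gl}_{N_1})\boxtimes\cdots\boxtimes U_q(\mathfrak{gl}_{N_d})$, $V=V_1\oplus\cdots\oplus V_d$ and $M=M_1\boxtimes\cdots\boxtimes M_d$. There exists an algebra homomorphism $$\Phi^{\mathrm{aff}}\colon\mathrm{YH}^{\mathrm{aff}}_{d,n}\to\operatorname{End}_A(M\otimes V^{\otimes n}),$$ given by $t_i\mapsto\tau_i$ ($1\le i\le n$), $s_i\mapsto\sigma_i$ ($0\le i\le n-1$).
   Context: $q$ is an indeterminate, $\Bbbk=\mathbb{C}(q)$, $d\ge1$, $n\ge1$, all $N_b>1$, and $\zeta\in\Bbbk$ is a primitive $d$-th root of unity. $A$ has componentwise multiplication and comultiplication; $V_b$ is an $A$-module with the factors other than the $b$-th acting through their counits. The framed affine braid group $\mathcal{FB}^{\mathrm{aff}}_{d,n}$ has generators $s_0,s_1,\dots,s_{n-1},t_1,\dots,t_n$ and relations $s_0s_1s_0s_1=s_1s_0s_1s_0$; $s_is_j=s_js_i$ for $|i-j|>1$; $s_is_{i+1}s_i=s_{i+1}s_is_{i+1}$ for $1\le i\le n-2$; $t_j^d=1$; $t_it_j=t_jt_i$; $t_js_0=s_0t_j$; $t_js_i=s_it_{s_i(j)}$ for $1\le i\le n-1$, where $s_i$ acts on indices as the transposition $(i,i+1)$. The affine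 Yokonuma–Hecke algebra $\mathrm{YH}^{\mathrm{aff}}_{d,n}$ is the quotient of $\Bbbk[\mathcal{FB}^{\mathrm{aff}}_{d,n}]$ by the relations $s_i^2=(q-q^{-1})E_is_i+1$ for $i=1,\dots,n-1$, where $E_i=\frac1d\sum_{a=1}^dt_i^at_{i+1}^{-a}$. $\check R^{(b)}\in\operatorname{End}_{U_q(\mathfrak{gl}_{N_b})}(V_b\otimes V_b)$ is the action of the $R$-matrix (composed with the flip), normalized so that $(\check R^{(b)})^2=(q-q^{-1})\check R^{(b)}+1$, with eigenvalue $q$ on the $q$-symmetric square and $-q^{-1}$ on the $q$-antisymmetric square. $\check K^{(b)}=\check R_{V_b,M_b}\check R_{M_b,V_b}\in\operatorname{End}_{U_q(\mathfrak{gl}_{N_b})}(M_b\otimes V_b)$ is the double braiding. Operators on $M\otimes V^{\otimes n}$ (identity on unmentioned factors): $\tau_i$ acts on the $i$-th factor of $V^{\otimes n}$ by $v\mapsto\zeta^{b-1}v$ for $v\in V_b$; for $i\geq1$, $\sigma_i$ acts on factors $i,i+1$ of $V^{\otimes n}$ by $v\otimes w\mapsto w\otimes v$ if $v\in V_b,w\in V_c$, $b\neq c$, and by $\check R^{(b)}$ on $V_b\otimes V_b$; $\sigma_0$ acts on $M$ and the first factor of $V^{\otimes n}$, and on $(M_1\boxtimes\cdots\boxtimes M_d)\otimes V_b$ it acts as $\check K^{(b)}$ on the factors $M_b$ and $V_b$ and trivially on the others. *)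

theory Defs
  imports
    "HOL-Algebra.QuotRing"
    "HOL-Algebra.Module"
    "HOL-Library.Poly_Mapping"
    "HOL-Library.FuncSet"
    "HOL-Combinatorics.Transposition"
    "HOL-Computational_Algebra.Polynomial"
    "HOL-Computational_Algebra.Fraction_Field"
begin

section \<open>The ground field\<close>

type_synonym kk = "complex poly fract"

definition qq :: kk where "qq = Fract [:0, 1:] 1"

definition primitive_root_of_unity :: "nat \<Rightarrow> kk \<Rightarrow> bool" where
  "primitive_root_of_unity d z \<longleftrightarrow> z ^ d = 1 \<and> (\<forall>k. 0 < k \<and> k < d \<longrightarrow> z ^ k \<noteq> 1)"

definition qint :: "nat \<Rightarrow> kk" where
  "qint m = (qq ^ m - inverse qq ^ m) / (qq - inverse qq)"

definition qfact :: "nat \<Rightarrow> kk" where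
  "qfact m = (\<Prod>l\<in>{1..m}. qint l)"


section \<open>Vector spaces with a basis\<close>

text \<open>
  Every vector space over the field is presented by a basis: \<open>fsp B\<close> is the space of finite
  formal linear combinations of elements of \<open>B\<close>. The tensor product of \<open>fsp B\<close> and \<open>fsp C\<close> is
  \<open>fsp (B \<times> C)\<close>, and similarly for several factors. An operator is a function on the whole type
  of formal combinations of which only the values on the relevant \<open>fsp B\<close> matter.
\<close>

type_synonym 'a vec = "'a \<Rightarrow>\<^sub>0 kk"
type_synonym 'a oper = "'a vec \<Rightarrow> 'a vec"

definition fsp :: "'a set \<Rightarrow> 'a vec set" where
  "fsp B = {v. Poly_Mapping.keys v \<subseteq> B}"

definition scl :: "kk \<Rightarrow> 'a vec \<Rightarrow> 'a vec" where
  "scl c v = Poly_Mapping.map ((*) c) v"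

lemma lookup_scl [simp]: "Poly_Mapping.lookup (scl c v) x = c * Poly_Mapping.lookup v x"
  by (simp add: scl_def map.rep_eq when_def)

interpretation kvs: vector_space "scl :: kk \<Rightarrow> 'a vec \<Rightarrow> 'a vec"
  by unfold_locales
    (auto intro!: poly_mapping_eqI simp: lookup_add algebra_simps)

definition bvec :: "'a \<Rightarrow> 'a vec" where
  "bvec a = Poly_Mapping.single a 1"

definition lin_ext :: "('a \<Rightarrow> 'b vec) \<Rightarrow> 'a vec \<Rightarrow> 'b vec" where
  "lin_ext \<phi> v = (\<Sum>a\<in>Poly_Mapping.keys v. scl (Poly_Mapping.lookup v a) (\<phi> a))"

definition reindex :: "('a \<Rightarrow> 'b) \<Rightarrow> 'a vec \<Rightarrow> 'b vec" where
  "reindex h = lin_ext (\<lambda>a. bvec (h a))"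

definition tens :: "'a vec \<Rightarrow> 'b vec \<Rightarrow> ('a \<times> 'b) vec" where
  "tens v w = lin_ext (\<lambda>a. lin_ext (\<lambda>b. bvec (a, b)) w) v"

definition tens_op :: "'a oper \<Rightarrow> 'b oper \<Rightarrow> ('a \<times> 'b) oper" where
  "tens_op S T = lin_ext (\<lambda>(a, b). tens (S (bvec a)) (T (bvec b)))"

definition linear_on :: "'a set \<Rightarrow> 'a oper \<Rightarrow> bool" where
  "linear_on B T \<longleftrightarrow>
     (\<forall>v\<in>fsp B. T v \<in> fsp B) \<and>
     (\<forall>v\<in>fsp B. \<forall>w\<in>fsp B. T (v + w) = T v + T w) \<and>
     (\<forall>c. \<forall>v\<in>fsp B. T (scl c v) = scl c (T v))"

definition word_op :: "('g \<Rightarrow> 'a oper) \<Rightarrow> 'g list \<Rightarrow> 'a oper" where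
  "word_op \<rho> u = foldr (\<lambda>g T. \<rho> g \<circ> T) u id"


section \<open>Modules over the quantum group of \<open>gl\<^sub>N\<close>\<close>

text \<open>
  \<open>GE i\<close>, \<open>GF i\<close> are the Chevalley generators, \<open>GK j\<close> is the group-like element
  \<open>q\<close> to the \<open>j\<close>-th standard coweight and \<open>GKi j\<close> its inverse; the usual \<open>K\<^sub>i\<close> of
  the \<open>i\<close>-th simple root is \<open>GK i\<close> times \<open>GKi (i + 1)\<close>.
\<close>

datatype uqgen = GE nat | GF nat | GK nat | GKi nat

definition uq_gens :: "nat \<Rightarrow> uqgen set" where
  "uq_gens N = GE ` {1..<N} \<union> GF ` {1..<N} \<union> GK ` {1..N} \<union> GKi ` {1..N}"

text \<open>The exponent of \<open>q\<close> in the commutation of \<open>GK j\<close> with \<open>GE i\<close>.\<close>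

definition wt_factor :: "nat \<Rightarrow> nat \<Rightarrow> kk" where
  "wt_factor j i = (if j = i then qq else if j = Suc i then inverse qq else 1)"

text \<open>A module is given by the action of the generators, subject to the Drinfeld-Jimbo relations.\<close>

definition uq_module :: "nat \<Rightarrow> 'a set \<Rightarrow> (uqgen \<Rightarrow> 'a oper) \<Rightarrow> bool" where
  "uq_module N B \<rho> \<longleftrightarrow>
     (\<forall>x\<in>uq_gens N. linear_on B (\<rho> x)) \<and>
     (\<forall>v\<in>fsp B.
        (\<forall>j\<in>{1..N}. \<rho> (GK j) (\<rho> (GKi j) v) = v \<and> \<rho> (GKi j) (\<rho> (GK j) v) = v) \<and>
        (\<forall>j\<in>{1..N}. \<forall>k\<in>{1..N}. \<rho> (GK j) (\<rho> (GK k) v) = \<rho> (GK k) (\<rho> (GK j) v)) \<and>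
        (\<forall>j\<in>{1..N}. \<forall>i\<in>{1..<N}.
           \<rho> (GK j) (\<rho> (GE i) v) = scl (wt_factor j i) (\<rho> (GE i) (\<rho> (GK j) v)) \<and>
           \<rho> (GK j) (\<rho> (GF i) v) = scl (inverse (wt_factor j i)) (\<rho> (GF i) (\<rho> (GK j) v))) \<and>
        (\<forall>i\<in>{1..<N}. \<forall>j\<in>{1..<N}.
           \<rho> (GE i) (\<rho> (GF j) v) - \<rho> (GF j) (\<rho> (GE i) v) =
             (if i = j
              then scl (1 / (qq - inverse qq))
                     (\<rho> (GK i) (\<rho> (GKi (Suc i)) v) - \<rho> (GKi i) (\<rho> (GK (Suc i)) v))
              else 0)) \<and>
        (\<forall>X\<in>{GE, GF}. \<forall>i\<in>{1..<N}. \<forall>j\<in>{1..<N}.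
           (Suc i < j \<longrightarrow> \<rho> (X i) (\<rho> (X j) v) = \<rho> (X j) (\<rho> (X i) v)) \<and>
           (i = Suc j \<or> j = Suc i \<longrightarrow>
              \<rho> (X i) (\<rho> (X i) (\<rho> (X j) v))
              - scl (qq + inverse qq) (\<rho> (X i) (\<rho> (X j) (\<rho> (X i) v)))
              + \<rho> (X j) (\<rho> (X i) (\<rho> (X i) v)) = 0)))"

text \<open>
  Category O: finitely generated weight modules on which the subalgebra generated by the \<open>GE i\<close>
  acts locally finitely. Weights are arbitrary characters of the torus part, they need not be
  powers of \<open>q\<close>.
\<close>

definition weight_vector :: "nat \<Rightarrow> 'a set \<Rightarrow> (uqgen \<Rightarrow> 'a oper) \<Rightarrow> 'a vec \<Rightarrow> bool" where
  "weight_vector N B \<rho> v \<longleftrightarrow>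
     v \<in> fsp B \<and> (\<exists>\<mu> :: nat \<Rightarrow> kk. \<forall>j\<in>{1..N}. \<rho> (GK j) v = scl (\<mu> j) v)"

definition category_O :: "nat \<Rightarrow> 'a set \<Rightarrow> (uqgen \<Rightarrow> 'a oper) \<Rightarrow> bool" where
  "category_O N B \<rho> \<longleftrightarrow>
     uq_module N B \<rho> \<and>
     fsp B \<subseteq> kvs.span {v. weight_vector N B \<rho> v} \<and>
     (\<exists>S. finite S \<and> S \<subseteq> fsp B \<and>
        fsp B \<subseteq> kvs.span {word_op \<rho> u s |u s. u \<in> lists (uq_gens N) \<and> s \<in> S}) \<and>
     (\<forall>v\<in>fsp B. \<exists>S. finite S \<and>
        (\<forall>u\<in>lists (GE ` {1..<N}). word_op \<rho> u v \<in> kvs.span S))"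

text \<open>The vector representation of \<open>gl\<^sub>N\<close> lives on \<open>fsp {1..N}\<close>.\<close>

fun vec_rep :: "uqgen \<Rightarrow> nat oper" where
  "vec_rep (GE i) = lin_ext (\<lambda>j. if j = Suc i then bvec i else 0)"
| "vec_rep (GF i) = lin_ext (\<lambda>j. if j = i then bvec (Suc i) else 0)"
| "vec_rep (GK i) = lin_ext (\<lambda>j. scl (if j = i then qq else 1) (bvec j))"
| "vec_rep (GKi i) = lin_ext (\<lambda>j. scl (if j = i then inverse qq else 1) (bvec j))"

text \<open>
  The comultiplication of a generator, as a list of pairs of words whose tensors are to be summed:
  \<open>E \<mapsto> E \<otimes> K + 1 \<otimes> E\<close> and \<open>F \<mapsto> F \<otimes> 1 + K\<inverse> \<otimes> F\<close>.
\<close>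

fun uq_comult :: "uqgen \<Rightarrow> (uqgen list \<times> uqgen list) list" where
  "uq_comult (GE i) = [([GE i], [GK i, GKi (Suc i)]), ([], [GE i])]"
| "uq_comult (GF i) = [([GF i], []), ([GKi i, GK (Suc i)], [GF i])]"
| "uq_comult (GK j) = [([GK j], [GK j])]"
| "uq_comult (GKi j) = [([GKi j], [GKi j])]"

fun uq_counit :: "uqgen \<Rightarrow> kk" where
  "uq_counit (GE i) = 0"
| "uq_counit (GF i) = 0"
| "uq_counit (GK j) = 1"
| "uq_counit (GKi j) = 1"


section \<open>The R-matrix\<close>

text \<open>
  \<open>E_root \<rho> i k\<close> and \<open>F_root \<rho> i k\<close> are the root vectors for the positive root
  \<open>\<epsilon>\<^sub>i - \<epsilon>\<^sub>j\<close> with \<open>j = i + k + 1\<close>, and its negative: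
  \<open>E\<^sub>i\<^sub>j = E\<^sub>i\<^sub>,\<^sub>j\<^sub>-\<^sub>1 E\<^sub>j\<^sub>-\<^sub>1 - q\<inverse> E\<^sub>j\<^sub>-\<^sub>1 E\<^sub>i\<^sub>,\<^sub>j\<^sub>-\<^sub>1\<close> and
  \<open>F\<^sub>i\<^sub>j = F\<^sub>j\<^sub>-\<^sub>1 F\<^sub>i\<^sub>,\<^sub>j\<^sub>-\<^sub>1 - q F\<^sub>i\<^sub>,\<^sub>j\<^sub>-\<^sub>1 F\<^sub>j\<^sub>-\<^sub>1\<close>.
\<close>

primrec E_root :: "(uqgen \<Rightarrow> 'a oper) \<Rightarrow> nat \<Rightarrow> nat \<Rightarrow> 'a oper" where
  "E_root \<rho> i 0 = \<rho> (GE i)"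
| "E_root \<rho> i (Suc k) = (\<lambda>v. E_root \<rho> i k (\<rho> (GE (i + Suc k)) v)
     - scl (inverse qq) (\<rho> (GE (i + Suc k)) (E_root \<rho> i k v)))"

primrec F_root :: "(uqgen \<Rightarrow> 'a oper) \<Rightarrow> nat \<Rightarrow> nat \<Rightarrow> 'a oper" where
  "F_root \<rho> i 0 = \<rho> (GF i)"
| "F_root \<rho> i (Suc k) = (\<lambda>v. \<rho> (GF (i + Suc k)) (F_root \<rho> i k v)
     - scl qq (F_root \<rho> i k (\<rho> (GF (i + Suc k)) v)))"

text \<open>
  The q-exponential of \<open>(q - q\<inverse>) T\<close> for a locally nilpotent operator \<open>T\<close>; the sum
  is finite on every vector.
\<close>

definition qexp_op :: "'a oper \<Rightarrow> 'a oper" where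
  "qexp_op T v = Sum_any (\<lambda>m.
     scl (qq ^ (m * (m - 1) div 2) * (qq - inverse qq) ^ m / qfact m) ((T ^^ m) v))"

definition pos_roots :: "nat \<Rightarrow> (nat \<times> nat) list" where
  "pos_roots N = concat (map (\<lambda>i. map (\<lambda>j. (i, j)) [Suc i..<Suc N]) [1..<N])"

text \<open>
  The quasi-R-matrix acting on the tensor product of two modules: the product of the
  q-exponentials of \<open>(q - q\<inverse>) E\<^sub>i\<^sub>j \<otimes> F\<^sub>i\<^sub>j\<close> over the positive roots
  in lexicographic order (a convex order), the smallest root leftmost.
\<close>

definition quasi_R ::
  "nat \<Rightarrow> (uqgen \<Rightarrow> 'a oper) \<Rightarrow> (uqgen \<Rightarrow> 'b oper) \<Rightarrow> ('a \<times> 'b) oper" where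
  "quasi_R N \<rho> \<rho>' = foldr
     (\<lambda>(i, j) T. qexp_op (tens_op (E_root \<rho> i (j - Suc i)) (F_root \<rho>' i (j - Suc i))) \<circ> T)
     (pos_roots N) id"

definition flip_op :: "('a \<times> 'b) vec \<Rightarrow> ('b \<times> 'a) vec" where
  "flip_op = reindex prod.swap"

text \<open>
  The universal R-matrix is the quasi-R-matrix followed by the Cartan part, which multiplies a
  tensor of weight vectors of weights \<open>\<lambda>\<close>, \<open>\<mu>\<close> by \<open>q\<close> to the power \<open>(\<lambda>, \<mu>)\<close>. When one factor is the
  vector representation, with basis vector \<open>j\<close> of weight \<open>\<epsilon>\<^sub>j\<close>, the Cartan part is the
  action of \<open>GK j\<close> on the other factor. The functions below compose the R-matrix with the flip.
\<close>

definition R_check_MV :: "nat \<Rightarrow> (uqgen \<Rightarrow> 'a oper) \<Rightarrow> ('a \<times> nat) vec \<Rightarrow> (nat \<times> 'a) vec" where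
  "R_check_MV N \<rho> v =
     flip_op (lin_ext (\<lambda>(x, j). tens (\<rho> (GK j) (bvec x)) (bvec j)) (quasi_R N \<rho> vec_rep v))"

definition R_check_VM :: "nat \<Rightarrow> (uqgen \<Rightarrow> 'a oper) \<Rightarrow> (nat \<times> 'a) vec \<Rightarrow> ('a \<times> nat) vec" where
  "R_check_VM N \<rho> v =
     flip_op (lin_ext (\<lambda>(j, x). tens (bvec j) (\<rho> (GK j) (bvec x))) (quasi_R N vec_rep \<rho> v))"

text \<open>
  On the square of the vector representation this needs no further rescaling: on two copies of the
  same basis vector it acts by \<open>q\<close>.
\<close>

definition R_check :: "nat \<Rightarrow> (nat \<times> nat) oper" where
  "R_check N = R_check_MV N vec_rep"

definition K_check :: "nat \<Rightarrow> (uqgen \<Rightarrow> 'a oper) \<Rightarrow> ('a \<times> nat) oper" where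
  "K_check N \<rho> = R_check_VM N \<rho> \<circ> R_check_MV N \<rho>"


section \<open>The \<open>A\<close>-module \<open>M \<otimes> V\<^sup>n\<close>\<close>

text \<open>
  The generators of \<open>A\<close> are the pairs \<open>(b, x)\<close> of a factor and a generator of that factor. The
  basis of \<open>V\<close> consists of the pairs \<open>(b, j)\<close> with \<open>1 \<le> j \<le> N b\<close>. A basis element of
  \<open>M \<otimes> V\<^sup>n\<close> is a family of basis elements of the \<open>M b\<close> together with a list of length \<open>n\<close> of
  basis elements of \<open>V\<close>; the \<open>i\<close>-th tensor factor is the list entry with index \<open>i - 1\<close>.
\<close>

definition A_gens :: "nat \<Rightarrow> (nat \<Rightarrow> nat) \<Rightarrow> (nat \<times> uqgen) set" where
  "A_gens d N = (SIGMA b:{1..d}. uq_gens (N b))"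

definition V_basis :: "nat \<Rightarrow> (nat \<Rightarrow> nat) \<Rightarrow> (nat \<times> nat) set" where
  "V_basis d N = (SIGMA b:{1..d}. {1..N b})"

type_synonym 'm tbasis = "(nat \<Rightarrow> 'm) \<times> (nat \<times> nat) list"

definition MV_basis :: "nat \<Rightarrow> nat \<Rightarrow> (nat \<Rightarrow> nat) \<Rightarrow> (nat \<Rightarrow> 'm set) \<Rightarrow> 'm tbasis set" where
  "MV_basis d n N B =
     (\<Pi>\<^sub>E b\<in>{1..d}. B b) \<times> {vs. length vs = n \<and> set vs \<subseteq> V_basis d N}"

definition A_comult ::
  "nat \<times> uqgen \<Rightarrow> ((nat \<times> uqgen) list \<times> (nat \<times> uqgen) list) list" where
  "A_comult = (\<lambda>(b, x). map (\<lambda>(u, w). (map (Pair b) u, map (Pair b) w)) (uq_comult x))"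

definition A_tensor ::
  "(nat \<times> uqgen \<Rightarrow> 'a oper) \<Rightarrow> (nat \<times> uqgen \<Rightarrow> 'b oper) \<Rightarrow> nat \<times> uqgen \<Rightarrow> ('a \<times> 'b) oper" where
  "A_tensor \<alpha> \<beta> g v = (\<Sum>(u, w)\<leftarrow>A_comult g. tens_op (word_op \<alpha> u) (word_op \<beta> w) v)"

definition act_M :: "(nat \<Rightarrow> uqgen \<Rightarrow> 'm oper) \<Rightarrow> nat \<times> uqgen \<Rightarrow> (nat \<Rightarrow> 'm) oper" where
  "act_M \<rho> = (\<lambda>(b, x). lin_ext (\<lambda>m. reindex (\<lambda>y. m(b := y)) (\<rho> b x (bvec (m b)))))"

definition act_V :: "nat \<times> uqgen \<Rightarrow> (nat \<times> nat) oper" where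
  "act_V = (\<lambda>(b, x). lin_ext (\<lambda>(c, j).
     if c = b then reindex (Pair b) (vec_rep x (bvec j)) else scl (uq_counit x) (bvec (c, j))))"

text \<open>
  The action on \<open>M \<otimes> V\<^sup>n\<^sup>+\<^sup>1\<close> is that on \<open>(M \<otimes> V\<^sup>n) \<otimes> V\<close>, transported along the
  bijection of bases that appends the last factor to the list.
\<close>

primrec act_MV ::
  "(nat \<Rightarrow> uqgen \<Rightarrow> 'm oper) \<Rightarrow> nat \<Rightarrow> nat \<times> uqgen \<Rightarrow> 'm tbasis oper" where
  "act_MV \<rho> 0 = (\<lambda>g. lin_ext (\<lambda>(m, vs). reindex (\<lambda>m'. (m', [])) (act_M \<rho> g (bvec m))))"
| "act_MV \<rho> (Suc n) = (\<lambda>g. lin_ext (\<lambda>(m, vs).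
     reindex (\<lambda>((m', ws), w). (m', ws @ [w]))
       (A_tensor (act_MV \<rho> n) act_V g (bvec ((m, butlast vs), last vs)))))"

text \<open>
  \<open>A\<close>-linearity is commutation with the generators of \<open>A\<close>. Endomorphisms are functions on
  \<open>M \<otimes> V\<^sup>n\<close>, hence extensional.
\<close>

definition End_A ::
  "nat \<Rightarrow> nat \<Rightarrow> (nat \<Rightarrow> nat) \<Rightarrow> (nat \<Rightarrow> 'm set) \<Rightarrow> (nat \<Rightarrow> uqgen \<Rightarrow> 'm oper) \<Rightarrow>
   (kk, 'm tbasis oper) module" where
  "End_A d n N B \<rho> =
     (let X = fsp (MV_basis d n N B) in
      \<lparr>carrier = {f \<in> extensional X. linear_on (MV_basis d n N B) f \<and>
           (\<forall>g\<in>A_gens d N. \<forall>v\<in>X. f (act_MV \<rho> n g v) = act_MV \<rho> n g (f v))},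
       monoid.mult = compose X,
       one = (\<lambda>v\<in>X. v),
       zero = (\<lambda>v\<in>X. 0),
       add = (\<lambda>f g. \<lambda>v\<in>X. f v + g v),
       module.smult = (\<lambda>c f. \<lambda>v\<in>X. scl c (f v))\<rparr>)"

definition tau_op :: "kk \<Rightarrow> nat \<Rightarrow> 'm tbasis oper" where
  "tau_op \<zeta> i = lin_ext (\<lambda>(m, vs). scl (\<zeta> ^ (fst (vs ! (i - 1)) - 1)) (bvec (m, vs)))"

definition sigma_VV :: "(nat \<Rightarrow> nat) \<Rightarrow> ((nat \<times> nat) \<times> (nat \<times> nat)) oper" where
  "sigma_VV N = lin_ext (\<lambda>((b, j), (c, k)).
     if b = c then reindex (\<lambda>(j', k'). ((b, j'), (b, k'))) (R_check (N b) (bvec (j, k)))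
     else bvec ((c, k), (b, j)))"

definition sigma_op ::
  "(nat \<Rightarrow> nat) \<Rightarrow> (nat \<Rightarrow> uqgen \<Rightarrow> 'm oper) \<Rightarrow> nat \<Rightarrow> 'm tbasis oper" where
  "sigma_op N \<rho> i =
     (if i = 0
      then lin_ext (\<lambda>(m, vs). case vs ! 0 of (b, j) \<Rightarrow>
             reindex (\<lambda>(y, k). (m(b := y), vs[0 := (b, k)]))
               (K_check (N b) (\<rho> b) (bvec (m b, j))))
      else lin_ext (\<lambda>(m, vs).
             reindex (\<lambda>(v, w). (m, vs[i - 1 := v, i := w]))
               (sigma_VV N (bvec (vs ! (i - 1), vs ! i)))))"


section \<open>The framed affine braid group\<close>

text \<open>
  A group presentation: words in letters \<open>(x, e)\<close>, where \<open>(x, True)\<close> stands for the generator \<open>x\<close>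
  and \<open>(x, False)\<close> for its inverse, modulo the congruence generated by the relations and
  free cancellation.
\<close>

type_synonym 'x word = "('x \<times> bool) list"

definition words :: "'x set \<Rightarrow> 'x word set" where
  "words X = lists (X \<times> UNIV)"

inductive word_cong :: "'x set \<Rightarrow> ('x word \<times> 'x word) set \<Rightarrow> 'x word \<Rightarrow> 'x word \<Rightarrow> bool"
  for X R where
  refl: "u \<in> words X \<Longrightarrow> word_cong X R u u"
| sym: "word_cong X R u v \<Longrightarrow> word_cong X R v u"
| trans: "word_cong X R u v \<Longrightarrow> word_cong X R v w \<Longrightarrow> word_cong X R u w"
| cancel: "u \<in> words X \<Longrightarrow> v \<in> words X \<Longrightarrow> x \<in> X \<Longrightarrow>
     word_cong X R (u @ [(x, e), (x, \<not> e)] @ v) (u @ v)"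
| rel: "u \<in> words X \<Longrightarrow> v \<in> words X \<Longrightarrow> (l, r) \<in> R \<Longrightarrow> l \<in> words X \<Longrightarrow> r \<in> words X \<Longrightarrow>
     word_cong X R (u @ l @ v) (u @ r @ v)"

definition word_class :: "'x set \<Rightarrow> ('x word \<times> 'x word) set \<Rightarrow> 'x word \<Rightarrow> 'x word set" where
  "word_class X R u = {v. word_cong X R u v}"

definition presented_group ::
  "'x set \<Rightarrow> ('x word \<times> 'x word) set \<Rightarrow> 'x word set monoid" where
  "presented_group X R =
     \<lparr>carrier = word_class X R ` words X,
      monoid.mult = (\<lambda>P Q. \<Union>u\<in>P. \<Union>v\<in>Q. word_class X R (u @ v)),
      one = word_class X R []\<rparr>"

datatype fbgen = S nat | T nat

definition fb_gens :: "nat \<Rightarrow> fbgen set" where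
  "fb_gens n = S ` {0..<n} \<union> T ` {1..n}"

abbreviation pos_word :: "fbgen list \<Rightarrow> fbgen word" where
  "pos_word xs \<equiv> map (\<lambda>x. (x, True)) xs"

definition fb_rels :: "nat \<Rightarrow> nat \<Rightarrow> (fbgen word \<times> fbgen word) set" where
  "fb_rels d n =
     (if 2 \<le> n then {(pos_word [S 0, S 1, S 0, S 1], pos_word [S 1, S 0, S 1, S 0])} else {}) \<union>
     {(pos_word [S i, S j], pos_word [S j, S i]) | i j. i < n \<and> j < n \<and> (Suc i < j \<or> Suc j < i)} \<union>
     {(pos_word [S i, S (i + 1), S i], pos_word [S (i + 1), S i, S (i + 1)]) | i.
        1 \<le> i \<and> i + 2 \<le> n} \<union>
     {(pos_word (replicate d (T j)), []) | j. j \<in> {1..n}} \<union>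
     {(pos_word [T i, T j], pos_word [T j, T i]) | i j. i \<in> {1..n} \<and> j \<in> {1..n}} \<union>
     {(pos_word [T j, S 0], pos_word [S 0, T j]) | j. j \<in> {1..n}} \<union>
     {(pos_word [T j, S i], pos_word [S i, T (Transposition.transpose i (i + 1) j)]) | i j.
        1 \<le> i \<and> i < n \<and> j \<in> {1..n}}"

definition FB_aff :: "nat \<Rightarrow> nat \<Rightarrow> fbgen word set monoid" where
  "FB_aff d n = presented_group (fb_gens n) (fb_rels d n)"

definition fb :: "nat \<Rightarrow> nat \<Rightarrow> fbgen \<Rightarrow> fbgen word set" where
  "fb d n x = word_class (fb_gens n) (fb_rels d n) [(x, True)]"


section \<open>The affine Yokonuma-Hecke algebra\<close>

definition group_algebra :: "('g, 'z) monoid_scheme \<Rightarrow> (kk, 'g \<Rightarrow> kk) module" where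
  "group_algebra G =
     \<lparr>carrier = {f. finite {x. f x \<noteq> 0} \<and> {x. f x \<noteq> 0} \<subseteq> carrier G},
      monoid.mult = (\<lambda>f g z. \<Sum>(x, y)\<in>{(x, y). f x \<noteq> 0 \<and> g y \<noteq> 0 \<and> x \<otimes>\<^bsub>G\<^esub> y = z}. f x * g y),
      one = (\<lambda>z. if z = \<one>\<^bsub>G\<^esub> then 1 else 0),
      zero = (\<lambda>z. 0),
      add = (\<lambda>f g z. f z + g z),
      module.smult = (\<lambda>c f z. c * f z)\<rparr>"

definition delta :: "'g \<Rightarrow> 'g \<Rightarrow> kk" where
  "delta x = (\<lambda>z. if z = x then 1 else 0)"

definition quot_algebra :: "('k, 'a) module \<Rightarrow> 'a set \<Rightarrow> ('k, 'a set) module" where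
  "quot_algebra A I =
     ring.extend (A Quot I)
       \<lparr>module.smult = (\<lambda>c P. \<Union>x\<in>P. I +>\<^bsub>A\<^esub> (c \<odot>\<^bsub>A\<^esub> x))\<rparr>"

definition alg_hom :: "('k, 'a) module \<Rightarrow> ('k, 'b) module \<Rightarrow> ('a \<Rightarrow> 'b) set" where
  "alg_hom A B =
     {h \<in> ring_hom A B. \<forall>c. \<forall>x\<in>carrier A. h (c \<odot>\<^bsub>A\<^esub> x) = c \<odot>\<^bsub>B\<^esub> h x}"

abbreviation kFB :: "nat \<Rightarrow> nat \<Rightarrow> (kk, fbgen word set \<Rightarrow> kk) module" where
  "kFB d n \<equiv> group_algebra (FB_aff d n)"

definition yh_E :: "nat \<Rightarrow> nat \<Rightarrow> nat \<Rightarrow> fbgen word set \<Rightarrow> kk" where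
  "yh_E d n i = (\<lambda>z. 1 / of_nat d * (\<Sum>a\<in>{1..d}.
     delta (fb d n (T i) [^]\<^bsub>FB_aff d n\<^esub> int a
            \<otimes>\<^bsub>FB_aff d n\<^esub> fb d n (T (i + 1)) [^]\<^bsub>FB_aff d n\<^esub> (- int a)) z))"

definition yh_rel :: "nat \<Rightarrow> nat \<Rightarrow> nat \<Rightarrow> fbgen word set \<Rightarrow> kk" where
  "yh_rel d n i =
     (delta (fb d n (S i)) \<otimes>\<^bsub>kFB d n\<^esub> delta (fb d n (S i)))
     \<ominus>\<^bsub>kFB d n\<^esub> ((qq - inverse qq) \<odot>\<^bsub>kFB d n\<^esub> (yh_E d n i \<otimes>\<^bsub>kFB d n\<^esub> delta (fb d n (S i)))
          \<oplus>\<^bsub>kFB d n\<^esub> \<one>\<^bsub>kFB d n\<^esub>)"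

definition yh_ideal :: "nat \<Rightarrow> nat \<Rightarrow> (fbgen word set \<Rightarrow> kk) set" where
  "yh_ideal d n = genideal (kFB d n) (yh_rel d n ` {1..<n})"

definition YH_aff :: "nat \<Rightarrow> nat \<Rightarrow> (kk, (fbgen word set \<Rightarrow> kk) set) module" where
  "YH_aff d n = quot_algebra (kFB d n) (yh_ideal d n)"

definition yh :: "nat \<Rightarrow> nat \<Rightarrow> fbgen \<Rightarrow> (fbgen word set \<Rightarrow> kk) set" where
  "yh d n x = yh_ideal d n +>\<^bsub>kFB d n\<^esub> delta (fb d n x)"

end

theory Submission
  imports Defs
begin

text \<open>
  The matrix coefficients of the \<open>R\<close>-matrix of a module with the vector representation are two
  triangular L-operators, whose entries are root vectors times weight factors. Their commutation
  relations with the Chevalley generators make the two braidings of the module with the vector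
  representation intertwiners; the comultiplication of the L-operators (the hexagon axiom)
  together with this naturality yields the Yang-Baxter and the reflection equation, and the
  vector representation itself gives the Hecke relation. Tensor factors from different blocks
  are merely flipped, and the sum over the powers of \<open>\<zeta>\<close> in \<open>E\<^sub>i\<close> projects on the part where the
  \<open>i\<close>-th and \<open>(i + 1)\<close>-st factor lie in the same block, so that the relations hold block by
  block. The homomorphism then comes from the universal properties of the presented group, of its
  group algebra and of the quotient.
\<close>

section \<open>Linear maps on spaces of formal combinations\<close>

text \<open>The R-matrix is a product of q-exponentials in a fixed convex order, whereas
  intertwining and comultiplication are visible only on matrix coefficients. Against the vector
  representation every factor is 1 plus a multiple of a square-zero operator. On M (x) V the product
  of any two of these operators, taken in the prescribed order, vanishes, so a single sum remains
  and its entries are the root vectors of the definition. On V (x) M chains of factors survive; the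
  sum over all chains is the root vector of the opposite bracket, with 1/q in place of q, and this
  identity (\<open>FB_FR\<close>) ties the second L-operator to the R-matrix. Both L-operators can
  moreover be solved from their commutation relation with one Chevalley generator. As expressions in
  the generators (\<open>Lr\<close>, \<open>Pr\<close>) they commute with every intertwiner, and
  their value on a tensor product follows by induction from the comultiplication alone. A module on
  a space with basis B says nothing about vectors outside that space; extending it by the counit,
  with agreement on the original space, allows all identities to be computed in one ring of
  operators.\<close>

definition lin :: "('a vec \<Rightarrow> 'b vec) \<Rightarrow> bool" where
  "lin f \<longleftrightarrow> (\<forall>v w. f (v + w) = f v + f w) \<and> (\<forall>c v. f (scl c v) = scl c (f v))"

lemma linI: "(\<And>v w. f (v + w) = f v + f w) \<Longrightarrow> (\<And>c v. f (scl c v) = scl c (f v)) \<Longrightarrow> lin f"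
  by (simp add: lin_def)

lemma lin_add: "lin f \<Longrightarrow> f (v + w) = f v + f w"
  and lin_scl: "lin f \<Longrightarrow> f (scl c v) = scl c (f v)"
  by (simp_all add: lin_def)

lemma lin_0: "lin f \<Longrightarrow> f 0 = 0"
  using lin_scl[of f 0 0] by simp

lemma lin_minus: "lin f \<Longrightarrow> f (- v) = - f v"
  using lin_scl[of f "- 1" v] by simp

lemma lin_diff: "lin f \<Longrightarrow> f (v - w) = f v - f w"
  using lin_add[of f v "- w"] by (simp add: lin_minus)

lemma lin_sum: "lin f \<Longrightarrow> f (sum g A) = (\<Sum>a\<in>A. f (g a))"
  by (induction A rule: infinite_finite_induct) (simp_all add: lin_0 lin_add)

lemmas lin_simps = lin_add lin_scl lin_0 lin_minus lin_diff lin_sum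

lemma lin_compose: "lin f \<Longrightarrow> lin g \<Longrightarrow> lin (\<lambda>v. f (g v))"
  by (simp add: lin_def)

lemma lin_comp [intro]: "lin f \<Longrightarrow> lin g \<Longrightarrow> lin (f \<circ> g)"
  by (simp add: lin_def)

lemma lin_id [simp, intro]: "lin id" "lin (\<lambda>v. v)"
  by (simp_all add: lin_def)

lemma lin_plus: "lin f \<Longrightarrow> lin g \<Longrightarrow> lin (\<lambda>v. f v + g v)"
  and lin_minus': "lin f \<Longrightarrow> lin g \<Longrightarrow> lin (\<lambda>v. f v - g v)"
  and lin_scale: "lin f \<Longrightarrow> lin (\<lambda>v. scl c (f v))"
  and lin_zero: "lin (\<lambda>v. 0)"
  by (simp_all add: lin_def algebra_simps kvs.scale_right_diff_distrib)

lemma lookup_sum_vec: "Poly_Mapping.lookup (sum f A) x = (\<Sum>a\<in>A. Poly_Mapping.lookup (f a) x)"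
  by (induction A rule: infinite_finite_induct) (simp_all add: lookup_add)

lemma lin_ext_superset:
  assumes "finite X" "Poly_Mapping.keys v \<subseteq> X"
  shows "lin_ext \<phi> v = (\<Sum>a\<in>X. scl (Poly_Mapping.lookup v a) (\<phi> a))"
  unfolding lin_ext_def
  by (rule sum.mono_neutral_left) (use assms in \<open>auto simp: not_in_keys_iff_lookup_eq_zero\<close>)

lemma lin_lin_ext [simp, intro]: "lin (lin_ext \<phi>)"
proof (rule linI)
  fix v w :: "'a vec"
  let ?X = "Poly_Mapping.keys v \<union> Poly_Mapping.keys w"
  have "Poly_Mapping.keys (v + w) \<subseteq> ?X"
    by (rule Poly_Mapping.keys_add)
  then show "lin_ext \<phi> (v + w) = lin_ext \<phi> v + lin_ext \<phi> w"
    by (simp add: lin_ext_superset[of ?X] lookup_add kvs.scale_left_distrib sum.distrib)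
next
  fix c and v :: "'a vec"
  have "Poly_Mapping.keys (scl c v) \<subseteq> Poly_Mapping.keys v"
    by (auto simp: in_keys_iff)
  then show "lin_ext \<phi> (scl c v) = scl c (lin_ext \<phi> v)"
    by (simp add: lin_ext_superset[of "Poly_Mapping.keys v"] kvs.scale_sum_right)
qed

lemma lin_ext_bvec [simp]: "lin_ext \<phi> (bvec a) = \<phi> a"
  by (simp add: lin_ext_def bvec_def)

lemma lookup_bvec: "Poly_Mapping.lookup (bvec a) x = (if x = a then 1 else 0)"
  by (simp add: bvec_def lookup_single when_def)

lemma vec_expand: "v = (\<Sum>a\<in>Poly_Mapping.keys v. scl (Poly_Mapping.lookup v a) (bvec a))"
proof (rule poly_mapping_eqI)
  fix x
  show "Poly_Mapping.lookup v x = Poly_Mapping.lookup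
      (\<Sum>a\<in>Poly_Mapping.keys v. scl (Poly_Mapping.lookup v a) (bvec a)) x"
    by (simp add: lookup_sum_vec lookup_bvec if_distrib[of "(*) _"] sum.delta in_keys_iff
        cong: if_cong)
qed

lemma lin_eq_lin_ext: "lin f \<Longrightarrow> f = lin_ext (\<lambda>a. f (bvec a))"
proof
  fix v
  assume f: "lin f"
  have "f v = f (\<Sum>a\<in>Poly_Mapping.keys v. scl (Poly_Mapping.lookup v a) (bvec a))"
    using vec_expand[of v] by (rule arg_cong)
  then show "f v = lin_ext (\<lambda>a. f (bvec a)) v"
    by (simp add: lin_ext_def lin_sum[OF f] lin_scl[OF f])
qed

lemma lin_ext_cong_fsp:
  "v \<in> fsp B \<Longrightarrow> (\<And>a. a \<in> B \<Longrightarrow> \<phi> a = \<psi> a) \<Longrightarrow> lin_ext \<phi> v = lin_ext \<psi> v"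
  unfolding lin_ext_def fsp_def by (rule sum.cong) auto

lemma lin_eq_fspI:
  assumes "lin f" "lin g" "\<And>a. a \<in> B \<Longrightarrow> f (bvec a) = g (bvec a)" "v \<in> fsp B"
  shows "f v = g v"
  using lin_ext_cong_fsp[OF assms(4), of "\<lambda>a. f (bvec a)" "\<lambda>a. g (bvec a)"] assms(3)
    lin_eq_lin_ext[OF assms(1)] lin_eq_lin_ext[OF assms(2)] by metis

lemma fsp_UNIV [simp]: "v \<in> fsp UNIV"
  by (simp add: fsp_def)

lemma lin_eqI:
  assumes "lin f" "lin g" "\<And>a. f (bvec a) = g (bvec a)"
  shows "f v = g v"
  by (rule lin_eq_fspI[OF assms(1,2), of UNIV]) (use assms in auto)

lemma fsp_0 [simp, intro]: "0 \<in> fsp B"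
  by (simp add: fsp_def)

lemma fsp_add [intro]: "v \<in> fsp B \<Longrightarrow> w \<in> fsp B \<Longrightarrow> v + w \<in> fsp B"
  using Poly_Mapping.keys_add[of v w] by (auto simp: fsp_def)

lemma fsp_scl [intro]: "v \<in> fsp B \<Longrightarrow> scl c v \<in> fsp B"
  by (auto simp: fsp_def in_keys_iff subset_iff)

lemma fsp_diff [intro]: "v \<in> fsp B \<Longrightarrow> w \<in> fsp B \<Longrightarrow> v - w \<in> fsp B"
  using fsp_add[of v B "scl (- 1) w"] fsp_scl[of w B "-1"] by simp

lemma fsp_sum [intro]: "(\<And>a. a \<in> A \<Longrightarrow> f a \<in> fsp B) \<Longrightarrow> sum f A \<in> fsp B"
  by (induction A rule: infinite_finite_induct) auto

lemma bvec_in_fsp [simp]: "bvec a \<in> fsp B \<longleftrightarrow> a \<in> B"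
  by (simp add: fsp_def bvec_def)

lemma lin_ext_in_fsp:
  "v \<in> fsp B \<Longrightarrow> (\<And>a. a \<in> B \<Longrightarrow> \<phi> a \<in> fsp C) \<Longrightarrow> lin_ext \<phi> v \<in> fsp C"
  unfolding lin_ext_def by (rule fsp_sum, rule fsp_scl) (auto simp: fsp_def)

lemma lin_in_fsp:
  "lin f \<Longrightarrow> v \<in> fsp B \<Longrightarrow> (\<And>a. a \<in> B \<Longrightarrow> f (bvec a) \<in> fsp C) \<Longrightarrow> f v \<in> fsp C"
  using lin_ext_in_fsp[of v B "\<lambda>a. f (bvec a)" C] lin_eq_lin_ext[of f] by metis

subsection \<open>Reindexing and tensors\<close>

lemma lin_reindex [simp, intro]: "lin (reindex h)"
  by (simp add: reindex_def)

lemma reindex_bvec [simp]: "reindex h (bvec a) = bvec (h a)"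
  by (simp add: reindex_def)

lemma reindex_reindex [simp]: "reindex g (reindex h v) = reindex (g \<circ> h) v"
  by (rule lin_eqI[of "\<lambda>v. reindex g (reindex h v)"]) (auto intro: lin_compose)

lemma reindex_id [simp]: "reindex id v = v" "reindex (\<lambda>x. x) v = v"
  by (rule lin_eqI[of "reindex _" "\<lambda>v. v"]; simp)+

lemma reindex_in_fsp: "v \<in> fsp B \<Longrightarrow> h ` B \<subseteq> C \<Longrightarrow> reindex h v \<in> fsp C"
  by (rule lin_in_fsp[OF lin_reindex]) auto

lemma inj_reindex: "inj h \<Longrightarrow> reindex h v = reindex h w \<Longrightarrow> v = w"
  by (metis (no_types, lifting) inv_o_cancel reindex_id(1) reindex_reindex)

lemma tens_bvec [simp]: "tens (bvec a) (bvec b) = bvec (a, b)"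
  by (simp add: tens_def)

lemma lin_tens_left [simp, intro]: "lin (\<lambda>v. tens v w)"
  unfolding tens_def by (rule lin_lin_ext)

lemma tens_bvec_left: "tens (bvec a) w = reindex (Pair a) w"
  by (simp add: tens_def reindex_def)

lemma lin_tens_right [simp, intro]: "lin (\<lambda>w. tens v w)"
proof (rule linI)
  show "tens v (x + y) = tens v x + tens v y" for x y
    by (rule lin_eqI[of "\<lambda>v. tens v (x + y)"]) (auto simp: tens_bvec_left lin_add intro: lin_plus)
  show "tens v (scl c x) = scl c (tens v x)" for c x
    by (rule lin_eqI[of "\<lambda>v. tens v (scl c x)"]) (auto simp: tens_bvec_left lin_scl intro: lin_scale)
qed

lemmas tens_simps =
  lin_simps[OF lin_tens_left] lin_simps[OF lin_tens_right]

lemma tens_bvec_right: "tens v (bvec b) = reindex (\<lambda>a. (a, b)) v"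
  by (rule lin_eqI[of "\<lambda>v. tens v (bvec b)"]) auto

lemma tens_in_fsp: "v \<in> fsp B \<Longrightarrow> w \<in> fsp C \<Longrightarrow> tens v w \<in> fsp (B \<times> C)"
  unfolding tens_def by (rule lin_ext_in_fsp, assumption, rule lin_ext_in_fsp) auto

lemma bilin_eqI:
  assumes "\<And>w. lin (\<lambda>v. f v w)" "\<And>w. lin (\<lambda>v. g v w)" "\<And>v. lin (f v)" "\<And>v. lin (g v)"
    and "\<And>a b. f (bvec a) (bvec b) = g (bvec a) (bvec b)"
  shows "f v w = g v w"
proof (rule lin_eqI[of "\<lambda>v. f v w" "\<lambda>v. g v w"])
  show "f (bvec a) w = g (bvec a) w" for a
    by (rule lin_eqI[of "f (bvec a)"]) (use assms in auto)
qed (use assms in auto)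

lemma lin_eq_tensI:
  assumes "lin f" "lin g" "\<And>x b. f (tens x (bvec b)) = g (tens x (bvec b))"
  shows "f v = g v"
proof (rule lin_eqI[OF assms(1,2)])
  show "f (bvec a) = g (bvec a)" for a
    using assms(3)[of "bvec (fst a)" "snd a"] by simp
qed

lemma lin_tens_op [simp, intro]: "lin (tens_op X Y)"
  by (simp add: tens_op_def)

lemma tens_op_bvec: "tens_op X Y (bvec (a, b)) = tens (X (bvec a)) (Y (bvec b))"
  by (simp add: tens_op_def)

lemma tens_op_tens: "lin X \<Longrightarrow> lin Y \<Longrightarrow> tens_op X Y (tens v w) = tens (X v) (Y w)"
  by (rule bilin_eqI[of "\<lambda>v w. tens_op X Y (tens v w)" "\<lambda>v w. tens (X v) (Y w)"])
    (auto simp: tens_op_bvec intro: lin_compose[of "tens_op X Y"] lin_compose[of "\<lambda>v. tens v _"]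
      lin_compose[of "tens _"])

subsection \<open>The algebra of linear operators\<close>

text \<open>With linearity packed into a type, operators form a \<open>ring_1\<close>, so the
  relations of the quantum group become equations between ring elements that can be normalized by
  \<open>algebra_simps\<close>.\<close>

typedef 'a lop = "{f :: 'a vec \<Rightarrow> 'a vec. lin f}" morphisms app Lop
  by (rule exI[of _ id]) simp

setup_lifting type_definition_lop

lemma lin_app [simp, intro]: "lin (app Y)"
  using app[of Y] by simp

lemma app_Lop [simp]: "lin f \<Longrightarrow> app (Lop f) = f"
  by (simp add: Lop_inverse)

instantiation lop :: (type) ring_1
begin
lift_definition zero_lop :: "'a lop" is "\<lambda>v. 0" by (rule lin_zero)
lift_definition one_lop :: "'a lop" is "\<lambda>v. v" by simp
lift_definition plus_lop :: "'a lop \<Rightarrow> 'a lop \<Rightarrow> 'a lop" is "\<lambda>f g v. f v + g v" by (rule lin_plus)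
lift_definition minus_lop :: "'a lop \<Rightarrow> 'a lop \<Rightarrow> 'a lop" is "\<lambda>f g v. f v - g v" by (rule lin_minus')
lift_definition uminus_lop :: "'a lop \<Rightarrow> 'a lop" is "\<lambda>f v. - f v"
  using lin_minus'[OF lin_zero] by simp
lift_definition times_lop :: "'a lop \<Rightarrow> 'a lop \<Rightarrow> 'a lop" is "\<lambda>f g v. f (g v)" by (rule lin_compose)
instance
proof
  \<comment> \<open>Types are inhabited, so a space of formal combinations is never zero; this
    separates 0 from 1.\<close>
  have "bvec undefined \<noteq> (0 :: 'a vec)"
    by (metis lookup_bvec lookup_zero zero_neq_one)
  then show "(0 :: 'a lop) \<noteq> 1"
    by (metis one_lop.rep_eq zero_lop.rep_eq)
qed (simp_all add: app_inject[symmetric] fun_eq_iff zero_lop.rep_eq one_lop.rep_eq plus_lop.rep_eq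
    minus_lop.rep_eq uminus_lop.rep_eq times_lop.rep_eq lin_simps[OF lin_app] add_ac)
end

lift_definition sop :: "kk \<Rightarrow> 'a lop \<Rightarrow> 'a lop" (infixr "*\<^sub>s" 76) is "\<lambda>c f v. scl c (f v)"
  by (rule lin_scale)

lemma app_simps [simp]:
  "app 0 v = 0" "app 1 v = v" "app (X + Y) v = app X v + app Y v" "app (X - Y) v = app X v - app Y v"
  "app (- Y) v = - app Y v" "app (X * Y) v = app X (app Y v)" "app (c *\<^sub>s Y) v = scl c (app Y v)"
  by (simp_all add: zero_lop.rep_eq one_lop.rep_eq plus_lop.rep_eq minus_lop.rep_eq
      uminus_lop.rep_eq times_lop.rep_eq sop.rep_eq)

lemma app_sum: "app (sum f A) v = (\<Sum>a\<in>A. app (f a) v)"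
  by (induction A rule: infinite_finite_induct) simp_all

lemmas app_lin = lin_simps[OF lin_app]

lemma lop_eqI: "(\<And>a. app X (bvec a) = app Y (bvec a)) \<Longrightarrow> X = Y"
  using lin_eqI[OF lin_app lin_app, of X Y] by (metis app_inject ext)

lemma sop_simps [simp]:
  "c *\<^sub>s d *\<^sub>s Y = (c * d) *\<^sub>s Y" "1 *\<^sub>s Y = Y" "0 *\<^sub>s Y = 0" "c *\<^sub>s 0 = 0"
  "(c *\<^sub>s X) * Y = c *\<^sub>s (X * Y)" "X * (c *\<^sub>s Y) = c *\<^sub>s (X * Y)"
  "c *\<^sub>s (- Y) = - (c *\<^sub>s Y)" "(- c) *\<^sub>s Y = - (c *\<^sub>s Y)"
  by (rule lop_eqI, simp add: app_lin)+

lemma sop_distrib: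
  "c *\<^sub>s (X + Y) = c *\<^sub>s X + c *\<^sub>s Y" "c *\<^sub>s (X - Y) = c *\<^sub>s X - c *\<^sub>s Y"
  "(c + d) *\<^sub>s Y = c *\<^sub>s Y + d *\<^sub>s Y" "(c - d) *\<^sub>s Y = c *\<^sub>s Y - d *\<^sub>s Y"
  by (rule lop_eqI, simp add: algebra_simps kvs.scale_left_diff_distrib kvs.scale_right_diff_distrib)+

lemma sop_sum: "c *\<^sub>s sum f A = (\<Sum>a\<in>A. c *\<^sub>s f a)"
  by (induction A rule: infinite_finite_induct) (simp_all add: sop_distrib)

definition tensor_lop :: "'a lop \<Rightarrow> 'b lop \<Rightarrow> ('a \<times> 'b) lop" (infixr "\<otimes>\<^sub>o" 71) where
  "X \<otimes>\<^sub>o Y = Lop (tens_op (app X) (app Y))"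

lemma app_tl: "app (X \<otimes>\<^sub>o Y) v = tens_op (app X) (app Y) v"
  by (simp add: tensor_lop_def)

lemma app_tl_tens [simp]: "app (X \<otimes>\<^sub>o Y) (tens v w) = tens (app X v) (app Y w)"
  by (simp add: app_tl tens_op_tens)

lemma lop_eq_tensI: "(\<And>v w. app X (tens v w) = app Y (tens v w)) \<Longrightarrow> X = Y"
  by (rule lop_eqI) (metis surj_pair tens_bvec)

lemma tl_mult: "(X \<otimes>\<^sub>o Y) * (X' \<otimes>\<^sub>o Y') = (X * X') \<otimes>\<^sub>o (Y * Y')"
  by (rule lop_eq_tensI) simp

lemma tl_distrib:
  "(X + X') \<otimes>\<^sub>o Y = X \<otimes>\<^sub>o Y + X' \<otimes>\<^sub>o Y" "X \<otimes>\<^sub>o (Y + Y') = X \<otimes>\<^sub>o Y + X \<otimes>\<^sub>o Y'"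
  "(X - X') \<otimes>\<^sub>o Y = X \<otimes>\<^sub>o Y - X' \<otimes>\<^sub>o Y" "X \<otimes>\<^sub>o (Y - Y') = X \<otimes>\<^sub>o Y - X \<otimes>\<^sub>o Y'"
  "(c *\<^sub>s X) \<otimes>\<^sub>o Y = c *\<^sub>s (X \<otimes>\<^sub>o Y)" "X \<otimes>\<^sub>o (c *\<^sub>s Y) = c *\<^sub>s (X \<otimes>\<^sub>o Y)"
  "0 \<otimes>\<^sub>o Y = 0" "X \<otimes>\<^sub>o 0 = 0" "(- X) \<otimes>\<^sub>o Y = - (X \<otimes>\<^sub>o Y)" "X \<otimes>\<^sub>o (- Y) = - (X \<otimes>\<^sub>o Y)"
  "1 \<otimes>\<^sub>o 1 = 1"
  by (rule lop_eq_tensI, simp add: tens_simps)+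


section \<open>Root vectors\<close>

text \<open>The parameter is left open because the computation serves twice: with q for the
  generators E and with 1/q for the generators F.\<close>

locale serre =
  fixes p :: kk and x :: "nat \<Rightarrow> 'a lop"
  assumes p0: "p \<noteq> 0" and p1: "p * p \<noteq> 1" and p2: "p * p \<noteq> - 1"
    and far: "Suc i < j \<Longrightarrow> x i * x j = x j * x i"
    and near: "i = Suc j \<or> j = Suc i \<Longrightarrow>
      x i * x i * x j - (p + inverse p) *\<^sub>s (x i * x j * x i) + x j * x i * x i = 0"
begin

primrec root :: "nat \<Rightarrow> nat \<Rightarrow> 'a lop" where
  "root i 0 = x i"
| "root i (Suc n) = root i n * x (i + Suc n) - inverse p *\<^sub>s (x (i + Suc n) * root i n)"

lemma far': "Suc i < j \<or> Suc j < i \<Longrightarrow> x i * x j = x j * x i"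
  using far by metis

lemma commute_commutator:
  "a * y = y * a \<Longrightarrow> a * z = z * a \<Longrightarrow>
    a * (y * z - c *\<^sub>s (z * y)) = (y * z - c *\<^sub>s (z * y)) * (a :: 'a lop)"
  by (simp add: algebra_simps) (metis mult.assoc)

lemma root_far: "m + 1 < i \<or> i + n + 1 < m \<Longrightarrow> x m * root i n = root i n * x m"
proof (induction n)
  case (Suc n)
  then show ?case
    by (simp only: root.simps) (rule commute_commutator; use Suc far' in auto)
qed (use far' in auto)

text \<open>The first generator commutes with the one appended last, so the iterated q-commutator
  may be bracketed from either end.\<close>

lemma root_left: "root i (Suc n) = x i * root (Suc i) n - inverse p *\<^sub>s (root (Suc i) n * x i)"
proof (induction n)
  case (Suc n)
  let ?y = "x (Suc (Suc (i + n)))" and ?G = "root (Suc i) n"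
  have c: "x i * ?y = ?y * x i"
    by (rule far) simp
  then have c': "x i * (?y * Z) = ?y * (x i * Z)" for Z
    by (metis mult.assoc)
  have "root i (Suc (Suc n)) = root i (Suc n) * ?y - inverse p *\<^sub>s (?y * root i (Suc n))"
    by (subst root.simps) simp
  also have "\<dots> = x i * (?G * ?y - inverse p *\<^sub>s (?y * ?G))
      - inverse p *\<^sub>s ((?G * ?y - inverse p *\<^sub>s (?y * ?G)) * x i)"
    unfolding Suc by (simp add: algebra_simps sop_distrib c c')
  finally show ?case by simp
qed simp

text \<open>The middle coefficient p + 1/p of the Serre relation is what the two terms of the
  q-commutator contribute together once the bracket is expanded.\<close>

lemma serre_first: "root i (Suc 0) * x i = inverse p *\<^sub>s (x i * root i (Suc 0))"
proof -
  have "x i * x i * x (Suc i) - (p + inverse p) *\<^sub>s (x i * x (Suc i) * x i)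
      + x (Suc i) * x i * x i = 0"
    by (rule near) simp
  then have "inverse p *\<^sub>s (x i * x i * x (Suc i) - (p + inverse p) *\<^sub>s (x i * x (Suc i) * x i)
      + x (Suc i) * x i * x i) = 0"
    by simp
  then show ?thesis
    using p0 by (simp add: algebra_simps sop_distrib)
qed

lemma serre_last: "root i (Suc 0) * x (Suc i) = p *\<^sub>s (x (Suc i) * root i (Suc 0))"
proof -
  have "x (Suc i) * x (Suc i) * x i - (p + inverse p) *\<^sub>s (x (Suc i) * x i * x (Suc i))
      + x i * x (Suc i) * x (Suc i) = 0"
    by (rule near) simp
  then show ?thesis
    using p0 by (simp add: algebra_simps sop_distrib)
qed

text \<open>The generator appended last is too far from \<open>x i\<close> to interfere, so the
  q-commutation of the shortest case persists.\<close>

lemma root_first: "root i (Suc n) * x i = inverse p *\<^sub>s (x i * root i (Suc n))"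
proof (induction n)
  case (Suc n)
  let ?y = "x (Suc (Suc (i + n)))" and ?G = "root i (Suc n)"
  have c: "?y * x i = x i * ?y"
    by (rule far') simp
  have c': "?y * (x i * Z) = x i * (?y * Z)" "?G * (x i * Z) = inverse p *\<^sub>s (x i * (?G * Z))" for Z
    using c Suc by (metis mult.assoc, metis mult.assoc sop_simps(5))
  have *: "root i (Suc (Suc n)) = ?G * ?y - inverse p *\<^sub>s (?y * ?G)"
    by (subst root.simps) simp
  show ?case
    unfolding * by (simp add: algebra_simps sop_distrib c c' Suc del: root.simps)
qed (rule serre_first)

text \<open>Dual to \<open>root_first\<close>: here the generator peeled off is the first one, which
  is why the induction goes through \<open>root_left\<close> and varies i.\<close>

lemma root_last: "root i (Suc n) * x (i + Suc n) = p *\<^sub>s (x (i + Suc n) * root i (Suc n))"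
proof (induction n arbitrary: i)
  case (Suc n)
  let ?y = "x (Suc (Suc (i + n)))" and ?G = "root (Suc i) (Suc n)"
  have IH: "?G * ?y = p *\<^sub>s (?y * ?G)"
    using Suc[of "Suc i"] by simp
  have c: "x i * ?y = ?y * x i"
    by (rule far) simp
  have c': "x i * (?y * Z) = ?y * (x i * Z)" "?G * (?y * Z) = p *\<^sub>s (?y * (?G * Z))" for Z
    using c IH by (metis mult.assoc, metis mult.assoc sop_simps(5))
  show ?case
    unfolding root_left[of i "Suc n"]
    by (simp add: algebra_simps sop_distrib c c' IH del: root.simps)
qed (use serre_last in simp)

text \<open>
  With \<open>a, b, c\<close> three consecutive generators, both expressions of the commutator of the root
  vectors of \<open>a, b\<close> and of \<open>b, c\<close> through the root vector of \<open>a, b, c\<close> give the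
  \<open>D = - p\<^sup>-\<^sup>2 D\<close> for the commutator \<open>D\<close> in question.
\<close>

lemma root_mid_base: "x (Suc i) * root i 2 = root i 2 * x (Suc i)"
proof -
  define b c G H R where "b = x (Suc i)" and "c = x (Suc (Suc i))" and "G = root i (Suc 0)"
    and "H = root (Suc i) (Suc 0)" and "R = root i 2"
  let ?p = "inverse p"
  have Gb: "G * b = p *\<^sub>s (b * G)" and Hb: "H * b = ?p *\<^sub>s (b * H)"
    using serre_last[of i] serre_first[of "Suc i"] by (simp_all add: G_def H_def b_def)
  then have bG: "b * G = ?p *\<^sub>s (G * b)" and bH: "b * H = p *\<^sub>s (H * b)"
    using p0 by simp_all
  have Gb': "G * (b * Z) = p *\<^sub>s (b * (G * Z))" and bH': "b * (H * Z) = p *\<^sub>s (H * (b * Z))" for Z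
    using Gb bH by (metis mult.assoc sop_simps(5))+
  have R1: "R = G * c - ?p *\<^sub>s (c * G)"
    by (simp add: R_def G_def c_def numeral_2_eq_2)
  have R2: "R = x i * H - ?p *\<^sub>s (H * x i)"
    using root_left[of i "Suc 0"] by (simp add: R_def H_def numeral_2_eq_2)
  have H: "H = b * c - ?p *\<^sub>s (c * b)" and G: "G = x i * b - ?p *\<^sub>s (b * x i)"
    by (simp_all add: H_def G_def b_def c_def)
  have r1: "R * b = G * c * b - c * b * G"
    unfolding R1 using p0 by (simp add: algebra_simps sop_distrib Gb)
  have r2: "b * R = ?p *\<^sub>s (G * b * c - b * c * G)"
    unfolding R1 using p0 by (simp add: algebra_simps sop_distrib Gb')
  have r3: "R * b = ?p *\<^sub>s (x i * b * H - H * x i * b)"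
    unfolding R2 using p0 by (simp add: algebra_simps sop_distrib Hb)
  have r4: "b * R = b * x i * H - H * b * x i"
    unfolding R2 using p0 by (simp add: algebra_simps sop_distrib bH')
  have "G * H - H * G = (G * b * c - b * c * G) - ?p *\<^sub>s (G * c * b - c * b * G)"
    unfolding H by (simp add: algebra_simps sop_distrib)
  also have "G * b * c - b * c * G = p *\<^sub>s (b * R)"
    using r2 p0 by simp
  finally have Z1: "G * H - H * G = p *\<^sub>s (b * R) - ?p *\<^sub>s (R * b)"
    by (simp add: r1)
  have "G * H - H * G = (x i * b * H - H * x i * b) - ?p *\<^sub>s (b * x i * H - H * b * x i)"
    unfolding G by (simp add: algebra_simps sop_distrib)
  also have "x i * b * H - H * x i * b = p *\<^sub>s (R * b)"
    using r3 p0 by simp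
  finally have Z2: "G * H - H * G = p *\<^sub>s (R * b) - ?p *\<^sub>s (b * R)"
    by (simp add: r4)
  have "(p + ?p) *\<^sub>s (b * R - R * b) = 0"
    using Z1 Z2 by (simp add: algebra_simps sop_distrib)
  moreover have "p + ?p \<noteq> 0"
    using p0 p2 by (simp add: field_simps add_eq_0_iff)
  ultimately have "b * R - R * b = 0"
    by (metis sop_simps(1,2,4) left_inverse)
  then show ?thesis by (simp add: b_def R_def)
qed

text \<open>If m is not the second index, the first generator can be split off. If it is, the case
  of three generators starts an induction on the length in which only distant generators are
  appended.\<close>

lemma root_mid: "i < m \<Longrightarrow> m < i + n \<Longrightarrow> x m * root i n = root i n * x m"
proof (induction n arbitrary: i)
  case (Suc n)
  show ?case
  proof (cases "m = Suc i")
    case False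
    then show ?thesis
      unfolding root_left using Suc
      by (intro commute_commutator far' Suc.IH) auto
  next
    case m: True
    have "2 + l \<ge> 2 \<Longrightarrow> x m * root i (2 + l) = root i (2 + l) * x m" for l
    proof (induction l)
      case 0
      show ?case using root_mid_base[of i] by (simp add: m)
    next
      case (Suc l)
      then show ?case
        unfolding add_Suc_right root.simps by (intro commute_commutator far') (auto simp: m)
    qed
    from this[of "n - 1"] Suc.prems m show ?thesis
      by (cases n) auto
  qed
qed simp

end

section \<open>L-operators\<close>

text \<open>The eigenvalue of the j-th torus generator on the a-th vector of the vector
  representation, that is, p to the power (eps_j, eps_a).\<close>

definition chi :: "kk \<Rightarrow> nat \<Rightarrow> nat \<Rightarrow> kk" where
  "chi p j a = (if j = a then p else 1)"

text \<open>p to the power (eps_j, alpha_i): the scalar \<open>wt_factor\<close> of the module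
  relations for a general parameter.\<close>

definition wfac :: "kk \<Rightarrow> nat \<Rightarrow> nat \<Rightarrow> kk" where
  "wfac p j i = chi p j i * inverse (chi p j (Suc i))"

lemma chi_nz [simp]: "p \<noteq> 0 \<Longrightarrow> chi p j a \<noteq> 0"
  by (simp add: chi_def)

lemma wfac_nz [simp]: "p \<noteq> 0 \<Longrightarrow> wfac p j a \<noteq> 0"
  by (simp add: wfac_def)

lemma inverse_chi: "inverse (chi p j a) = chi (inverse p) j a"
  by (simp add: chi_def)

lemma inverse_wfac: "inverse (wfac p j a) = wfac (inverse p) j a"
  by (simp add: wfac_def chi_def)

text \<open>Indices run over all natural numbers, with e and f set to 0 outside the range, so that
  most identities carry no side conditions. The commutator of e and f is the exception: outside the
  range its torus terms have no reason to cancel.\<close>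

locale uq_ops =
  fixes N :: nat and p :: kk and e f k ki :: "nat \<Rightarrow> 'a lop"
  assumes p0: "p \<noteq> 0" and p1: "p * p \<noteq> 1" and p2: "p * p \<noteq> - 1"
    and k_ki: "k j * ki j = 1" and ki_k: "ki j * k j = 1"
    and k_k: "k i * k j = k j * k i"
    and k_e: "k j * e i = wfac p j i *\<^sub>s (e i * k j)"
    and k_f: "k j * f i = inverse (wfac p j i) *\<^sub>s (f i * k j)"
    and e_out: "i \<notin> {1..<N} \<Longrightarrow> e i = 0" and f_out: "i \<notin> {1..<N} \<Longrightarrow> f i = 0"
    and e_f: "i \<in> {1..<N} \<Longrightarrow> j \<in> {1..<N} \<Longrightarrow> e i * f j - f j * e i =
      (if i = j then (1 / (p - inverse p)) *\<^sub>s (k j * ki (Suc j) - ki j * k (Suc j)) else 0)"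
    and e_far: "Suc i < j \<Longrightarrow> e i * e j = e j * e i"
    and f_far: "Suc i < j \<Longrightarrow> f i * f j = f j * f i"
    and e_near: "i = Suc j \<or> j = Suc i \<Longrightarrow>
      e i * e i * e j - (p + inverse p) *\<^sub>s (e i * e j * e i) + e j * e i * e i = 0"
    and f_near: "i = Suc j \<or> j = Suc i \<Longrightarrow>
      f i * f i * f j - (p + inverse p) *\<^sub>s (f i * f j * f i) + f j * f i * f i = 0"
begin

sublocale E: serre p e
  by standard (use p0 p1 p2 e_far e_near in auto)

lemma inverse_p: "inverse p * inverse p \<noteq> 1" "inverse p * inverse p \<noteq> - 1"
proof -
  have *: "inverse p * inverse p = inverse (p * p)" by simp
  show "inverse p * inverse p \<noteq> 1" unfolding * using p1 by (metis inverse_1 inverse_inverse_eq)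
  show "inverse p * inverse p \<noteq> - 1"
    unfolding * using p2 by (metis inverse_1 inverse_inverse_eq inverse_minus_eq)
qed

sublocale F: serre "inverse p" f
  by standard (use p0 inverse_p f_far f_near in \<open>simp_all add: add.commute\<close>)

text \<open>Exchanging E with F and q with 1/q fixes the torus: the commutator changes sign, and so
  does its denominator. Every fact about root vectors of E thereby yields one for F.\<close>

lemma swap: "uq_ops N (inverse p) f e k ki"
proof
  show "f i * e j - e j * f i = (if i = j then (1 / (inverse p - inverse (inverse p))) *\<^sub>s
      (k j * ki (Suc j) - ki j * k (Suc j)) else 0)" if "i \<in> {1..<N}" "j \<in> {1..<N}" for i j
  proof -
    have "f i * e j - e j * f i = - (e j * f i - f i * e j)" by simp
    also have "\<dots> = (if i = j then (- (1 / (p - inverse p))) *\<^sub>s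
      (k j * ki (Suc j) - ki j * k (Suc j)) else 0)"
      using e_f[OF that(2,1)] by simp
    also have "- (1 / (p - inverse p)) = 1 / (inverse p - inverse (inverse p))"
      by (metis inverse_inverse_eq minus_diff_eq minus_divide_right)
    finally show ?thesis .
  qed
  show "inverse p * inverse p \<noteq> 1" "inverse p * inverse p \<noteq> - 1"
    using F.p1 F.p2 by auto
qed (use p0 k_ki ki_k k_k k_e k_f e_out f_out e_far f_far e_near f_near in
    \<open>auto simp: inverse_wfac[symmetric] add.commute\<close>)

lemma ki_comm: "ki i * k j = k j * ki i" "ki i * ki j = ki j * ki i"
proof -
  have *: "ki i * k j = k j * ki i" for i j
    by (metis k_k k_ki ki_k mult.assoc mult.left_neutral mult.right_neutral)
  then show "ki i * k j = k j * ki i" .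
  show "ki i * ki j = ki j * ki i"
    by (metis * k_ki ki_k mult.assoc mult.left_neutral mult.right_neutral)
qed

lemma k_root: "k j * E.root i n = (chi p j i * inverse (chi p j (Suc (i + n)))) *\<^sub>s (E.root i n * k j)"
proof (induction n)
  case 0
  then show ?case by (simp add: k_e wfac_def)
next
  case (Suc n)
  let ?y = "e (Suc (i + n))" and ?c = "chi p j i * inverse (chi p j (Suc (i + n)))"
  have 1: "k j * (E.root i n * Z) = ?c *\<^sub>s (E.root i n * (k j * Z))"
    "k j * (?y * Z) = wfac p j (Suc (i + n)) *\<^sub>s (?y * (k j * Z))" for Z
    by (metis Suc mult.assoc sop_simps(5), metis k_e mult.assoc sop_simps(5))
  have 2: "chi p j (Suc (i + n)) * (inverse (chi p j (Suc (i + n))) * z) = z" for z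
    using p0 by (simp add: mult.assoc[symmetric])
  show ?case
    using p0 by (simp add: algebra_simps sop_distrib 1 Suc k_e) (simp add: wfac_def algebra_simps 2)
qed

lemma ki_root:
  "ki j * E.root i n = (inverse (chi p j i) * chi p j (Suc (i + n))) *\<^sub>s (E.root i n * ki j)"
proof -
  have "E.root i n * ki j = ki j * (k j * E.root i n) * ki j"
    by (simp add: mult.assoc[symmetric] ki_k)
  also have "\<dots> = (chi p j i * inverse (chi p j (Suc (i + n)))) *\<^sub>s (ki j * E.root i n)"
    by (simp add: k_root mult.assoc k_ki)
  finally show ?thesis using p0 by (simp add: field_simps)
qed

lemma e_f': "m \<in> {1..<N} \<Longrightarrow> e i * f m - f m * e i =
    (if i = m then (1 / (p - inverse p)) *\<^sub>s (k m * ki (Suc m) - ki m * k (Suc m)) else 0)"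
  using e_f[of i m] e_out[of i] by (cases "i \<in> {1..<N}") auto

lemma root_f_outside:
  "m \<in> {1..<N} \<Longrightarrow> m < i \<or> i + n < m \<Longrightarrow> f m * E.root i n = E.root i n * f m"
proof (induction n)
  case 0
  then show ?case using e_f'[of m i] by (auto split: if_splits)
next
  case (Suc n)
  have "f m * e (i + Suc n) = e (i + Suc n) * f m"
    using e_f'[of m "i + Suc n"] Suc.prems by (auto split: if_splits)
  then show ?case
    using Suc by (auto intro: E.commute_commutator)
qed

text \<open>The torus element of the simple root m; \<open>K'\<close> is its inverse.\<close>

definition K :: "nat \<Rightarrow> 'a lop" where "K m = k m * ki (Suc m)"
definition K' :: "nat \<Rightarrow> 'a lop" where "K' m = ki m * k (Suc m)"

lemma K_root:
  "K m * E.root i n = (wfac p i m * inverse (wfac p (Suc (i + n)) m)) *\<^sub>s (E.root i n * K m)"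
  "K' m * E.root i n = (wfac p (Suc (i + n)) m * inverse (wfac p i m)) *\<^sub>s (E.root i n * K' m)"
proof -
  have *: "a * r = c *\<^sub>s (r * a) \<Longrightarrow> b * r = d *\<^sub>s (r * b) \<Longrightarrow> a * b * r = (c * d) *\<^sub>s (r * (a * b))"
    for a b r :: "'a lop" and c d
  proof -
    assume 1: "a * r = c *\<^sub>s (r * a)" and 2: "b * r = d *\<^sub>s (r * b)"
    have "a * b * r = d *\<^sub>s (a * r * b)" by (simp add: 2 mult.assoc)
    then show ?thesis by (simp add: 1 mult.assoc mult.commute)
  qed
  have [simp]: "chi p a b = chi p b a" for a b
    by (simp add: chi_def)
  show "K m * E.root i n = (wfac p i m * inverse (wfac p (Suc (i + n)) m)) *\<^sub>s (E.root i n * K m)"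
    unfolding K_def by (subst *[OF k_root ki_root]) (simp add: wfac_def chi_def)
  show "K' m * E.root i n = (wfac p (Suc (i + n)) m * inverse (wfac p i m)) *\<^sub>s (E.root i n * K' m)"
    unfolding K'_def by (subst *[OF ki_root k_root]) (simp add: wfac_def chi_def)
qed

lemma e_f'': "m \<in> {1..<N} \<Longrightarrow> e i * f m - f m * e i =
    (if i = m then (1 / (p - inverse p)) *\<^sub>s (K m - K' m) else 0)"
  using e_f' by (simp add: K_def K'_def)

lemma p_inv: "p - inverse p \<noteq> 0"
  using p0 p1 by (metis diff_eq_diff_eq diff_zero right_inverse)

text \<open>The generator \<open>e m\<close> occurs at most once in the chain. At either end of the
  chain one of the two torus terms of [e, f] survives the q-commutator; in the interior both
  disappear.\<close>

lemma root_f: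
  assumes m: "m \<in> {1..<N}"
  shows "E.root i (Suc n) * f m - f m * E.root i (Suc n) =
    (if m = Suc (i + n) then K m * E.root i n
     else if m = i then - (E.root (Suc i) n * K' m) else 0)"
proof (induction n)
  define c where "c = 1 / (p - inverse p)"
  have c: "c * (p - inverse p) = 1" using p_inv by (simp add: c_def)
  have ef: "e i * f m - f m * e i = (if i = m then c *\<^sub>s (K m - K' m) else 0)" for i
    using e_f''[OF m] by (simp add: c_def)
  have step: "E.root i (Suc n) * f m - f m * E.root i (Suc n) =
      (G * f m - f m * G) * y + G * (y * f m - f m * y)
      - inverse p *\<^sub>s ((y * f m - f m * y) * G + y * (G * f m - f m * G))"
    if "G = E.root i n" "y = e (Suc (i + n))" for n G y
    by (simp add: that algebra_simps sop_distrib)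
  have last: "E.root i (Suc n) * f m - f m * E.root i (Suc n) = K m * E.root i n"
    if mn: "m = Suc (i + n)" for n
  proof -
    let ?G = "E.root i n"
    have GK: "?G * K m = p *\<^sub>s (K m * ?G)" and KG: "?G * K' m = inverse p *\<^sub>s (K' m * ?G)"
      using K_root[of m i n] p0 by (simp_all add: mn wfac_def chi_def)
    have "E.root i (Suc n) * f m - f m * E.root i (Suc n) =
      ?G * (c *\<^sub>s (K m - K' m)) - inverse p *\<^sub>s (c *\<^sub>s (K m - K' m) * ?G)"
      using step[OF HOL.refl HOL.refl, of n] root_f_outside[OF m, of i n] ef[of m] mn by simp
    \<comment> \<open>Moving the root vector to the right gives K the coefficients p and - 1/p,
      while the two K' terms both carry 1/p and cancel.\<close>
    also have "\<dots> = (c * (p - inverse p)) *\<^sub>s (K m * ?G)"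
      by (simp add: algebra_simps sop_distrib GK KG)
    finally show ?thesis by (simp only: c sop_simps)
  qed
  have other: "E.root i (Suc n) * f m - f m * E.root i (Suc n) =
      (G * f m - f m * G) * y - inverse p *\<^sub>s (y * (G * f m - f m * G))"
    if "m \<noteq> Suc (i + n)" "G = E.root i n" "y = e (Suc (i + n))" for n G y
    using step[OF that(2,3)] ef[of "Suc (i + n)"] that by simp
  {
    case 0
    show ?case
    proof (cases "m = Suc i")
      case True
      then show ?thesis using last[of 0] by simp
    next
      case False
      let ?y = "e (Suc i)"
      show ?thesis
      proof (cases "m = i")
        case True
        have Ky: "K m * ?y = inverse p *\<^sub>s (?y * K m)" and Ky': "K' m * ?y = p *\<^sub>s (?y * K' m)"
          using K_root[of m "Suc i" 0] p0 True by (simp_all add: wfac_def chi_def)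
        have "E.root i (Suc 0) * f m - f m * E.root i (Suc 0) =
            (c *\<^sub>s (K m - K' m)) * ?y - inverse p *\<^sub>s (?y * (c *\<^sub>s (K m - K' m)))"
          using other[of 0, OF _ HOL.refl HOL.refl] False ef[of i] True by simp
        \<comment> \<open>At the other end of the chain the roles are exchanged: the K terms cancel
          and K' survives.\<close>
        also have "\<dots> = - ((c * (p - inverse p)) *\<^sub>s (?y * K' m))"
          by (simp add: algebra_simps sop_distrib Ky Ky')
        finally show ?thesis using True by (simp add: c)
      next
        case False': False
        then show ?thesis
          using other[of 0, OF _ HOL.refl HOL.refl] False ef[of i] by simp
      qed
    qed
  next
    case (Suc n)
    let ?y = "e (Suc (Suc (i + n)))"
    show ?case
    proof (cases "m = Suc (Suc (i + n))")
      case True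
      then show ?thesis using last[of "Suc n"] by simp
    next
      case False
      have o: "E.root i (Suc (Suc n)) * f m - f m * E.root i (Suc (Suc n)) =
        (E.root i (Suc n) * f m - f m * E.root i (Suc n)) * ?y
        - inverse p *\<^sub>s (?y * (E.root i (Suc n) * f m - f m * E.root i (Suc n)))"
        using other[of "Suc n", OF _ HOL.refl HOL.refl] False by simp
      show ?thesis
      proof (cases "m = Suc (i + n)")
        case True
        \<comment> \<open>Once a further generator is appended, passing it through K produces a
          factor p that cancels the 1/p of the bracket. This is why an interior index contributes
          nothing.\<close>
        have yK: "?y * K m = p *\<^sub>s (K m * ?y)"
          using K_root[of m "Suc (Suc (i + n))" 0] p0 True by (simp add: wfac_def chi_def)
        then have yK': "?y * (K m * Z) = p *\<^sub>s (K m * (?y * Z))" for Z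
          by (metis mult.assoc sop_simps(5))
        have "?y * E.root i n = E.root i n * ?y"
          by (rule E.root_far) simp
        then show ?thesis
          unfolding o Suc using True p0 by (simp add: yK'[unfolded True] mult.assoc)
      next
        case False2: False
        show ?thesis
        proof (cases "m = i")
          case True
          have Ky: "K' m * ?y = ?y * K' m"
            using K_root(2)[of m "Suc (Suc (i + n))" 0] p0 True by (simp add: wfac_def chi_def)
          show ?thesis
            unfolding o Suc using True False2 by (simp add: algebra_simps sop_distrib Ky[unfolded True])
        next
          case False
          then show ?thesis
            unfolding o Suc using False2 \<open>m \<noteq> Suc (Suc (i + n))\<close> by simp
        qed
      qed
    qed
  }
qed


section \<open>The triangular L-operator made of the root vectors of E\<close>

definition Lp :: "nat \<Rightarrow> nat \<Rightarrow> 'a lop" where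
  "Lp j i = (if j < i then 0 else if j = i then k i
     else (p - inverse p) *\<^sub>s (k j * E.root i (j - Suc i)))"

lemma Lp_simps: "j < i \<Longrightarrow> Lp j i = 0" "Lp i i = k i"
  "Lp (Suc (i + n)) i = (p - inverse p) *\<^sub>s (k (Suc (i + n)) * E.root i n)"
  by (simp_all add: Lp_def)

lemma k_Lp: "k l * Lp j i = (chi p l i * inverse (chi p l j)) *\<^sub>s (Lp j i * k l)"
proof (cases "i < j")
  case True
  then obtain n where j: "j = Suc (i + n)" using less_iff_Suc_add by auto
  have "k l * (k j * E.root i n) = k j * (k l * E.root i n)"
    by (metis k_k mult.assoc)
  also have "\<dots> = (chi p l i * inverse (chi p l j)) *\<^sub>s (k j * E.root i n * k l)"
    by (simp add: k_root[of l] j mult.assoc)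
  finally show ?thesis
    unfolding j Lp_simps by (simp add: mult.commute[of "p - inverse p"])
qed (use p0 k_k in \<open>auto simp: Lp_def\<close>)

lemma K_k: "K m * k l = k l * K m" "K' m * k l = k l * K' m"
proof -
  have *: "a * c = c * a \<Longrightarrow> b * c = c * b \<Longrightarrow> a * b * c = c * (a * b)" for a b c :: "'a lop"
    by (metis mult.assoc)
  show "K m * k l = k l * K m" "K' m * k l = k l * K' m"
    unfolding K_def K'_def by (intro * ki_comm(1) k_k)+
qed

lemma K_K'_k: "K m * k (Suc m) = k m" "K' m * k m = k (Suc m)"
proof -
  show "K m * k (Suc m) = k m"
    by (simp add: K_def mult.assoc ki_k)
  have "K' m * k m = ki m * (k m * k (Suc m))"
    by (simp add: K'_def mult.assoc k_k)
  then show "K' m * k m = k (Suc m)"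
    by (simp add: mult.assoc[symmetric] ki_k)
qed

lemma e_k: "e m * k j = inverse (wfac p j m) *\<^sub>s (k j * e m)"
  using p0 by (simp add: k_e)

lemma f_k: "f m * k j = wfac p j m *\<^sub>s (k j * f m)"
  using p0 by (simp add: k_f)

text \<open>This is \<open>Lp_e\<close> with \<open>k j\<close> and the scalar removed. At m = j and
  i = m + 1 it is the recursion of the root vectors from the right and from the left, at m = i and m
  + 1 = j the q-commutation coming from the Serre relations, elsewhere plain commutation.\<close>

lemma root_e:
  assumes j: "j = Suc (i + n)"
  shows "wfac p i m *\<^sub>s (E.root i n * e m) + (if i = Suc m then E.root m (Suc n) else 0)
    = inverse (wfac p j m) *\<^sub>s (e m * E.root i n) + (if j = m then E.root i (Suc n) else 0)"
proof -
  have "m = j \<or> i = Suc m \<or> m = i \<and> n = 0 \<or> m = i \<and> n = Suc (n - 1)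
      \<or> Suc m = j \<and> n = Suc (n - 1) \<or> i < m \<and> Suc m < j \<or> Suc m < i \<or> j < m"
    using j by presburger
  then consider "m = j" | "i = Suc m" | "m = i" "n = 0" | n' where "m = i" "n = Suc n'"
    | n' where "Suc m = j" "n = Suc n'" | "i < m" "Suc m < j" | "Suc m < i \<or> j < m"
    by blast
  then show ?thesis
  proof cases
    case 1
    then show ?thesis by (simp add: j wfac_def chi_def)
  next
    case 2
    have "E.root m (Suc n) = e m * E.root i n - inverse p *\<^sub>s (E.root i n * e m)"
      unfolding E.root_left by (simp add: 2)
    with 2 show ?thesis by (simp add: j wfac_def chi_def)
  next
    case 3
    then show ?thesis by (simp add: j wfac_def chi_def)
  next
    case 4
    then show ?thesis using E.root_first[of i n'] p0 by (simp add: j wfac_def chi_def del: E.root.simps)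
  next
    case 5
    then have "m = i + Suc n'" using j by simp
    then show ?thesis using E.root_last[of i n'] p0 5 by (simp add: j wfac_def chi_def del: E.root.simps)
  next
    case 6
    then show ?thesis using E.root_mid[of i m n] by (simp add: j wfac_def chi_def)
  next
    case 7
    then have "e m * E.root i n = E.root i n * e m" using j by (intro E.root_far) auto
    with 7 j show ?thesis by (auto simp: wfac_def chi_def)
  qed
qed

text \<open>The equation compares coefficients of v_j when E_m is applied to x (x) v_i before and
  after the braiding. The conditional terms come from E_m sending v_(m+1) to v_m, on the left in the
  argument and on the right in the value.\<close>

lemma Lp_e: "wfac p i m *\<^sub>s (Lp j i * e m) + (if i = Suc m then Lp j m else 0)
    = e m * Lp j i + (if j = m then K m * Lp (Suc m) i else 0)"
proof (cases j i rule: linorder_cases)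
  case less
  then show ?thesis
    by (auto simp: Lp_def K_K'_k)
next
  case equal
  have c1: "wfac p i i = p" "wfac p (Suc i) i = inverse p" "i \<noteq> m \<Longrightarrow> i \<noteq> Suc m \<Longrightarrow> wfac p i m = 1" for i
    by (auto simp: wfac_def chi_def)
  have K: "K m * (k (Suc m) * Z) = k m * Z" for Z
    by (metis K_K'_k(1) mult.assoc)
  consider "i = m" | "i = Suc m" | "i \<noteq> m" "i \<noteq> Suc m" by blast
  then show ?thesis
  proof cases
    case 1
    have L: "Lp (Suc m) m = (p - inverse p) *\<^sub>s (k (Suc m) * e m)"
      using Lp_simps(3)[of m 0] by simp
    from 1 show ?thesis
      by (simp add: L equal Lp_simps(2) c1 e_k K sop_distrib algebra_simps)
  next
    case 2
    have L: "Lp (Suc m) m = (p - inverse p) *\<^sub>s (k (Suc m) * e m)"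
      using Lp_simps(3)[of m 0] by simp
    from 2 show ?thesis
      by (simp add: L equal Lp_simps(2) c1 e_k sop_distrib algebra_simps)
  next
    case 3
    then show ?thesis by (simp add: equal Lp_simps(2) c1 e_k)
  qed
next
  case greater
  then obtain n where j: "j = Suc (i + n)" using less_iff_Suc_add by auto
  let ?R = "E.root i n"
  have K: "K m * (k (Suc m) * Z) = k m * Z" for Z
    by (metis K_K'_k(1) mult.assoc)
  have ek: "e m * (k j * Z) = inverse (wfac p j m) *\<^sub>s (k j * (e m * Z))" for Z
    by (metis e_k mult.assoc sop_simps(5))
  have main: "wfac p i m *\<^sub>s (?R * e m) + (if i = Suc m then E.root m (Suc n) else 0)
      = inverse (wfac p j m) *\<^sub>s (e m * ?R) + (if j = m then E.root i (Suc n) else 0)"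
    by (rule root_e[OF j])
  have Lm: "Lp j m = (p - inverse p) *\<^sub>s (k j * E.root m (Suc n))" if "i = Suc m"
    using Lp_simps(3)[of m "Suc n"] that j by simp
  have LS: "K m * Lp (Suc m) i = (p - inverse p) *\<^sub>s (k j * E.root i (Suc n))" if "j = m"
    using Lp_simps(3)[of i "Suc n"] that j K[of "E.root i (Suc n)"] by (auto simp del: E.root.simps)
  have "wfac p i m *\<^sub>s (Lp j i * e m) + (if i = Suc m then Lp j m else 0) = (p - inverse p) *\<^sub>s
      (k j * (wfac p i m *\<^sub>s (?R * e m) + (if i = Suc m then E.root m (Suc n) else 0)))"
    using Lm by (simp add: j Lp_simps(3) sop_distrib(1,2) distrib_left mult.assoc mult.commute del: E.root.simps)
  also have "\<dots> = e m * Lp j i + (if j = m then K m * Lp (Suc m) i else 0)"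
    unfolding main using LS ek[of ?R]
    by (simp add: j Lp_simps(3) sop_distrib(1,2) distrib_left mult.assoc mult.commute del: E.root.simps)
  finally show ?thesis .
qed

end


context uq_ops begin

text \<open>The same comparison for F_m. The commutator of a root vector with F_m is a shorter root
  vector times a torus element, which is exactly a neighbouring entry of the L-operator.\<close>

lemma Lp_f:
  assumes m: "m \<in> {1..<N}"
  shows "Lp j i * f m + (if i = m then Lp j (Suc m) * K' m else 0)
    = (if j = Suc m then Lp m i else 0) + inverse (wfac p j m) *\<^sub>s (f m * Lp j i)"
proof (cases j i rule: linorder_cases)
  case greater
  then obtain n where j: "j = Suc (i + n)" using less_iff_Suc_add by auto
  let ?R = "E.root i n" and ?l = "p - inverse p"
  have fk: "f m * (k j * Z) = wfac p j m *\<^sub>s (k j * (f m * Z))" for Z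
    by (metis f_k mult.assoc sop_simps(5))
  have kK: "k (Suc m) * K m = k m" "k (Suc m) * (K m * Z) = k m * Z" for Z
    by (metis K_K'_k(1) K_k(1), metis K_K'_k(1) K_k(1) mult.assoc)
  have main: "?l *\<^sub>s (k j * (?R * f m - f m * ?R)) + (if i = m then Lp j (Suc m) * K' m else 0)
      = (if j = Suc m then Lp m i else 0)"
  proof (cases n)
    case 0
    show ?thesis
    proof (cases "i = m")
      case True
      \<comment> \<open>For a simple root the prefactor \<open>p - inverse p\<close> of the
        L-operator cancels the denominator of [e, f], and the two torus terms that remain give
        diagonal entries.\<close>
      have "k j * (?R * f m - f m * ?R) = (1 / ?l) *\<^sub>s (k j * (K m - K' m))"
        using e_f''[OF m, of m] True 0 by simp
      then have "?l *\<^sub>s (k j * (?R * f m - f m * ?R)) = k j * (K m - K' m)"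
        using p_inv by simp
      then show ?thesis using True 0 j by (simp add: Lp_simps algebra_simps kK)
    next
      case False
      then show ?thesis using e_f''[OF m, of i] 0 j by simp
    qed
  next
    case (Suc n')
    have R: "?R * f m - f m * ?R = (if m = Suc (i + n') then K m * E.root i n'
        else if m = i then - (E.root (Suc i) n' * K' m) else 0)"
      unfolding Suc by (rule root_f[OF m])
    consider "m = Suc (i + n')" | "m = i" | "m \<noteq> Suc (i + n')" "m \<noteq> i" by blast
    then show ?thesis
    proof cases
      case 1
      then show ?thesis unfolding R using j Suc kK(2) Lp_simps(3)[of i n'] by simp
    next
      case 2
      then have jm: "j = Suc (Suc m + n')" using j Suc by simp
      show ?thesis unfolding R jm Lp_simps(3) using 2 by (simp add: mult.assoc Lp_simps)
    next
      case 3
      then show ?thesis unfolding R using j Suc by simp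
    qed
  qed
  have "f m * Lp j i = wfac p j m *\<^sub>s (?l *\<^sub>s (k j * (f m * ?R)))"
    by (simp add: j Lp_simps(3) fk[unfolded j] mult.commute)
  then have "inverse (wfac p j m) *\<^sub>s (f m * Lp j i) = ?l *\<^sub>s (k j * (f m * ?R))"
    using p0 by (simp add: mult.assoc[symmetric])
  then have "Lp j i * f m - inverse (wfac p j m) *\<^sub>s (f m * Lp j i) = ?l *\<^sub>s (k j * (?R * f m - f m * ?R))"
    by (simp add: j Lp_simps(3) sop_distrib(1,2) right_diff_distrib[of "k _"] mult.assoc)
  with main show ?thesis by (simp add: algebra_simps)
qed (use p0 in \<open>auto simp: Lp_def k_f\<close>)

section \<open>The opposite triangular L-operator, made of root vectors of F\<close>

definition FB :: "nat \<Rightarrow> nat \<Rightarrow> 'a lop" where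
  "FB i n = (- inverse p) ^ n *\<^sub>s F.root i n"

text \<open>Writing G for the shorter root vector and y for the new generator, the bracket of
  \<open>F.root\<close> is G y - p y G. The powers of - 1/p turn it into y G - (1/p) G y, with the
  new generator leading.\<close>

lemma FB_simps:
  "FB i 0 = f i"
  "FB i (Suc n) = f (i + Suc n) * FB i n - inverse p *\<^sub>s (FB i n * f (i + Suc n))"
proof -
  have *: "inverse p * z * p = z" for z
    using p0 by simp
  show "FB i (Suc n) = f (i + Suc n) * FB i n - inverse p *\<^sub>s (FB i n * f (i + Suc n))"
    by (simp add: FB_def sop_distrib *)
qed (simp add: FB_def)

definition Pm :: "nat \<Rightarrow> nat \<Rightarrow> 'a lop" where
  "Pm i j = (if j < i then 0 else if i = j then k i
     else (p - inverse p) *\<^sub>s (k i * FB i (j - Suc i)))"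

lemma Pm_simps: "j < i \<Longrightarrow> Pm i j = 0" "Pm i i = k i"
  "Pm i (Suc (i + n)) = (p - inverse p) *\<^sub>s (k i * FB i n)"
  "Pm i (Suc (i + n)) = ((p - inverse p) * (- inverse p) ^ n) *\<^sub>s (k i * F.root i n)"
  by (simp_all add: Pm_def FB_def)

lemma k_Pm: "k l * Pm i j = (chi p l j * inverse (chi p l i)) *\<^sub>s (Pm i j * k l)"
proof (cases "i < j")
  case True
  interpret S: uq_ops N "inverse p" f e k ki by (rule swap)
  from True obtain n where j: "j = Suc (i + n)" using less_iff_Suc_add by auto
  have "k l * (k i * F.root i n) = k i * (k l * F.root i n)"
    by (metis k_k mult.assoc)
  also have "\<dots> = (chi p l j * inverse (chi p l i)) *\<^sub>s (k i * F.root i n * k l)"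
    by (simp add: S.k_root[of l] j mult.assoc inverse_chi[symmetric] mult.commute)
  finally show ?thesis
    unfolding j Pm_simps(4) by (simp add: mult.commute[of "_ * _ ^ _"])
qed (use p0 k_k in \<open>auto simp: Pm_def\<close>)

text \<open>The counterpart of \<open>Lp_e\<close> for the braiding V (x) M -> M (x) V:
  \<open>swap\<close> carries \<open>root_e\<close> over to F, and the rescaling in
  \<open>FB\<close> accounts for the difference in signs and scalars.\<close>

lemma Pm_f: "(if j = m then Pm i (Suc m) else 0) + inverse (wfac p j m) *\<^sub>s (Pm i j * f m)
    = f m * Pm i j + (if i = Suc m then K' m * Pm m j else 0)"
proof (cases i j rule: linorder_cases)
  case greater
  then show ?thesis by (auto simp: Pm_def K_K'_k)
next
  case equal
  have c1: "wfac p i i = p" "wfac p (Suc i) i = inverse p" "i \<noteq> m \<Longrightarrow> i \<noteq> Suc m \<Longrightarrow> wfac p i m = 1" for i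
    by (auto simp: wfac_def chi_def)
  have K: "K' m * (k m * Z) = k (Suc m) * Z" for Z
    by (metis K_K'_k(2) mult.assoc)
  have L: "Pm m (Suc m) = (p - inverse p) *\<^sub>s (k m * f m)"
    using Pm_simps(3)[of m 0] by (simp add: FB_simps)
  consider "i = m" | "i = Suc m" | "i \<noteq> m" "i \<noteq> Suc m" by blast
  then show ?thesis
  proof cases
    case 1
    then show ?thesis using p0 by (simp add: equal[symmetric] L Pm_simps(2) c1 f_k sop_distrib)
  next
    case 2
    then show ?thesis using p0 by (simp add: equal[symmetric] L K Pm_simps(2) c1 f_k sop_distrib right_diff_distrib)
  next
    case 3
    then show ?thesis by (simp add: equal[symmetric] Pm_simps(2) c1 f_k)
  qed
next
  case less
  interpret S: uq_ops N "inverse p" f e k ki by (rule swap)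
  from less obtain n where j: "j = Suc (i + n)" using less_iff_Suc_add by auto
  let ?R = "F.root i n" and ?l = "(p - inverse p) * (- inverse p) ^ n"
  have K: "K' m * (k m * Z) = k (Suc m) * Z" for Z
    by (metis K_K'_k(2) mult.assoc)
  have fk: "f m * (k i * Z) = wfac p i m *\<^sub>s (k i * (f m * Z))" for Z
    by (metis f_k mult.assoc sop_simps(5))
  have "inverse (wfac p i m) *\<^sub>s (?R * f m) + (if i = Suc m then F.root m (Suc n) else 0)
      = wfac p j m *\<^sub>s (f m * ?R) + (if j = m then F.root i (Suc n) else 0)"
    using S.root_e[OF j, of m] by (simp add: inverse_wfac[symmetric] del: F.root.simps)
  \<comment> \<open>The factor brings the weights into the positions of the claim. In the
    exceptional cases i = m + 1 and j = m it equals 1/p, which the rescaling of \<open>FB\<close>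
    absorbs.\<close>
  then have "(wfac p i m * inverse (wfac p j m)) *\<^sub>s
      (inverse (wfac p i m) *\<^sub>s (?R * f m) + (if i = Suc m then F.root m (Suc n) else 0))
     = (wfac p i m * inverse (wfac p j m)) *\<^sub>s
      (wfac p j m *\<^sub>s (f m * ?R) + (if j = m then F.root i (Suc n) else 0))"
    by simp
  then have main: "inverse (wfac p j m) *\<^sub>s (?R * f m) - (if j = m then inverse p *\<^sub>s F.root i (Suc n) else 0)
     = wfac p i m *\<^sub>s (f m * ?R) - (if i = Suc m then inverse p *\<^sub>s F.root m (Suc n) else 0)"
    using p0 by (auto simp: sop_distrib(1,2) j wfac_def chi_def algebra_simps simp del: F.root.simps split: if_splits)
  have 1: "(if j = m then Pm i (Suc m) else 0) =
      - (?l *\<^sub>s (k i * (if j = m then inverse p *\<^sub>s F.root i (Suc n) else 0)))"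
    using Pm_simps(4)[of i "Suc n"] by (auto simp: j mult_ac simp del: F.root.simps)
  have 2: "(if i = Suc m then K' m * Pm m j else 0) =
      - (?l *\<^sub>s (k i * (if i = Suc m then inverse p *\<^sub>s F.root m (Suc n) else 0)))"
    using Pm_simps(4)[of m "Suc n"] by (auto simp: j K mult_ac simp del: F.root.simps)
  have "(if j = m then Pm i (Suc m) else 0) + inverse (wfac p j m) *\<^sub>s (Pm i j * f m)
     = ?l *\<^sub>s (k i * (inverse (wfac p j m) *\<^sub>s (?R * f m)
         - (if j = m then inverse p *\<^sub>s F.root i (Suc n) else 0)))"
    unfolding 1 by (simp add: j Pm_simps(4) right_diff_distrib sop_distrib(1,2) mult.assoc
        mult.commute[of "inverse (wfac _ _ _)"] del: F.root.simps)
  also have "\<dots> = f m * Pm i j + (if i = Suc m then K' m * Pm m j else 0)"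
    unfolding main 2 by (simp add: j Pm_simps(4) right_diff_distrib sop_distrib(1,2) fk
        del: F.root.simps)
  finally show ?thesis .
qed

text \<open>The mirror image of \<open>Lp_f\<close>: the commutator of a root vector of F with E_m
  is \<open>root_f\<close> for the swapped generators.\<close>

lemma Pm_e:
  assumes m: "m \<in> {1..<N}"
  shows "Pm i j * e m + (if j = Suc m then Pm i m * K m else 0)
    = wfac p i m *\<^sub>s (e m * Pm i j) + (if i = m then Pm (Suc m) j else 0)"
proof (cases i j rule: linorder_cases)
  case less
  interpret S: uq_ops N "inverse p" f e k ki by (rule swap)
  from less obtain n where j: "j = Suc (i + n)" using less_iff_Suc_add by auto
  let ?R = "F.root i n" and ?l = "p - inverse p"
  have ek: "e m * (k i * Z) = inverse (wfac p i m) *\<^sub>s (k i * (e m * Z))" for Z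
    by (metis e_k mult.assoc sop_simps(5))
  have kK: "k m * K' m = k (Suc m)" "k m * (K' m * Z) = k (Suc m) * Z" for Z
    by (metis K_K'_k(2) K_k(2), metis K_K'_k(2) K_k(2) mult.assoc)
  have "?l \<noteq> 0" by (rule p_inv)
  have pp: "inverse p * (z * p) = z" "inverse p * (p * z) = z" "x * (inverse p * z) * p = x * z" for x z
    using p0 by simp_all
  have main: "(?l * (- inverse p) ^ n) *\<^sub>s (k i * (?R * e m - e m * ?R))
      + (if j = Suc m then Pm i m * K m else 0) = (if i = m then Pm (Suc m) j else 0)"
  proof (cases n)
    case 0
    show ?thesis
    proof (cases "i = m")
      case True
      have "f m * e m - e m * f m = - (e m * f m - f m * e m)"
        by simp
      then have "k i * (?R * e m - e m * ?R) = (- (1 / ?l)) *\<^sub>s (k i * (K m - K' m))"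
        using e_f''[OF m, of m] True 0 by simp
      then have "?l *\<^sub>s (k i * (?R * e m - e m * ?R)) = - (k i * (K m - K' m))"
        using \<open>?l \<noteq> 0\<close> by simp
      then show ?thesis using True 0 j by (simp add: Pm_simps algebra_simps kK)
    next
      case False
      then show ?thesis using e_f''[OF m, of m] S.e_f''[OF m, of i] 0 j by simp
    qed
  next
    case (Suc n')
    have R: "?R * e m - e m * ?R = (if m = Suc (i + n') then K m * F.root i n'
        else if m = i then - (F.root (Suc i) n' * K' m) else 0)"
      unfolding Suc by (rule S.root_f[OF m])
    consider "m = Suc (i + n')" | "m = i" | "m \<noteq> Suc (i + n')" "m \<noteq> i" by blast
    then show ?thesis
    proof cases
      case 1
      have "K m * F.root i n' = p *\<^sub>s (F.root i n' * K m)"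
        using S.K_root(1)[of m i n'] 1 by (simp add: wfac_def chi_def)
      then show ?thesis unfolding R using 1 j Suc Pm_simps(4)[of i n'] by (simp add: mult.assoc pp)
    next
      case 2
      then have jm: "j = Suc (Suc m + n')" using j Suc by simp
      have "K' m * F.root (Suc m) n' = inverse p *\<^sub>s (F.root (Suc m) n' * K' m)"
        using S.K_root(2)[of m "Suc m" n'] p0 by (simp add: wfac_def chi_def)
      then have "F.root (Suc m) n' * K' m = p *\<^sub>s (K' m * F.root (Suc m) n')"
        using p0 by simp
      then show ?thesis unfolding R jm Pm_simps(4) using 2 Suc by (simp add: kK[unfolded 2(1)] pp)
    next
      case 3
      then show ?thesis unfolding R using j Suc by simp
    qed
  qed
  have "e m * Pm i j = inverse (wfac p i m) *\<^sub>s ((?l * (- inverse p) ^ n) *\<^sub>s (k i * (e m * ?R)))"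
    by (simp add: j Pm_simps(4) ek mult.commute)
  then have "wfac p i m *\<^sub>s (e m * Pm i j) = (?l * (- inverse p) ^ n) *\<^sub>s (k i * (e m * ?R))"
    using p0 by (simp add: mult.assoc[symmetric])
  then have "Pm i j * e m - wfac p i m *\<^sub>s (e m * Pm i j)
      = (?l * (- inverse p) ^ n) *\<^sub>s (k i * (?R * e m - e m * ?R))"
    by (simp add: j Pm_simps(4) sop_distrib(1,2) right_diff_distrib[of "k _"] mult.assoc)
  with main show ?thesis by (simp add: algebra_simps)
qed (use p0 in \<open>auto simp: Pm_def k_e K_k[symmetric] K_K'_k\<close>)

text \<open>The root vectors of \<open>F_root\<close>, from which the R-matrix is built; the bracket
  has p where that of \<open>FB\<close> has 1/p.\<close>

primrec FR :: "nat \<Rightarrow> nat \<Rightarrow> 'a lop" where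
  "FR i 0 = f i"
| "FR i (Suc n) = f (i + Suc n) * FR i n - p *\<^sub>s (FR i n * f (i + Suc n))"

lemma FR_far: "i + n + 1 < m \<Longrightarrow> f m * FR i n = FR i n * f m"
proof (induction n)
  case (Suc n)
  then show ?case
    by (simp only: FR.simps) (rule E.commute_commutator; use Suc F.far' in auto)
qed (use F.far' in auto)

text \<open>Unrolled, the right side is the sum over all ways to cut the chain of indices into
  pieces, with one factor p - 1/p per cut. Precisely this sum arises when the ordered product of
  q-exponentials acts on V (x) M.\<close>

lemma FB_FR: "FB i n = FR i n + (p - inverse p) *\<^sub>s (\<Sum>s<n. FR i s * FB (i + s + 1) (n - s - 1))"
proof (induction n)
  case 0
  then show ?case by (simp add: FB_simps)
next
  case (Suc n)
  let ?y = "f (i + Suc n)" and ?l = "p - inverse p"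
  let ?X = "\<Sum>s<n. FR i s * FB (i + s + 1) (n - s - 1)"
  have "FR i s * FB (i + s + 1) (Suc n - s - 1) =
      ?y * (FR i s * FB (i + s + 1) (n - s - 1)) - inverse p *\<^sub>s (FR i s * FB (i + s + 1) (n - s - 1) * ?y)"
    if "s < n" for s
  proof -
    from that obtain t where t: "n = Suc (s + t)" using less_iff_Suc_add by auto
    have "?y * FR i s = FR i s * ?y" using that by (intro FR_far) simp
    then have "?y * (FR i s * Z) = FR i s * (?y * Z)" for Z by (metis mult.assoc)
    then show ?thesis by (simp add: t FB_simps algebra_simps)
  qed
  then have "(\<Sum>s<Suc n. FR i s * FB (i + s + 1) (Suc n - s - 1)) =
      (\<Sum>s<n. ?y * (FR i s * FB (i + s + 1) (n - s - 1)) - inverse p *\<^sub>s (FR i s * FB (i + s + 1) (n - s - 1) * ?y))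
       + FR i n * ?y"
    by (simp add: FB_simps)
  also have "\<dots> = ?y * ?X - inverse p *\<^sub>s (?X * ?y) + FR i n * ?y"
    by (simp add: sum_subtractf sum_distrib_left sum_distrib_right sop_sum del: sop_simps)
  finally have *: "(\<Sum>s<Suc n. FR i s * FB (i + s + 1) (Suc n - s - 1)) = \<dots>" .
  have "FB i (Suc n) = ?y * (FR i n + ?l *\<^sub>s ?X) - inverse p *\<^sub>s ((FR i n + ?l *\<^sub>s ?X) * ?y)"
    unfolding FB_simps(2) Suc ..
  also have "\<dots> = FR i (Suc n) + ?l *\<^sub>s (?y * ?X - inverse p *\<^sub>s (?X * ?y) + FR i n * ?y)"
    by (simp add: algebra_simps sop_distrib)
  finally show ?case unfolding * .
qed

lemma root_trivial: "i = 0 \<or> i + n \<ge> N \<Longrightarrow> E.root i n = 0"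
  by (induction n) (auto simp: e_out)

lemma FB_trivial: "i = 0 \<or> i + n \<ge> N \<Longrightarrow> FB i n = 0"
  by (induction n) (auto simp: f_out FB_simps)

end


section \<open>Modules, their tensor products and intertwiners\<close>

definition uq_act :: "nat \<Rightarrow> (uqgen \<Rightarrow> 'a lop) \<Rightarrow> bool" where
  "uq_act N X \<longleftrightarrow> uq_ops N qq (\<lambda>i. X (GE i)) (\<lambda>i. X (GF i)) (\<lambda>j. X (GK j)) (\<lambda>j. X (GKi j))"

text \<open>\<open>Lp_e\<close> with j = m determines each entry from the preceding one. Taken as a
  definition, this makes sense for every assignment of operators to the generators, in particular
  for a tensor product, for which no relations have been checked.\<close>

primrec Lr :: "(uqgen \<Rightarrow> 'a lop) \<Rightarrow> nat \<Rightarrow> nat \<Rightarrow> 'a lop" where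
  "Lr X i 0 = X (GK i)"
| "Lr X i (Suc n) = X (GKi (i + n)) * X (GK (Suc (i + n))) *
    (wfac qq i (i + n) *\<^sub>s (Lr X i n * X (GE (i + n))) - X (GE (i + n)) * Lr X i n)"

text \<open>The recursion solved from \<open>Pm_f\<close> with j = m; the factor 1/q is the inverse
  of \<open>wfac qq m m\<close>.\<close>

primrec Pr :: "(uqgen \<Rightarrow> 'a lop) \<Rightarrow> nat \<Rightarrow> nat \<Rightarrow> 'a lop" where
  "Pr X i 0 = X (GK i)"
| "Pr X i (Suc n) = X (GF (i + n)) * Pr X i n - inverse qq *\<^sub>s (Pr X i n * X (GF (i + n)))"

definition LL :: "(uqgen \<Rightarrow> 'a lop) \<Rightarrow> nat \<Rightarrow> nat \<Rightarrow> 'a lop" where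
  "LL X j i = (if j < i then 0 else Lr X i (j - i))"

definition PP :: "(uqgen \<Rightarrow> 'a lop) \<Rightarrow> nat \<Rightarrow> nat \<Rightarrow> 'a lop" where
  "PP X i j = (if j < i then 0 else Pr X i (j - i))"

fun tact :: "(uqgen \<Rightarrow> 'a lop) \<Rightarrow> (uqgen \<Rightarrow> 'b lop) \<Rightarrow> uqgen \<Rightarrow> ('a \<times> 'b) lop" where
  "tact X Y (GE i) = X (GE i) \<otimes>\<^sub>o (Y (GK i) * Y (GKi (Suc i))) + 1 \<otimes>\<^sub>o Y (GE i)"
| "tact X Y (GF i) = X (GF i) \<otimes>\<^sub>o 1 + (X (GKi i) * X (GK (Suc i))) \<otimes>\<^sub>o Y (GF i)"
| "tact X Y (GK j) = X (GK j) \<otimes>\<^sub>o Y (GK j)"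
| "tact X Y (GKi j) = X (GKi j) \<otimes>\<^sub>o Y (GKi j)"

definition inter :: "(uqgen \<Rightarrow> 'a lop) \<Rightarrow> (uqgen \<Rightarrow> 'b lop) \<Rightarrow> ('a vec \<Rightarrow> 'b vec) \<Rightarrow> bool" where
  "inter X Y \<Phi> \<longleftrightarrow> lin \<Phi> \<and> (\<forall>g v. \<Phi> (app (X g) v) = app (Y g) (\<Phi> v))"

lemma inter_LL: "inter X Y \<Phi> \<Longrightarrow> \<Phi> (app (LL X j i) v) = app (LL Y j i) (\<Phi> v)"
proof -
  assume a: "inter X Y \<Phi>"
  have "\<Phi> (app (Lr X i n) v) = app (Lr Y i n) (\<Phi> v)" for n v
    using a by (induction n arbitrary: v) (simp_all add: inter_def app_lin lin_simps)
  then show ?thesis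
    using a by (simp add: LL_def inter_def lin_0)
qed

lemma inter_PP: "inter X Y \<Phi> \<Longrightarrow> \<Phi> (app (PP X i j) v) = app (PP Y i j) (\<Phi> v)"
proof -
  assume a: "inter X Y \<Phi>"
  have "\<Phi> (app (Pr X i n) v) = app (Pr Y i n) (\<Phi> v)" for n v
    using a by (induction n arbitrary: v) (simp_all add: inter_def app_lin lin_simps)
  then show ?thesis
    using a by (simp add: PP_def inter_def lin_0)
qed

locale uq_rep =
  fixes N :: nat and X :: "uqgen \<Rightarrow> 'a lop"
  assumes act: "uq_act N X"
begin

sublocale uq_ops N qq "\<lambda>i. X (GE i)" "\<lambda>i. X (GF i)" "\<lambda>j. X (GK j)" "\<lambda>j. X (GKi j)"
  using act by (simp add: uq_act_def)

lemma K_inv: "X (GKi m) * X (GK (Suc m)) * (K m * Z) = Z"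
proof -
  have "X (GKi m) * X (GK (Suc m)) * K m = X (GKi m) * (K m * X (GK (Suc m)))"
    by (simp add: K_k mult.assoc)
  also have "\<dots> = 1" by (simp add: K_K'_k ki_k)
  finally show ?thesis by (metis mult.assoc mult.left_neutral)
qed

lemma Lp_Suc: "i \<le> m \<Longrightarrow> K m * Lp (Suc m) i =
    wfac qq i m *\<^sub>s (Lp m i * X (GE m)) - X (GE m) * Lp m i"
  using Lp_e[of i m m] by (simp add: algebra_simps)

lemma LL_eq: "LL X = Lp"
proof (intro ext)
  fix j i
  have "Lr X i n = Lp (i + n) i" for n
  proof (induction n)
    case (Suc n)
    show ?case
      using K_inv[of "i + n" "Lp (Suc (i + n)) i"] Lp_Suc[of i "i + n"] by (simp add: Suc)
  qed (simp add: Lp_simps)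
  from this[of "j - i"] show "LL X j i = Lp j i"
    by (simp add: LL_def Lp_simps)
qed

lemma PP_eq: "PP X = Pm"
proof (intro ext)
  fix i j
  have "Pr X i n = Pm i (i + n)" for n
  proof (induction n)
    case (Suc n)
    show ?case
      using Pm_f[of "i + n" "i + n" i] by (simp add: Suc wfac_def chi_def algebra_simps)
  qed (simp add: Pm_simps)
  from this[of "j - i"] show "PP X i j = Pm i j"
    by (simp add: PP_def Pm_simps)
qed

lemma ki_Lp: "X (GKi l) * Lp j i = (inverse (chi qq l i) * chi qq l j) *\<^sub>s (Lp j i * X (GKi l))"
proof -
  have "Lp j i * X (GKi l) = X (GKi l) * (X (GK l) * Lp j i) * X (GKi l)"
    by (simp add: mult.assoc[symmetric] ki_k)
  also have "\<dots> = (chi qq l i * inverse (chi qq l j)) *\<^sub>s (X (GKi l) * Lp j i)"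
    by (simp add: k_Lp mult.assoc k_ki)
  finally show ?thesis using p0 by (simp add: field_simps)
qed

lemma K_Lp: "K m * Lp j i = (wfac qq i m * inverse (wfac qq j m)) *\<^sub>s (Lp j i * K m)"
proof -
  have *: "Lp j i * (a * b) = Lp j i * a * b" for a b by (simp add: mult.assoc)
  have sym: "chi qq a b = chi qq b a" for a b
    by (simp add: chi_def)
  have "K m * Lp j i = X (GK m) * ((inverse (chi qq (Suc m) i) * chi qq (Suc m) j) *\<^sub>s (Lp j i * X (GKi (Suc m))))"
    by (simp add: K_def mult.assoc ki_Lp)
  also have "\<dots> = ((inverse (chi qq (Suc m) i) * chi qq (Suc m) j) * (chi qq m i * inverse (chi qq m j)))
      *\<^sub>s (Lp j i * K m)"
    by (simp add: mult.assoc[symmetric] k_Lp[of m] K_def)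
  finally show ?thesis
    by (simp add: wfac_def sym[of m] sym[of "Suc m"] mult_ac)
qed

lemma ki_Pm: "X (GKi l) * Pm i j = (inverse (chi qq l j) * chi qq l i) *\<^sub>s (Pm i j * X (GKi l))"
proof -
  have "Pm i j * X (GKi l) = X (GKi l) * (X (GK l) * Pm i j) * X (GKi l)"
    by (simp add: mult.assoc[symmetric] ki_k)
  also have "\<dots> = (chi qq l j * inverse (chi qq l i)) *\<^sub>s (X (GKi l) * Pm i j)"
    by (simp add: k_Pm mult.assoc k_ki)
  finally show ?thesis using p0 by (simp add: field_simps)
qed

lemma K'_Pm: "K' m * Pm i j = (wfac qq i m * inverse (wfac qq j m)) *\<^sub>s (Pm i j * K' m)"
proof -
  have sym: "chi qq a b = chi qq b a" for a b
    by (simp add: chi_def)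
  have "K' m * Pm i j = X (GKi m) * ((chi qq (Suc m) j * inverse (chi qq (Suc m) i)) *\<^sub>s (Pm i j * X (GK (Suc m))))"
    by (simp add: K'_def mult.assoc k_Pm)
  also have "\<dots> = ((chi qq (Suc m) j * inverse (chi qq (Suc m) i)) * (inverse (chi qq m j) * chi qq m i))
      *\<^sub>s (Pm i j * K' m)"
    by (simp add: mult.assoc[symmetric] ki_Pm[of m] K'_def)
  finally show ?thesis
    by (simp add: wfac_def sym[of m] sym[of "Suc m"] mult_ac)
qed

end

text \<open>Induction along the recursion of \<open>Lr\<close>. The first half of the
  comultiplication of E_m advances the k-th summand to the next row; the second half contributes
  only at k = m, where it creates the new summand k = m + 1.\<close>

lemma LL_tact:
  assumes X: "uq_act N X" and Y: "uq_act N Y"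
  shows "LL (tact X Y) j i = (\<Sum>k\<in>{i..j}. LL X j k \<otimes>\<^sub>o LL Y k i)"
proof -
  interpret X: uq_rep N X by standard fact
  interpret Y: uq_rep N Y by standard fact
  have "Lr (tact X Y) i n = (\<Sum>k\<in>{i..i + n}. X.Lp (i + n) k \<otimes>\<^sub>o Y.Lp k i)" for n
  proof (induction n)
    case 0
    then show ?case by (simp add: X.Lp_simps Y.Lp_simps)
  next
    case (Suc n)
    define m where "m = i + n"
    let ?XK = "X (GKi m) * X (GK (Suc m))" and ?YK = "Y (GKi m) * Y (GK (Suc m))"
    let ?w = "wfac qq i m" and ?XE = "X (GE m)" and ?YE = "Y (GE m)"
    have step: "(?XK \<otimes>\<^sub>o ?YK) * (?w *\<^sub>s ((X.Lp m k \<otimes>\<^sub>o Y.Lp k i) * tact X Y (GE m))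
          - tact X Y (GE m) * (X.Lp m k \<otimes>\<^sub>o Y.Lp k i))
        = X.Lp (Suc m) k \<otimes>\<^sub>o Y.Lp k i + (if k = m then X.Lp (Suc m) (Suc m) \<otimes>\<^sub>o Y.Lp (Suc m) i else 0)"
      if k: "k \<in> {i..m}" for k
    proof -
      have a: "wfac qq k m *\<^sub>s (Y.K m * Y.Lp k i) = ?w *\<^sub>s (Y.Lp k i * Y.K m)"
        using X.p0 by (simp add: Y.K_Lp mult.left_commute)
      have b: "?w *\<^sub>s (Y.Lp k i * ?YE) - ?YE * Y.Lp k i = (if k = m then Y.K m * Y.Lp (Suc m) i else 0)"
        using Y.Lp_e[of i m k] k by (auto simp: algebra_simps)
      have c: "X.K m * X.Lp (Suc m) k = wfac qq k m *\<^sub>s (X.Lp m k * ?XE) - ?XE * X.Lp m k"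
        using X.Lp_Suc[of k m] k by simp
      have d: "?XK * X.Lp m m = X.Lp (Suc m) (Suc m)"
        using X.K_K'_k(2)[of m] by (simp add: X.Lp_simps X.K'_def)
      have tE: "tact X Y (GE m) = ?XE \<otimes>\<^sub>o Y.K m + 1 \<otimes>\<^sub>o ?YE"
        by (simp add: Y.K_def)
      have "?w *\<^sub>s ((X.Lp m k \<otimes>\<^sub>o Y.Lp k i) * tact X Y (GE m)) - tact X Y (GE m) * (X.Lp m k \<otimes>\<^sub>o Y.Lp k i)
        = (X.Lp m k * ?XE) \<otimes>\<^sub>o (?w *\<^sub>s (Y.Lp k i * Y.K m)) - (?XE * X.Lp m k) \<otimes>\<^sub>o (Y.K m * Y.Lp k i)
          + X.Lp m k \<otimes>\<^sub>o (?w *\<^sub>s (Y.Lp k i * ?YE) - ?YE * Y.Lp k i)"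
        unfolding tE by (simp add: distrib_left distrib_right tl_mult tl_distrib sop_distrib)
      also have "\<dots> = (X.K m * X.Lp (Suc m) k) \<otimes>\<^sub>o (Y.K m * Y.Lp k i)
          + X.Lp m k \<otimes>\<^sub>o (if k = m then Y.K m * Y.Lp (Suc m) i else 0)"
        unfolding a[symmetric] b c by (simp add: tl_distrib)
      finally show ?thesis
        by (simp add: distrib_left tl_mult X.K_inv Y.K_inv d tl_distrib)
    qed
    have "Lr (tact X Y) i (Suc n) = (\<Sum>k\<in>{i..m}. (?XK \<otimes>\<^sub>o ?YK) *
        (?w *\<^sub>s ((X.Lp m k \<otimes>\<^sub>o Y.Lp k i) * tact X Y (GE m)) - tact X Y (GE m) * (X.Lp m k \<otimes>\<^sub>o Y.Lp k i)))"
      by (simp add: Suc m_def[symmetric] tl_mult sum_distrib_left sum_distrib_right sop_sum sum_subtractf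
          right_diff_distrib del: tact.simps(1))
    also have "\<dots> = (\<Sum>k\<in>{i..m}. X.Lp (Suc m) k \<otimes>\<^sub>o Y.Lp k i
        + (if k = m then X.Lp (Suc m) (Suc m) \<otimes>\<^sub>o Y.Lp (Suc m) i else 0))"
      by (rule sum.cong[OF HOL.refl step])
    also have "\<dots> = (\<Sum>k\<in>{i..Suc m}. X.Lp (Suc m) k \<otimes>\<^sub>o Y.Lp k i)"
      by (simp add: sum.distrib m_def sum.atLeast_Suc_atMost[symmetric])
    finally show ?case by (simp add: m_def)
  qed
  from this[of "j - i"] show ?thesis
    by (cases "j < i") (simp_all add: LL_def[of "tact X Y"] X.LL_eq Y.LL_eq)
qed

text \<open>As for \<open>LL_tact\<close>, with F_m: the term F (x) 1 extends the entry of X, and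
  the other term extends that of Y, which survives only at k = m.\<close>

lemma PP_tact:
  assumes X: "uq_act N X" and Y: "uq_act N Y"
  shows "PP (tact X Y) i j = (\<Sum>k\<in>{i..j}. PP X k j \<otimes>\<^sub>o PP Y i k)"
proof -
  interpret X: uq_rep N X by standard fact
  interpret Y: uq_rep N Y by standard fact
  have "Pr (tact X Y) i n = (\<Sum>k\<in>{i..i + n}. X.Pm k (i + n) \<otimes>\<^sub>o Y.Pm i k)" for n
  proof (induction n)
    case 0
    then show ?case by (simp add: X.Pm_simps Y.Pm_simps)
  next
    case (Suc n)
    define m where "m = i + n"
    let ?XF = "X (GF m)" and ?YF = "Y (GF m)" and ?q = "inverse qq"
    have step: "tact X Y (GF m) * (X.Pm k m \<otimes>\<^sub>o Y.Pm i k) - ?q *\<^sub>s ((X.Pm k m \<otimes>\<^sub>o Y.Pm i k) * tact X Y (GF m))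
        = X.Pm k (Suc m) \<otimes>\<^sub>o Y.Pm i k + (if k = m then X.Pm (Suc m) (Suc m) \<otimes>\<^sub>o Y.Pm i (Suc m) else 0)"
      if k: "k \<in> {i..m}" for k
    proof -
      have wm: "wfac qq m m = qq" by (simp add: wfac_def chi_def)
      have a: "?q *\<^sub>s (X.Pm k m * X.K' m) = inverse (wfac qq k m) *\<^sub>s (X.K' m * X.Pm k m)"
        using X.p0 by (simp add: X.K'_Pm wm mult.assoc[symmetric])
      have b: "?YF * Y.Pm i k - inverse (wfac qq k m) *\<^sub>s (Y.Pm i k * ?YF) = (if k = m then Y.Pm i (Suc m) else 0)"
        using Y.Pm_f[of k m i] k by (auto simp: algebra_simps)
      have c: "X.Pm k (Suc m) = ?XF * X.Pm k m - ?q *\<^sub>s (X.Pm k m * ?XF)"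
        using X.Pm_f[of m m k] k by (simp add: wm algebra_simps)
      have d: "X.K' m * X.Pm m m = X.Pm (Suc m) (Suc m)"
        using X.K_K'_k(2)[of m] by (simp add: X.Pm_simps)
      have tF: "tact X Y (GF m) = ?XF \<otimes>\<^sub>o 1 + X.K' m \<otimes>\<^sub>o ?YF"
        by (simp add: X.K'_def)
      have "tact X Y (GF m) * (X.Pm k m \<otimes>\<^sub>o Y.Pm i k) - ?q *\<^sub>s ((X.Pm k m \<otimes>\<^sub>o Y.Pm i k) * tact X Y (GF m))
        = (?XF * X.Pm k m - ?q *\<^sub>s (X.Pm k m * ?XF)) \<otimes>\<^sub>o Y.Pm i k
          + ((X.K' m * X.Pm k m) \<otimes>\<^sub>o (?YF * Y.Pm i k) - (?q *\<^sub>s (X.Pm k m * X.K' m)) \<otimes>\<^sub>o (Y.Pm i k * ?YF))"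
        unfolding tF by (simp add: distrib_left distrib_right tl_mult tl_distrib sop_distrib)
      also have "\<dots> = X.Pm k (Suc m) \<otimes>\<^sub>o Y.Pm i k
          + (X.K' m * X.Pm k m) \<otimes>\<^sub>o (?YF * Y.Pm i k - inverse (wfac qq k m) *\<^sub>s (Y.Pm i k * ?YF))"
        unfolding a c by (simp add: tl_distrib)
      finally show ?thesis
        unfolding b by (auto simp: d tl_distrib)
    qed
    have "Pr (tact X Y) i (Suc n) = (\<Sum>k\<in>{i..m}.
        tact X Y (GF m) * (X.Pm k m \<otimes>\<^sub>o Y.Pm i k) - ?q *\<^sub>s ((X.Pm k m \<otimes>\<^sub>o Y.Pm i k) * tact X Y (GF m)))"
      by (simp add: Suc m_def[symmetric] sum_distrib_left sum_distrib_right sop_sum sum_subtractf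
          del: tact.simps)
    also have "\<dots> = (\<Sum>k\<in>{i..m}. X.Pm k (Suc m) \<otimes>\<^sub>o Y.Pm i k
        + (if k = m then X.Pm (Suc m) (Suc m) \<otimes>\<^sub>o Y.Pm i (Suc m) else 0))"
      by (rule sum.cong[OF HOL.refl step])
    also have "\<dots> = (\<Sum>k\<in>{i..Suc m}. X.Pm k (Suc m) \<otimes>\<^sub>o Y.Pm i k)"
      by (simp add: sum.distrib m_def sum.atLeast_Suc_atMost[symmetric])
    finally show ?case by (simp add: m_def)
  qed
  from this[of "j - i"] show ?thesis
    by (cases "j < i") (simp_all add: PP_def[of "tact X Y"] X.PP_eq Y.PP_eq)
qed


section \<open>The vector representation and the braidings described by their components\<close>

lemma qq_neq: "qq \<noteq> 0" "qq * qq \<noteq> 1" "qq * qq \<noteq> - 1"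
  by (simp_all add: qq_def Zero_fract_def One_fract_def eq_fract one_pCons)

definition lam :: kk where "lam = qq - inverse qq"

lemma lam_nz: "lam \<noteq> 0"
  using qq_neq unfolding lam_def by (metis diff_eq_diff_eq diff_zero right_inverse)

text \<open>The torus acts on v_j for every natural j, but E and F act only inside the range. So the
  relations hold on all formal combinations, and each v_j with j outside 1..N spans a submodule of
  its own.\<close>

fun Vop :: "nat \<Rightarrow> uqgen \<Rightarrow> nat lop" where
  "Vop N (GE i) = (if i \<in> {1..<N} then Lop (vec_rep (GE i)) else 0)"
| "Vop N (GF i) = (if i \<in> {1..<N} then Lop (vec_rep (GF i)) else 0)"
| "Vop N (GK i) = Lop (vec_rep (GK i))"
| "Vop N (GKi i) = Lop (vec_rep (GKi i))"

lemma app_Vop: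
  "app (Vop N (GE i)) (bvec j) = (if i \<in> {1..<N} \<and> j = Suc i then bvec i else 0)"
  "app (Vop N (GF i)) (bvec j) = (if i \<in> {1..<N} \<and> j = i then bvec (Suc i) else 0)"
  "app (Vop N (GK i)) (bvec j) = scl (chi qq i j) (bvec j)"
  "app (Vop N (GKi i)) (bvec j) = scl (inverse (chi qq i j)) (bvec j)"
  by (auto simp: chi_def)

declare Vop.simps [simp del]

lemma Vop_eq_vec_rep: "x \<in> uq_gens N \<Longrightarrow> app (Vop N x) = vec_rep x"
  by (auto simp: uq_gens_def Vop.simps)

lemma uq_act_Vop: "uq_act N (Vop N)"
  unfolding uq_act_def
proof
  show "Vop N (GE i) * Vop N (GF j) - Vop N (GF j) * Vop N (GE i) = (if i = j then
      (1 / (qq - inverse qq)) *\<^sub>s (Vop N (GK j) * Vop N (GKi (Suc j)) - Vop N (GKi j) * Vop N (GK (Suc j)))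
      else 0)" if "i \<in> {1..<N}" "j \<in> {1..<N}" for i j
  proof (rule lop_eqI)
    fix b
    have [simp]: "qq \<noteq> inverse qq" "(inverse qq - qq) / (qq - inverse qq) = - 1"
      using lam_nz by (auto simp: lam_def divide_eq_eq)
    show "app (Vop N (GE i) * Vop N (GF j) - Vop N (GF j) * Vop N (GE i)) (bvec b) =
      app (if i = j then (1 / (qq - inverse qq)) *\<^sub>s (Vop N (GK j) * Vop N (GKi (Suc j)) - Vop N (GKi j) * Vop N (GK (Suc j)))
      else 0) (bvec b)"
      using that by (auto simp: app_Vop app_lin chi_def kvs.scale_left_diff_distrib[symmetric])
  qed
qed (use qq_neq in \<open>auto intro!: lop_eqI simp: app_Vop app_lin wfac_def chi_def\<close>)

subsection \<open>Components with respect to the vector representation\<close>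

definition compl :: "nat \<Rightarrow> (nat \<times> 'a) vec \<Rightarrow> 'a vec" where
  "compl j = lin_ext (\<lambda>(i, a). if i = j then bvec a else 0)"

definition compr :: "nat \<Rightarrow> ('a \<times> nat) vec \<Rightarrow> 'a vec" where
  "compr j = lin_ext (\<lambda>(a, i). if i = j then bvec a else 0)"

lemma lin_compl [simp, intro]: "lin (compl j)" and lin_compr [simp, intro]: "lin (compr j)"
  by (simp_all add: compl_def compr_def)

lemmas compl_lin = lin_simps[OF lin_compl] and compr_lin = lin_simps[OF lin_compr]

lemma compl_bvec [simp]: "compl j (bvec (i, a)) = (if i = j then bvec a else 0)"
  and compr_bvec [simp]: "compr j (bvec (a, i)) = (if i = j then bvec a else 0)"
  by (simp_all add: compl_def compr_def)

lemma lin_if_zero [simp]: "lin (\<lambda>v. if b then v else 0)"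
  by (simp add: lin_def)

lemma compl_Pair [simp]: "compl j (reindex (Pair i) v) = (if i = j then v else 0)"
  by (rule lin_eqI[of "\<lambda>v. compl j (reindex (Pair i) v)"])
    (auto intro: lin_compose[of "compl j"] simp: lin_zero)

lemma compr_Pair [simp]: "compr j (reindex (\<lambda>a. (a, i)) v) = (if i = j then v else 0)"
  by (rule lin_eqI[of "\<lambda>v. compr j (reindex (\<lambda>a. (a, i)) v)"])
    (auto intro: lin_compose[of "compr j"] simp: lin_zero)

lemma compl_tens [simp]: "compl j (tens (bvec i) v) = (if i = j then v else 0)"
  and compr_tens [simp]: "compr j (tens v (bvec i)) = (if i = j then v else 0)"
  by (simp_all add: tens_bvec_left tens_bvec_right)

lemma lookup_compl: "Poly_Mapping.lookup (compl j v) a = Poly_Mapping.lookup v (j, a)"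
proof -
  have "Poly_Mapping.lookup (compl j v) a = (\<Sum>x\<in>Poly_Mapping.keys v. Poly_Mapping.lookup v x *
      Poly_Mapping.lookup (if fst x = j then bvec (snd x) else 0) a)"
    by (simp add: compl_def lin_ext_def case_prod_beta lookup_sum_vec)
  also have "\<dots> = (\<Sum>x\<in>Poly_Mapping.keys v. if x = (j, a) then Poly_Mapping.lookup v x else 0)"
    by (rule sum.cong) (auto simp: lookup_bvec prod_eq_iff)
  finally show ?thesis by (auto simp: in_keys_iff)
qed

lemma lookup_compr: "Poly_Mapping.lookup (compr j v) a = Poly_Mapping.lookup v (a, j)"
proof -
  have "Poly_Mapping.lookup (compr j v) a = (\<Sum>x\<in>Poly_Mapping.keys v. Poly_Mapping.lookup v x *
      Poly_Mapping.lookup (if snd x = j then bvec (fst x) else 0) a)"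
    by (simp add: compr_def lin_ext_def case_prod_beta lookup_sum_vec)
  also have "\<dots> = (\<Sum>x\<in>Poly_Mapping.keys v. if x = (a, j) then Poly_Mapping.lookup v x else 0)"
    by (rule sum.cong) (auto simp: lookup_bvec prod_eq_iff)
  finally show ?thesis by (auto simp: in_keys_iff)
qed

lemma compl_eqI: "(\<And>j. compl j v = compl j w) \<Longrightarrow> v = w"
  by (rule poly_mapping_eqI) (metis lookup_compl surj_pair)

lemma compr_eqI: "(\<And>j. compr j v = compr j w) \<Longrightarrow> v = w"
  by (rule poly_mapping_eqI) (metis lookup_compr surj_pair)

text \<open>The braiding is described by its matrix coefficients, which is the form used by
  naturality and the hexagon. That the R-matrix has these coefficients is
  \<open>is_alpha_R_check_MV\<close>.\<close>

definition is_alpha :: "(uqgen \<Rightarrow> 'a lop) \<Rightarrow> (('a \<times> nat) vec \<Rightarrow> (nat \<times> 'a) vec) \<Rightarrow> bool" where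
  "is_alpha X a \<longleftrightarrow> lin a \<and> (\<forall>j i x. compl j (a (tens x (bvec i))) = app (LL X j i) x)"

definition is_beta :: "(uqgen \<Rightarrow> 'a lop) \<Rightarrow> ((nat \<times> 'a) vec \<Rightarrow> ('a \<times> nat) vec) \<Rightarrow> bool" where
  "is_beta X b \<longleftrightarrow> lin b \<and> (\<forall>j i x. compr i (b (tens (bvec j) x)) = app (PP X i j) x)"

lemma compl_tact_Vop:
  assumes "uq_act N X"
  shows
  "compl j (app (tact (Vop N) X (GE m)) w) = app (X (GE m)) (compl j w) +
    (if j = m \<and> m \<in> {1..<N} then app (X (GK m)) (app (X (GKi (Suc m))) (compl (Suc m) w)) else 0)"
  "compl j (app (tact (Vop N) X (GF m)) w) = scl (inverse (wfac qq j m)) (app (X (GF m)) (compl j w)) +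
    (if j = Suc m \<and> m \<in> {1..<N} then compl m w else 0)"
  "compl j (app (tact (Vop N) X (GK m)) w) = scl (chi qq m j) (app (X (GK m)) (compl j w))"
  "compl j (app (tact (Vop N) X (GKi m)) w) = scl (inverse (chi qq m j)) (app (X (GKi m)) (compl j w))"
proof -
  have lin: "lin (\<lambda>w. compl j (app Y w))" "lin (\<lambda>w. app Z (compl j w))" "lin (\<lambda>w. scl c (app Z (compl j w)))"
     "lin (\<lambda>w. if b then app Z (app Z' (compl j' w)) else 0)" "lin (\<lambda>w. if b then compl j' w else 0)"
    for Y :: "(nat \<times> 'a) lop" and Z Z' :: "'a lop" and c b j'
    by (auto simp: lin_def compl_lin app_lin algebra_simps)
  have e: "app (A \<otimes>\<^sub>o B) (bvec (i, a)) = tens (app A (bvec i)) (app B (bvec a))"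
    for A :: "nat lop" and B :: "'a lop" and i a
    by (simp add: app_tl tens_op_bvec)
  note s = e app_Vop compl_lin tens_simps app_lin wfac_def chi_def
  show "compl j (app (tact (Vop N) X (GE m)) w) = app (X (GE m)) (compl j w) +
    (if j = m \<and> m \<in> {1..<N} then app (X (GK m)) (app (X (GKi (Suc m))) (compl (Suc m) w)) else 0)"
    by (rule lin_eqI[of "\<lambda>w. compl j (app _ w)"], intro lin, intro lin_plus lin) (auto simp: s)
  show "compl j (app (tact (Vop N) X (GF m)) w) = scl (inverse (wfac qq j m)) (app (X (GF m)) (compl j w)) +
    (if j = Suc m \<and> m \<in> {1..<N} then compl m w else 0)"
    by (rule lin_eqI[of "\<lambda>w. compl j (app _ w)"], intro lin, intro lin_plus lin) (auto simp: s)
  show "compl j (app (tact (Vop N) X (GK m)) w) = scl (chi qq m j) (app (X (GK m)) (compl j w))"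
    by (rule lin_eqI[of "\<lambda>w. compl j (app _ w)"], intro lin, intro lin) (auto simp: s)
  show "compl j (app (tact (Vop N) X (GKi m)) w) = scl (inverse (chi qq m j)) (app (X (GKi m)) (compl j w))"
    by (rule lin_eqI[of "\<lambda>w. compl j (app _ w)"], intro lin, intro lin) (auto simp: s)
qed

lemma compr_tact_Vop:
  assumes "uq_act N X"
  shows
  "compr j (app (tact X (Vop N) (GE m)) w) = scl (wfac qq j m) (app (X (GE m)) (compr j w)) +
    (if j = m \<and> m \<in> {1..<N} then compr (Suc m) w else 0)"
  "compr j (app (tact X (Vop N) (GF m)) w) = app (X (GF m)) (compr j w) +
    (if j = Suc m \<and> m \<in> {1..<N} then app (X (GKi m)) (app (X (GK (Suc m))) (compr m w)) else 0)"
  "compr j (app (tact X (Vop N) (GK m)) w) = scl (chi qq m j) (app (X (GK m)) (compr j w))"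
  "compr j (app (tact X (Vop N) (GKi m)) w) = scl (inverse (chi qq m j)) (app (X (GKi m)) (compr j w))"
proof -
  have lin: "lin (\<lambda>w. compr j (app Y w))" "lin (\<lambda>w. app Z (compr j w))" "lin (\<lambda>w. scl c (app Z (compr j w)))"
     "lin (\<lambda>w. if b then app Z (app Z' (compr j' w)) else 0)" "lin (\<lambda>w. if b then compr j' w else 0)"
    for Y :: "('a \<times> nat) lop" and Z Z' :: "'a lop" and c b j'
    by (auto simp: lin_def compr_lin app_lin algebra_simps)
  have e: "app (B \<otimes>\<^sub>o A) (bvec (a, i)) = tens (app B (bvec a)) (app A (bvec i))"
    for A :: "nat lop" and B :: "'a lop" and i a
    by (simp add: app_tl tens_op_bvec)
  note s = e app_Vop compr_lin tens_simps app_lin wfac_def chi_def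
  show "compr j (app (tact X (Vop N) (GE m)) w) = scl (wfac qq j m) (app (X (GE m)) (compr j w)) +
    (if j = m \<and> m \<in> {1..<N} then compr (Suc m) w else 0)"
    by (rule lin_eqI[of "\<lambda>w. compr j (app _ w)"], intro lin, intro lin_plus lin) (auto simp: s)
  show "compr j (app (tact X (Vop N) (GF m)) w) = app (X (GF m)) (compr j w) +
    (if j = Suc m \<and> m \<in> {1..<N} then app (X (GKi m)) (app (X (GK (Suc m))) (compr m w)) else 0)"
    by (rule lin_eqI[of "\<lambda>w. compr j (app _ w)"], intro lin, intro lin_plus lin) (auto simp: s)
  show "compr j (app (tact X (Vop N) (GK m)) w) = scl (chi qq m j) (app (X (GK m)) (compr j w))"
    by (rule lin_eqI[of "\<lambda>w. compr j (app _ w)"], intro lin, intro lin) (auto simp: s)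
  show "compr j (app (tact X (Vop N) (GKi m)) w) = scl (inverse (chi qq m j)) (app (X (GKi m)) (compr j w))"
    by (rule lin_eqI[of "\<lambda>w. compr j (app _ w)"], intro lin, intro lin) (auto simp: s)
qed

lemma tact_Vop_tens:
  assumes "uq_act N X"
  shows
  "app (tact X (Vop N) (GE m)) (tens x (bvec i)) = scl (wfac qq i m) (tens (app (X (GE m)) x) (bvec i))
     + (if i = Suc m \<and> m \<in> {1..<N} then tens x (bvec m) else 0)"
  "app (tact X (Vop N) (GF m)) (tens x (bvec i)) = tens (app (X (GF m)) x) (bvec i)
     + (if i = m \<and> m \<in> {1..<N} then tens (app (X (GKi m)) (app (X (GK (Suc m))) x)) (bvec (Suc m)) else 0)"
  "app (tact X (Vop N) (GK m)) (tens x (bvec i)) = scl (chi qq m i) (tens (app (X (GK m)) x) (bvec i))"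
  "app (tact X (Vop N) (GKi m)) (tens x (bvec i)) = scl (inverse (chi qq m i)) (tens (app (X (GKi m)) x) (bvec i))"
  by (auto simp: app_Vop tens_simps app_lin wfac_def chi_def)

lemma tact_Vop_tens':
  assumes "uq_act N X"
  shows
  "app (tact (Vop N) X (GE m)) (tens (bvec i) x) = tens (bvec i) (app (X (GE m)) x)
     + (if i = Suc m \<and> m \<in> {1..<N} then tens (bvec m) (app (X (GK m)) (app (X (GKi (Suc m))) x)) else 0)"
  "app (tact (Vop N) X (GF m)) (tens (bvec i) x) = scl (inverse (wfac qq i m)) (tens (bvec i) (app (X (GF m)) x))
     + (if i = m \<and> m \<in> {1..<N} then tens (bvec (Suc m)) x else 0)"
  "app (tact (Vop N) X (GK m)) (tens (bvec i) x) = scl (chi qq m i) (tens (bvec i) (app (X (GK m)) x))"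
  "app (tact (Vop N) X (GKi m)) (tens (bvec i) x) = scl (inverse (chi qq m i)) (tens (bvec i) (app (X (GKi m)) x))"
  by (auto simp: app_Vop tens_simps app_lin wfac_def chi_def)

declare tact.simps [simp del]

lemma lin_eq_tensI':
  assumes "lin f" "lin g" "\<And>x b. f (tens (bvec b) x) = g (tens (bvec b) x)"
  shows "f v = g v"
proof (rule lin_eqI[OF assms(1,2)])
  show "f (bvec a) = g (bvec a)" for a
    using assms(3)[of "fst a" "bvec (snd a)"] by simp
qed

lemma app_if: "app (if b then Y else Z) v = (if b then app Y v else app Z v)"
  by simp

text \<open>Component by component, and one generator at a time, the claim is \<open>Lp_e\<close>,
  \<open>Lp_f\<close>, \<open>k_Lp\<close> or \<open>ki_Lp\<close>; for E and F outside the range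
  both sides vanish.\<close>

lemma inter_alpha:
  assumes X: "uq_act N X" and a: "is_alpha X a"
  shows "inter (tact X (Vop N)) (tact (Vop N) X) a"
  unfolding inter_def
proof (intro conjI allI)
  interpret X: uq_rep N X by standard fact
  have la: "lin a" and ca: "compl j (a (tens x (bvec i))) = app (X.Lp j i) x" for j i x
    using a by (auto simp: is_alpha_def X.LL_eq)
  show "lin a" by (rule la)
  fix g v
  show "a (app (tact X (Vop N) g) v) = app (tact (Vop N) X g) (a v)"
  proof (rule lin_eq_tensI[of "\<lambda>v. a (app _ v)" "\<lambda>v. app _ (a v)"])
    fix x i
    show "a (app (tact X (Vop N) g) (tens x (bvec i))) = app (tact (Vop N) X g) (a (tens x (bvec i)))"
    proof (rule compl_eqI)
      fix j
      show "compl j (a (app (tact X (Vop N) g) (tens x (bvec i)))) =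
          compl j (app (tact (Vop N) X g) (a (tens x (bvec i))))"
      proof (cases g)
        case (GE m)
        show ?thesis
        proof (cases "m \<in> {1..<N}")
          case True
          have "app (wfac qq i m *\<^sub>s (X.Lp j i * X (GE m)) + (if i = Suc m then X.Lp j m else 0)) x =
            app (X (GE m) * X.Lp j i + (if j = m then X.K m * X.Lp (Suc m) i else 0)) x"
            by (simp only: X.Lp_e)
          then show ?thesis using True
            by (simp add: GE tact_Vop_tens[OF X] compl_tact_Vop[OF X] ca compl_lin lin_simps[OF la] X.K_def
                app_if if_distrib[of "compl j"] if_distrib[of a] cong: if_cong)
        next
          case False
          then show ?thesis
            using X.e_out[OF False] False by (auto simp: GE tact_Vop_tens[OF X] compl_tact_Vop[OF X] compl_lin lin_simps[OF la] tens_simps)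
        qed
      next
        case (GF m)
        show ?thesis
        proof (cases "m \<in> {1..<N}")
          case True
          have "app (X.Lp j i * X (GF m) + (if i = m then X.Lp j (Suc m) * X.K' m else 0)) x =
            app ((if j = Suc m then X.Lp m i else 0) + inverse (wfac qq j m) *\<^sub>s (X (GF m) * X.Lp j i)) x"
            by (simp only: X.Lp_f[OF True])
          then show ?thesis using True
            by (simp add: GF tact_Vop_tens[OF X] compl_tact_Vop[OF X] ca compl_lin lin_simps[OF la] X.K'_def
                app_if if_distrib[of "compl j"] if_distrib[of a] add.commute cong: if_cong)
        next
          case False
          then show ?thesis
            using X.f_out[OF False] False by (auto simp: GF tact_Vop_tens[OF X] compl_tact_Vop[OF X] compl_lin lin_simps[OF la] tens_simps)
        qed
      next
        case (GK m)
        show ?thesis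
          using X.p0 by (simp add: GK tact_Vop_tens[OF X] compl_tact_Vop[OF X] ca compl_lin lin_simps[OF la]
              app_simps(6)[symmetric] X.k_Lp del: app_simps(6))
      next
        case (GKi m)
        have "app (X (GKi m)) (app (X.Lp j i) x) = scl (inverse (chi qq m i) * chi qq m j) (app (X.Lp j i) (app (X (GKi m)) x))"
          by (metis X.ki_Lp app_simps(6,7))
        then show ?thesis
          using X.p0 by (simp add: GKi tact_Vop_tens[OF X] compl_tact_Vop[OF X] ca compl_lin lin_simps[OF la])
      qed
    qed
  qed (auto intro: lin_compose la)
qed

lemma inter_beta:
  assumes X: "uq_act N X" and b: "is_beta X b"
  shows "inter (tact (Vop N) X) (tact X (Vop N)) b"
  unfolding inter_def
proof (intro conjI allI)
  interpret X: uq_rep N X by standard fact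
  have lb: "lin b" and cb: "compr i (b (tens (bvec j) x)) = app (X.Pm i j) x" for j i x
    using b by (auto simp: is_beta_def X.PP_eq)
  show "lin b" by (rule lb)
  fix g v
  show "b (app (tact (Vop N) X g) v) = app (tact X (Vop N) g) (b v)"
  proof (rule lin_eq_tensI'[of "\<lambda>v. b (app _ v)" "\<lambda>v. app _ (b v)"])
    fix x j
    show "b (app (tact (Vop N) X g) (tens (bvec j) x)) = app (tact X (Vop N) g) (b (tens (bvec j) x))"
    proof (rule compr_eqI)
      fix i
      show "compr i (b (app (tact (Vop N) X g) (tens (bvec j) x))) =
          compr i (app (tact X (Vop N) g) (b (tens (bvec j) x)))"
      proof (cases g)
        case (GE m)
        show ?thesis
        proof (cases "m \<in> {1..<N}")
          case True
          have "app (X.Pm i j * X (GE m) + (if j = Suc m then X.Pm i m * X.K m else 0)) x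
              = app (wfac qq i m *\<^sub>s (X (GE m) * X.Pm i j) + (if i = m then X.Pm (Suc m) j else 0)) x"
            by (simp only: X.Pm_e[OF True])
          then show ?thesis using True
            by (simp add: GE tact_Vop_tens'[OF X] compr_tact_Vop[OF X] cb compr_lin lin_simps[OF lb] X.K_def
                app_if if_distrib[of "compr i"] if_distrib[of b] cong: if_cong)
        next
          case False
          then show ?thesis
            using X.e_out[OF False] False by (auto simp: GE tact_Vop_tens'[OF X] compr_tact_Vop[OF X] compr_lin lin_simps[OF lb] tens_simps)
        qed
      next
        case (GF m)
        show ?thesis
        proof (cases "m \<in> {1..<N}")
          case True
          have "app ((if j = m then X.Pm i (Suc m) else 0) + inverse (wfac qq j m) *\<^sub>s (X.Pm i j * X (GF m))) x
            = app (X (GF m) * X.Pm i j + (if i = Suc m then X.K' m * X.Pm m j else 0)) x"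
            by (simp only: X.Pm_f)
          then show ?thesis using True
            by (simp add: GF tact_Vop_tens'[OF X] compr_tact_Vop[OF X] cb compr_lin lin_simps[OF lb] X.K'_def
                app_if if_distrib[of "compr i"] if_distrib[of b] add.commute cong: if_cong)
        next
          case False
          then show ?thesis
            using X.f_out[OF False] False by (auto simp: GF tact_Vop_tens'[OF X] compr_tact_Vop[OF X] compr_lin lin_simps[OF lb] tens_simps)
        qed
      next
        case (GK m)
        show ?thesis
          using X.p0 by (simp add: GK tact_Vop_tens'[OF X] compr_tact_Vop[OF X] cb compr_lin lin_simps[OF lb]
              app_simps(6)[symmetric] X.k_Pm del: app_simps(6))
      next
        case (GKi m)
        have "app (X (GKi m)) (app (X.Pm i j) x) = scl (inverse (chi qq m j) * chi qq m i) (app (X.Pm i j) (app (X (GKi m)) x))"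
          by (metis X.ki_Pm app_simps(6,7))
        then show ?thesis
          using X.p0 by (simp add: GKi tact_Vop_tens'[OF X] compr_tact_Vop[OF X] cb compr_lin lin_simps[OF lb])
      qed
    qed
  qed (auto intro: lin_compose lb)
qed


section \<open>Yang-Baxter and reflection equations\<close>

definition op12 :: "(('a \<times> 'b) vec \<Rightarrow> ('c \<times> 'd) vec) \<Rightarrow> ('a \<times> 'b \<times> 'z) vec \<Rightarrow> ('c \<times> 'd \<times> 'z) vec" where
  "op12 f = lin_ext (\<lambda>(x, y, z). reindex (\<lambda>(a, b). (a, b, z)) (f (bvec (x, y))))"

definition op23 :: "(('b \<times> 'z) vec \<Rightarrow> ('c \<times> 'd) vec) \<Rightarrow> ('a \<times> 'b \<times> 'z) vec \<Rightarrow> ('a \<times> 'c \<times> 'd) vec" where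
  "op23 f = lin_ext (\<lambda>(x, y, z). reindex (Pair x) (f (bvec (y, z))))"

lemma lin_op12 [simp, intro]: "lin (op12 f)"
  by (simp add: op12_def)

lemma lin_op23 [simp, intro]: "lin (op23 f)"
  by (simp add: op23_def)

lemma op12_bvec: "op12 f (bvec (x, y, z)) = reindex (\<lambda>(a, b). (a, b, z)) (f (bvec (x, y)))"
  by (simp add: op12_def)

lemma op23_bvec: "op23 f (bvec (x, y, z)) = reindex (Pair x) (f (bvec (y, z)))"
  by (simp add: op23_def)

lemma op12_reindex: "lin f \<Longrightarrow> op12 f (reindex (\<lambda>(a, b). (a, b, z)) w) = reindex (\<lambda>(a, b). (a, b, z)) (f w)"
  by (rule lin_eqI[of "\<lambda>w. op12 f (reindex _ w)"]) (auto simp: op12_bvec intro: lin_compose)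

lemma op23_reindex: "lin f \<Longrightarrow> op23 f (reindex (Pair x) w) = reindex (Pair x) (f w)"
  by (rule lin_eqI[of "\<lambda>w. op23 f (reindex _ w)"]) (auto simp: op23_bvec intro: lin_compose)

lemma op12_comp: "lin f \<Longrightarrow> op12 (f \<circ> g) v = op12 f (op12 g v)"
  by (rule lin_eqI[of "op12 _" "\<lambda>v. op12 f (op12 g v)"]) (auto simp: op12_bvec op12_reindex intro: lin_compose)

lemma compl_op23: "lin f \<Longrightarrow> compl j (op23 f v) = f (compl j v)"
  by (rule lin_eqI[of "\<lambda>v. compl j (op23 f v)" "\<lambda>v. f (compl j v)"])
    (auto simp: op23_bvec lin_0 intro: lin_compose[of "compl j"] lin_compose[of f])

text \<open>\<open>compr\<close> for triples: these are nested to the right, so the last factor has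
  to be exposed before its component can be taken.\<close>

definition comp3 :: "nat \<Rightarrow> ('a \<times> 'b \<times> nat) vec \<Rightarrow> ('a \<times> 'b) vec" where
  "comp3 j v = compr j (reindex (\<lambda>(a, b, i). ((a, b), i)) v)"

lemma lin_comp3 [simp, intro]: "lin (comp3 j)"
  unfolding comp3_def[abs_def] by (rule lin_compose) auto

lemma comp3_bvec [simp]: "comp3 j (bvec (a, b, i)) = (if i = j then bvec (a, b) else 0)"
  by (simp add: comp3_def)

lemma comp3_eqI: "(\<And>j. comp3 j v = comp3 j w) \<Longrightarrow> v = w"
  unfolding comp3_def by (rule inj_reindex[of "\<lambda>(a, b, i). ((a, b), i)"])
    (auto simp: inj_def intro: compr_eqI)

lemma comp3_reindex [simp]: "comp3 j (reindex (\<lambda>(a, b). (a, b, i)) w) = (if i = j then w else 0)"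
  by (rule lin_eqI[of "\<lambda>w. comp3 j (reindex _ w)"]) (auto intro: lin_compose[of "comp3 j"])

lemma comp3_op12: "lin f \<Longrightarrow> comp3 j (op12 f v) = f (comp3 j v)"
  by (rule lin_eqI[of "\<lambda>v. comp3 j (op12 f v)" "\<lambda>v. f (comp3 j v)"])
    (auto simp: op12_bvec lin_0 intro: lin_compose[of "comp3 j"] lin_compose[of f])

lemmas lin_os = lin_compose[OF lin_compl] lin_compose[OF lin_compr] lin_compose[OF lin_comp3]
  lin_compose[OF lin_op12] lin_compose[OF lin_op23] lin_compose[OF lin_reindex]
  lin_compose[OF lin_tens_right] lin_compose[OF lin_tens_left] lin_compose[OF lin_app]

lemma lin_eq_sum: "(\<And>k. k \<in> A \<Longrightarrow> lin (f k)) \<Longrightarrow> lin (\<lambda>v. \<Sum>k\<in>A. f k v)"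
  by (auto simp: lin_def sum.distrib kvs.scale_sum_right)

text \<open>Carrying the vector past Y and then past X multiplies the two matrices of coefficients,
  and this matrix product is the comultiplication of the L-operator.\<close>

lemma alpha_hexagon:
  assumes X: "uq_act N X" and Y: "uq_act N Y" and a: "is_alpha X a" and b: "is_alpha Y b"
  shows "compl j (op12 a (op23 b (reindex (\<lambda>(x, y). (x, y, i)) w))) = app (LL (tact X Y) j i) w"
proof (rule lin_eqI[of "\<lambda>w. compl j (op12 a (op23 b (reindex _ w)))"])
  have la: "lin a" and ca: "\<And>j i x. compl j (a (tens x (bvec i))) = app (LL X j i) x"
    and lb: "lin b" and cb: "\<And>j i x. compl j (b (tens x (bvec i))) = app (LL Y j i) x"
    using a b by (auto simp: is_alpha_def)
  show "lin (\<lambda>w. compl j (op12 a (op23 b (reindex (\<lambda>(x, y). (x, y, i)) w))))"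
    by (intro lin_os) auto
  have *: "compl j (op12 a (reindex (Pair x) u)) = (\<Sum>k\<le>j. tens (app (LL X j k) (bvec x)) (compl k u))"
    for x and u :: "(nat \<times> 'b) vec"
  proof (rule lin_eqI[of "\<lambda>u. compl j (op12 a (reindex (Pair x) u))"])
    show "lin (\<lambda>u. \<Sum>k\<le>j. tens (app (LL X j k) (bvec x)) (compl k u))"
      by (intro lin_eq_sum lin_os) auto
    fix c :: "nat \<times> 'b"
    obtain k y where c: "c = (k, y)" by force
    have "compl j (reindex (\<lambda>(i, x). (i, x, y)) v) = reindex (\<lambda>x. (x, y)) (compl j v)" for v :: "(nat \<times> 'a) vec"
      by (rule lin_eqI[of "\<lambda>v. compl j (reindex _ v)"]) (auto simp: lin_0 intro: lin_compose)
    then have "compl j (op12 a (reindex (Pair x) (bvec c))) = tens (app (LL X j k) (bvec x)) (bvec y)"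
      using ca[of j "bvec x" k] by (simp add: c op12_bvec tens_bvec_right)
    \<comment> \<open>For k > j the left side is 0 too, because the L-operator is
      triangular.\<close>
    also have "\<dots> = (\<Sum>k'\<le>j. if k = k' then tens (app (LL X j k) (bvec x)) (bvec y) else 0)"
      by (auto simp: LL_def tens_simps)
    also have "\<dots> = (\<Sum>k\<le>j. tens (app (LL X j k) (bvec x)) (compl k (bvec c)))"
      by (rule sum.cong) (auto simp: c tens_simps)
    finally show "compl j (op12 a (reindex (Pair x) (bvec c))) = \<dots>" .
  qed (intro lin_os, auto)
  fix c :: "'a \<times> 'b"
  obtain x y where c: "c = (x, y)" by force
  have "compl j (op12 a (op23 b (reindex (\<lambda>(x, y). (x, y, i)) (bvec c)))) =
      (\<Sum>k\<le>j. tens (app (LL X j k) (bvec x)) (app (LL Y k i) (bvec y)))"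
    using cb[of _ "bvec y" i] by (simp add: c op23_bvec *)
  also have "\<dots> = (\<Sum>k\<in>{i..j}. tens (app (LL X j k) (bvec x)) (app (LL Y k i) (bvec y)))"
    by (rule sum.mono_neutral_right) (auto simp: LL_def[of Y] tens_simps)
  also have "\<dots> = app (LL (tact X Y) j i) (bvec c)"
    by (simp add: LL_tact[OF X Y] app_sum c app_tl tens_op_bvec)
  finally show "compl j (op12 a (op23 b (reindex (\<lambda>(x, y). (x, y, i)) (bvec c)))) = \<dots>" .
qed auto

text \<open>The hexagon for the second braiding, where the vector passes X before Y.\<close>

lemma beta_hexagon:
  assumes X: "uq_act N X" and Y: "uq_act N Y" and a: "is_beta X a" and b: "is_beta Y b"
  shows "comp3 i (op23 b (op12 a (reindex (Pair j) w))) = app (PP (tact X Y) i j) w"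
proof (rule lin_eqI[of "\<lambda>w. comp3 i (op23 b (op12 a (reindex _ w)))"])
  have la: "lin a" and ca: "\<And>j i x. compr i (a (tens (bvec j) x)) = app (PP X i j) x"
    and lb: "lin b" and cb: "\<And>j i x. compr i (b (tens (bvec j) x)) = app (PP Y i j) x"
    using a b by (auto simp: is_beta_def)
  show "lin (\<lambda>w. comp3 i (op23 b (op12 a (reindex (Pair j) w))))"
    by (intro lin_os) auto
  have *: "comp3 i (op23 b (reindex (\<lambda>(x, k). (x, k, y)) u)) = (\<Sum>k\<in>{i..j}. tens (compr k u) (app (PP Y i k) (bvec y)))"
    if u: "\<And>k. k > j \<Longrightarrow> compr k u = 0" for y and u :: "('a \<times> nat) vec"
  proof -
    \<comment> \<open>The index of the vector factor is unbounded at this point. The sum is taken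
      over a finite set containing every index that occurs, and triangularity cuts it down to
      {i..j}.\<close>
    have "comp3 i (op23 b (reindex (\<lambda>(x, k). (x, k, y)) u)) =
      (\<Sum>k\<in>A. tens (compr k u) (app (PP Y i k) (bvec y)))" if "finite A" "u \<in> fsp (UNIV \<times> A)" for A
    proof (rule lin_eq_fspI[OF _ _ _ that(2), of "\<lambda>u. comp3 i (op23 b (reindex (\<lambda>(x, k). (x, k, y)) u))"])
      show "lin (\<lambda>u. \<Sum>k\<in>A. tens (compr k u) (app (PP Y i k) (bvec y)))"
        by (intro lin_eq_sum lin_os) auto
      fix c :: "'a \<times> nat" assume "c \<in> UNIV \<times> A"
      then obtain x k where c: "c = (x, k)" and k: "k \<in> A" by force
      have "comp3 i (reindex (Pair x) v) = reindex (Pair x) (compr i v)" for v :: "('b \<times> nat) vec"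
        by (rule lin_eqI[of "\<lambda>v. comp3 i (reindex _ v)"]) (auto simp: lin_0 intro: lin_compose)
      then have "comp3 i (op23 b (reindex (\<lambda>(x, k). (x, k, y)) (bvec c))) = tens (bvec x) (app (PP Y i k) (bvec y))"
        using cb[of i k "bvec y"] by (simp add: c op23_bvec tens_bvec_left)
      also have "\<dots> = (\<Sum>k'\<in>A. if k = k' then tens (bvec x) (app (PP Y i k) (bvec y)) else 0)"
        using k that(1) by simp
      also have "\<dots> = (\<Sum>k\<in>A. tens (compr k (bvec c)) (app (PP Y i k) (bvec y)))"
        by (rule sum.cong) (auto simp: c tens_simps)
      finally show "comp3 i (op23 b (reindex (\<lambda>(x, k). (x, k, y)) (bvec c))) = \<dots>" .
    qed (intro lin_os, auto)
    note A = this
    let ?A = "snd ` Poly_Mapping.keys u \<union> {i..j}"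
    have "u \<in> fsp (UNIV \<times> ?A)"
      by (force simp: fsp_def)
    from A[OF _ this] have "comp3 i (op23 b (reindex (\<lambda>(x, k). (x, k, y)) u)) =
      (\<Sum>k\<in>?A. tens (compr k u) (app (PP Y i k) (bvec y)))" by simp
    also have "\<dots> = (\<Sum>k\<in>{i..j}. tens (compr k u) (app (PP Y i k) (bvec y)))"
      by (rule sum.mono_neutral_right) (use u in \<open>auto simp: PP_def tens_simps not_le\<close>)
    finally show ?thesis .
  qed
  fix c :: "'a \<times> 'b"
  obtain x y where c: "c = (x, y)" by force
  have "comp3 i (op23 b (op12 a (reindex (Pair j) (bvec c)))) =
      (\<Sum>k\<in>{i..j}. tens (app (PP X k j) (bvec x)) (app (PP Y i k) (bvec y)))"
    using ca[of _ j "bvec x"] by (simp add: c op12_bvec * PP_def)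
  also have "\<dots> = app (PP (tact X Y) i j) (bvec c)"
    by (simp add: PP_tact[OF X Y] app_sum c app_tl tens_op_bvec)
  finally show "comp3 i (op23 b (op12 a (reindex (Pair j) (bvec c)))) = \<dots>" .
qed auto

text \<open>The composite of b and a is the braiding of the tensor product of X and Y with V. Its
  coefficients are L-operator entries of the tensor product, which commute with the
  intertwiner.\<close>

lemma braid_alpha:
  assumes X: "uq_act N X" and Y: "uq_act N Y" and a: "is_alpha X a" and b: "is_alpha Y b"
    and \<Phi>: "inter (tact X Y) (tact Y X) \<Phi>"
  shows "op23 \<Phi> (op12 a (op23 b v)) = op12 b (op23 a (op12 \<Phi> v))"
proof (rule lin_eqI[of "\<lambda>v. op23 \<Phi> (op12 a (op23 b v))" "\<lambda>v. op12 b (op23 a (op12 \<Phi> v))"])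
  have l: "lin \<Phi>" using \<Phi> by (simp add: inter_def)
  fix c :: "'a \<times> 'b \<times> nat"
  obtain x y i where c: "c = (x, y, i)" by (cases c) auto
  then have bc: "bvec c = reindex (\<lambda>(x, y). (x, y, i)) (bvec (x, y))" by simp
  show "op23 \<Phi> (op12 a (op23 b (bvec c))) = op12 b (op23 a (op12 \<Phi> (bvec c)))"
  proof (rule compl_eqI)
    fix j
    show "compl j (op23 \<Phi> (op12 a (op23 b (bvec c)))) = compl j (op12 b (op23 a (op12 \<Phi> (bvec c))))"
      unfolding bc op12_reindex[OF l] compl_op23[OF l] alpha_hexagon[OF X Y a b] alpha_hexagon[OF Y X b a]
      by (rule inter_LL[OF \<Phi>])
  qed
qed (intro lin_os; auto)+

lemma braid_beta:
  assumes X: "uq_act N X" and Y: "uq_act N Y" and a: "is_beta X a" and b: "is_beta Y b"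
    and \<Phi>: "inter (tact X Y) (tact Y X) \<Phi>"
  shows "op12 \<Phi> (op23 b (op12 a v)) = op23 a (op12 b (op23 \<Phi> v))"
proof (rule lin_eqI[of "\<lambda>v. op12 \<Phi> (op23 b (op12 a v))" "\<lambda>v. op23 a (op12 b (op23 \<Phi> v))"])
  have l: "lin \<Phi>" using \<Phi> by (simp add: inter_def)
  fix c :: "nat \<times> 'a \<times> 'b"
  obtain j x y where c: "c = (j, x, y)" by (cases c) auto
  then have bc: "bvec c = reindex (Pair j) (bvec (x, y))" by simp
  show "op12 \<Phi> (op23 b (op12 a (bvec c))) = op23 a (op12 b (op23 \<Phi> (bvec c)))"
  proof (rule comp3_eqI)
    fix i
    show "comp3 i (op12 \<Phi> (op23 b (op12 a (bvec c)))) = comp3 i (op23 a (op12 b (op23 \<Phi> (bvec c))))"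
      unfolding bc op23_reindex[OF l] comp3_op12[OF l] beta_hexagon[OF X Y a b] beta_hexagon[OF Y X b a]
      by (rule inter_PP[OF \<Phi>])
  qed
qed (intro lin_os; auto)+

lemma yang_baxter:
  assumes "is_alpha (Vop N) R"
  shows "op23 R (op12 R (op23 R v)) = op12 R (op23 R (op12 R v))"
  by (intro braid_alpha[of N "Vop N" "Vop N"] inter_alpha uq_act_Vop assms)

text \<open>Three instances of naturality, with the intertwiner a in \<open>y1\<close> and b in
  \<open>y2\<close> and \<open>y3\<close>, bring both sides to b12 b23 R12 R12 a23 a12. In
  \<open>y2\<close> the operator R acts as a braiding of the second kind, hence the two hypotheses
  on R.\<close>

lemma reflection_equation:
  assumes X: "uq_act N X" and a: "is_alpha X a" and b: "is_beta X b"
    and R: "is_alpha (Vop N) R" "is_beta (Vop N) R"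
  shows "op12 (b \<circ> a) (op23 R (op12 (b \<circ> a) (op23 R v))) = op23 R (op12 (b \<circ> a) (op23 R (op12 (b \<circ> a) v)))"
proof -
  have V: "uq_act N (Vop N)" by (rule uq_act_Vop)
  have y1: "op23 a (op12 a (op23 R v)) = op12 R (op23 a (op12 a v))" for v
    by (intro braid_alpha[OF X V] inter_alpha X a R)
  have y2: "op12 b (op23 b (op12 R v)) = op23 R (op12 b (op23 b v))" for v
    by (intro braid_beta[OF V X] inter_beta X b R)
  have y3: "op12 a (op23 R (op12 b v)) = op23 b (op12 R (op23 a v))" for v
    by (rule HOL.sym, intro braid_alpha[OF V X] inter_beta X a b R)
  have lb: "lin b" using b by (simp add: is_beta_def)
  show ?thesis
    unfolding op12_comp[OF lb] y3 y1 y2[symmetric] ..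
qed


section \<open>The R-matrix of a module and the vector representation\<close>

text \<open>The q-exponential of a square-zero operator. It suffices throughout, since one tensor
  factor is always a root vector in the vector representation, which is a matrix unit off the
  diagonal or zero.\<close>

definition qe :: "'a oper \<Rightarrow> 'a oper" where
  "qe F v = v + scl lam (F v)"

lemma lin_qe [intro]: "lin F \<Longrightarrow> lin (qe F)"
  unfolding qe_def[abs_def] by (intro lin_plus lin_id lin_scale)

lemma qexp_op_square_zero:
  assumes F: "lin F" "\<And>v. F (F v) = 0"
  shows "qexp_op F = qe F"
proof
  fix v
  let ?g = "\<lambda>m. scl (qq ^ (m * (m - 1) div 2) * (qq - inverse qq) ^ m / qfact m) ((F ^^ m) v)"
  have "(F ^^ Suc (Suc m)) v = 0" for m
    using F by (simp add: lin_0)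
  then have "?g m = 0" if "m \<notin> {0, 1}" for m
    using that by (cases m rule: nat.exhaust; cases "m - 1") auto
  then have "{m. ?g m \<noteq> 0} \<subseteq> {0, 1}"
    by blast
  then have "Sum_any ?g = sum ?g {0, 1}"
    by (rule Sum_any.expand_superset[rotated]) simp
  moreover have "qfact 0 = 1" "qfact 1 = 1"
    using lam_nz by (simp_all add: qfact_def qint_def lam_def)
  ultimately show "qexp_op F v = qe F v"
    by (simp add: qexp_op_def qe_def lam_def)
qed

lemma tens_op_square_zero_left:
  "lin F \<Longrightarrow> lin G \<Longrightarrow> (\<And>v. F (F v) = 0) \<Longrightarrow> tens_op F G (tens_op F G v) = 0"
  by (rule lin_eqI[of "\<lambda>v. tens_op F G (tens_op F G v)"])
    (auto simp: tens_op_bvec tens_op_tens tens_simps lin_zero intro: lin_compose)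

lemma tens_op_square_zero_right:
  "lin F \<Longrightarrow> lin G \<Longrightarrow> (\<And>v. G (G v) = 0) \<Longrightarrow> tens_op F G (tens_op F G v) = 0"
  by (rule lin_eqI[of "\<lambda>v. tens_op F G (tens_op F G v)"])
    (auto simp: tens_op_bvec tens_op_tens tens_simps lin_zero intro: lin_compose)

subsection \<open>Root vectors in the vector representation\<close>

lemma lin_vec_rep [simp, intro]: "lin (vec_rep x)"
  by (cases x) simp_all

lemma E_root_vec: "E_root vec_rep i n = lin_ext (\<lambda>a. if a = Suc (i + n) then bvec i else 0)"
proof (induction n)
  case (Suc n)
  show ?case
  proof
    fix v
    show "E_root vec_rep i (Suc n) v = lin_ext (\<lambda>a. if a = Suc (i + Suc n) then bvec i else 0) v"
      unfolding E_root.simps Suc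
      by (rule lin_eqI) (auto intro!: lin_minus' lin_scale lin_compose[OF lin_lin_ext] simp: lin_0[OF lin_lin_ext])
  qed
qed simp

lemma F_root_vec: "F_root vec_rep i n = lin_ext (\<lambda>a. if a = i then bvec (Suc (i + n)) else 0)"
proof (induction n)
  case (Suc n)
  show ?case
  proof
    fix v
    show "F_root vec_rep i (Suc n) v = lin_ext (\<lambda>a. if a = i then bvec (Suc (i + Suc n)) else 0) v"
      unfolding F_root.simps Suc
      by (rule lin_eqI) (auto intro!: lin_minus' lin_scale lin_compose[OF lin_lin_ext] simp: lin_0[OF lin_lin_ext])
  qed
qed (simp cong: if_cong)

lemma E_root_vec_square: "E_root vec_rep i n (E_root vec_rep i n v) = 0"
  unfolding E_root_vec
  by (rule lin_eqI) (auto intro!: lin_zero lin_compose[OF lin_lin_ext] simp: lin_0[OF lin_lin_ext])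

lemma F_root_vec_square: "F_root vec_rep i n (F_root vec_rep i n v) = 0"
  unfolding F_root_vec
  by (rule lin_eqI) (auto intro!: lin_zero lin_compose[OF lin_lin_ext] simp: lin_0[OF lin_lin_ext])

lemma set_pos_roots: "set (pos_roots N) = {(i, j). 1 \<le> i \<and> i < j \<and> j \<le> N}"
  by (auto simp: pos_roots_def image_iff simp del: upt_Suc)

lemma distinct_concat_map_pairs:
  "distinct xs \<Longrightarrow> (\<And>i. distinct (f i)) \<Longrightarrow> distinct (concat (map (\<lambda>i. map (Pair i) (f i)) xs))"
  by (induction xs) (auto simp: distinct_map inj_on_def)

lemma distinct_pos_roots: "distinct (pos_roots N)"
  unfolding pos_roots_def by (rule distinct_concat_map_pairs) auto

lemma sorted_map_Pair: "sorted_wrt (\<lambda>r s. fst r \<le> fst s) (map (Pair (x :: nat)) ys)"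
  by (induction ys) auto

lemma sorted_concat_map_pairs:
  "sorted (xs :: nat list) \<Longrightarrow> sorted_wrt (\<lambda>r s. fst r \<le> fst s) (concat (map (\<lambda>i. map (Pair i) (f i)) xs))"
  by (induction xs) (auto simp: sorted_wrt_append sorted_map_Pair)

lemma sorted_pos_roots: "sorted_wrt (\<lambda>r s. fst r \<le> fst s) (pos_roots N)"
  unfolding pos_roots_def by (rule sorted_concat_map_pairs) simp

lemma foldr_cong_fun: "(\<And>x. x \<in> set xs \<Longrightarrow> f x = g x) \<Longrightarrow> foldr (\<lambda>x h. f x \<circ> h) xs h = foldr (\<lambda>x h. g x \<circ> h) xs h"
  by (induction xs) auto

lemma quasi_R_vec_right:
  assumes "\<And>i k. lin (E_root \<rho> i k)"
  shows "quasi_R N \<rho> vec_rep = foldr (\<lambda>r h.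
    qe (tens_op (E_root \<rho> (fst r) (snd r - Suc (fst r))) (F_root vec_rep (fst r) (snd r - Suc (fst r)))) \<circ> h) (pos_roots N) id"
proof -
  have "qexp_op (tens_op (E_root \<rho> i k) (F_root vec_rep i k)) = qe (tens_op (E_root \<rho> i k) (F_root vec_rep i k))"
    for i k
    by (intro qexp_op_square_zero tens_op_square_zero_right assms F_root_vec_square)
      (auto simp: F_root_vec)
  then show ?thesis by (simp add: quasi_R_def case_prod_unfold)
qed

lemma quasi_R_vec_left:
  assumes "\<And>i k. lin (F_root \<rho> i k)"
  shows "quasi_R N vec_rep \<rho> = foldr (\<lambda>r h.
    qe (tens_op (E_root vec_rep (fst r) (snd r - Suc (fst r))) (F_root \<rho> (fst r) (snd r - Suc (fst r)))) \<circ> h) (pos_roots N) id"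
proof -
  have "qexp_op (tens_op (E_root vec_rep i k) (F_root \<rho> i k)) = qe (tens_op (E_root vec_rep i k) (F_root \<rho> i k))"
    for i k
    by (intro qexp_op_square_zero tens_op_square_zero_left assms E_root_vec_square)
      (auto simp: E_root_vec)
  then show ?thesis by (simp add: quasi_R_def case_prod_unfold)
qed

lemma lin_foldr: "(\<And>r. r \<in> set rs \<Longrightarrow> lin (f r)) \<Longrightarrow> lin (foldr (\<lambda>r h. f r \<circ> h) rs id)"
  by (induction rs) auto

lemma foldr_qe:
  assumes "\<And>r. lin (f r)" "sorted_wrt (\<lambda>r s. \<forall>v. f r (f s v) = 0) rs"
  shows "foldr (\<lambda>r h. qe (f r) \<circ> h) rs id v = v + scl lam (\<Sum>r\<leftarrow>rs. f r v)"
  using assms(2)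
proof (induction rs)
  case (Cons r rs)
  have "f r (\<Sum>s\<leftarrow>ss. f s v) = 0" if "set ss \<subseteq> set rs" for ss
    using that Cons.prems assms(1) by (induction ss) (auto simp: lin_simps)
  from this[of rs] Cons show ?case
    by (simp add: qe_def lin_simps[OF assms(1)] kvs.scale_right_distrib algebra_simps)
qed simp

lemma lin_if: "lin f \<Longrightarrow> lin (\<lambda>v. if b then f v else 0)"
  by (auto simp: lin_def)

context uq_rep begin

lemma E_root_eq: "E_root (\<lambda>g. app (X g)) i n = app (E.root i n)"
  by (induction n) (auto simp: fun_eq_iff)

lemma F_root_eq: "F_root (\<lambda>g. app (X g)) i n = app (FR i n)"
  by (induction n) (auto simp: fun_eq_iff)

text \<open>On V, F_ab F_cd is nonzero only if d = a, but the order of the roots has a <= c < d. So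
  no product of two root terms survives, and the ordered product is 1 plus a single sum.\<close>

lemma quasi_R_MV:
  "compr j (quasi_R N (\<lambda>g. app (X g)) vec_rep (tens x (bvec i))) =
    (if j < i then 0 else if j = i then x else scl lam (app (E.root i (j - Suc i)) x))"
proof -
  let ?f = "\<lambda>r. tens_op (app (E.root (fst r) (snd r - Suc (fst r)))) (F_root vec_rep (fst r) (snd r - Suc (fst r)))"
  have f: "?f (a, b) (tens y (bvec a)) = tens (app (E.root a (b - Suc a)) y) (bvec b)" if "a < b" for a b y
    using that by (simp add: tens_op_tens F_root_vec)
  have f0: "?f (a, b) (tens y (bvec c)) = 0" if "c \<noteq> a" for a b c y
    using that by (simp add: tens_op_tens F_root_vec tens_simps)
  have "sorted_wrt (\<lambda>r s. \<forall>v. ?f r (?f s v) = 0) (pos_roots N)"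
  proof (rule sorted_wrt_mono_rel[OF _ sorted_pos_roots])
    fix r s assume rs: "r \<in> set (pos_roots N)" "s \<in> set (pos_roots N)" "fst r \<le> fst s"
    obtain a b c d where [simp]: "r = (a, b)" "s = (c, d)" by (cases r, cases s)
    show "\<forall>v. ?f r (?f s v) = 0"
    proof
      fix v
      show "?f r (?f s v) = 0"
      proof (rule lin_eq_tensI[of "\<lambda>v. ?f r (?f s v)"])
        fix y e
        show "?f r (?f s (tens y (bvec e))) = 0"
          using rs f[of c d y] f0[of e c d y] f0[of d a b] by (cases "e = c") (auto simp: set_pos_roots lin_0[OF lin_tens_op])
      qed (auto intro: lin_compose lin_zero)
    qed
  qed
  then have q: "quasi_R N (\<lambda>g. app (X g)) vec_rep v = v + scl lam (\<Sum>r\<leftarrow>pos_roots N. ?f r v)" for v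
    by (subst quasi_R_vec_right) (auto simp: E_root_eq intro!: foldr_qe)
  have "(\<Sum>r\<leftarrow>pos_roots N. ?f r (tens x (bvec i))) = (\<Sum>r\<in>set (pos_roots N). ?f r (tens x (bvec i)))"
    by (rule sum_list_distinct_conv_sum_set[OF distinct_pos_roots])
  then have "compr j (\<Sum>r\<leftarrow>pos_roots N. ?f r (tens x (bvec i))) = (\<Sum>r\<in>set (pos_roots N). compr j (?f r (tens x (bvec i))))"
    by (simp add: compr_lin)
  also have "\<dots> = (\<Sum>r\<in>set (pos_roots N). if r = (i, j) then app (E.root i (j - Suc i)) x else 0)"
  proof (rule sum.cong[OF HOL.refl])
    fix r assume r: "r \<in> set (pos_roots N)"
    obtain a b where [simp]: "r = (a, b)" by force
    show "compr j (?f r (tens x (bvec i))) = (if r = (i, j) then app (E.root i (j - Suc i)) x else 0)"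
      using r f[of a b x] f0[of i a b x] by (cases "a = i") (auto simp: set_pos_roots compr_lin)
  qed
  also have "\<dots> = (if i < j then app (E.root i (j - Suc i)) x else 0)"
  proof -
    \<comment> \<open>The product contains only roots with indices between 1 and N; for the others
      the root vector itself vanishes.\<close>
    have "i < j \<Longrightarrow> i = 0 \<or> N < j \<Longrightarrow> E.root i (j - Suc i) = 0"
      by (rule root_trivial) auto
    then show ?thesis
      by (subst sum.delta, intro finite_set) (auto simp: set_pos_roots)
  qed
  finally show ?thesis by (auto simp: q compr_lin)
qed

lemma is_alpha_R_check_MV: "is_alpha X (R_check_MV N (\<lambda>g. app (X g)))"
  unfolding is_alpha_def LL_eq
proof (intro conjI allI)
  let ?h = "lin_ext (\<lambda>(x, j). tens (app (X (GK j)) (bvec x)) (bvec j))"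
  have lq: "lin (quasi_R N (\<lambda>g. app (X g)) vec_rep)"
    by (subst quasi_R_vec_right) (auto simp: E_root_eq intro!: lin_foldr)
  show "lin (R_check_MV N (\<lambda>g. app (X g)))"
    unfolding R_check_MV_def[abs_def] flip_op_def
    by (rule lin_compose[OF lin_reindex], rule lin_compose[OF lin_lin_ext lq])
  fix j i x
  have 1: "compl j (flip_op v) = compr j v" for v :: "('a \<times> nat) vec"
    unfolding flip_op_def by (rule lin_eqI[of "\<lambda>v. compl j (reindex _ v)"]) (auto intro: lin_compose)
  have 2: "compr j (?h v) = app (X (GK j)) (compr j v)" for v
    by (rule lin_eqI[of "\<lambda>v. compr j (?h v)"]) (auto intro: lin_compose simp: app_lin)
  show "compl j (R_check_MV N (\<lambda>g. app (X g)) (tens x (bvec i))) = app (Lp j i) x"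
    by (simp add: R_check_MV_def 1 2 quasi_R_MV Lp_def app_lin lam_def)
qed

text \<open>On V the products E_ij E_jk do survive, with (i, j) to the left of (j, k). The factor of
  a root reads the component of its second index and changes that of its first; later factors have
  first index no larger, so the component read already has its final value.\<close>

lemma quasi_R_VM_rec:
  "compl i (quasi_R N vec_rep (\<lambda>g. app (X g)) v) = compl i v + scl lam (\<Sum>j\<in>{j. 1 \<le> i \<and> i < j \<and> j \<le> N}.
     app (FR i (j - Suc i)) (compl j (quasi_R N vec_rep (\<lambda>g. app (X g)) v)))"
proof -
  let ?f = "\<lambda>r. tens_op (E_root vec_rep (fst r) (snd r - Suc (fst r))) (app (FR (fst r) (snd r - Suc (fst r))))"
  let ?F = "\<lambda>rs. foldr (\<lambda>r h. qe (?f r) \<circ> h) rs id"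
  have f: "compl i (?f r w) = (if i = fst r then app (FR i (snd r - Suc i)) (compl (snd r) w) else 0)"
    if "fst r < snd r" for r w i
  proof (rule lin_eqI[of "\<lambda>w. compl i (?f r w)"])
    show "lin (\<lambda>w. compl i (?f r w))" "lin (\<lambda>w. if i = fst r then app (FR i (snd r - Suc i)) (compl (snd r) w) else 0)"
      by (intro lin_if lin_os lin_tens_op lin_id)+
  qed (use that in \<open>auto simp: tens_op_bvec E_root_vec tens_simps compl_lin app_lin\<close>)
  have "compl i (?F rs v) = compl i v + scl lam (\<Sum>r\<leftarrow>rs. if fst r = i then app (FR i (snd r - Suc i)) (compl (snd r) (?F rs v)) else 0)"
    if "sorted_wrt (\<lambda>r s. fst r \<le> fst s) rs" "\<forall>r\<in>set rs. fst r < snd r" for rs i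
    using that
  proof (induction rs)
    case (Cons r rs)
    define u w where "u = ?F rs v" and "w = ?F (r # rs) v"
    have r: "fst r < snd r" using Cons by simp
    have IH: "compl i u = compl i v +
        scl lam (\<Sum>r\<leftarrow>rs. if fst r = i then app (FR i (snd r - Suc i)) (compl (snd r) u) else 0)"
      unfolding u_def by (rule Cons.IH) (use Cons.prems in auto)
    have "w = qe (?f r) u"
      by (simp add: w_def u_def)
    then have new: "compl c w = compl c u + (if c = fst r then scl lam (app (FR c (snd r - Suc c)) (compl (snd r) u)) else 0)" for c
      using f[OF r] by (simp add: qe_def compl_lin)
    have same: "compl (snd s) w = compl (snd s) u" if "s \<in> set (r # rs)" for s
    proof -
      have "fst r < snd s" using Cons.prems that by (fastforce intro: le_less_trans)
      then show ?thesis using new[of "snd s"] by simp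
    qed
    have "(\<Sum>s\<leftarrow>rs. if fst s = i then app (FR i (snd s - Suc i)) (compl (snd s) w) else 0)
        = (\<Sum>s\<leftarrow>rs. if fst s = i then app (FR i (snd s - Suc i)) (compl (snd s) u) else 0)"
      using same by (intro arg_cong[where f = sum_list] map_cong) auto
    moreover have "compl (snd r) w = compl (snd r) u"
      by (rule same) simp
    ultimately have "compl i w = compl i v +
        scl lam (\<Sum>s\<leftarrow>r # rs. if fst s = i then app (FR i (snd s - Suc i)) (compl (snd s) w) else 0)"
      using new[of i] IH by (auto simp: kvs.scale_right_distrib add_ac)
    then show ?case unfolding w_def .
  qed simp
  note main = this[OF sorted_pos_roots, of N]
  have q: "quasi_R N vec_rep (\<lambda>g. app (X g)) = ?F (pos_roots N)"
    by (subst quasi_R_vec_left) (auto simp: F_root_eq)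
  let ?u = "quasi_R N vec_rep (\<lambda>g. app (X g)) v"
  have "(\<Sum>r\<leftarrow>pos_roots N. if fst r = i then app (FR i (snd r - Suc i)) (compl (snd r) ?u) else 0)
      = (\<Sum>r\<in>set (pos_roots N). if fst r = i then app (FR i (snd r - Suc i)) (compl (snd r) ?u) else 0)"
    by (rule sum_list_distinct_conv_sum_set[OF distinct_pos_roots])
  also have "\<dots> = (\<Sum>r\<in>{r\<in>set (pos_roots N). fst r = i}. app (FR i (snd r - Suc i)) (compl (snd r) ?u))"
    by (rule sum.inter_filter[symmetric]) simp
  also have "\<dots> = (\<Sum>j\<in>{j. 1 \<le> i \<and> i < j \<and> j \<le> N}. app (FR i (j - Suc i)) (compl j ?u))"
    by (rule sum.reindex_bij_witness[of _ "Pair i" snd]) (auto simp: set_pos_roots)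
  finally have s: "(\<Sum>r\<leftarrow>pos_roots N. if fst r = i then app (FR i (snd r - Suc i)) (compl (snd r) ?u) else 0) = \<dots>" .
  have "compl i ?u = compl i v + scl lam
      (\<Sum>r\<leftarrow>pos_roots N. if fst r = i then app (FR i (snd r - Suc i)) (compl (snd r) ?u) else 0)"
    unfolding q by (rule main) (auto simp: set_pos_roots)
  then show ?thesis unfolding s .
qed

text \<open>Component i is computed from components with larger index, hence the descending
  induction; the recursion it obeys is \<open>FB_FR\<close>.\<close>

lemma quasi_R_VM:
  "compl i (quasi_R N vec_rep (\<lambda>g. app (X g)) (tens (bvec j) x)) =
    (if j < i then 0 else if i = j then x else scl lam (app (FB i (j - Suc i)) x))"
proof (induction "N - i" arbitrary: i rule: less_induct)
  case less
  let ?u = "quasi_R N vec_rep (\<lambda>g. app (X g)) (tens (bvec j) x)"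
  let ?J = "{b. 1 \<le> i \<and> i < b \<and> b \<le> N}"
  have *: "compl i ?u = (if i = j then x else 0) + scl lam (\<Sum>b\<in>?J. app (FR i (b - Suc i))
     (if j < b then 0 else if b = j then x else scl lam (app (FB b (j - Suc b)) x)))"
    by (subst quasi_R_VM_rec) (use less in \<open>auto intro!: sum.cong arg_cong2[where f = "(+)"] arg_cong[where f = "scl lam"]\<close>)
  show ?case
  proof (cases "i < j \<and> 1 \<le> i \<and> j \<le> N")
    case True
    then obtain n where n: "j = Suc (i + n)" using less_iff_Suc_add by auto
    have "(\<Sum>b\<in>?J. app (FR i (b - Suc i)) (if j < b then 0 else if b = j then x else scl lam (app (FB b (j - Suc b)) x)))
       = (\<Sum>b\<in>{i<..j}. app (FR i (b - Suc i)) (if b = j then x else scl lam (app (FB b (j - Suc b)) x)))"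
      by (rule sum.mono_neutral_cong_right) (use True in \<open>auto simp: app_lin\<close>)
    also have "{i<..j} = insert j {i<..<j}" using True by auto
    also have "(\<Sum>b\<in>insert j {i<..<j}. app (FR i (b - Suc i)) (if b = j then x else scl lam (app (FB b (j - Suc b)) x)))
       = app (FR i n) x + (\<Sum>b\<in>{i<..<j}. scl lam (app (FR i (b - Suc i)) (app (FB b (j - Suc b)) x)))"
      by (simp add: n app_lin)
    also have "(\<Sum>b\<in>{i<..<j}. scl lam (app (FR i (b - Suc i)) (app (FB b (j - Suc b)) x)))
       = (\<Sum>s<n. scl lam (app (FR i s) (app (FB (i + s + 1) (n - s - 1)) x)))"
      by (rule sum.reindex_bij_witness[of _ "\<lambda>s. i + s + 1" "\<lambda>b. b - Suc i"]) (auto simp: n add.commute[of n])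
    finally show ?thesis
      using True unfolding * by (simp add: n FB_FR[of i n] app_sum lam_def kvs.scale_sum_right)
  next
    case False
    have "app (FR i (b - Suc i)) (if j < b then 0 else if b = j then x else scl lam (app (FB b (j - Suc b)) x)) = 0"
      if "b \<in> ?J" for b
      using that False FB_trivial[of b "j - Suc b"] by (auto simp: app_lin)
    then have "compl i ?u = (if i = j then x else 0)"
      unfolding * by simp
    moreover have "FB i (j - Suc i) = 0" if "i < j"
      using that False by (intro FB_trivial) auto
    ultimately show ?thesis by auto
  qed
qed

lemma is_beta_R_check_VM: "is_beta X (R_check_VM N (\<lambda>g. app (X g)))"
  unfolding is_beta_def PP_eq
proof (intro conjI allI)
  let ?h = "lin_ext (\<lambda>(j, x). tens (bvec j) (app (X (GK j)) (bvec x)))"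
  have lq: "lin (quasi_R N vec_rep (\<lambda>g. app (X g)))"
    by (subst quasi_R_vec_left) (auto simp: F_root_eq intro!: lin_foldr)
  show "lin (R_check_VM N (\<lambda>g. app (X g)))"
    unfolding R_check_VM_def[abs_def] flip_op_def
    by (rule lin_compose[OF lin_reindex], rule lin_compose[OF lin_lin_ext lq])
  fix j i x
  have 1: "compr i (flip_op v) = compl i v" for v :: "(nat \<times> 'a) vec"
    unfolding flip_op_def by (rule lin_eqI[of "\<lambda>v. compr i (reindex _ v)"]) (auto intro: lin_compose)
  have 2: "compl i (?h v) = app (X (GK i)) (compl i v)" for v
    by (rule lin_eqI[of "\<lambda>v. compl i (?h v)"]) (auto intro: lin_compose simp: app_lin)
  show "compr i (R_check_VM N (\<lambda>g. app (X g)) (tens (bvec j) x)) = app (Pm i j) x"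
    by (simp add: R_check_VM_def 1 2 quasi_R_VM Pm_def app_lin lam_def)
qed

end


section \<open>The braiding of the vector representation with itself\<close>

lemma E_root_Vop: "1 \<le> i \<Longrightarrow> i + n < N \<Longrightarrow> E_root (\<lambda>g. app (Vop N g)) i n = E_root vec_rep i n"
  by (induction n) (auto simp: fun_eq_iff Vop.simps simp del: vec_rep.simps)

text \<open>\<open>Vop\<close> and \<open>vec_rep\<close> differ only for E and F outside the range,
  and the R-matrix involves only roots inside it.\<close>

lemma R_check_eq: "R_check N = R_check_MV N (\<lambda>g. app (Vop N g))"
proof -
  have "quasi_R N (\<lambda>g. app (Vop N g)) vec_rep = quasi_R N vec_rep vec_rep"
    unfolding quasi_R_def case_prod_unfold
  proof (rule foldr_cong_fun)
    fix r assume "r \<in> set (pos_roots N)"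
    then have "E_root (\<lambda>g. app (Vop N g)) (fst r) (snd r - Suc (fst r)) = E_root vec_rep (fst r) (snd r - Suc (fst r))"
      by (intro E_root_Vop) (auto simp: set_pos_roots)
    then show "qexp_op (tens_op (E_root (\<lambda>g. app (Vop N g)) (fst r) (snd r - Suc (fst r)))
        (F_root vec_rep (fst r) (snd r - Suc (fst r)))) = qexp_op (tens_op
        (E_root vec_rep (fst r) (snd r - Suc (fst r))) (F_root vec_rep (fst r) (snd r - Suc (fst r))))"
      by simp
  qed
  moreover have "app (Vop N (GK j)) = vec_rep (GK j)" for j
    by (simp add: Vop.simps del: vec_rep.simps)
  ultimately show ?thesis
    by (simp add: R_check_def R_check_MV_def fun_eq_iff del: vec_rep.simps)
qed

interpretation V: uq_rep N "Vop N" for N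
  by standard (rule uq_act_Vop)

lemma is_alpha_R_check: "is_alpha (Vop N) (R_check N)"
  unfolding R_check_eq by (rule V.is_alpha_R_check_MV)

lemma lin_R_check [simp, intro]: "lin (R_check N)"
  using is_alpha_R_check by (simp add: is_alpha_def)

lemma app_V_root: "app (V.E.root N i n) (bvec a) = (if 1 \<le> i \<and> i + n < N \<and> a = Suc (i + n) then bvec i else 0)"
  by (induction n arbitrary: a) (auto simp: app_Vop app_lin)

lemma app_V_FB: "app (V.FB N i n) (bvec a) = (if 1 \<le> i \<and> i + n < N \<and> a = i then bvec (Suc (i + n)) else 0)"
  by (induction n arbitrary: a) (auto simp: app_Vop app_lin V.FB_simps)

lemma R_check_bvec: "R_check N (bvec (a, i)) = scl (chi qq i a) (bvec (i, a)) +
    (if i < a \<and> 1 \<le> i \<and> a \<le> N then scl lam (bvec (a, i)) else 0)"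
proof (rule compl_eqI)
  fix j
  have "compl j (R_check N (tens (bvec a) (bvec i))) = app (V.Lp N j i) (bvec a)"
    using is_alpha_R_check by (simp add: is_alpha_def V.LL_eq del: tens_bvec)
  then show "compl j (R_check N (bvec (a, i))) = compl j (scl (chi qq i a) (bvec (i, a)) +
      (if i < a \<and> 1 \<le> i \<and> a \<le> N then scl lam (bvec (a, i)) else 0))"
    by (auto simp: V.Lp_def app_V_root app_Vop app_lin compl_lin lam_def chi_def)
qed

text \<open>On V (x) V the two braidings coincide, because both kinds of root vectors act on V as
  the same matrix units. The reflection equation uses R in both roles.\<close>

lemma is_beta_R_check: "is_beta (Vop N) (R_check N)"
  unfolding is_beta_def V.PP_eq
proof (intro conjI allI lin_R_check)
  fix j i x
  show "compr i (R_check N (tens (bvec j) x)) = app (V.Pm N i j) x"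
  proof (rule lin_eqI[of "\<lambda>x. compr i (R_check N (tens (bvec j) x))"])
    show "lin (\<lambda>x. compr i (R_check N (tens (bvec j) x)))"
      by (intro lin_os lin_compose[OF lin_R_check] lin_tens_right)
    show "compr i (R_check N (tens (bvec j) (bvec a))) = app (V.Pm N i j) (bvec a)" for a
      by (auto simp: R_check_bvec V.Pm_def app_V_FB app_Vop app_lin compr_lin lam_def chi_def)
  qed simp
qed

text \<open>The bound on the indices matters: on two distinct basis vectors of which one lies
  outside 1..N the operator is a mere flip, with square 1.\<close>

lemma R_check_hecke:
  assumes "v \<in> fsp ({1..N} \<times> {1..N})"
  shows "R_check N (R_check N v) = scl lam (R_check N v) + v"
proof (rule lin_eq_fspI[OF _ _ _ assms, of "\<lambda>v. R_check N (R_check N v)"])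
  show "lin (\<lambda>v. scl lam (R_check N v) + v)"
    by (intro lin_plus lin_scale lin_R_check lin_id)
  fix c assume c: "c \<in> {1..N} \<times> {1..N}"
  obtain a i where [simp]: "c = (a, i)" by force
  have q2: "qq * qq = lam * qq + 1"
    using qq_neq by (simp add: lam_def algebra_simps)
  show "R_check N (R_check N (bvec c)) = scl lam (R_check N (bvec c)) + bvec c"
  proof (cases a i rule: linorder_cases)
    case equal
    have "scl (lam * qq + 1) (bvec (i, i)) = scl lam (scl qq (bvec (i, i))) + bvec (i, i)"
      by (simp add: kvs.scale_left_distrib)
    with equal show ?thesis
      by (simp add: R_check_bvec lin_simps[OF lin_R_check] chi_def q2[symmetric])
  qed (use c in \<open>simp_all add: R_check_bvec lin_simps[OF lin_R_check] chi_def add.commute\<close>)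
qed (rule lin_compose[OF lin_R_check lin_R_check])

lemma R_check_in_fsp: "v \<in> fsp ({1..N} \<times> {1..N}) \<Longrightarrow> R_check N v \<in> fsp ({1..N} \<times> {1..N})"
  by (rule lin_in_fsp[OF lin_R_check]) (auto simp: R_check_bvec intro!: fsp_add fsp_scl)

subsection \<open>Bijections between subspaces spanned by basis elements\<close>

text \<open>The modules may be infinite-dimensional, so invertibility is carried along by an
  explicit inverse. It is linear on the whole space, so that it can in turn be lifted to an operator
  on M (x) V^n.\<close>

definition bij_fsp :: "'a set \<Rightarrow> 'b set \<Rightarrow> ('a vec \<Rightarrow> 'b vec) \<Rightarrow> bool" where
  "bij_fsp C D f \<longleftrightarrow> lin f \<and> (\<forall>v\<in>fsp C. f v \<in> fsp D) \<and>
    (\<exists>g. lin g \<and> (\<forall>w\<in>fsp D. g w \<in> fsp C \<and> f (g w) = w) \<and> (\<forall>v\<in>fsp C. g (f v) = v))"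

lemma bij_fspI:
  assumes "lin f" "lin g" "\<And>c. c \<in> C \<Longrightarrow> f (bvec c) \<in> fsp D" "\<And>d. d \<in> D \<Longrightarrow> g (bvec d) \<in> fsp C"
    "\<And>c. c \<in> C \<Longrightarrow> g (f (bvec c)) = bvec c" "\<And>d. d \<in> D \<Longrightarrow> f (g (bvec d)) = bvec d"
  shows "bij_fsp C D f"
  unfolding bij_fsp_def
proof (intro conjI ballI exI[of _ g] assms(1,2))
  show "f v \<in> fsp D" if "v \<in> fsp C" for v
    using lin_in_fsp[OF assms(1) that] assms by blast
  show "g v \<in> fsp C" if "v \<in> fsp D" for v
    using lin_in_fsp[OF assms(2) that] assms by blast
  show "f (g v) = v" if "v \<in> fsp D" for v
    by (rule lin_eq_fspI[OF lin_compose[OF assms(1,2)] lin_id(2) _ that]) (use assms in auto)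
  show "g (f v) = v" if "v \<in> fsp C" for v
    by (rule lin_eq_fspI[OF lin_compose[OF assms(2,1)] lin_id(2) _ that]) (use assms in auto)
qed

lemma bij_fsp_comp:
  assumes "bij_fsp C D f" "bij_fsp D E h"
  shows "bij_fsp C E (h \<circ> f)"
proof -
  from assms(1) obtain g where g: "lin g" "\<forall>w\<in>fsp D. g w \<in> fsp C \<and> f (g w) = w" "\<forall>v\<in>fsp C. g (f v) = v"
    by (auto simp: bij_fsp_def)
  from assms(2) obtain k where k: "lin k" "\<forall>w\<in>fsp E. k w \<in> fsp D \<and> h (k w) = w" "\<forall>v\<in>fsp D. k (h v) = v"
    by (auto simp: bij_fsp_def)
  show ?thesis
    unfolding bij_fsp_def
    by (intro conjI exI[of _ "g \<circ> k"]) (use assms g k in \<open>auto simp: bij_fsp_def\<close>)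
qed

lemma bij_fsp_id: "bij_fsp C C id"
  by (rule bij_fspI[of _ id]) auto

lemma bij_fsp_foldr:
  "(\<And>r. r \<in> set rs \<Longrightarrow> bij_fsp C C (f r)) \<Longrightarrow> bij_fsp C C (foldr (\<lambda>r h. f r \<circ> h) rs id)"
  by (induction rs) (auto intro: bij_fsp_comp bij_fsp_id)

text \<open>As F squares to zero, the inverse of 1 + lam F is 1 - lam F.\<close>

lemma bij_fsp_qe:
  assumes "lin F" "\<And>v. F (F v) = 0" "\<And>v. v \<in> fsp C \<Longrightarrow> F v \<in> fsp C"
  shows "bij_fsp C C (qe F)"
proof (rule bij_fspI[of _ "\<lambda>v. v - scl lam (F v)"])
  show "lin (\<lambda>v. v - scl lam (F v))"
    by (intro lin_minus' lin_scale lin_id assms)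
qed (use assms in \<open>auto simp: qe_def lin_simps[OF assms(1)] intro!: fsp_add fsp_diff fsp_scl\<close>)

lemma bij_fsp_flip: "bij_fsp (B \<times> C) (C \<times> B) flip_op"
  unfolding flip_op_def by (rule bij_fspI[of _ "reindex prod.swap"]) auto

lemma tens_op_in_fsp:
  assumes "\<And>v. v \<in> fsp B \<Longrightarrow> F v \<in> fsp B'" "\<And>v. v \<in> fsp C \<Longrightarrow> G v \<in> fsp C'" "v \<in> fsp (B \<times> C)"
  shows "tens_op F G v \<in> fsp (B' \<times> C')"
  unfolding tens_op_def by (rule lin_ext_in_fsp[OF assms(3)]) (auto intro!: tens_in_fsp assms)

context uq_rep begin

context
  fixes B :: "'a set"
  assumes stable: "\<And>g v. v \<in> fsp B \<Longrightarrow> app (X g) v \<in> fsp B"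
begin

lemma root_stable: "v \<in> fsp B \<Longrightarrow> app (E.root i n) v \<in> fsp B"
  by (induction n arbitrary: v) (auto intro!: fsp_diff fsp_scl stable)

lemma FR_stable: "v \<in> fsp B \<Longrightarrow> app (FR i n) v \<in> fsp B"
  by (induction n arbitrary: v) (auto intro!: fsp_diff fsp_scl stable)

lemma bij_R_check_MV: "bij_fsp (B \<times> {1..N}) ({1..N} \<times> B) (R_check_MV N (\<lambda>g. app (X g)))"
proof -
  let ?h = "lin_ext (\<lambda>(x, j). tens (app (X (GK j)) (bvec x)) (bvec j))"
  let ?h' = "lin_ext (\<lambda>(x, j). tens (app (X (GKi j)) (bvec x)) (bvec j))"
  have h: "?h (tens x (bvec j)) = tens (app (X (GK j)) x) (bvec j)"
    "?h' (tens x (bvec j)) = tens (app (X (GKi j)) x) (bvec j)" for x j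
    by (rule lin_eqI[of "\<lambda>x. lin_ext _ (tens x (bvec j))"], auto intro: lin_compose)+
  have kk: "app (X (GK j)) (app (X (GKi j)) x) = x" "app (X (GKi j)) (app (X (GK j)) x) = x" for j x
    using k_ki[of j] ki_k[of j] by (metis app_simps(2,6))+
  have 1: "bij_fsp (B \<times> {1..N}) (B \<times> {1..N}) ?h"
    by (rule bij_fspI[of _ ?h']) (auto simp: h kk intro!: tens_in_fsp stable)
  have 2: "bij_fsp (B \<times> {1..N}) (B \<times> {1..N}) (quasi_R N (\<lambda>g. app (X g)) vec_rep)"
    unfolding quasi_R_vec_right[of "\<lambda>g. app (X g)", unfolded E_root_eq, OF lin_app]
    by (intro bij_fsp_foldr bij_fsp_qe lin_tens_op tens_op_square_zero_right lin_app F_root_vec_square)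
      (auto simp: F_root_vec set_pos_roots intro!: tens_op_in_fsp[where B = B and C = "{1..N}"] root_stable lin_ext_in_fsp)
  have "R_check_MV N (\<lambda>g. app (X g)) = flip_op \<circ> (?h \<circ> quasi_R N (\<lambda>g. app (X g)) vec_rep)"
    by (simp add: R_check_MV_def fun_eq_iff)
  then show ?thesis
    using bij_fsp_comp[OF bij_fsp_comp[OF 2 1] bij_fsp_flip] by simp
qed

lemma bij_R_check_VM: "bij_fsp ({1..N} \<times> B) (B \<times> {1..N}) (R_check_VM N (\<lambda>g. app (X g)))"
proof -
  let ?h = "lin_ext (\<lambda>(j, x). tens (bvec j) (app (X (GK j)) (bvec x)))"
  let ?h' = "lin_ext (\<lambda>(j, x). tens (bvec j) (app (X (GKi j)) (bvec x)))"
  have h: "?h (tens (bvec j) x) = tens (bvec j) (app (X (GK j)) x)"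
    "?h' (tens (bvec j) x) = tens (bvec j) (app (X (GKi j)) x)" for x j
    by (rule lin_eqI[of "\<lambda>x. lin_ext _ (tens (bvec j) x)"], auto intro: lin_compose)+
  have kk: "app (X (GK j)) (app (X (GKi j)) x) = x" "app (X (GKi j)) (app (X (GK j)) x) = x" for j x
    using k_ki[of j] ki_k[of j] by (metis app_simps(2,6))+
  have 1: "bij_fsp ({1..N} \<times> B) ({1..N} \<times> B) ?h"
    by (rule bij_fspI[of _ ?h']) (auto simp: h kk intro!: tens_in_fsp stable)
  have 2: "bij_fsp ({1..N} \<times> B) ({1..N} \<times> B) (quasi_R N vec_rep (\<lambda>g. app (X g)))"
    unfolding quasi_R_vec_left[of "\<lambda>g. app (X g)", unfolded F_root_eq, OF lin_app]
    by (intro bij_fsp_foldr bij_fsp_qe lin_tens_op tens_op_square_zero_left lin_app E_root_vec_square)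
      (auto simp: E_root_vec set_pos_roots intro!: tens_op_in_fsp[where C = B and B = "{1..N}"] FR_stable lin_ext_in_fsp)
  have "R_check_VM N (\<lambda>g. app (X g)) = flip_op \<circ> (?h \<circ> quasi_R N vec_rep (\<lambda>g. app (X g)))"
    by (simp add: R_check_VM_def fun_eq_iff)
  then show ?thesis
    using bij_fsp_comp[OF bij_fsp_comp[OF 2 1] bij_fsp_flip] by simp
qed

lemma bij_K_check: "bij_fsp (B \<times> {1..N}) (B \<times> {1..N}) (K_check N (\<lambda>g. app (X g)))"
  unfolding K_check_def by (rule bij_fsp_comp[OF bij_R_check_MV bij_R_check_VM])

end

lemma inter_K_check: "inter (tact X (Vop N)) (tact X (Vop N)) (K_check N (\<lambda>g. app (X g)))"
proof -
  have "inter (tact X (Vop N)) (tact (Vop N) X) (R_check_MV N (\<lambda>g. app (X g)))"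
    "inter (tact (Vop N) X) (tact X (Vop N)) (R_check_VM N (\<lambda>g. app (X g)))"
    by (rule inter_alpha[OF act is_alpha_R_check_MV] inter_beta[OF act is_beta_R_check_VM])+
  then show ?thesis
    by (auto simp: inter_def K_check_def)
qed

lemma K_check_reflection:
  fixes v :: "('a \<times> nat \<times> nat) vec"
  shows "op12 (K_check N (\<lambda>g. app (X g))) (op23 (R_check N) (op12 (K_check N (\<lambda>g. app (X g))) (op23 (R_check N) v)))
    = op23 (R_check N) (op12 (K_check N (\<lambda>g. app (X g))) (op23 (R_check N) (op12 (K_check N (\<lambda>g. app (X g))) v)))"
  unfolding K_check_def
  by (rule reflection_equation[OF act is_alpha_R_check_MV is_beta_R_check_VM is_alpha_R_check is_beta_R_check])

end

lemma inter_R_check: "inter (tact (Vop N) (Vop N)) (tact (Vop N) (Vop N)) (R_check N)"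
  by (rule inter_alpha[OF uq_act_Vop is_alpha_R_check])

subsection \<open>Extension of a module by the trivial representation\<close>

text \<open>
  A module on \<open>fsp B\<close> is extended to the space of all formal combinations by letting the quantum
  group act through the counit on the remaining basis elements; generators outside the range
  act through the counit everywhere. This turns the generators into elements of the ring of
  operators.
\<close>

definition ext :: "nat \<Rightarrow> 'a set \<Rightarrow> (uqgen \<Rightarrow> 'a oper) \<Rightarrow> uqgen \<Rightarrow> 'a lop" where
  "ext N B \<rho> x = Lop (lin_ext (\<lambda>a. if a \<in> B \<and> x \<in> uq_gens N then \<rho> x (bvec a) else scl (uq_counit x) (bvec a)))"

lemma linear_on_lin_ext:
  assumes "linear_on B F" "v \<in> fsp B"
  shows "F v = lin_ext (\<lambda>a. F (bvec a)) v"
proof -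
  have F0: "F 0 = 0"
    using assms(1) unfolding linear_on_def by (metis fsp_0 kvs.scale_zero_left)
  have "(\<Sum>a\<in>A. scl (c a) (bvec a)) \<in> fsp B \<and>
      F (\<Sum>a\<in>A. scl (c a) (bvec a)) = (\<Sum>a\<in>A. scl (c a) (F (bvec a)))" if "finite A" "A \<subseteq> B" for A c
    using that
  proof (induction A)
    case (insert a A)
    have "scl (c a) (bvec a) \<in> fsp B"
      using insert.prems by (intro fsp_scl) simp
    moreover have "(\<Sum>a\<in>A. scl (c a) (bvec a)) \<in> fsp B"
      using insert by simp
    ultimately have "F (scl (c a) (bvec a) + (\<Sum>a\<in>A. scl (c a) (bvec a))) =
        F (scl (c a) (bvec a)) + F (\<Sum>a\<in>A. scl (c a) (bvec a))"
      "F (scl (c a) (bvec a)) = scl (c a) (F (bvec a))"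
      using assms(1) insert.prems unfolding linear_on_def by simp_all
    with insert show ?case
      by (auto intro!: fsp_add fsp_scl)
  qed (simp add: F0)
  from this[of "Poly_Mapping.keys v" "Poly_Mapping.lookup v"] show ?thesis
    using assms(2) vec_expand[of v] by (simp add: lin_ext_def fsp_def)
qed

lemma app_ext_bvec: "app (ext N B \<rho> x) (bvec a) =
    (if a \<in> B \<and> x \<in> uq_gens N then \<rho> x (bvec a) else scl (uq_counit x) (bvec a))"
  by (simp add: ext_def)

lemma app_ext:
  assumes "uq_module N B \<rho>" "v \<in> fsp B" "x \<in> uq_gens N"
  shows "app (ext N B \<rho> x) v = \<rho> x v"
proof -
  have "linear_on B (\<rho> x)" using assms by (simp add: uq_module_def)
  then have "\<rho> x v = lin_ext (\<lambda>a. \<rho> x (bvec a)) v"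
    using assms by (intro linear_on_lin_ext)
  also have "\<dots> = app (ext N B \<rho> x) v"
    using assms by (simp add: ext_def) (rule lin_ext_cong_fsp, auto)
  finally show ?thesis ..
qed

lemma ext_stable:
  assumes "uq_module N B \<rho>" "v \<in> fsp B"
  shows "app (ext N B \<rho> x) v \<in> fsp B"
  by (rule lin_in_fsp[OF lin_app assms(2)])
    (use assms in \<open>auto simp: app_ext_bvec uq_module_def linear_on_def intro!: fsp_scl\<close>)

lemma uq_gens_iff [simp]:
  "GE i \<in> uq_gens N \<longleftrightarrow> i \<in> {1..<N}" "GF i \<in> uq_gens N \<longleftrightarrow> i \<in> {1..<N}"
  "GK i \<in> uq_gens N \<longleftrightarrow> i \<in> {1..N}" "GKi i \<in> uq_gens N \<longleftrightarrow> i \<in> {1..N}"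
  by (auto simp: uq_gens_def)

lemma uq_act_ext:
  assumes m: "uq_module N B \<rho>"
  shows "uq_act N (ext N B \<rho>)"
proof -
  let ?X = "ext N B \<rho>"
  have eqI: "Y = Z" if "\<And>a. a \<in> B \<Longrightarrow> app Y (bvec a) = app Z (bvec a)"
    "\<And>a. a \<notin> B \<Longrightarrow> app Y (bvec a) = app Z (bvec a)" for Y Z :: "'a lop"
    by (rule lop_eqI) (use that in blast)
  have out: "?X x = uq_counit x *\<^sub>s 1" if "x \<notin> uq_gens N" for x
    by (rule lop_eqI) (use that in \<open>simp add: app_ext_bvec\<close>)
  have s: "app (?X y) (bvec a) \<in> fsp B" if "a \<in> B" for y a
    using that by (intro ext_stable[OF m]) simp
  have s2: "app (?X x) (app (?X y) (bvec a)) \<in> fsp B" if "a \<in> B" for x y a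
    by (intro ext_stable[OF m] s that)
  note e = app_ext[OF m]
  have s': "app (?X x) v \<in> fsp B" if "v \<in> fsp B" for x v
    using that by (rule ext_stable[OF m])
  let ?E = "\<lambda>i. ?X (GE i)" and ?F = "\<lambda>i. ?X (GF i)" and ?K = "\<lambda>i. ?X (GK i)" and ?Ki = "\<lambda>i. ?X (GKi i)"
  \<comment> \<open>A relation is checked in three situations: on B with all generators in range,
    where the module relations apply; on a basis vector outside B, where everything is a counit
    scalar; and with some generator out of range, which is itself a scalar operator.\<close>
  have range: "(\<And>a. \<lbrakk>a \<in> B; \<forall>x\<in>set xs. x \<in> uq_gens N\<rbrakk> \<Longrightarrow> app Y (bvec a) = app Z (bvec a)) \<Longrightarrow>
     (\<And>a. a \<notin> B \<Longrightarrow> app Y (bvec a) = app Z (bvec a)) \<Longrightarrow>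
     (\<exists>x\<in>set xs. x \<notin> uq_gens N \<Longrightarrow> Y = Z) \<Longrightarrow> Y = Z" for xs and Y Z :: "'a lop"
    using eqI by blast
  have E0: "?E i = 0" "?F i = 0" if "i \<notin> {1..<N}" for i
    using out[of "GE i"] out[of "GF i"] that by simp_all
  have K1: "?K i = 1" "?Ki i = 1" if "i \<notin> {1..N}" for i
    using out[of "GK i"] out[of "GKi i"] that by simp_all
  note o = app_ext_bvec app_lin
  have M: "(\<forall>j\<in>{1..N}. \<rho> (GK j) (\<rho> (GKi j) v) = v \<and> \<rho> (GKi j) (\<rho> (GK j) v) = v) \<and>
        (\<forall>j\<in>{1..N}. \<forall>k\<in>{1..N}. \<rho> (GK j) (\<rho> (GK k) v) = \<rho> (GK k) (\<rho> (GK j) v)) \<and>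
        (\<forall>j\<in>{1..N}. \<forall>i\<in>{1..<N}.
           \<rho> (GK j) (\<rho> (GE i) v) = scl (wt_factor j i) (\<rho> (GE i) (\<rho> (GK j) v)) \<and>
           \<rho> (GK j) (\<rho> (GF i) v) = scl (inverse (wt_factor j i)) (\<rho> (GF i) (\<rho> (GK j) v))) \<and>
        (\<forall>i\<in>{1..<N}. \<forall>j\<in>{1..<N}.
           \<rho> (GE i) (\<rho> (GF j) v) - \<rho> (GF j) (\<rho> (GE i) v) =
             (if i = j
              then scl (1 / (qq - inverse qq))
                     (\<rho> (GK i) (\<rho> (GKi (Suc i)) v) - \<rho> (GKi i) (\<rho> (GK (Suc i)) v))
              else 0)) \<and>
        (\<forall>X\<in>{GE, GF}. \<forall>i\<in>{1..<N}. \<forall>j\<in>{1..<N}.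
           (Suc i < j \<longrightarrow> \<rho> (X i) (\<rho> (X j) v) = \<rho> (X j) (\<rho> (X i) v)) \<and>
           (i = Suc j \<or> j = Suc i \<longrightarrow>
              \<rho> (X i) (\<rho> (X i) (\<rho> (X j) v))
              - scl (qq + inverse qq) (\<rho> (X i) (\<rho> (X j) (\<rho> (X i) v)))
              + \<rho> (X j) (\<rho> (X i) (\<rho> (X i) v)) = 0))" if "v \<in> fsp B" for v
    by (rule bspec[OF conjunct2[OF m[unfolded uq_module_def]] that])
  have \<rho>s: "\<rho> x v \<in> fsp B" if "v \<in> fsp B" "x \<in> uq_gens N" for x v
    using m that by (simp add: uq_module_def linear_on_def)
  have wt: "wt_factor j i = wfac qq j i" for i j
    by (auto simp: wt_factor_def wfac_def chi_def)
  have KKi: "?K j * ?Ki j = 1" "?Ki j * ?K j = 1" for j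
  proof -
    show "?K j * ?Ki j = 1"
    proof (rule range[of "[GK j, GKi j]"])
      fix a assume a: "a \<in> B" "\<forall>x\<in>set [GK j, GKi j]. x \<in> uq_gens N"
      then show "app (?K j * ?Ki j) (bvec a) = app 1 (bvec a)"
        using M[THEN conjunct1, of "bvec a"] by (simp add: e \<rho>s)
    qed (use K1[of j] in \<open>auto simp: o\<close>)
    show "?Ki j * ?K j = 1"
    proof (rule range[of "[GK j, GKi j]"])
      fix a assume a: "a \<in> B" "\<forall>x\<in>set [GK j, GKi j]. x \<in> uq_gens N"
      then show "app (?Ki j * ?K j) (bvec a) = app 1 (bvec a)"
        using M[THEN conjunct1, of "bvec a"] by (simp add: e \<rho>s)
    qed (use K1[of j] in \<open>auto simp: o\<close>)
  qed
  have KK: "?K i * ?K j = ?K j * ?K i" for i j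
  proof (rule range[of "[GK i, GK j]"])
    fix a assume a: "a \<in> B" "\<forall>x\<in>set [GK i, GK j]. x \<in> uq_gens N"
    then show "app (?K i * ?K j) (bvec a) = app (?K j * ?K i) (bvec a)"
      using M[THEN conjunct2, THEN conjunct1, of "bvec a"] by (simp add: e \<rho>s)
  qed (use K1[of i] K1[of j] in \<open>auto simp: o\<close>)
  have wf1: "wfac qq j i = 1" if "j \<notin> {1..N}" "i \<in> {1..<N}" for i j
    using that by (auto simp: wfac_def chi_def)
  \<comment> \<open>A torus index outside 1..N differs from i and i + 1 for every i in range, so the
    weight factor is 1; for i out of range the generator is 0.\<close>
  have wE: "wfac qq j i *\<^sub>s ?E i = ?E i" "inverse (wfac qq j i) *\<^sub>s ?F i = ?F i" if "j \<notin> {1..N}" for i j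
    using wf1[OF that, of i] E0[of i] by (cases "i \<in> {1..<N}"; simp)+
  note M3 = M[THEN conjunct2, THEN conjunct2, THEN conjunct1, THEN bspec, THEN bspec]
  have KE: "?K j * ?E i = wfac qq j i *\<^sub>s (?E i * ?K j)" for i j
  proof (rule range[of "[GK j, GE i]"])
    fix a assume a: "a \<in> B" "\<forall>x\<in>set [GK j, GE i]. x \<in> uq_gens N"
    then show "app (?K j * ?E i) (bvec a) = app (wfac qq j i *\<^sub>s (?E i * ?K j)) (bvec a)"
      using M3[of "bvec a" j i] by (simp add: e \<rho>s wt)
  qed (use K1[of j] E0[of i] wE[of j i] in \<open>auto simp: o\<close>)
  have KF: "?K j * ?F i = inverse (wfac qq j i) *\<^sub>s (?F i * ?K j)" for i j
  proof (rule range[of "[GK j, GF i]"])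
    fix a assume a: "a \<in> B" "\<forall>x\<in>set [GK j, GF i]. x \<in> uq_gens N"
    then show "app (?K j * ?F i) (bvec a) = app (inverse (wfac qq j i) *\<^sub>s (?F i * ?K j)) (bvec a)"
      using M3[of "bvec a" j i] by (simp add: e \<rho>s wt)
  qed (use K1[of j] E0[of i] wE[of j i] in \<open>auto simp: o\<close>)
  note M4 = M[THEN conjunct2, THEN conjunct2, THEN conjunct2, THEN conjunct1, THEN bspec, THEN bspec]
  have EF: "?E i * ?F j - ?F j * ?E i = (if i = j then (1 / (qq - inverse qq)) *\<^sub>s
      (?K j * ?Ki (Suc j) - ?Ki j * ?K (Suc j)) else 0)" if "i \<in> {1..<N}" "j \<in> {1..<N}" for i j
  proof (rule eqI)
    fix a assume a: "a \<in> B"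
    then show "app (?E i * ?F j - ?F j * ?E i) (bvec a) = app (if i = j then (1 / (qq - inverse qq)) *\<^sub>s
      (?K j * ?Ki (Suc j) - ?Ki j * ?K (Suc j)) else 0) (bvec a)"
      using M4[of "bvec a" i j] that by (auto simp: e \<rho>s)
  qed (use that in \<open>auto simp: o\<close>)
  note M5 = M[THEN conjunct2, THEN conjunct2, THEN conjunct2, THEN conjunct2, THEN bspec, THEN bspec, THEN bspec]
  have far: "?X (G i) * ?X (G j) = ?X (G j) * ?X (G i)"
    if G: "G \<in> {GE, GF}" and ij: "Suc i < j" for G i j
  proof (rule range[of "[G i, G j]"])
    fix a assume a: "a \<in> B" "\<forall>x\<in>set [G i, G j]. x \<in> uq_gens N"
    then show "app (?X (G i) * ?X (G j)) (bvec a) = app (?X (G j) * ?X (G i)) (bvec a)"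
      using M5[of "bvec a" G i j] G ij by (auto simp: e \<rho>s)
  qed (use G E0[of i] E0[of j] in \<open>auto simp: o\<close>)
  have near: "?X (G i) * ?X (G i) * ?X (G j) - (qq + inverse qq) *\<^sub>s (?X (G i) * ?X (G j) * ?X (G i))
      + ?X (G j) * ?X (G i) * ?X (G i) = 0"
    if G: "G \<in> {GE, GF}" and ij: "i = Suc j \<or> j = Suc i" for G i j
  proof (rule range[of "[G i, G j]"])
    fix a assume a: "a \<in> B" "\<forall>x\<in>set [G i, G j]. x \<in> uq_gens N"
    have "i \<in> {1..<N}" "j \<in> {1..<N}" using a G by auto
    from M5[of "bvec a" G, OF _ G this] a ij
    have "\<rho> (G i) (\<rho> (G i) (\<rho> (G j) (bvec a))) - scl (qq + inverse qq) (\<rho> (G i) (\<rho> (G j) (\<rho> (G i) (bvec a))))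
              + \<rho> (G j) (\<rho> (G i) (\<rho> (G i) (bvec a))) = 0" by simp
    with a show "app (?X (G i) * ?X (G i) * ?X (G j) - (qq + inverse qq) *\<^sub>s (?X (G i) * ?X (G j) * ?X (G i))
      + ?X (G j) * ?X (G i) * ?X (G i)) (bvec a) = app 0 (bvec a)"
      by (simp add: e \<rho>s)
  qed (use G E0[of i] E0[of j] in \<open>auto simp: o\<close>)
  show ?thesis
    unfolding uq_act_def
    by standard (use qq_neq KKi KK KE KF E0 EF far[of GE] far[of GF] near[of GE] near[of GF] in simp_all)
qed

subsection \<open>Agreement of operators on a subspace\<close>

text \<open>\<open>uq_module\<close> constrains the given operators on \<open>fsp B\<close> alone,
  and only there can they be compared with their extension. Stability is part of the notion so that
  agreement survives composition.\<close>

definition agree :: "'a set \<Rightarrow> 'b set \<Rightarrow> ('a vec \<Rightarrow> 'b vec) \<Rightarrow> ('a vec \<Rightarrow> 'b vec) \<Rightarrow> bool" where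
  "agree B C f g \<longleftrightarrow> (\<forall>v\<in>fsp B. f v = g v \<and> g v \<in> fsp C)"

lemma agree_comp: "agree B C f g \<Longrightarrow> agree C D f' g' \<Longrightarrow> agree B D (f' \<circ> f) (g' \<circ> g)"
  by (simp add: agree_def)

text \<open>On \<open>fsp B\<close> the series agree term by term, so \<open>Sum_any\<close> ranges
  over the same nonzero terms in both.\<close>

lemma agree_qexp: "agree B B f g \<Longrightarrow> agree B B (qexp_op f) (qexp_op g)"
proof -
  assume a: "agree B B f g"
  have "(f ^^ m) v = (g ^^ m) v \<and> (g ^^ m) v \<in> fsp B" if "v \<in> fsp B" for m v
    using that a by (induction m) (auto simp: agree_def)
  then show ?thesis
    unfolding agree_def qexp_op_def by (auto simp: Sum_any.expand_set intro!: fsp_sum fsp_scl)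
qed

lemma agree_tens_op: "agree B B' f g \<Longrightarrow> agree C C' f' g' \<Longrightarrow> agree (B \<times> C) (B' \<times> C') (tens_op f f') (tens_op g g')"
  unfolding agree_def tens_op_def
  by (auto intro!: lin_ext_cong_fsp[of _ "B \<times> C"] lin_ext_in_fsp[of _ "B \<times> C"] tens_in_fsp)

lemma agree_E_root:
  assumes "\<And>m. m \<in> {1..<N} \<Longrightarrow> agree B B (\<rho> (GE m)) (\<rho>' (GE m))" "1 \<le> i"
  shows "i + n < N \<Longrightarrow> agree B B (E_root \<rho> i n) (E_root \<rho>' i n)"
proof (induction n)
  case (Suc n)
  then have "agree B B (E_root \<rho> i n) (E_root \<rho>' i n)"
    "agree B B (\<rho> (GE (i + Suc n))) (\<rho>' (GE (i + Suc n)))"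
    using assms by auto
  then show ?case by (auto simp: agree_def intro!: fsp_diff fsp_scl)
qed (use assms in auto)

lemma agree_F_root:
  assumes "\<And>m. m \<in> {1..<N} \<Longrightarrow> agree B B (\<rho> (GF m)) (\<rho>' (GF m))" "1 \<le> i"
  shows "i + n < N \<Longrightarrow> agree B B (F_root \<rho> i n) (F_root \<rho>' i n)"
proof (induction n)
  case (Suc n)
  then have "agree B B (F_root \<rho> i n) (F_root \<rho>' i n)"
    "agree B B (\<rho> (GF (i + Suc n))) (\<rho>' (GF (i + Suc n)))"
    using assms by auto
  then show ?case by (auto simp: agree_def intro!: fsp_diff fsp_scl)
qed (use assms in auto)

lemma agree_foldr:
  "(\<And>r. r \<in> set rs \<Longrightarrow> agree B B (f r) (g r)) \<Longrightarrow>
    agree B B (foldr (\<lambda>r h. f r \<circ> h) rs id) (foldr (\<lambda>r h. g r \<circ> h) rs id)"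
proof (induction rs)
  case (Cons r rs)
  have "agree B B (foldr (\<lambda>r h. f r \<circ> h) rs id) (foldr (\<lambda>r h. g r \<circ> h) rs id)"
    by (rule Cons.IH) (rule Cons.prems, simp)
  moreover have "agree B B (f r) (g r)"
    by (rule Cons.prems) simp
  ultimately have "agree B B (f r \<circ> foldr (\<lambda>r h. f r \<circ> h) rs id) (g r \<circ> foldr (\<lambda>r h. g r \<circ> h) rs id)"
    by (rule agree_comp)
  moreover have "foldr (\<lambda>r h. F r \<circ> h) (r # rs) id = F r \<circ> foldr (\<lambda>r h. F r \<circ> h) rs id"
    for F :: "'a \<Rightarrow> 'b vec \<Rightarrow> 'b vec"
    by simp
  ultimately show ?case by metis
qed (simp add: agree_def)

lemma agree_quasi_R:
  assumes "\<And>m. m \<in> {1..<N} \<Longrightarrow> agree B B (\<rho> (GE m)) (\<rho>' (GE m))"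
    "\<And>m. m \<in> {1..<N} \<Longrightarrow> agree C C (\<pi> (GF m)) (\<pi>' (GF m))"
  shows "agree (B \<times> C) (B \<times> C) (quasi_R N \<rho> \<pi>) (quasi_R N \<rho>' \<pi>')"
  unfolding quasi_R_def case_prod_unfold
proof (rule agree_foldr)
  fix r assume "r \<in> set (pos_roots N)"
  then show "agree (B \<times> C) (B \<times> C)
     (qexp_op (tens_op (E_root \<rho> (fst r) (snd r - Suc (fst r))) (F_root \<pi> (fst r) (snd r - Suc (fst r)))))
     (qexp_op (tens_op (E_root \<rho>' (fst r) (snd r - Suc (fst r))) (F_root \<pi>' (fst r) (snd r - Suc (fst r)))))"
    by (intro agree_qexp agree_tens_op agree_E_root agree_F_root assms) (auto simp: set_pos_roots)
qed

lemma agree_vec_rep: "x \<in> uq_gens N \<Longrightarrow> agree {1..N} {1..N} (vec_rep x) (vec_rep x)"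
  unfolding agree_def
proof (intro ballI conjI HOL.refl)
  fix v assume "x \<in> uq_gens N" "v \<in> fsp {1..N}"
  then show "vec_rep x v \<in> fsp {1..N}"
    by (cases x) (auto intro!: lin_ext_in_fsp fsp_scl split: if_splits)
qed

lemma agree_flip: "agree (B \<times> C) (C \<times> B) flip_op flip_op"
  by (auto simp: agree_def flip_op_def intro!: reindex_in_fsp)

lemma agree_ext: "uq_module N B \<rho> \<Longrightarrow> x \<in> uq_gens N \<Longrightarrow> agree B B (\<rho> x) (app (ext N B \<rho> x))"
  unfolding agree_def by (intro ballI conjI app_ext[symmetric] ext_stable)

lemma agree_R_check_MV:
  assumes m: "uq_module N B \<rho>"
  shows "agree (B \<times> {1..N}) ({1..N} \<times> B) (R_check_MV N \<rho>) (R_check_MV N (\<lambda>g. app (ext N B \<rho> g)))"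
proof -
  have 1: "agree (B \<times> {1..N}) (B \<times> {1..N}) (lin_ext (\<lambda>(x, j). tens (\<rho> (GK j) (bvec x)) (bvec j)))
      (lin_ext (\<lambda>(x, j). tens (app (ext N B \<rho> (GK j)) (bvec x)) (bvec j)))"
    unfolding agree_def
  proof (intro ballI conjI)
    fix v :: "('a \<times> nat) vec" assume v: "v \<in> fsp (B \<times> {1..N})"
    show "lin_ext (\<lambda>(x, j). tens (\<rho> (GK j) (bvec x)) (bvec j)) v = lin_ext (\<lambda>(x, j). tens (app (ext N B \<rho> (GK j)) (bvec x)) (bvec j)) v"
      by (rule lin_ext_cong_fsp[OF v]) (auto simp: app_ext[OF m])
    show "lin_ext (\<lambda>(x, j). tens (app (ext N B \<rho> (GK j)) (bvec x)) (bvec j)) v \<in> fsp (B \<times> {1..N})"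
      by (rule lin_ext_in_fsp[OF v]) (auto intro!: tens_in_fsp ext_stable[OF m])
  qed
  have 2: "agree (B \<times> {1..N}) (B \<times> {1..N}) (quasi_R N \<rho> vec_rep) (quasi_R N (\<lambda>g. app (ext N B \<rho> g)) vec_rep)"
    by (intro agree_quasi_R agree_ext[OF m] agree_vec_rep) auto
  from agree_comp[OF agree_comp[OF 2 1] agree_flip] show ?thesis
    by (simp add: R_check_MV_def[abs_def] comp_def)
qed

lemma agree_R_check_VM:
  assumes m: "uq_module N B \<rho>"
  shows "agree ({1..N} \<times> B) (B \<times> {1..N}) (R_check_VM N \<rho>) (R_check_VM N (\<lambda>g. app (ext N B \<rho> g)))"
proof -
  have 1: "agree ({1..N} \<times> B) ({1..N} \<times> B) (lin_ext (\<lambda>(j, x). tens (bvec j) (\<rho> (GK j) (bvec x))))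
      (lin_ext (\<lambda>(j, x). tens (bvec j) (app (ext N B \<rho> (GK j)) (bvec x))))"
    unfolding agree_def
  proof (intro ballI conjI)
    fix v :: "(nat \<times> 'a) vec" assume v: "v \<in> fsp ({1..N} \<times> B)"
    show "lin_ext (\<lambda>(j, x). tens (bvec j) (\<rho> (GK j) (bvec x))) v = lin_ext (\<lambda>(j, x). tens (bvec j) (app (ext N B \<rho> (GK j)) (bvec x))) v"
      by (rule lin_ext_cong_fsp[OF v]) (auto simp: app_ext[OF m])
    show "lin_ext (\<lambda>(j, x). tens (bvec j) (app (ext N B \<rho> (GK j)) (bvec x))) v \<in> fsp ({1..N} \<times> B)"
      by (rule lin_ext_in_fsp[OF v]) (auto intro!: tens_in_fsp ext_stable[OF m])
  qed
  have 2: "agree ({1..N} \<times> B) ({1..N} \<times> B) (quasi_R N vec_rep \<rho>) (quasi_R N vec_rep (\<lambda>g. app (ext N B \<rho> g)))"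
    by (intro agree_quasi_R agree_ext[OF m] agree_vec_rep) auto
  from agree_comp[OF agree_comp[OF 2 1] agree_flip] show ?thesis
    by (simp add: R_check_VM_def[abs_def] comp_def)
qed

lemma agree_K_check:
  "uq_module N B \<rho> \<Longrightarrow> agree (B \<times> {1..N}) (B \<times> {1..N}) (K_check N \<rho>) (K_check N (\<lambda>g. app (ext N B \<rho> g)))"
  unfolding K_check_def by (rule agree_comp[OF agree_R_check_MV agree_R_check_VM])


section \<open>The action on \<open>M \<otimes> V\<^sup>n\<close>\<close>

lemma inter_comp: "inter X Y \<Phi> \<Longrightarrow> inter Y Z \<Psi> \<Longrightarrow> inter X Z (\<Psi> \<circ> \<Phi>)"
  by (auto simp: inter_def)

lemma reindex_tens: "reindex (map_prod h k) (tens v w) = tens (reindex h v) (reindex k w)"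
  by (rule bilin_eqI[of "\<lambda>v w. reindex (map_prod h k) (tens v w)" "\<lambda>v w. tens (reindex h v) (reindex k w)"])
    (auto intro: lin_os lin_compose)

lemma inter_reindexI:
  "(\<And>g a. app (Y g) (bvec (h a)) = reindex h (app (X g) (bvec a))) \<Longrightarrow> inter X Y (reindex h)"
  unfolding inter_def
  by (intro conjI lin_reindex allI HOL.sym[OF lin_eqI[of "\<lambda>v. app _ (reindex h v)" "\<lambda>v. reindex h (app _ v)"]])
    (auto intro: lin_os)

lemma inter_map_prod:
  fixes h :: "'a \<Rightarrow> 'b" and k :: "'c \<Rightarrow> 'd"
  assumes "inter X X' (reindex h)" "inter Y Y' (reindex k)"
  shows "inter (tact X Y) (tact X' Y') (reindex (map_prod h k))"
proof (rule inter_reindexI)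
  have h: "app (X' g) (bvec (h a)) = reindex h (app (X g) (bvec a))"
     "app (X' g) (reindex h v) = reindex h (app (X g) v)"
    and k: "app (Y' g) (bvec (k c)) = reindex k (app (Y g) (bvec c))"
     "app (Y' g) (reindex k w) = reindex k (app (Y g) w)" for g a c v w
    using assms unfolding inter_def by (metis reindex_bvec)+
  fix g and ac :: "'a \<times> 'c"
  obtain a c where [simp]: "ac = (a, c)" by force
  show "app (tact X' Y' g) (bvec (map_prod h k ac)) = reindex (map_prod h k) (app (tact X Y g) (bvec ac))"
    by (cases g) (simp_all add: tact.simps app_tl tens_op_bvec reindex_tens h k lin_simps[OF lin_reindex] del: reindex_bvec,
       simp_all add: h)
qed

text \<open>This is how the b-th factor of A acts on each V_c with c different from b.\<close>

definition triv :: "uqgen \<Rightarrow> 'a lop" where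
  "triv x = uq_counit x *\<^sub>s 1"

lemma tact_triv_right: "tact X triv g = X g \<otimes>\<^sub>o 1"
  and tact_triv_left: "tact triv Y g = 1 \<otimes>\<^sub>o Y g"
  by (cases g; simp add: tact.simps triv_def tl_distrib)+

lemma tact_triv: "tact triv triv = triv"
  by (rule HOL.ext) (simp add: tact_triv_right triv_def tl_distrib)

definition stab :: "'a set \<Rightarrow> (uqgen \<Rightarrow> 'a lop) \<Rightarrow> bool" where
  "stab C X \<longleftrightarrow> (\<forall>g. \<forall>v\<in>fsp C. app (X g) v \<in> fsp C)"

lemma stabI: "(\<And>g a. a \<in> C \<Longrightarrow> app (X g) (bvec a) \<in> fsp C) \<Longrightarrow> stab C X"
  unfolding stab_def by (auto intro: lin_in_fsp[OF lin_app])

lemma stab_tact: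
  fixes C :: "'a set" and D :: "'b set"
  shows "stab C X \<Longrightarrow> stab D Y \<Longrightarrow> stab (C \<times> D) (tact X Y)"
proof (rule stabI)
  fix g and ac :: "'a \<times> 'b" assume s: "stab C X" "stab D Y" and "ac \<in> C \<times> D"
  then obtain a c where [simp]: "ac = (a, c)" "a \<in> C" "c \<in> D" by force
  show "app (tact X Y g) (bvec ac) \<in> fsp (C \<times> D)"
    using s by (cases g) (auto simp: stab_def tact.simps app_tl tens_op_bvec intro!: fsp_add tens_in_fsp)
qed

definition com :: "'a set \<Rightarrow> (uqgen \<Rightarrow> 'a lop) \<Rightarrow> 'a oper \<Rightarrow> bool" where
  "com C X F \<longleftrightarrow> (\<forall>g. \<forall>v\<in>fsp C. F (app (X g) v) = app (X g) (F v))"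

lemma comI:
  assumes F: "lin F" and "\<And>g a. a \<in> C \<Longrightarrow> F (app (X g) (bvec a)) = app (X g) (F (bvec a))"
  shows "com C X F"
  unfolding com_def
proof (intro allI ballI)
  show "F (app (X g) v) = app (X g) (F v)" if "v \<in> fsp C" for g v
    by (rule lin_eq_fspI[OF lin_compose[OF F lin_app] lin_compose[OF lin_app F] _ that]) (rule assms)
qed

lemma com_tens_left:
  fixes C :: "'a set" and Y :: "uqgen \<Rightarrow> 'b lop"
  assumes F: "lin F" and c: "com C X F" and s: "stab C X"
  shows "com (C \<times> UNIV) (tact X Y) (tens_op F id)"
proof (rule comI)
  fix g and ac :: "'a \<times> 'b" assume "ac \<in> C \<times> (UNIV :: 'b set)"
  then obtain a c where [simp]: "ac = (a, c)" "a \<in> C" by force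
  have e: "F (app (X g) v) = app (X g) (F v)" "app (X g) v \<in> fsp C" if "v \<in> fsp C" for g v
    using that assms by (auto simp: com_def stab_def)
  show "tens_op F id (app (tact X Y g) (bvec ac)) = app (tact X Y g) (tens_op F id (bvec ac))"
    by (cases g) (simp_all add: tact.simps app_tl tens_op_bvec tens_op_tens F e lin_simps[OF lin_tens_op])
qed auto

lemma com_tens_right:
  fixes C :: "'b set" and X :: "uqgen \<Rightarrow> 'a lop"
  assumes F: "lin F" and c: "com C Y F" and s: "stab C Y"
  shows "com (UNIV \<times> C) (tact X Y) (tens_op id F)"
proof (rule comI)
  fix g and ac :: "'a \<times> 'b" assume "ac \<in> (UNIV :: 'a set) \<times> C"
  then obtain a c where [simp]: "ac = (a, c)" "c \<in> C" by force
  have e: "F (app (Y g) v) = app (Y g) (F v)" "app (Y g) v \<in> fsp C" if "v \<in> fsp C" for g v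
    using that assms by (auto simp: com_def stab_def)
  show "tens_op id F (app (tact X Y g) (bvec ac)) = app (tact X Y g) (tens_op id F (bvec ac))"
    by (cases g) (simp_all add: tact.simps app_tl tens_op_bvec tens_op_tens F e lin_simps[OF lin_tens_op])
qed auto

text \<open>Coassociativity of the comultiplication. It regroups the left nested tensor power so
  that the last two factors can be treated together.\<close>

lemma inter_assoc:
  fixes X :: "uqgen \<Rightarrow> 'a lop" and Y :: "uqgen \<Rightarrow> 'b lop" and Z :: "uqgen \<Rightarrow> 'c lop"
  shows "inter (tact X (tact Y Z)) (tact (tact X Y) Z) (reindex (\<lambda>(a, b, c). ((a, b), c)))"
proof (rule inter_reindexI)
  fix g and abc :: "'a \<times> 'b \<times> 'c"
  obtain a b c where [simp]: "abc = (a, b, c)" by (cases abc) auto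
  have t: "reindex (\<lambda>(a, b, c). ((a, b), c)) (tens u (tens v w)) = tens (tens u v) w"
    for u :: "'a vec" and v :: "'b vec" and w :: "'c vec"
  proof (rule lin_eqI[of "\<lambda>u. reindex _ (tens u (tens v w))"])
    show "reindex (\<lambda>(a, b, c). ((a, b), c)) (tens (bvec a) (tens v w)) = tens (tens (bvec a) v) w" for a :: 'a
      by (rule bilin_eqI[of "\<lambda>v w. reindex _ (tens (bvec a) (tens v w))" "\<lambda>v w. tens (tens (bvec a) v) w"])
        (auto intro!: lin_os)
  qed (auto intro!: lin_os)
  show "app (tact (tact X Y) Z g) (bvec ((\<lambda>(a, b, c). ((a, b), c)) abc)) =
      reindex (\<lambda>(a, b, c). ((a, b), c)) (app (tact X (tact Y Z) g) (bvec abc))"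
    by (cases g) (simp_all add: tact.simps app_tl tens_op_bvec tens_op_tens t tens_simps lin_simps[OF lin_reindex]
        add.assoc, simp_all add: tens_bvec[symmetric] t del: tens_bvec)
qed

section \<open>The action of a single factor of A on M (x) V^n\<close>

definition apnd :: "'m tbasis \<times> (nat \<times> nat) \<Rightarrow> 'm tbasis" where
  "apnd = (\<lambda>((m, ws), w). (m, ws @ [w]))"

definition VB :: "(nat \<Rightarrow> nat) \<Rightarrow> nat \<Rightarrow> uqgen \<Rightarrow> (nat \<times> nat) lop" where
  "VB N b x = Lop (lin_ext (\<lambda>(c, j).
     if c = b then reindex (Pair b) (app (Vop (N b) x) (bvec j)) else scl (uq_counit x) (bvec (c, j))))"

text \<open>The b-th factor of A alone, with Y its action on M_b. In contrast to
  \<open>act_MV\<close>, all values are elements of the ring of operators.\<close>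

primrec AA :: "(nat \<Rightarrow> nat) \<Rightarrow> (uqgen \<Rightarrow> 'm lop) \<Rightarrow> nat \<Rightarrow> nat \<Rightarrow> uqgen \<Rightarrow> 'm tbasis lop" where
  "AA N Y b 0 = (\<lambda>x. Lop (lin_ext (\<lambda>(m, vs). reindex (\<lambda>y. (m(b := y), [])) (app (Y x) (bvec (m b))))))"
| "AA N Y b (Suc n) = (\<lambda>x. Lop (lin_ext (\<lambda>(m, vs).
     reindex apnd (app (tact (AA N Y b n) (VB N b) x) (bvec ((m, butlast vs), last vs))))))"

lemma app_VB: "app (VB N b x) (bvec (c, j)) =
    (if c = b then reindex (Pair b) (app (Vop (N b) x) (bvec j)) else scl (uq_counit x) (bvec (c, j)))"
  by (simp add: VB_def)

lemma inter_VB: "inter (Vop (N b)) (VB N b) (reindex (Pair b))"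
  by (rule inter_reindexI) (simp add: app_VB)

lemma inter_VB': "c \<noteq> b \<Longrightarrow> inter triv (VB N b) (reindex (Pair c))"
  by (rule inter_reindexI) (simp add: app_VB triv_def lin_scl[OF lin_reindex])

lemma inter_AA_0: "inter Y (AA N Y b 0) (reindex (\<lambda>y. (m(b := y), [])))"
  by (rule inter_reindexI) simp

lemma inter_AA_Suc: "inter (tact (AA N Y b n) (VB N b)) (AA N Y b (Suc n)) (reindex apnd)"
  by (rule inter_reindexI) (auto simp: apnd_def)

lemma VB_stable: "stab ({c} \<times> UNIV) (VB N b)"
  by (rule stabI) (auto simp: app_VB intro!: reindex_in_fsp[of _ UNIV] fsp_scl)

text \<open>Each block of V is a submodule, so the sequence of blocks along a list is invariant. On
  every subspace with a fixed sequence the framing operators are scalars.\<close>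

lemma AA_blocks: "stab {(m, vs). map fst vs = bs} (AA N Y b (length bs))"
proof (induction bs rule: rev_induct)
  case Nil
  show ?case
    by (rule stabI) (auto intro!: reindex_in_fsp[of _ UNIV])
next
  case (snoc c bs)
  have s: "stab ({(m, vs). map fst vs = bs} \<times> {c} \<times> UNIV) (tact (AA N Y b (length bs)) (VB N b))"
    by (rule stab_tact[OF snoc VB_stable])
  show ?case
  proof (rule stabI)
    fix g and a :: "'a tbasis" assume "a \<in> {(m, vs). map fst vs = bs @ [c]}"
    then obtain m vs where a: "a = (m, vs)" "map fst vs = bs @ [c]" by auto
    then have "vs \<noteq> []" by auto
    with a(2) have "map fst (butlast vs) = bs" "fst (last vs) = c"
      by (simp_all add: map_butlast last_map[symmetric])
    then have "app (tact (AA N Y b (length bs)) (VB N b) g) (bvec ((m, butlast vs), last vs))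
        \<in> fsp ({(m, vs). map fst vs = bs} \<times> {c} \<times> UNIV)"
      using s by (auto simp: stab_def mem_Times_iff)
    then show "app (AA N Y b (length (bs @ [c])) g) (bvec a) \<in> fsp {(m, vs). map fst vs = bs @ [c]}"
      by (auto simp: a intro!: reindex_in_fsp simp: apnd_def)
  qed
qed

lemma agree_plus:
  "agree C D f g \<Longrightarrow> agree C D f' g' \<Longrightarrow> agree C D (\<lambda>v. f v + f' v) (\<lambda>v. g v + g' v)"
  by (auto simp: agree_def)

lemma agree_id: "agree C C id id"
  by (simp add: agree_def)

lemma agree_A_tensor:
  assumes \<alpha>: "\<And>x. x \<in> uq_gens N \<Longrightarrow> agree C C (\<alpha> (b, x)) (app (Y x))"
    and \<beta>: "\<And>x. x \<in> uq_gens N \<Longrightarrow> agree D D (\<beta> (b, x)) (app (Z x))"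
    and x: "x \<in> uq_gens N"
  shows "agree (C \<times> D) (C \<times> D) (A_tensor \<alpha> \<beta> (b, x)) (app (tact Y Z x))"
proof -
  have one: "app 1 = id" and mult: "app (P * Q) = app P \<circ> app Q" for P Q :: "'x lop"
    by (auto simp: fun_eq_iff)
  note r = agree_plus agree_tens_op agree_comp[where C = D] agree_comp[where C = C] agree_id \<alpha> \<beta>
  show ?thesis
  proof (cases x)
    case (GE i)
    have "agree (C \<times> D) (C \<times> D)
      (\<lambda>v. tens_op (\<alpha> (b, GE i)) (\<beta> (b, GK i) \<circ> \<beta> (b, GKi (Suc i))) v + tens_op id (\<beta> (b, GE i)) v)
      (\<lambda>v. tens_op (app (Y (GE i))) (app (Z (GK i)) \<circ> app (Z (GKi (Suc i)))) v + tens_op id (app (Z (GE i))) v)"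
      by (intro r) (use x GE in auto)
    then show ?thesis
      unfolding GE by (simp add: A_tensor_def[abs_def] A_comult_def word_op_def tact.simps app_tl agree_def mult one del: app_simps(2,6))
  next
    case (GF i)
    have "agree (C \<times> D) (C \<times> D)
      (\<lambda>v. tens_op (\<alpha> (b, GF i)) id v + tens_op (\<alpha> (b, GKi i) \<circ> \<alpha> (b, GK (Suc i))) (\<beta> (b, GF i)) v)
      (\<lambda>v. tens_op (app (Y (GF i))) id v + tens_op (app (Y (GKi i)) \<circ> app (Y (GK (Suc i)))) (app (Z (GF i))) v)"
      by (intro r) (use x GF in auto)
    then show ?thesis
      unfolding GF by (simp add: A_tensor_def[abs_def] A_comult_def word_op_def tact.simps app_tl agree_def mult one del: app_simps(2,6))
  next
    case (GK i)
    have "agree (C \<times> D) (C \<times> D) (tens_op (\<alpha> (b, GK i)) (\<beta> (b, GK i))) (tens_op (app (Y (GK i))) (app (Z (GK i))))"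
      by (intro r) (use x GK in auto)
    then show ?thesis
      unfolding GK by (simp add: A_tensor_def[abs_def] A_comult_def word_op_def tact.simps app_tl agree_def)
  next
    case (GKi i)
    have "agree (C \<times> D) (C \<times> D) (tens_op (\<alpha> (b, GKi i)) (\<beta> (b, GKi i))) (tens_op (app (Y (GKi i))) (app (Z (GKi i))))"
      by (intro r) (use x GKi in auto)
    then show ?thesis
      unfolding GKi by (simp add: A_tensor_def[abs_def] A_comult_def word_op_def tact.simps app_tl agree_def)
  qed
qed

lemma agree_act_V:
  assumes b: "b \<in> {1..d}" and x: "x \<in> uq_gens (N b)"
  shows "agree (V_basis d N) (V_basis d N) (act_V (b, x)) (app (VB N b x))"
  unfolding agree_def
proof (intro ballI conjI)
  fix v assume v: "v \<in> fsp (V_basis d N)"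
  have e: "lin_ext \<phi> v = lin_ext \<psi> v" if "\<And>c j. (c, j) \<in> V_basis d N \<Longrightarrow> \<phi> (c, j) = \<psi> (c, j)" for \<phi> \<psi> :: "_ \<Rightarrow> (nat \<times> nat) vec"
    using that by (intro lin_ext_cong_fsp[OF v]) auto
  show "act_V (b, x) v = app (VB N b x) v"
    unfolding act_V_def VB_def by (auto intro!: e simp: Vop_eq_vec_rep[OF x])
  have "vec_rep x (bvec j) \<in> fsp {1..N b}" if "j \<in> {1..N b}" for j
    using agree_vec_rep[OF x] that by (simp add: agree_def)
  then show "app (VB N b x) v \<in> fsp (V_basis d N)"
    unfolding VB_def using b x
    by (auto intro!: lin_ext_in_fsp[OF v] reindex_in_fsp[of _ "{1..N b}"] fsp_scl simp: V_basis_def Vop_eq_vec_rep)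
qed

lemma agree_act_MV:
  assumes b: "b \<in> {1..d}" and m: "uq_module (N b) (B b) (\<rho> b)" and x: "x \<in> uq_gens (N b)"
  shows "agree (MV_basis d n N B) (MV_basis d n N B) (act_MV \<rho> n (b, x)) (app (AA N (ext (N b) (B b) (\<rho> b)) b n x))"
  using x
proof (induction n arbitrary: x)
  case 0
  have "act_M \<rho> (b, x) (bvec \<mu>) = reindex (\<lambda>y. \<mu>(b := y)) (app (ext (N b) (B b) (\<rho> b) x) (bvec (\<mu> b)))"
    "app (ext (N b) (B b) (\<rho> b) x) (bvec (\<mu> b)) \<in> fsp (B b)"
    if "\<mu> \<in> (\<Pi>\<^sub>E b\<in>{1..d}. B b)" for \<mu>
  proof -
    have "\<mu> b \<in> B b" using that b by auto
    then show "app (ext (N b) (B b) (\<rho> b) x) (bvec (\<mu> b)) \<in> fsp (B b)"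
      by (intro ext_stable[OF m]) simp
    show "act_M \<rho> (b, x) (bvec \<mu>) = reindex (\<lambda>y. \<mu>(b := y)) (app (ext (N b) (B b) (\<rho> b) x) (bvec (\<mu> b)))"
      using 0 \<open>\<mu> b \<in> B b\<close> by (simp add: act_M_def app_ext[OF m])
  qed
  note \<mu> = this
  show ?case
    unfolding agree_def
  proof (intro ballI conjI)
    fix v :: "'a tbasis vec" assume v: "v \<in> fsp (MV_basis d 0 N B)"
    show "act_MV \<rho> 0 (b, x) v = app (AA N (ext (N b) (B b) (\<rho> b)) b 0 x) v"
      using \<mu>(1) by (auto intro!: lin_ext_cong_fsp[OF v] simp: MV_basis_def comp_def)
    show "app (AA N (ext (N b) (B b) (\<rho> b)) b 0 x) v \<in> fsp (MV_basis d 0 N B)"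
    proof (simp, rule lin_ext_in_fsp[OF v])
      fix a :: "'a tbasis" assume "a \<in> MV_basis d 0 N B"
      then obtain \<nu> where a: "a = (\<nu>, [])" and \<nu>: "\<nu> \<in> (\<Pi>\<^sub>E b\<in>{1..d}. B b)"
        by (auto simp: MV_basis_def)
      have "\<nu>(b := y) \<in> (\<Pi>\<^sub>E b\<in>{1..d}. B b)" if "y \<in> B b" for y
        using \<nu> b that by (auto simp: PiE_iff extensional_def)
      then show "(case a of (m, vs) \<Rightarrow> reindex (\<lambda>y. (m(b := y), [])) (app (ext (N b) (B b) (\<rho> b) x) (bvec (m b)))) \<in> fsp (MV_basis d 0 N B)"
        using \<mu>(2)[OF \<nu>] by (auto simp: a MV_basis_def intro!: reindex_in_fsp[of _ "B b"])
    qed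
  qed
next
  case (Suc n)
  have IH: "agree (MV_basis d n N B \<times> V_basis d N) (MV_basis d n N B \<times> V_basis d N)
      (A_tensor (act_MV \<rho> n) act_V (b, x)) (app (tact (AA N (ext (N b) (B b) (\<rho> b)) b n) (VB N b) x))"
    by (rule agree_A_tensor[where N = "N b"]) (rule Suc.IH Suc.prems agree_act_V[where N = N, OF b]; assumption?)+
  have c: "(\<mu>, butlast vs) \<in> MV_basis d n N B \<and> last vs \<in> V_basis d N" if "(\<mu>, vs) \<in> MV_basis d (Suc n) N B" for \<mu> vs
  proof -
    have "vs \<noteq> []" using that by (auto simp: MV_basis_def)
    then show ?thesis using that last_in_set[of vs] by (auto simp: MV_basis_def dest: in_set_butlastD)
  qed
  have ap: "(\<lambda>((m', ws), w). (m', ws @ [w])) = apnd" by (simp add: apnd_def)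
  show ?case
    unfolding agree_def
  proof (intro ballI conjI)
    fix v :: "'a tbasis vec" assume v: "v \<in> fsp (MV_basis d (Suc n) N B)"
    show "act_MV \<rho> (Suc n) (b, x) v = app (AA N (ext (N b) (B b) (\<rho> b)) b (Suc n) x) v"
      using IH c by (auto intro!: lin_ext_cong_fsp[OF v] simp: ap agree_def)
    show "app (AA N (ext (N b) (B b) (\<rho> b)) b (Suc n) x) v \<in> fsp (MV_basis d (Suc n) N B)"
    proof (simp, rule lin_ext_in_fsp[OF v])
      fix a :: "'a tbasis" assume a: "a \<in> MV_basis d (Suc n) N B"
      obtain \<mu> vs where [simp]: "a = (\<mu>, vs)" by force
      have "app (tact (AA N (ext (N b) (B b) (\<rho> b)) b n) (VB N b) x) (bvec ((\<mu>, butlast vs), last vs)) \<in> fsp (MV_basis d n N B \<times> V_basis d N)"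
        using IH c[of \<mu> vs] a by (auto simp: agree_def)
      then show "(case a of (m, vs) \<Rightarrow> reindex apnd (app (tact (AA N (ext (N b) (B b) (\<rho> b)) b n) (VB N b) x) (bvec ((m, butlast vs), last vs)))) \<in> fsp (MV_basis d (Suc n) N B)"
        by (auto intro!: reindex_in_fsp simp: apnd_def MV_basis_def)
    qed
  qed
qed


section \<open>The operators on \<open>M \<otimes> V\<^sup>n\<close>\<close>

text \<open>The family of operators is a parameter so that the double braiding of the given module
  can be traded for that of its extension, which is linear everywhere.\<close>

definition sig0 :: "(nat \<Rightarrow> ('m \<times> nat) oper) \<Rightarrow> 'm tbasis oper" where
  "sig0 F = lin_ext (\<lambda>(m, vs). case vs ! 0 of (b, j) \<Rightarrow>
     reindex (\<lambda>(y, k). (m(b := y), vs[0 := (b, k)])) (F b (bvec (m b, j))))"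

text \<open>The index is shifted: \<open>sigi N i\<close> represents \<open>S (i + 1)\<close> and
  acts on the list entries i and i + 1, counted from 0.\<close>

definition sigi :: "(nat \<Rightarrow> nat) \<Rightarrow> nat \<Rightarrow> 'm tbasis oper" where
  "sigi N i = lin_ext (\<lambda>(m, vs).
     reindex (\<lambda>(v, w). (m, vs[i := v, Suc i := w])) (sigma_VV N (bvec (vs ! i, vs ! Suc i))))"

lemma sigma_op_0: "sigma_op N \<rho> 0 = sig0 (\<lambda>b. K_check (N b) (\<rho> b))"
  by (simp add: sigma_op_def sig0_def)

lemma sigma_op_Suc: "sigma_op N \<rho> (Suc i) = sigi N i"
  by (simp add: sigma_op_def sigi_def)

lemma lin_sig0 [simp, intro]: "lin (sig0 F)"
  by (simp add: sig0_def)

lemma lin_sigi [simp, intro]: "lin (sigi N i)"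
  by (simp add: sigi_def)

lemma lin_sigma_VV [simp, intro]: "lin (sigma_VV N)"
  by (simp add: sigma_VV_def)

lemma lin_tau_op [simp, intro]: "lin (tau_op \<zeta> i)"
  by (simp add: tau_op_def)

lemma op_reindexI:
  assumes "lin F" "lin G" "\<And>c. F (bvec (h c)) = reindex k (G (bvec c))"
  shows "F (reindex h v) = reindex k (G v)"
  by (rule lin_eqI[OF lin_compose[OF assms(1) lin_reindex] lin_compose[OF lin_reindex assms(2)]])
    (simp add: assms)

lemma op_reindexI_fsp:
  assumes "lin F" "lin G" "\<And>c. c \<in> C \<Longrightarrow> F (bvec (h c)) = reindex k (G (bvec c))" "v \<in> fsp C"
  shows "F (reindex h v) = reindex k (G v)"
  by (rule lin_eq_fspI[OF lin_compose[OF assms(1) lin_reindex] lin_compose[OF lin_reindex assms(2)] _ assms(4)])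
    (simp add: assms)

lemma sig0_reindex:
  assumes F: "lin (F b)"
  shows "sig0 F (reindex (\<lambda>(y, k). (m(b := y), (b, k) # vs)) v) = reindex (\<lambda>(y, k). (m(b := y), (b, k) # vs)) (F b v)"
  by (rule op_reindexI[OF lin_sig0 F]) (auto simp: sig0_def)

lemma sigma_VV_eq:
  "sigma_VV N (reindex (map_prod (Pair b) (Pair b)) v) = reindex (map_prod (Pair b) (Pair b)) (R_check (N b) v)"
  by (rule op_reindexI[OF lin_sigma_VV lin_R_check]) (auto simp: sigma_VV_def map_prod_def)

lemma sigma_VV_neq: "b \<noteq> c \<Longrightarrow> sigma_VV N (bvec ((b, j), (c, k))) = bvec ((c, k), (b, j))"
  by (simp add: sigma_VV_def)

lemma sigi_reindex:
  assumes "Suc i < length vs"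
  shows "sigi N i (reindex (\<lambda>(v, w). (m, vs[i := v, Suc i := w])) u) =
    reindex (\<lambda>(v, w). (m, vs[i := v, Suc i := w])) (sigma_VV N u)"
  by (rule op_reindexI[OF lin_sigi lin_sigma_VV])
    (use assms in \<open>auto simp: sigi_def list_update_swap[of "Suc i" i]\<close>)

lemma tau_op_scalar:
  "v \<in> fsp {(m, vs). fst (vs ! (i - 1)) = c} \<Longrightarrow> tau_op \<zeta> i v = scl (\<zeta> ^ (c - 1)) v"
  by (rule lin_eq_fspI[of "tau_op \<zeta> i"]) (auto simp: tau_op_def intro: lin_scale)

lemma fsp_mono: "B \<subseteq> C \<Longrightarrow> v \<in> fsp B \<Longrightarrow> v \<in> fsp C"
  by (auto simp: fsp_def)

subsection \<open>Linearity over the quantum groups\<close>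

text \<open>Each basis vector lies in the image of a simpler module under an embedding h. There F
  becomes a map G between simpler modules, possibly with another embedding k at the target, as when
  two blocks are exchanged.\<close>

lemma com_transfer:
  assumes "inter Y X (reindex h)" "\<And>v. F (reindex h v) = reindex k (G v)"
    "\<And>v. G (app (Y g) v) = app (Z g) (G v)" "inter Z X (reindex k)"
  shows "F (app (X g) (bvec (h c))) = app (X g) (F (bvec (h c)))"
proof -
  have "F (app (X g) (reindex h (bvec c))) = app (X g) (F (reindex h (bvec c)))"
    using assms unfolding inter_def by metis
  then show ?thesis by simp
qed

lemma reindex_comp: "reindex g \<circ> reindex h = reindex (g \<circ> h)"
  by (simp add: fun_eq_iff)

text \<open>V (x) V is the sum of the products of blocks V_c (x) V_e. Only c = e = b uses the
  R-matrix, through \<open>inter_R_check\<close>; otherwise at least one factor carries the trivial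
  action, and scalars or flips remain.\<close>

lemma com_sigma_VV: "com UNIV (tact (VB N b) (VB N b)) (sigma_VV N)"
proof (rule comI)
  fix g and a :: "(nat \<times> nat) \<times> (nat \<times> nat)"
  obtain c j e k where a: "a = ((c, j), (e, k))" by (cases a) auto
  let ?h = "\<lambda>c e. map_prod (Pair c) (Pair e) :: nat \<times> nat \<Rightarrow> (nat \<times> nat) \<times> (nat \<times> nat)"
  let ?T = "tact (VB N b) (VB N b)"
  have R: "app ((\<lambda>g. 1 \<otimes>\<^sub>o Y g) g) (reindex prod.swap v) = reindex prod.swap (app (Y g \<otimes>\<^sub>o 1) v)"
     "app (Y g \<otimes>\<^sub>o 1) (reindex prod.swap v) = reindex prod.swap (app ((\<lambda>g. 1 \<otimes>\<^sub>o Y g) g) v)"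
    for Y :: "uqgen \<Rightarrow> nat lop" and g and v :: "(nat \<times> nat) vec"
    by (rule op_reindexI[OF lin_app lin_app]; auto simp: app_tl tens_op_bvec tens_bvec_left tens_bvec_right comp_def)+
  have sw: "sigma_VV N (reindex (?h c e) v) = reindex (?h e c) (reindex prod.swap v)" if "c \<noteq> e" for c e v
    unfolding reindex_reindex using that
    by (intro op_reindexI[OF lin_sigma_VV lin_id(2)]) (auto simp: sigma_VV_neq)
  show "sigma_VV N (app (?T g) (bvec a)) = app (?T g) (sigma_VV N (bvec a))"
  proof -
    have ah: "a = ?h c e (j, k)" by (simp add: a)
    consider "c = e" "c = b" | "c = e" "c \<noteq> b" | "c \<noteq> e" "c = b" | "c \<noteq> e" "e = b" | "c \<noteq> e" "c \<noteq> b" "e \<noteq> b"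
      by blast
    then show ?thesis
    proof cases
      case 1
      have i: "inter (tact (Vop (N b)) (Vop (N b))) ?T (reindex (?h b b))"
        by (rule inter_map_prod[OF inter_VB inter_VB])
      from 1 have cb: "c = b" and eb: "e = b" by simp_all
      show ?thesis
        unfolding ah cb eb
        by (rule com_transfer[where F = "sigma_VV N" and G = "R_check (N b)", OF i _ _ i])
          (use inter_R_check[of "N b"] in \<open>simp_all add: sigma_VV_eq inter_def\<close>)
    next
      case 2
      have i: "inter triv ?T (reindex (?h c c))"
        using inter_map_prod[OF inter_VB'[OF 2(2), of N] inter_VB'[OF 2(2), of N]] by (simp add: tact_triv)
      show ?thesis
        unfolding ah \<open>c = e\<close>[symmetric]
        by (rule com_transfer[where F = "sigma_VV N" and G = "R_check (N c)", OF i _ _ i])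
          (simp_all add: sigma_VV_eq triv_def lin_scl[OF lin_R_check])
    next
      case 3
      then have "e \<noteq> b" by simp
      have i: "inter (\<lambda>g. Vop (N b) g \<otimes>\<^sub>o 1) ?T (reindex (?h b e))"
        using inter_map_prod[OF inter_VB[of N b] inter_VB'[OF \<open>e \<noteq> b\<close>, of N]] by (simp add: tact_triv_right[abs_def])
      have i': "inter (\<lambda>g. 1 \<otimes>\<^sub>o Vop (N b) g) ?T (reindex (?h e b))"
        using inter_map_prod[OF inter_VB'[OF \<open>e \<noteq> b\<close>, of N] inter_VB[of N b]] by (simp add: tact_triv_left[abs_def])
      show ?thesis
        unfolding ah \<open>c = b\<close>
        by (rule com_transfer[where F = "sigma_VV N" and G = "reindex prod.swap", OF i _ _ i']) (use 3 sw in \<open>simp_all add: R\<close>)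
    next
      case 4
      then have "c \<noteq> b" by simp
      have i: "inter (\<lambda>g. Vop (N b) g \<otimes>\<^sub>o 1) ?T (reindex (?h b c))"
        using inter_map_prod[OF inter_VB[of N b] inter_VB'[OF \<open>c \<noteq> b\<close>, of N]] by (simp add: tact_triv_right[abs_def])
      have i': "inter (\<lambda>g. 1 \<otimes>\<^sub>o Vop (N b) g) ?T (reindex (?h c b))"
        using inter_map_prod[OF inter_VB'[OF \<open>c \<noteq> b\<close>, of N] inter_VB[of N b]] by (simp add: tact_triv_left[abs_def])
      show ?thesis
        unfolding ah \<open>e = b\<close>
        by (rule com_transfer[where F = "sigma_VV N" and G = "reindex prod.swap", OF i' _ _ i]) (use 4 sw in \<open>simp_all add: R\<close>)
    next
      case 5
      have i: "inter triv ?T (reindex (?h c e))" if "c \<noteq> b" "e \<noteq> b" for c e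
        using inter_map_prod[OF inter_VB'[OF that(1), of N] inter_VB'[OF that(2), of N]] by (simp add: tact_triv)
      show ?thesis
        unfolding ah
        by (rule com_transfer[where F = "sigma_VV N" and G = "reindex prod.swap", OF i[OF 5(2,3)] _ _ i[OF 5(3,2)]]) (use 5 sw in \<open>simp_all add: triv_def lin_scl[OF lin_reindex]\<close>)
    qed
  qed
qed auto

text \<open>\<open>MV_basis\<close> without bounds inside the blocks and without a condition on the
  M-part. The relations other than the quadratic one are verified on this larger set, which is
  stable under \<open>AA\<close> for every Y.\<close>

definition tb :: "nat \<Rightarrow> nat \<Rightarrow> 'm tbasis set" where
  "tb d n = {(m, vs). length vs = n \<and> fst ` set vs \<subseteq> {1..d}}"

lemma AA_stable: "stab (tb d n) (AA N Y b n)"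
proof (rule stabI)
  fix g and a :: "'a tbasis" assume a: "a \<in> tb d n"
  obtain m vs where [simp]: "a = (m, vs)" by force
  have "app (AA N Y b (length (map fst vs)) g) (bvec a) \<in> fsp {(m', vs'). map fst vs' = map fst vs}"
    using AA_blocks[of "map fst vs" N Y b] by (auto simp: stab_def)
  moreover have "{(m', vs'). map fst vs' = map fst vs} \<subseteq> tb d n"
    using a unfolding tb_def by (auto simp del: set_map simp: set_map[symmetric] dest: map_eq_imp_length_eq)
  ultimately show "app (AA N Y b n g) (bvec a) \<in> fsp (tb d n)"
    using a by (auto simp: tb_def intro: fsp_mono)
qed

text \<open>An operator leaving the appended factor alone has the form F (x) id, and commutation
  passes through the comultiplication because F commutes with both legs on the first tensor
  factor.\<close>

lemma com_AA_Suc: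
  assumes "lin F'" "lin F" "com (tb d n) (AA N Y b n) F"
    "\<And>m ws u. length ws = n \<Longrightarrow> F' (bvec (m, ws @ [u])) = reindex apnd (tens (F (bvec (m, ws))) (bvec u))"
  shows "com (tb d (Suc n)) (AA N Y b (Suc n)) F'"
proof (rule comI[OF assms(1)])
  fix g and a :: "'a tbasis" assume "a \<in> tb d (Suc n)"
  then obtain m ws u where a: "a = apnd ((m, ws), u)" and ws: "(m, ws) \<in> tb d n"
    by (auto simp: tb_def apnd_def length_Suc_conv_rev)
  have i: "app (AA N Y b (Suc n) g) (reindex apnd w) = reindex apnd (app (tact (AA N Y b n) (VB N b) g) w)" for w
    using inter_AA_Suc[of N Y b n] unfolding inter_def by metis
  have F': "F' (reindex apnd w) = reindex apnd (tens_op F id w)" if "w \<in> fsp (tb d n \<times> UNIV)" for w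
    by (rule op_reindexI_fsp[OF assms(1) lin_tens_op _ that])
      (auto simp: apnd_def assms(4) tb_def tens_op_bvec)
  have w: "bvec ((m, ws), u) \<in> fsp (tb d n \<times> UNIV)"
    using ws by simp
  then have w': "app (tact (AA N Y b n) (VB N b) g) (bvec ((m, ws), u)) \<in> fsp (tb d n \<times> UNIV)"
    using stab_tact[OF AA_stable[of d n N Y b], of UNIV "VB N b"] by (simp add: stab_def)
  have "tens_op F id (app (tact (AA N Y b n) (VB N b) g) (bvec ((m, ws), u)))
      = app (tact (AA N Y b n) (VB N b) g) (tens_op F id (bvec ((m, ws), u)))"
    using com_tens_left[OF assms(2,3) AA_stable, of "VB N b"] w unfolding com_def by blast
  moreover have a': "bvec a = reindex apnd (bvec ((m, ws), u))"
    by (simp add: a)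
  ultimately show "F' (app (AA N Y b (Suc n) g) (bvec a)) = app (AA N Y b (Suc n) g) (F' (bvec a))"
    unfolding a' i F'[OF w'] F'[OF w] by (simp only:)
qed

text \<open>For the last two factors coassociativity rewrites the module as (M (x) V^n) (x) (V (x)
  V), where the operator becomes id (x) \<open>sigma_VV N\<close>.\<close>

lemma com_sigi_last: "com (tb d (Suc (Suc n))) (AA N Y b (Suc (Suc n))) (sigi N n)"
proof (rule comI[OF lin_sigi])
  fix g and a :: "'a tbasis" assume "a \<in> tb d (Suc (Suc n))"
  then obtain m ws u w where a: "a = (m, ws @ [u, w])" and ws: "length ws = n"
    by (auto simp: tb_def length_Suc_conv_rev)
  let ?h = "apnd \<circ> (map_prod apnd id \<circ> (\<lambda>(a, b, c). ((a, b), c))) :: 'a tbasis \<times> (nat \<times> nat) \<times> (nat \<times> nat) \<Rightarrow> _"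
  let ?Y = "tact (AA N Y b n) (tact (VB N b) (VB N b))"
  have id: "inter Z Z (reindex id)" for Z :: "uqgen \<Rightarrow> 'z lop"
    by (rule inter_reindexI) simp
  have i: "inter ?Y (AA N Y b (Suc (Suc n))) (reindex ?h)"
    using inter_comp[OF inter_comp[OF inter_assoc inter_map_prod[OF inter_AA_Suc id]] inter_AA_Suc]
    by (simp add: reindex_comp comp_assoc)
  let ?k = "\<lambda>(u, w). (m, ws @ [u, w])"
  \<comment> \<open>\<open>sigi N n\<close> meets the two last entries only if the list before them
    has length n. The action preserves the sequence of blocks and with it this length.\<close>
  have "app (?Y g) (bvec ((m, ws), u, w)) \<in> fsp ({(m, vs). length vs = n} \<times> UNIV)"
  proof -
    have "stab ({(m, vs). map fst vs = map fst ws} \<times> UNIV) ?Y"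
      using stab_tact[OF AA_blocks[of "map fst ws" N Y b], of UNIV] ws by (simp add: stab_def)
    then have "app (?Y g) (bvec ((m, ws), u, w)) \<in> fsp ({(m, vs). map fst vs = map fst ws} \<times> UNIV)"
      by (simp add: stab_def)
    then show ?thesis
      by (rule fsp_mono[rotated]) (use ws in \<open>auto dest: map_eq_imp_length_eq\<close>)
  qed
  note w' = this
  have h: "sigi N n (reindex ?h v) = reindex ?h (tens_op id (sigma_VV N) v)"
    if "v \<in> fsp ({(m, vs). length vs = n} \<times> UNIV)" for v :: "('a tbasis \<times> (nat \<times> nat) \<times> (nat \<times> nat)) vec"
  proof (rule op_reindexI_fsp[OF lin_sigi lin_tens_op _ that])
    fix c :: "'a tbasis \<times> (nat \<times> nat) \<times> (nat \<times> nat)"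
    assume "c \<in> {(m, vs). length vs = n} \<times> UNIV"
    then obtain m ws u w where c: "c = ((m, ws), u, w)" "length ws = n" by (cases c) auto
    show "sigi N n (bvec (?h c)) = reindex ?h (tens_op id (sigma_VV N) (bvec c))"
      using c(2) by (auto simp: c(1) apnd_def sigi_def nth_append list_update_append tens_op_bvec tens_bvec_left comp_def
          case_prod_unfold map_prod_def)
  qed
  have "tens_op id (sigma_VV N) (app (?Y g) (bvec ((m, ws), u, w))) = app (?Y g) (tens_op id (sigma_VV N) (bvec ((m, ws), u, w)))"
    using com_tens_right[OF lin_sigma_VV com_sigma_VV, of N b "AA N Y b n"] by (simp add: com_def stab_def)
  moreover have "bvec a = reindex ?h (bvec ((m, ws), u, w))"
    by (simp add: a apnd_def)
  moreover have "app (AA N Y b (Suc (Suc n)) g) (reindex ?h v) = reindex ?h (app (?Y g) v)" for v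
    using i unfolding inter_def by metis
  ultimately show "sigi N n (app (AA N Y b (Suc (Suc n)) g) (bvec a)) = app (AA N Y b (Suc (Suc n)) g) (sigi N n (bvec a))"
    using h[OF w'] h[of "bvec ((m, ws), u, w)"] ws by (simp only:) simp
qed

text \<open>The pair is treated as the last two factors, and the l remaining ones are appended one
  at a time by \<open>com_AA_Suc\<close>.\<close>

lemma com_sigi:
  assumes "Suc i < n"
  shows "com (tb d n) (AA N Y b n) (sigi N i)"
proof -
  have "com (tb d (Suc (Suc (i + l)))) (AA N Y b (Suc (Suc (i + l)))) (sigi N i)" for l
  proof (induction l)
    case 0
    show ?case using com_sigi_last[of d i N Y b] by simp
  next
    case (Suc l)
    have "com (tb d (Suc (Suc (Suc (i + l))))) (AA N Y b (Suc (Suc (Suc (i + l))))) (sigi N i)"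
      by (rule com_AA_Suc[OF lin_sigi lin_sigi Suc])
        (auto simp: sigi_def nth_append list_update_append apnd_def case_prod_unfold comp_def tens_bvec_right)
    then show ?case by simp
  qed
  moreover have "Suc (Suc (i + (n - Suc (Suc i)))) = n" using assms by simp
  ultimately show ?thesis by metis
qed

lemma com_sig0:
  assumes b: "b \<in> {1..d}" and F: "\<And>c. c \<in> {1..d} \<Longrightarrow> lin (F c)" and i: "inter (tact Y (Vop (N b))) (tact Y (Vop (N b))) (F b)"
    and n: "n \<ge> 1"
  shows "com (tb d n) (AA N Y b n) (sig0 F)"
proof -
  have base: "com (tb d 1) (AA N Y b 1) (sig0 F)"
  proof (rule comI[OF lin_sig0])
    fix g and a :: "'a tbasis" assume "a \<in> tb d 1"
    then obtain m c j where a: "a = (m, [(c, j)])" and c: "c \<in> {1..d}"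
      by (auto simp: tb_def length_Suc_conv)
    have A1: "AA N Y b 1 = AA N Y b (Suc 0)" by simp
    have ap: "apnd \<circ> map_prod (\<lambda>y. (m(b := y), [])) (Pair e) = (\<lambda>(y, k). (m(b := y), [(e, k)]))" for m :: "nat \<Rightarrow> 'a" and e
      by (auto simp: apnd_def)
    show "sig0 F (app (AA N Y b 1 g) (bvec a)) = app (AA N Y b 1 g) (sig0 F (bvec a))"
    proof (cases "c = b")
      case True
      let ?h = "\<lambda>(y, k). (m(b := y), [(b, k)])"
      have I: "inter (tact Y (Vop (N b))) (AA N Y b 1) (reindex ?h)"
        using inter_comp[OF inter_map_prod[OF inter_AA_0[of Y N b m] inter_VB[of N b]] inter_AA_Suc[of N Y b 0]]
        by (simp only: reindex_comp ap A1)
      have a': "a = ?h (m b, j)" using True by (simp add: a)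
      show ?thesis
        unfolding a' by (rule com_transfer[where F = "sig0 F" and G = "F b", OF I _ _ I])
          (use i F b in \<open>auto simp: inter_def intro!: sig0_reindex\<close>)
    next
      case False
      \<comment> \<open>For a block c other than b, the coordinates b and c of the M-part are
        exposed as separate tensor factors: the generator acts on the first, and \<open>F c\<close>
        on the second together with the vector.\<close>
      let ?h = "\<lambda>(y, z, k). (m(b := y, c := z), [(c, k)])"
      have I1: "inter (tact Y triv) (AA N Y b 1) (reindex (\<lambda>(y, k). (m(b := y), [(c, k)])))" for m
        using inter_comp[OF inter_map_prod[OF inter_AA_0[of Y N b m] inter_VB'[OF False, of N]] inter_AA_Suc[of N Y b 0]]
        by (simp only: reindex_comp ap A1)
      have I: "inter (\<lambda>g. Y g \<otimes>\<^sub>o 1) (AA N Y b 1) (reindex ?h)"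
      proof (rule inter_reindexI)
        fix g and yzk :: "'a \<times> 'a \<times> nat"
        obtain y z k where [simp]: "yzk = (y, z, k)" by (cases yzk) auto
        have "app (AA N Y b 1 g) (reindex (\<lambda>(y, k). ((m(c := z))(b := y), [(c, k)])) (bvec (y, k))) =
          reindex (\<lambda>(y, k). ((m(c := z))(b := y), [(c, k)])) (app (Y g \<otimes>\<^sub>o 1) (bvec (y, k)))"
          using I1[of "m(c := z)"] unfolding inter_def tact_triv_right by metis
        then show "app (AA N Y b 1 g) (bvec (?h yzk)) = reindex ?h (app (Y g \<otimes>\<^sub>o 1) (bvec yzk))"
          using False by (simp add: app_tl tens_op_bvec tens_bvec_right comp_def fun_upd_twist[of b c])
      qed
      have a': "a = ?h (m b, m c, j)" using False by (simp add: a)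
      have s: "sig0 F (reindex ?h v) = reindex ?h (tens_op id (F c) v)" for v
      proof (rule op_reindexI[OF lin_sig0 lin_tens_op])
        fix yzk :: "'a \<times> 'a \<times> nat"
        obtain y z k where [simp]: "yzk = (y, z, k)" by (cases yzk) auto
        show "sig0 F (bvec (?h yzk)) = reindex ?h (tens_op id (F c) (bvec yzk))"
          by (simp add: sig0_def tens_op_bvec tens_bvec_left comp_def case_prod_unfold)
      qed
      show ?thesis
        unfolding a'
      proof (rule com_transfer[where F = "sig0 F" and G = "tens_op id (F c)", OF I s _ I])
        fix v
        show "tens_op id (F c) (app (Y g \<otimes>\<^sub>o 1) v) = app (Y g \<otimes>\<^sub>o 1) (tens_op id (F c) v)"
          by (rule lin_eqI[of "\<lambda>v. tens_op id (F c) (app _ v)" "\<lambda>v. app _ (tens_op id (F c) v)"])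
            (auto simp: app_tl tens_op_bvec tens_op_tens F[OF c] intro: lin_compose)
      qed
    qed
  qed
  have "com (tb d (Suc l)) (AA N Y b (Suc l)) (sig0 F)" for l
  proof (induction l)
    case (Suc l)
    show ?case
    proof (rule com_AA_Suc[OF lin_sig0 lin_sig0 Suc])
      fix m :: "nat \<Rightarrow> 'a" and ws :: "(nat \<times> nat) list" and u :: "nat \<times> nat"
      assume "length ws = Suc l"
      then obtain c k vs where ws: "ws = (c, k) # vs" by (cases ws) auto
      show "sig0 F (bvec (m, ws @ [u])) = reindex apnd (tens (sig0 F (bvec (m, ws))) (bvec u))"
        by (simp add: ws sig0_def tens_bvec_right comp_def apnd_def case_prod_unfold)
    qed
  qed (use base in simp)
  moreover have "Suc (n - 1) = n" using n by simp
  ultimately show ?thesis by metis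
qed

lemma com_tau:
  assumes "i \<in> {1..n}"
  shows "com (tb d n) (AA N Y b n) (tau_op \<zeta> i)"
proof (rule comI[OF lin_tau_op])
  fix g and a :: "'a tbasis" assume "a \<in> tb d n"
  then obtain m vs where a: "a = (m, vs)" and vs: "length vs = n" by (auto simp: tb_def)
  have s: "tau_op \<zeta> i v = scl (\<zeta> ^ (fst (vs ! (i - 1)) - 1)) v" if "v \<in> fsp {(m', vs'). map fst vs' = map fst vs}" for v :: "'a tbasis vec"
  proof (rule tau_op_scalar, rule fsp_mono[OF _ that])
    have nth: "fst (vs' ! (i - 1)) = fst (vs ! (i - 1))" if "map fst vs' = map fst vs" for vs' :: "(nat \<times> nat) list"
    proof -
      have "i - 1 < length vs" "length vs' = length vs" using assms vs map_eq_imp_length_eq[OF that] by auto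
      then show ?thesis by (metis nth_map that)
    qed
    show "{(m', vs'). map fst vs' = map fst vs} \<subseteq> {(m :: nat \<Rightarrow> 'a, vs' :: (nat \<times> nat) list). fst (vs' ! (i - 1)) = fst (vs ! (i - 1))}"
    proof (rule subsetI)
      fix x :: "'a tbasis" assume "x \<in> {(m', vs'). map fst vs' = map fst vs}"
      then have "map fst (snd x) = map fst vs" by (simp only: mem_Collect_eq case_prod_unfold)
      from nth[OF this] show "x \<in> {(m, vs'). fst (vs' ! (i - 1)) = fst (vs ! (i - 1))}"
        by (simp only: mem_Collect_eq case_prod_unfold)
    qed
  qed
  have "app (AA N Y b n g) (bvec a) \<in> fsp {(m', vs'). map fst vs' = map fst vs}"
    using AA_blocks[of "map fst vs" N Y b] vs by (auto simp: stab_def a)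
  then show "tau_op \<zeta> i (app (AA N Y b n g) (bvec a)) = app (AA N Y b n g) (tau_op \<zeta> i (bvec a))"
    by (simp only: s a bvec_in_fsp mem_Collect_eq case_prod_conv app_lin)
qed


subsection \<open>Braid relations\<close>

text \<open>Two factors in block b and one in block e; \<open>k1\<close>, \<open>k2\<close>,
  \<open>k3\<close> put the odd one last, in the middle and first. It moves by flips alone, so the
  R-matrix may act before or after, which settles three cases of the Yang-Baxter equation.\<close>

lemma sigma_VV_three:
  fixes b e l :: nat
  assumes "b \<noteq> e"
  defines "k1 \<equiv> \<lambda>(j, k). ((b, j), (b, k), (e, l))" and "k2 \<equiv> \<lambda>(j, k). ((b, j), (e, l), (b, k))"
    and "k3 \<equiv> \<lambda>(j, k). ((e, l), (b, j), (b, k))"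
  shows "op12 (sigma_VV N) (reindex k1 v) = reindex k1 (R_check (N b) v)"
    "op23 (sigma_VV N) (reindex k1 v) = reindex k2 v"
    "op12 (sigma_VV N) (reindex k2 v) = reindex k3 v"
    "op23 (sigma_VV N) (reindex k2 v) = reindex k1 v"
    "op12 (sigma_VV N) (reindex k3 v) = reindex k2 v"
    "op23 (sigma_VV N) (reindex k3 v) = reindex k3 (R_check (N b) v)"
  unfolding k1_def k2_def k3_def
  by (rule op_reindexI[OF lin_op12 lin_R_check] op_reindexI[OF lin_op23 lin_R_check]
      op_reindexI[OF lin_op12 lin_id(2)] op_reindexI[OF lin_op23 lin_id(2)];
      use assms(1) in \<open>auto simp: op12_bvec op23_bvec sigma_VV_def comp_def case_prod_unfold\<close>)+

lemma sigma_VV_yang_baxter: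
  "op12 (sigma_VV N) (op23 (sigma_VV N) (op12 (sigma_VV N) v)) =
   op23 (sigma_VV N) (op12 (sigma_VV N) (op23 (sigma_VV N) v))"
proof (rule lin_eqI[of "\<lambda>v. op12 (sigma_VV N) (op23 (sigma_VV N) (op12 (sigma_VV N) v))"
      "\<lambda>v. op23 (sigma_VV N) (op12 (sigma_VV N) (op23 (sigma_VV N) v))"])
  fix a :: "(nat \<times> nat) \<times> (nat \<times> nat) \<times> (nat \<times> nat)"
  obtain b j c k e l where a: "a = ((b, j), (c, k), (e, l))" by (cases a) auto
  show "op12 (sigma_VV N) (op23 (sigma_VV N) (op12 (sigma_VV N) (bvec a))) =
    op23 (sigma_VV N) (op12 (sigma_VV N) (op23 (sigma_VV N) (bvec a)))"
  proof -
    consider "b = c" "c = e" | "b = c" "b \<noteq> e" | "c = e" "c \<noteq> b" | "b = e" "b \<noteq> c" | "b \<noteq> c" "c \<noteq> e" "b \<noteq> e"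
      by blast
    then show ?thesis
    proof cases
      case 1
      let ?h = "map_prod (Pair b) (map_prod (Pair b) (Pair b)) :: nat \<times> nat \<times> nat \<Rightarrow> _"
      have 1: "op12 (sigma_VV N) (reindex ?h v) = reindex ?h (op12 (R_check (N b)) v)"
        "op23 (sigma_VV N) (reindex ?h v) = reindex ?h (op23 (R_check (N b)) v)" for v
        by (rule op_reindexI[OF lin_op12 lin_op12] op_reindexI[OF lin_op23 lin_op23];
            auto simp: op12_bvec op23_bvec sigma_VV_def comp_def case_prod_unfold map_prod_def)+
      have "bvec a = reindex ?h (bvec (j, k, l))" using \<open>b = c\<close> \<open>c = e\<close> by (simp add: a)
      then show ?thesis
        by (simp only: 1 yang_baxter[OF is_alpha_R_check])
    next
      case 2
      then have "bvec a = reindex (\<lambda>(j, k). ((b, j), (b, k), (e, l))) (bvec (j, k))" by (simp add: a)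
      then show ?thesis by (simp only: sigma_VV_three[OF 2(2)])
    next
      case 3
      then have "bvec a = reindex (\<lambda>(k, l). ((b, j), (c, k), (c, l))) (bvec (k, l))" by (simp add: a)
      then show ?thesis by (simp only: sigma_VV_three[OF 3(2)])
    next
      case 4
      then have "bvec a = reindex (\<lambda>(j, l). ((b, j), (c, k), (b, l))) (bvec (j, l))" by (simp add: a)
      then show ?thesis by (simp only: sigma_VV_three[OF 4(2)])
    next
      case 5
      then show ?thesis by (simp add: a op12_bvec op23_bvec sigma_VV_neq)
    qed
  qed
qed (intro lin_os lin_id)+

lemma sigi_braid:
  assumes v: "v \<in> fsp (tb d n)" and i: "Suc (Suc i) < n"
  shows "sigi N i (sigi N (Suc i) (sigi N i v)) = sigi N (Suc i) (sigi N i (sigi N (Suc i) v))"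
proof (rule lin_eq_fspI[OF _ _ _ v, of "\<lambda>v. sigi N i (sigi N (Suc i) (sigi N i v))" "\<lambda>v. sigi N (Suc i) (sigi N i (sigi N (Suc i) v))"])
  fix a :: "'a tbasis" assume "a \<in> tb d n"
  then obtain m vs where a: "a = (m, vs)" and len: "length vs = n" by (auto simp: tb_def)
  \<comment> \<open>A triple inserted into a fixed list: along this map the two operators become
    \<open>op12\<close> and \<open>op23\<close> of \<open>sigma_VV N\<close>, since repeated updates
    overwrite one another.\<close>
  let ?h = "\<lambda>(u, v, w). (m, vs[i := u, Suc i := v, Suc (Suc i) := w])"
  have u1: "vs[i := u, Suc i := v, Suc (Suc i) := w, i := u', Suc i := v'] = vs[i := u', Suc i := v', Suc (Suc i) := w]"
    "vs[i := u, Suc i := v, Suc (Suc i) := w, Suc i := v', Suc (Suc i) := w'] = vs[i := u, Suc i := v', Suc (Suc i) := w']"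
    for u v w u' v' w'
    by (rule nth_equalityI; use i len in \<open>auto simp: nth_list_update\<close>)+
  have h: "sigi N i (reindex ?h v) = reindex ?h (op12 (sigma_VV N) v)"
    "sigi N (Suc i) (reindex ?h v) = reindex ?h (op23 (sigma_VV N) v)" for v
    using i len by (rule_tac op_reindexI[OF lin_sigi lin_op12] op_reindexI[OF lin_sigi lin_op23];
      auto simp: sigi_def op12_bvec op23_bvec comp_def case_prod_unfold u1)+
  have "bvec a = reindex ?h (bvec (vs ! i, vs ! Suc i, vs ! Suc (Suc i)))"
    by (simp add: a)
  then show "sigi N i (sigi N (Suc i) (sigi N i (bvec a))) = sigi N (Suc i) (sigi N i (sigi N (Suc i) (bvec a)))"
    by (simp only: h sigma_VV_yang_baxter)
qed (intro lin_compose[OF lin_sigi] lin_sigi)+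

lemma tens_op_commute:
  "lin F \<Longrightarrow> lin G \<Longrightarrow> tens_op F id (tens_op id G v) = tens_op id G (tens_op F id v)"
  by (rule lin_eqI[of "\<lambda>v. tens_op F id (tens_op id G v)" "\<lambda>v. tens_op id G (tens_op F id v)"])
    (auto simp: tens_op_bvec tens_op_tens intro: lin_compose)

lemma sigi_far:
  assumes v: "v \<in> fsp (tb d n)" and ij: "Suc i < j" "Suc j < n"
  shows "sigi N i (sigi N j v) = sigi N j (sigi N i v)"
proof (rule lin_eq_fspI[OF _ _ _ v, of "\<lambda>v. sigi N i (sigi N j v)" "\<lambda>v. sigi N j (sigi N i v)"])
  fix a :: "'a tbasis" assume "a \<in> tb d n"
  then obtain m vs where a: "a = (m, vs)" and len: "length vs = n" by (auto simp: tb_def)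
  let ?h = "\<lambda>((v, w), (v', w')). (m, vs[i := v, Suc i := w, j := v', Suc j := w'])"
  have u1: "vs[i := v, Suc i := w, j := v', Suc j := w', i := x, Suc i := y] = vs[i := x, Suc i := y, j := v', Suc j := w']"
    "vs[i := v, Suc i := w, j := v', Suc j := w', j := x, Suc j := y] = vs[i := v, Suc i := w, j := x, Suc j := y]"
    for v w v' w' x y
    by (rule nth_equalityI; use ij len in \<open>auto simp: nth_list_update\<close>)+
  have h: "sigi N i (reindex ?h v) = reindex ?h (tens_op (sigma_VV N) id v)"
    "sigi N j (reindex ?h v) = reindex ?h (tens_op id (sigma_VV N) v)" for v
    using ij len by (rule_tac op_reindexI[OF lin_sigi lin_tens_op];
      auto simp: sigi_def tens_op_bvec comp_def case_prod_unfold u1 tens_bvec_left tens_bvec_right)+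
  have "bvec a = reindex ?h (bvec ((vs ! i, vs ! Suc i), (vs ! j, vs ! Suc j)))"
    by (simp add: a)
  then show "sigi N i (sigi N j (bvec a)) = sigi N j (sigi N i (bvec a))"
    by (simp only: h tens_op_commute[OF lin_sigma_VV lin_sigma_VV])
qed (rule lin_compose[OF lin_sigi lin_sigi])+

lemma sig0_far:
  assumes v: "v \<in> fsp (tb d n)" and F: "\<And>c. c \<in> {1..d} \<Longrightarrow> lin (F c)" and j: "Suc (Suc j) < n"
  shows "sig0 F (sigi N (Suc j) v) = sigi N (Suc j) (sig0 F v)"
proof (rule lin_eq_fspI[OF _ _ _ v, of "\<lambda>v. sig0 F (sigi N (Suc j) v)" "\<lambda>v. sigi N (Suc j) (sig0 F v)"])
  fix a :: "'a tbasis" assume "a \<in> tb d n"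
  then obtain m b l vs where a: "a = (m, (b, l) # vs)" and len: "Suc (length vs) = n" and b: "b \<in> {1..d}"
    using j unfolding tb_def by (cases a; cases "snd a") auto
  let ?h = "\<lambda>((y, l), (v, w)). (m(b := y), (b, l) # vs[j := v, Suc j := w])"
  have u1: "vs[j := v, Suc j := w, j := x, Suc j := y] = vs[j := x, Suc j := y]" for v w x y
    by (rule nth_equalityI; use j len in \<open>auto simp: nth_list_update\<close>)
  have h1: "sig0 F (reindex ?h v) = reindex ?h (tens_op (F b) id v)" for v
    by (rule op_reindexI[OF lin_sig0 lin_tens_op])
      (auto simp: sig0_def tens_op_bvec comp_def case_prod_unfold tens_bvec_right)
  have h2: "sigi N (Suc j) (reindex ?h v) = reindex ?h (tens_op id (sigma_VV N) v)" for v
    using j len by (rule_tac op_reindexI[OF lin_sigi lin_tens_op])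
      (auto simp: sigi_def tens_op_bvec comp_def case_prod_unfold u1 tens_bvec_left)
  have "bvec a = reindex ?h (bvec ((m b, l), (vs ! j, vs ! Suc j)))"
    by (simp add: a)
  then show "sig0 F (sigi N (Suc j) (bvec a)) = sigi N (Suc j) (sig0 F (bvec a))"
    by (simp only: h1 h2 tens_op_commute[OF F[OF b] lin_sigma_VV])
qed (rule lin_compose[OF lin_sig0 lin_sigi] lin_compose[OF lin_sigi lin_sig0])+

lemma sig0_reflection:
  assumes v: "v \<in> fsp (tb d n)" and F: "\<And>c. c \<in> {1..d} \<Longrightarrow> lin (F c)" and n: "2 \<le> n"
    and refl: "\<And>c v. c \<in> {1..d} \<Longrightarrow> op12 (F c) (op23 (R_check (N c)) (op12 (F c) (op23 (R_check (N c)) v)))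
      = op23 (R_check (N c)) (op12 (F c) (op23 (R_check (N c)) (op12 (F c) v)))"
  shows "sig0 F (sigi N 0 (sig0 F (sigi N 0 v))) = sigi N 0 (sig0 F (sigi N 0 (sig0 F v)))"
proof (rule lin_eq_fspI[OF _ _ _ v, of "\<lambda>v. sig0 F (sigi N 0 (sig0 F (sigi N 0 v)))" "\<lambda>v. sigi N 0 (sig0 F (sigi N 0 (sig0 F v)))"])
  fix a :: "'a tbasis" assume a': "a \<in> tb d n"
  obtain m us where [simp]: "a = (m, us)" by force
  obtain b j c k vs where us: "us = (b, j) # (c, k) # vs"
    using a' n by (cases us; cases "drop 1 us") (auto simp: tb_def)
  have a: "a = (m, (b, j) # (c, k) # vs)" and b: "b \<in> {1..d}" and c: "c \<in> {1..d}"
    using a' by (auto simp: us tb_def)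
  show "sig0 F (sigi N 0 (sig0 F (sigi N 0 (bvec a)))) = sigi N 0 (sig0 F (sigi N 0 (sig0 F (bvec a))))"
  proof (cases "b = c")
    case True
    let ?h = "\<lambda>(y, j, k). (m(b := y), (b, j) # (b, k) # vs)"
    have h1: "sig0 F (reindex ?h v) = reindex ?h (op12 (F b) v)" for v
      by (rule op_reindexI[OF lin_sig0 lin_op12]) (auto simp: sig0_def op12_bvec comp_def case_prod_unfold)
    have h2: "sigi N 0 (reindex ?h v) = reindex ?h (op23 (R_check (N b)) v)" for v
      by (rule op_reindexI[OF lin_sigi lin_op23]) (auto simp: sigi_def op23_bvec sigma_VV_def comp_def case_prod_unfold)
    have "bvec a = reindex ?h (bvec (m b, j, k))"
      using True by (simp add: us)
    then show ?thesis by (simp only: h1 h2 refl[OF b])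
  next
    case False
    \<comment> \<open>The two maps differ in the order of the blocks, which the flip exchanges.
      \<open>F b\<close> and \<open>F c\<close> then act on disjoint tensor factors, and the
      relation reduces to their commuting.\<close>
    let ?h = "\<lambda>((y, j), (z, k)). (m(b := y, c := z), (b, j) # (c, k) # vs)"
    let ?k = "\<lambda>((y, j), (z, k)). (m(b := y, c := z), (c, k) # (b, j) # vs)"
    have h1: "sig0 F (reindex ?h v) = reindex ?h (tens_op (F b) id v)" for v
      using False by (rule_tac op_reindexI[OF lin_sig0 lin_tens_op])
        (auto simp: sig0_def tens_op_bvec comp_def case_prod_unfold tens_bvec_right fun_upd_twist[of b c])
    have h2: "sig0 F (reindex ?k v) = reindex ?k (tens_op id (F c) v)" for v
      by (rule op_reindexI[OF lin_sig0 lin_tens_op])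
        (auto simp: sig0_def tens_op_bvec comp_def case_prod_unfold tens_bvec_left)
    have h3: "sigi N 0 (reindex ?h v) = reindex ?k v" for v
      using False by (rule_tac op_reindexI[OF lin_sigi lin_id(2)]) (auto simp: sigi_def sigma_VV_neq)
    have h4: "sigi N 0 (reindex ?k v) = reindex ?h v" for v
      using False by (rule_tac op_reindexI[OF lin_sigi lin_id(2)]) (auto simp: sigi_def sigma_VV_neq)
    have "bvec a = reindex ?h (bvec ((m b, j), (m c, k)))"
      using False by (simp add: us)
    then show ?thesis by (simp only: h1 h2 h3 h4 tens_op_commute[OF F[OF b] F[OF c]])
  qed
qed (intro lin_compose[OF lin_sigi] lin_compose[OF lin_sig0] lin_sigi lin_sig0)+

subsection \<open>Blocks, the framing generators and the quadratic relation\<close>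

lemma tau_op_bvec: "tau_op \<zeta> i (bvec (m, vs)) = scl (\<zeta> ^ (fst (vs ! (i - 1)) - 1)) (bvec (m, vs))"
  by (simp add: tau_op_def)

lemma tau_op_commute: "tau_op \<zeta> i (tau_op \<xi> j v) = tau_op \<xi> j (tau_op \<zeta> i v)"
  by (rule lin_eqI[of "\<lambda>v. tau_op \<zeta> i (tau_op \<xi> j v)" "\<lambda>v. tau_op \<xi> j (tau_op \<zeta> i v)"])
    (auto simp: tau_op_bvec lin_scl[OF lin_tau_op] mult.commute intro: lin_compose)

lemma lin_funpow: "lin (F :: 'a oper) \<Longrightarrow> lin (F ^^ a)"
  by (induction a) auto

lemma tau_op_pow: "(tau_op \<zeta> i ^^ a) (bvec (m, vs)) = scl ((\<zeta> ^ (fst (vs ! (i - 1)) - 1)) ^ a) (bvec (m, vs))"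
  by (induction a) (auto simp: tau_op_bvec lin_scl[OF lin_tau_op] mult.commute)

lemma tau_op_pow_d: "\<zeta> ^ d = 1 \<Longrightarrow> (tau_op \<zeta> i ^^ d) v = v"
proof (rule lin_eqI[of _ "\<lambda>v. v"])
  show "lin (tau_op \<zeta> i ^^ d)" by (rule lin_funpow) auto
  show "(tau_op \<zeta> i ^^ d) (bvec a) = bvec a" if "\<zeta> ^ d = 1" for a
    using that by (cases a) (simp add: tau_op_pow power_mult[symmetric] mult.commute[of _ d], simp add: power_mult)
qed auto

lemma tau_op_inverse: "\<zeta> \<noteq> 0 \<Longrightarrow> tau_op \<zeta> i (tau_op (inverse \<zeta>) i v) = v"
  by (rule lin_eqI[of "\<lambda>v. tau_op \<zeta> i (tau_op (inverse \<zeta>) i v)" "\<lambda>v. v"])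
    (auto simp: tau_op_bvec lin_scl[OF lin_tau_op] power_mult_distrib[symmetric] intro: lin_compose)

lemma sigi_blocks:
  assumes "Suc i < length vs"
  shows "sigi N i (bvec (m, vs)) \<in>
    fsp {(m', vs'). map fst vs' = (map fst vs)[i := fst (vs ! Suc i), Suc i := fst (vs ! i)]}"
proof -
  obtain b j c k where e: "vs ! i = (b, j)" "vs ! Suc i = (c, k)" by force
  have "sigma_VV N (bvec ((b, j), (c, k))) \<in> fsp {(u, w). fst u = c \<and> fst w = b}"
    by (auto simp: sigma_VV_def intro!: reindex_in_fsp[of _ UNIV])
  then show ?thesis
    using assms by (auto simp: sigi_def e map_update intro!: reindex_in_fsp)
qed

lemma sig0_blocks:
  assumes "vs \<noteq> []"
  shows "sig0 F (bvec (m, vs)) \<in> fsp {(m', vs'). map fst vs' = map fst vs}"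
proof -
  obtain b j us where "vs = (b, j) # us" using assms by (cases vs) auto
  then show ?thesis
    by (auto simp: sig0_def intro!: reindex_in_fsp[of _ UNIV])
qed

lemma tau_op_blocks:
  assumes "v \<in> fsp {(m, vs). map fst vs = bs}" "i \<in> {1..length bs}"
  shows "tau_op \<zeta> i v = scl (\<zeta> ^ (bs ! (i - 1) - 1)) v"
proof (rule tau_op_scalar, rule fsp_mono[OF _ assms(1)])
  have "i - 1 < length bs" using assms(2) by auto
  then show "{(m, vs). map fst vs = bs} \<subseteq> {(m, vs). fst (vs ! (i - 1)) = bs ! (i - 1)}"
    by auto
qed

lemma tau_sig0:
  assumes v: "v \<in> fsp (tb d n)" and i: "i \<in> {1..n}"
  shows "tau_op \<zeta> i (sig0 F v) = sig0 F (tau_op \<zeta> i v)"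
proof (rule lin_eq_fspI[OF _ _ _ v, of "\<lambda>v. tau_op \<zeta> i (sig0 F v)" "\<lambda>v. sig0 F (tau_op \<zeta> i v)"])
  fix a :: "'a tbasis" assume "a \<in> tb d n"
  then obtain m vs where a: "a = (m, vs)" and len: "length vs = n" by (auto simp: tb_def)
  then have ne: "vs \<noteq> []" using i by auto
  have "i - 1 < length vs" using i len by auto
  then show "tau_op \<zeta> i (sig0 F (bvec a)) = sig0 F (tau_op \<zeta> i (bvec a))"
    using tau_op_blocks[OF sig0_blocks[OF ne], of i \<zeta> F m] i len
    by (simp add: a tau_op_bvec lin_scl[OF lin_sig0])
qed (rule lin_compose[OF lin_tau_op lin_sig0] lin_compose[OF lin_sig0 lin_tau_op])+

lemma tau_sigi:
  assumes v: "v \<in> fsp (tb d n)" and i: "Suc i < n" and j: "j \<in> {1..n}"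
  shows "tau_op \<zeta> j (sigi N i v) = sigi N i (tau_op \<zeta> (Transposition.transpose (Suc i) (Suc (Suc i)) j) v)"
proof (rule lin_eq_fspI[OF _ _ _ v, of "\<lambda>v. tau_op \<zeta> j (sigi N i v)" "\<lambda>v. sigi N i (tau_op \<zeta> _ v)"])
  fix a :: "'a tbasis" assume "a \<in> tb d n"
  then obtain m vs where a: "a = (m, vs)" and len: "length vs = n" by (auto simp: tb_def)
  have "j - 1 < length vs" using j len by auto
  moreover have "(map fst vs)[i := fst (vs ! Suc i), Suc i := fst (vs ! i)] ! (j - 1) =
     fst (vs ! (Transposition.transpose (Suc i) (Suc (Suc i)) j - 1))"
    using i j len by (auto simp: nth_list_update transpose_def)
  ultimately show "tau_op \<zeta> j (sigi N i (bvec a)) = sigi N i (tau_op \<zeta> (Transposition.transpose (Suc i) (Suc (Suc i)) j) (bvec a))"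
    using tau_op_blocks[OF sigi_blocks[of i vs N m], of j \<zeta>] i j len
    by (simp add: a tau_op_bvec lin_scl[OF lin_sigi])
qed (rule lin_compose[OF lin_tau_op lin_sigi] lin_compose[OF lin_sigi lin_tau_op])+

text \<open>What the idempotent \<open>yh_E d n (i + 1)\<close> becomes in the representation, by
  \<open>sum_tau_EE\<close> and \<open>Psi_yh_E\<close>.\<close>

definition EE :: "nat \<Rightarrow> 'm tbasis oper" where
  "EE i = lin_ext (\<lambda>(m, vs). if fst (vs ! i) = fst (vs ! Suc i) then bvec (m, vs) else 0)"

lemma lin_EE [simp, intro]: "lin (EE i)"
  by (simp add: EE_def)

lemma EE_scalar: "v \<in> fsp {(m, vs). (fst (vs ! i) = fst (vs ! Suc i)) = P} \<Longrightarrow> EE i v = (if P then v else 0)"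
  by (cases P; rule lin_eq_fspI[of "EE i"]) (auto simp: EE_def lin_zero)

lemma EE_sigi:
  assumes v: "v \<in> fsp (tb d n)" and i: "Suc i < n"
  shows "EE i (sigi N i v) = sigi N i (EE i v)"
proof (rule lin_eq_fspI[OF _ _ _ v, of "\<lambda>v. EE i (sigi N i v)" "\<lambda>v. sigi N i (EE i v)"])
  fix a :: "'a tbasis" assume "a \<in> tb d n"
  then obtain m vs where a: "a = (m, vs)" and len: "length vs = n" by (auto simp: tb_def)
  have "sigi N i (bvec (m, vs)) \<in> fsp {(m', vs'). (fst (vs' ! i) = fst (vs' ! Suc i)) = (fst (vs ! i) = fst (vs ! Suc i))}"
  proof (rule fsp_mono[OF _ sigi_blocks])
    show "{(m', vs'). map fst vs' = (map fst vs)[i := fst (vs ! Suc i), Suc i := fst (vs ! i)]} \<subseteq>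
       {(m', vs'). (fst (vs' ! i) = fst (vs' ! Suc i)) = (fst (vs ! i) = fst (vs ! Suc i))}"
    proof (rule subsetI)
      fix x assume "x \<in> {(m', vs'). map fst vs' = (map fst vs)[i := fst (vs ! Suc i), Suc i := fst (vs ! i)]}"
      then have e: "map fst (snd x) = (map fst vs)[i := fst (vs ! Suc i), Suc i := fst (vs ! i)]" by auto
      have l: "length (snd x) = n" using arg_cong[OF e, of length] len by simp
      have "map fst (snd x) ! i = fst (vs ! Suc i)" "map fst (snd x) ! Suc i = fst (vs ! i)"
        unfolding e using i len by (auto simp: nth_list_update)
      then show "x \<in> {(m', vs'). (fst (vs' ! i) = fst (vs' ! Suc i)) = (fst (vs ! i) = fst (vs ! Suc i))}"
        using i l by (auto simp: case_prod_unfold)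
    qed
  qed (use i len in simp)
  then have "EE i (sigi N i (bvec (m, vs))) = (if fst (vs ! i) = fst (vs ! Suc i) then sigi N i (bvec (m, vs)) else 0)"
    by (rule EE_scalar)
  then show "EE i (sigi N i (bvec a)) = sigi N i (EE i (bvec a))"
    by (auto simp: a EE_def lin_0[OF lin_sigi])
qed (rule lin_compose[OF lin_EE lin_sigi] lin_compose[OF lin_sigi lin_EE])+

lemma sum_roots_of_unity:
  assumes "(z :: kk) ^ d = 1"
  shows "(\<Sum>a\<in>{1..d}. z ^ a) = (if z = 1 then of_nat d else 0)"
proof (cases "z = 1")
  case False
  have "(\<Sum>a\<in>{1..d}. z ^ a) = (\<Sum>a<d. z ^ Suc a)"
    by (rule sum.reindex_bij_witness[of _ Suc "\<lambda>a. a - 1"]) auto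
  also have "\<dots> = z * (\<Sum>a<d. z ^ a)"
    by (simp add: sum_distrib_left)
  also have "(\<Sum>a<d. z ^ a) = 0"
    using False assms by (simp add: geometric_sum)
  finally show ?thesis using False by simp
qed simp

lemma primitive_root_inj:
  assumes z: "primitive_root_of_unity d \<zeta>" and bc: "b \<in> {1..d}" "c \<in> {1..d}"
    and eq: "\<zeta> ^ (b - 1) = \<zeta> ^ (c - 1)"
  shows "b = c"
proof -
  have z0: "\<zeta> \<noteq> 0" and z1: "\<zeta> ^ d = 1" and z2: "\<And>k. 0 < k \<Longrightarrow> k < d \<Longrightarrow> \<zeta> ^ k \<noteq> 1"
    using z bc by (auto simp: primitive_root_of_unity_def power_0_left)
  have *: False if "b < c" "b \<in> {1..d}" "c \<in> {1..d}" "\<zeta> ^ (b - 1) = \<zeta> ^ (c - 1)" for b c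
  proof -
    have "c - 1 = (b - 1) + (c - b)" using that by auto
    then have "\<zeta> ^ (b - 1) * \<zeta> ^ (c - b) = \<zeta> ^ (b - 1)"
      using that(4) by (metis power_add)
    then have "\<zeta> ^ (c - b) = 1" using z0 by simp
    moreover have "0 < c - b" "c - b < d" using that by auto
    ultimately show False using z2 by blast
  qed
  show ?thesis
    using *[of b c] *[of c b] bc eq by (metis linorder_neqE_nat)
qed

lemma sum_tau_EE:
  assumes v: "v \<in> fsp (tb d n)" and i: "Suc i < n" and z: "primitive_root_of_unity d \<zeta>"
  shows "(\<Sum>a\<in>{1..d}. (tau_op \<zeta> (Suc i) ^^ a) ((tau_op (inverse \<zeta>) (Suc (Suc i)) ^^ a) v)) = scl (of_nat d) (EE i v)"
proof (rule lin_eq_fspI[OF _ _ _ v, of "\<lambda>v. \<Sum>a\<in>{1..d}. (tau_op \<zeta> _ ^^ a) ((tau_op _ _ ^^ a) v)" "\<lambda>v. scl _ (EE i v)"])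
  show "lin (\<lambda>v. \<Sum>a\<in>{1..d}. (tau_op \<zeta> (Suc i) ^^ a) ((tau_op (inverse \<zeta>) (Suc (Suc i)) ^^ a) v))"
    by (rule lin_eq_sum) (rule lin_compose[OF lin_funpow[OF lin_tau_op] lin_funpow[OF lin_tau_op]])
  show "lin (\<lambda>v. scl (of_nat d) (EE i v))" by (intro lin_scale lin_EE)
  fix a :: "'a tbasis" assume a': "a \<in> tb d n"
  then obtain m vs where a: "a = (m, vs)" and len: "length vs = n" by (auto simp: tb_def)
  define b c where "b = fst (vs ! i)" and "c = fst (vs ! Suc i)"
  have bc: "b \<in> {1..d}" "c \<in> {1..d}"
    using a' i len by (auto simp: a tb_def b_def c_def dest!: subsetD[of "fst ` set vs"])
  \<comment> \<open>The eigenvalue of t_(i+1) times the inverse of t_(i+2) on this basis vector: a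
    d-th root of unity, equal to 1 exactly when the two blocks coincide.\<close>
  define y where "y = \<zeta> ^ (b - 1) * inverse \<zeta> ^ (c - 1)"
  have z0: "\<zeta> \<noteq> 0" and z1: "\<zeta> ^ d = 1"
    using z bc by (auto simp: primitive_root_of_unity_def power_0_left)
  have "y ^ d = (\<zeta> ^ d) ^ (b - 1) * inverse (\<zeta> ^ d) ^ (c - 1)"
    by (simp add: y_def power_mult_distrib power_mult[symmetric] mult.commute power_inverse)
  then have yd: "y ^ d = 1" by (simp add: z1)
  have y1: "y = 1 \<longleftrightarrow> b = c"
  proof
    assume "y = 1"
    then have "\<zeta> ^ (b - 1) = \<zeta> ^ (c - 1)"
      using z0 by (simp add: y_def power_inverse field_simps)
    then show "b = c" by (rule primitive_root_inj[OF z bc])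
  qed (use z0 in \<open>simp add: y_def power_inverse\<close>)
  have "(tau_op \<zeta> (Suc i) ^^ k) ((tau_op (inverse \<zeta>) (Suc (Suc i)) ^^ k) (bvec a)) = scl (y ^ k) (bvec a)" for k
    by (simp add: a tau_op_pow lin_scl[OF lin_funpow[OF lin_tau_op]] y_def power_mult_distrib b_def c_def mult.commute)
  then have "(\<Sum>k\<in>{1..d}. (tau_op \<zeta> (Suc i) ^^ k) ((tau_op (inverse \<zeta>) (Suc (Suc i)) ^^ k) (bvec a))) = scl (\<Sum>k\<in>{1..d}. y ^ k) (bvec a)"
    by (simp add: kvs.scale_sum_left)
  from this[unfolded sum_roots_of_unity[OF yd]] show "(\<Sum>k\<in>{1..d}. (tau_op \<zeta> (Suc i) ^^ k) ((tau_op (inverse \<zeta>) (Suc (Suc i)) ^^ k) (bvec a))) = scl (of_nat d) (EE i (bvec a))"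
    using y1 by (auto simp: a EE_def b_def c_def)
qed

lemma MV_basis_tb: "MV_basis d n N B \<subseteq> tb d n"
  by (force simp: MV_basis_def tb_def V_basis_def)

text \<open>Within one block the quadratic relation is the Hecke relation of the R-matrix. For
  different blocks the operator is a flip with square 1, and the projection \<open>EE i\<close>
  removes the linear term.\<close>

lemma sigi_MV:
  assumes i: "Suc i < n" and v: "v \<in> fsp (MV_basis d n N B)"
  shows "sigi N i v \<in> fsp (MV_basis d n N B)"
    and "sigi N i (sigi N i v) = scl lam (EE i (sigi N i v)) + v"
proof -
  have *: "sigi N i (bvec a) \<in> fsp (MV_basis d n N B) \<and>
      sigi N i (sigi N i (bvec a)) = scl lam (EE i (sigi N i (bvec a))) + bvec a" if a': "a \<in> MV_basis d n N B" for a
  proof -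
    obtain m vs where a: "a = (m, vs)" and len: "length vs = n" and V: "set vs \<subseteq> V_basis d N"
      and m: "m \<in> (\<Pi>\<^sub>E b\<in>{1..d}. B b)" using a' by (auto simp: MV_basis_def)
    obtain b j c k where e: "vs ! i = (b, j)" "vs ! Suc i = (c, k)" by force
    have bc: "(b, j) \<in> V_basis d N" "(c, k) \<in> V_basis d N"
      using V i len by (metis e(1) Suc_lessD nth_mem subsetD, metis e(2) nth_mem subsetD)
    let ?h = "\<lambda>(v, w). (m, vs[i := v, Suc i := w])"
    have h: "sigi N i (reindex ?h u) = reindex ?h (sigma_VV N u)" for u
      using i len by (intro sigi_reindex) simp
    have ah: "bvec a = reindex ?h (bvec ((b, j), (c, k)))"
      by (simp add: a e[symmetric])
    have hM: "reindex ?h u \<in> fsp (MV_basis d n N B)" if "u \<in> fsp (V_basis d N \<times> V_basis d N)" for u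
      by (rule reindex_in_fsp[OF that])
        (use m V len in \<open>auto simp: MV_basis_def dest!: set_update_subset_insert[THEN subsetD]\<close>)
    show ?thesis
    proof (cases "b = c")
      case True
      let ?g = "map_prod (Pair b) (Pair b) :: nat \<times> nat \<Rightarrow> _"
      have g: "bvec ((b, j), (c, k)) = reindex ?g (bvec (j, k))" using True by simp
      have jk: "bvec (j, k) \<in> fsp ({1..N b} \<times> {1..N b})"
        using bc True by (auto simp: V_basis_def)
      have gV: "reindex ?g u \<in> fsp (V_basis d N \<times> V_basis d N)" if "u \<in> fsp ({1..N b} \<times> {1..N b})" for u
        by (rule reindex_in_fsp[OF that]) (use bc in \<open>auto simp: V_basis_def\<close>)
      have EE: "EE i (reindex ?h (reindex ?g u)) = reindex ?h (reindex ?g u)" for u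
        unfolding reindex_reindex
        by (rule op_reindexI[OF lin_EE lin_id(2)]) (use i len in \<open>auto simp: EE_def\<close>)
      have "sigi N i (bvec a) = reindex ?h (reindex ?g (R_check (N b) (bvec (j, k))))"
        unfolding ah h g sigma_VV_eq ..
      moreover have "sigi N i (sigi N i (bvec a)) = reindex ?h (reindex ?g (scl lam (R_check (N b) (bvec (j, k))) + bvec (j, k)))"
        unfolding ah h g sigma_VV_eq R_check_hecke[OF jk] ..
      ultimately show ?thesis
        using hM[OF gV[OF R_check_in_fsp[OF jk]]] by (simp only: EE lin_simps[OF lin_reindex] ah g)
    next
      case False
      have "sigi N i (bvec a) = bvec (?h ((c, k), (b, j)))"
        unfolding ah h sigma_VV_neq[OF False] by simp
      moreover have "sigi N i (sigi N i (bvec a)) = bvec a"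
        unfolding ah h sigma_VV_neq[OF False] sigma_VV_neq[OF False[symmetric]] ..
      moreover have "EE i (bvec (?h ((c, k), (b, j)))) = 0"
        using False i len by (simp add: EE_def)
      moreover have "bvec (?h ((c, k), (b, j))) \<in> fsp (MV_basis d n N B)"
        using hM[of "bvec ((c, k), (b, j))"] bc by simp
      ultimately show ?thesis by simp
    qed
  qed
  show "sigi N i v \<in> fsp (MV_basis d n N B)"
    by (rule lin_in_fsp[OF lin_sigi v]) (use * in blast)
  show "sigi N i (sigi N i v) = scl lam (EE i (sigi N i v)) + v"
    by (rule lin_eq_fspI[OF lin_compose[OF lin_sigi lin_sigi]
          lin_plus[OF lin_scale[OF lin_compose[OF lin_EE lin_sigi]] lin_id(2)] _ v]) (use * in blast)
qed

lemma EE_MV: "v \<in> fsp (MV_basis d n N B) \<Longrightarrow> EE i v \<in> fsp (MV_basis d n N B)"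
  by (rule lin_in_fsp[OF lin_EE]) (auto simp: EE_def)

lemma tau_MV: "v \<in> fsp (MV_basis d n N B) \<Longrightarrow> tau_op \<zeta> i v \<in> fsp (MV_basis d n N B)"
  by (rule lin_in_fsp[OF lin_tau_op]) (auto simp: tau_op_def intro!: fsp_scl)

text \<open>The quadratic relation provides the inverse, sigma - lam E, because E commutes with
  sigma.\<close>

lemma bij_sigi:
  assumes i: "Suc i < n"
  shows "bij_betw (sigi N i) (fsp (MV_basis d n N B)) (fsp (MV_basis d n N B))"
proof (rule bij_betw_byWitness[where f' = "\<lambda>v. sigi N i v - scl lam (EE i v)"])
  have t: "v \<in> fsp (tb d n)" if "v \<in> fsp (MV_basis d n N B)" for v
    by (rule fsp_mono[OF MV_basis_tb that])
  show "\<forall>v\<in>fsp (MV_basis d n N B). sigi N i (sigi N i v) - scl lam (EE i (sigi N i v)) = v"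
  proof
    fix v assume "v \<in> fsp (MV_basis d n N B)"
    from sigi_MV(2)[OF i this] show "sigi N i (sigi N i v) - scl lam (EE i (sigi N i v)) = v"
      by (simp only: add_diff_cancel_left')
  qed
  show "\<forall>v\<in>fsp (MV_basis d n N B). sigi N i (sigi N i v - scl lam (EE i v)) = v"
  proof
    fix v assume v: "v \<in> fsp (MV_basis d n N B)"
    show "sigi N i (sigi N i v - scl lam (EE i v)) = v"
      unfolding lin_diff[OF lin_sigi] lin_scl[OF lin_sigi] sigi_MV(2)[OF i v] EE_sigi[OF t[OF v] i] by simp
  qed
qed (use sigi_MV(1)[OF i] EE_MV in \<open>auto intro!: fsp_diff fsp_scl\<close>)

lemma sig0_MV:
  assumes F: "\<And>c. c \<in> {1..d} \<Longrightarrow> bij_fsp (B c \<times> {1..N c}) (B c \<times> {1..N c}) (F c)" and n: "n \<ge> 1"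
  shows "bij_betw (sig0 F) (fsp (MV_basis d n N B)) (fsp (MV_basis d n N B))"
    and "v \<in> fsp (MV_basis d n N B) \<Longrightarrow> sig0 F v \<in> fsp (MV_basis d n N B)"
proof -
  \<comment> \<open>A family of inverses for all blocks at once. The operator \<open>sig0\<close>
    leaves the block of the first vector unchanged, so lifting this family inverts it.\<close>
  have "\<forall>c. \<exists>g. c \<in> {1..d} \<longrightarrow> lin g \<and> (\<forall>w\<in>fsp (B c \<times> {1..N c}). g w \<in> fsp (B c \<times> {1..N c}) \<and> F c (g w) = w \<and> g (F c w) = w)"
    using F unfolding bij_fsp_def by meson
  then obtain G where G: "\<And>c. c \<in> {1..d} \<Longrightarrow> lin (G c)"
      "\<And>c w. c \<in> {1..d} \<Longrightarrow> w \<in> fsp (B c \<times> {1..N c}) \<Longrightarrow> G c w \<in> fsp (B c \<times> {1..N c}) \<and> F c (G c w) = w \<and> G c (F c w) = w"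
    by metis
  have Fl: "lin (F c)" "w \<in> fsp (B c \<times> {1..N c}) \<Longrightarrow> F c w \<in> fsp (B c \<times> {1..N c})" if "c \<in> {1..d}" for c w
    using F[OF that] by (auto simp: bij_fsp_def)
  have *: "sig0 F' (bvec a) \<in> fsp (MV_basis d n N B) \<and> sig0 G' (sig0 F' (bvec a)) = bvec a"
    if a': "a \<in> MV_basis d n N B" and
      F': "\<And>c. c \<in> {1..d} \<Longrightarrow> lin (F' c)" "\<And>c w. c \<in> {1..d} \<Longrightarrow> w \<in> fsp (B c \<times> {1..N c}) \<Longrightarrow> F' c w \<in> fsp (B c \<times> {1..N c}) \<and> G' c (F' c w) = w"
      and G': "\<And>c. c \<in> {1..d} \<Longrightarrow> lin (G' c)" for F' G' a
  proof -
    obtain m us where a0: "a = (m, us)" and len: "length us = n" and V: "set us \<subseteq> V_basis d N"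
      and m: "m \<in> (\<Pi>\<^sub>E b\<in>{1..d}. B b)" using a' by (auto simp: MV_basis_def)
    obtain b j vs where a: "a = (m, (b, j) # vs)" using a0 len n by (cases us) auto
    have b: "b \<in> {1..d}" and j: "j \<in> {1..N b}" using V a a0 by (auto simp: V_basis_def)
    have mb: "bvec (m b, j) \<in> fsp (B b \<times> {1..N b})" using m b j by auto
    let ?h = "\<lambda>(y, k). (m(b := y), (b, k) # vs)"
    have ah: "bvec a = reindex ?h (bvec (m b, j))" by (simp add: a)
    have hM: "reindex ?h u \<in> fsp (MV_basis d n N B)" if "u \<in> fsp (B b \<times> {1..N b})" for u
      by (rule reindex_in_fsp[OF that])
        (use m V len b a a0 in \<open>auto simp: MV_basis_def V_basis_def PiE_iff extensional_def\<close>)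
    show ?thesis
      unfolding ah sig0_reindex[of F', OF F'(1)[OF b]] sig0_reindex[of G', OF G'[OF b]]
      using F'(2)[OF b mb] hM by simp
  qed
  have st: "sig0 F v \<in> fsp (MV_basis d n N B)" if "v \<in> fsp (MV_basis d n N B)" for v
    by (rule lin_in_fsp[OF lin_sig0 that]) (use *[of _ F G] Fl G in blast)
  have st': "sig0 G v \<in> fsp (MV_basis d n N B)" if "v \<in> fsp (MV_basis d n N B)" for v
    by (rule lin_in_fsp[OF lin_sig0 that]) (use *[of _ G F] Fl G in blast)
  show "v \<in> fsp (MV_basis d n N B) \<Longrightarrow> sig0 F v \<in> fsp (MV_basis d n N B)" by (rule st)
  have GF: "sig0 G (sig0 F v) = v" if "v \<in> fsp (MV_basis d n N B)" for v
    by (rule lin_eq_fspI[OF lin_compose[OF lin_sig0 lin_sig0] lin_id(2) _ that]) (use *[of _ F G] Fl G in blast)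
  have FG: "sig0 F (sig0 G v) = v" if "v \<in> fsp (MV_basis d n N B)" for v
    by (rule lin_eq_fspI[OF lin_compose[OF lin_sig0 lin_sig0] lin_id(2) _ that]) (use *[of _ G F] Fl G in blast)
  show "bij_betw (sig0 F) (fsp (MV_basis d n N B)) (fsp (MV_basis d n N B))"
    by (rule bij_betw_byWitness[where f' = "sig0 G"]) (use GF FG st st' in auto)
qed

lemma sig0_cong_MV:
  assumes "\<And>c. c \<in> {1..d} \<Longrightarrow> agree (B c \<times> {1..N c}) (B c \<times> {1..N c}) (F c) (F' c)" and n: "n \<ge> 1"
    and v: "v \<in> fsp (MV_basis d n N B)"
  shows "sig0 F v = sig0 F' v"
  unfolding sig0_def
proof (rule lin_ext_cong_fsp[OF v])
  fix a :: "'a tbasis" assume a': "a \<in> MV_basis d n N B"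
  then obtain m b j vs where a: "a = (m, (b, j) # vs)"
    using n by (cases a; cases "snd a") (auto simp: MV_basis_def)
  have "b \<in> {1..d}" "bvec (m b, j) \<in> fsp (B b \<times> {1..N b})"
    using a' by (auto simp: a MV_basis_def V_basis_def)
  then show "(case a of (m, vs) \<Rightarrow> case vs ! 0 of (b, j) \<Rightarrow> reindex (\<lambda>(y, k). (m(b := y), vs[0 := (b, k)])) (F b (bvec (m b, j))))
    = (case a of (m, vs) \<Rightarrow> case vs ! 0 of (b, j) \<Rightarrow> reindex (\<lambda>(y, k). (m(b := y), vs[0 := (b, k)])) (F' b (bvec (m b, j))))"
    using assms(1) by (simp add: a agree_def)
qed


section \<open>Presented groups, group algebras and quotients\<close>

lemma word_cong_words: "word_cong X R u v \<Longrightarrow> u \<in> words X \<and> v \<in> words X"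
  by (induction rule: word_cong.induct) (auto simp: words_def)

lemma words_append [simp]: "u @ v \<in> words X \<longleftrightarrow> u \<in> words X \<and> v \<in> words X"
  by (auto simp: words_def)

lemma words_Nil [simp]: "[] \<in> words X"
  by (simp add: words_def)

lemma word_cong_context:
  "word_cong X R u v \<Longrightarrow> p \<in> words X \<Longrightarrow> s \<in> words X \<Longrightarrow> word_cong X R (p @ u @ s) (p @ v @ s)"
proof (induction rule: word_cong.induct)
  case (refl u)
  then show ?case by (intro word_cong.refl) simp
next
  case (sym u v)
  then show ?case by (blast intro: word_cong.sym)
next
  case (trans u v w)
  then show ?case by (blast intro: word_cong.trans)
next
  case (cancel u v x e)
  then show ?case using word_cong.cancel[of "p @ u" X "v @ s" x R e] by simp
next
  case (rel u v l r)
  then show ?case using word_cong.rel[of "p @ u" X "v @ s" l r R] by simp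
qed

lemma word_cong_append:
  assumes "word_cong X R u u'" "word_cong X R v v'"
  shows "word_cong X R (u @ v) (u' @ v')"
proof -
  have "word_cong X R ([] @ u @ v) ([] @ u' @ v)"
    by (rule word_cong_context) (use assms word_cong_words in auto)
  moreover have "word_cong X R (u' @ v @ []) (u' @ v' @ [])"
    by (rule word_cong_context) (use assms word_cong_words in auto)
  ultimately show ?thesis by (auto intro: word_cong.trans)
qed

lemma word_class_eq:
  assumes "word_cong X R u v"
  shows "word_class X R u = word_class X R v"
  using assms unfolding word_class_def by (blast intro: word_cong.sym word_cong.trans)

lemma word_class_mem: "u \<in> words X \<Longrightarrow> u \<in> word_class X R u"
  by (simp add: word_class_def word_cong.refl)

lemma presented_group_mult:
  assumes "u \<in> words X" "v \<in> words X"
  shows "word_class X R u \<otimes>\<^bsub>presented_group X R\<^esub> word_class X R v = word_class X R (u @ v)"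
proof -
  have eq: "word_class X R (u' @ v') = word_class X R (u @ v)"
    if "u' \<in> word_class X R u" "v' \<in> word_class X R v" for u' v'
    using that by (intro word_class_eq word_cong_append) (auto simp: word_class_def intro: word_cong.sym)
  have "(\<Union>u'\<in>word_class X R u. \<Union>v'\<in>word_class X R v. word_class X R (u' @ v'))
      = (\<Union>u'\<in>word_class X R u. \<Union>v'\<in>word_class X R v. word_class X R (u @ v))"
    by (intro SUP_cong HOL.refl eq)
  also have "\<dots> = word_class X R (u @ v)"
    using word_class_mem[OF assms(1)] word_class_mem[OF assms(2)] by (metis SUP_const empty_iff)
  finally show ?thesis
    by (simp add: presented_group_def)
qed

definition inverse_word :: "'x word \<Rightarrow> 'x word" where
  "inverse_word u = rev (map (\<lambda>(x, e). (x, \<not> e)) u)"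

lemma inverse_word_words: "u \<in> words X \<Longrightarrow> inverse_word u \<in> words X"
  by (force simp: words_def inverse_word_def)

lemma inverse_word_cancel: "u \<in> words X \<Longrightarrow> word_cong X R (inverse_word u @ u) []"
proof (induction u)
  case Nil
  show ?case by (simp add: inverse_word_def word_cong.refl)
next
  case (Cons a u)
  obtain x e where a: "a = (x, e)" by force
  have u: "u \<in> words X" "x \<in> X" using Cons.prems by (auto simp: words_def a)
  have "word_cong X R (inverse_word u @ [(x, \<not> e), (x, \<not> \<not> e)] @ u) (inverse_word u @ u)"
    using u by (intro word_cong.cancel inverse_word_words)
  with Cons.IH[OF u(1)] show ?case
    by (auto simp: a inverse_word_def intro: word_cong.trans)
qed

lemma group_presented_group: "group (presented_group X R)"
proof (rule groupI)
  let ?G = "presented_group X R"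
  have car: "carrier ?G = word_class X R ` words X" and one: "\<one>\<^bsub>?G\<^esub> = word_class X R []"
    by (simp_all add: presented_group_def)
  show "\<one>\<^bsub>?G\<^esub> \<in> carrier ?G"
    by (auto simp: car one)
  fix x assume x: "x \<in> carrier ?G"
  then obtain u where u: "u \<in> words X" "x = word_class X R u" by (auto simp: car)
  show "\<one>\<^bsub>?G\<^esub> \<otimes>\<^bsub>?G\<^esub> x = x"
    using u by (simp add: one presented_group_mult)
  have "word_class X R (inverse_word u) \<otimes>\<^bsub>?G\<^esub> x = \<one>\<^bsub>?G\<^esub>"
    using u by (simp add: presented_group_mult inverse_word_words one word_class_eq[OF inverse_word_cancel])
  then show "\<exists>y\<in>carrier ?G. y \<otimes>\<^bsub>?G\<^esub> x = \<one>\<^bsub>?G\<^esub>"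
    using inverse_word_words[OF u(1)] by (auto simp: car)
  fix y assume "y \<in> carrier ?G"
  then obtain v where v: "v \<in> words X" "y = word_class X R v" by (auto simp: car)
  show "x \<otimes>\<^bsub>?G\<^esub> y \<in> carrier ?G"
    using u v by (auto simp: presented_group_mult car)
  fix z assume "z \<in> carrier ?G"
  then obtain w where w: "w \<in> words X" "z = word_class X R w" by (auto simp: car)
  show "x \<otimes>\<^bsub>?G\<^esub> y \<otimes>\<^bsub>?G\<^esub> z = x \<otimes>\<^bsub>?G\<^esub> (y \<otimes>\<^bsub>?G\<^esub> z)"
    using u v w by (simp add: presented_group_mult)
qed

primrec eval_word :: "('h, 'z) monoid_scheme \<Rightarrow> ('x \<Rightarrow> 'h) \<Rightarrow> 'x word \<Rightarrow> 'h" where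
  "eval_word H f [] = \<one>\<^bsub>H\<^esub>"
| "eval_word H f (a # u) = (if snd a then f (fst a) else inv\<^bsub>H\<^esub> f (fst a)) \<otimes>\<^bsub>H\<^esub> eval_word H f u"

text \<open>The universal property of a presentation (von Dyck). Evaluation of words respects the
  congruence, so it may be read off at an arbitrary representative of a class.\<close>

lemma presented_group_hom:
  assumes H: "group H" and f: "\<And>x. x \<in> X \<Longrightarrow> f x \<in> carrier H"
    and R: "\<And>l r. (l, r) \<in> R \<Longrightarrow> l \<in> words X \<Longrightarrow> r \<in> words X \<Longrightarrow> eval_word H f l = eval_word H f r"
  obtains \<phi> where "\<phi> \<in> hom (presented_group X R) H" "\<And>x. x \<in> X \<Longrightarrow> \<phi> (word_class X R [(x, True)]) = f x"
proof -
  interpret H: group H by fact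
  have cl: "eval_word H f u \<in> carrier H" if "u \<in> words X" for u
    using that by (induction u) (auto simp: words_def f)
  have ap: "eval_word H f (u @ v) = eval_word H f u \<otimes>\<^bsub>H\<^esub> eval_word H f v" if "u \<in> words X" "v \<in> words X" for u v
    using that
  proof (induction u)
    case (Cons a u)
    have "u \<in> words X" "fst a \<in> X" using Cons.prems by (auto simp: words_def)
    with Cons show ?case by (simp add: cl f H.m_assoc)
  qed (simp add: cl)
  have ev: "eval_word H f u = eval_word H f v" if "word_cong X R u v" for u v
    using that
  proof (induction rule: word_cong.induct)
    case (cancel u v x e)
    have w: "[(x, e), (x, \<not> e)] \<in> words X" using cancel by (simp add: words_def)
    have "eval_word H f [(x, e), (x, \<not> e)] = \<one>\<^bsub>H\<^esub>"
      using f[OF cancel(3)] by simp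
    then show ?case
      using cancel w by (simp only: ap words_append cl H.l_one)
  next
    case (rel u v l r)
    then show ?case by (simp add: ap R)
  qed simp_all
  define \<phi> where "\<phi> P = eval_word H f (SOME u. u \<in> P)" for P
  have \<phi>: "\<phi> (word_class X R u) = eval_word H f u" if "u \<in> words X" for u
  proof -
    have "(SOME v. v \<in> word_class X R u) \<in> word_class X R u"
      using word_class_mem[OF that] by (rule someI)
    then show ?thesis unfolding \<phi>_def by (intro ev[symmetric]) (simp add: word_class_def)
  qed
  show ?thesis
  proof
    show "\<phi> \<in> hom (presented_group X R) H"
      by (rule homI) (auto simp: presented_group_def[of X R] \<phi> cl, simp add: presented_group_mult[unfolded presented_group_def, simplified] \<phi> ap)
    show "\<phi> (word_class X R [(x, True)]) = f x" if "x \<in> X" for x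
      using that f by (simp add: \<phi> words_def)
  qed
qed

subsection \<open>Group algebras\<close>

abbreviation supp :: "('g \<Rightarrow> kk) \<Rightarrow> 'g set" where
  "supp f \<equiv> {x. f x \<noteq> 0}"

lemma sum_supp: "finite A \<Longrightarrow> supp f \<subseteq> A \<Longrightarrow> (\<Sum>x\<in>supp f. f x * \<theta> x) = (\<Sum>x\<in>A. f x * \<theta> x)"
  by (rule sum.mono_neutral_left) auto

lemma ga_mult: "(f \<otimes>\<^bsub>group_algebra G\<^esub> g) z = (\<Sum>(x, y)\<in>{(x, y). f x \<noteq> 0 \<and> g y \<noteq> 0 \<and> x \<otimes>\<^bsub>G\<^esub> y = z}. f x * g y)"
  by (simp add: group_algebra_def)

text \<open>Summing over a rectangle that contains the supports, instead of the exact fibre of the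
  product, allows sums to be exchanged and f, g and f + g to be compared over a common index
  set.\<close>

lemma ga_mult_alt:
  assumes "finite A" "finite B" "supp f \<subseteq> A" "supp g \<subseteq> B"
  shows "(f \<otimes>\<^bsub>group_algebra G\<^esub> g) z = (\<Sum>x\<in>A. \<Sum>y\<in>B. if x \<otimes>\<^bsub>G\<^esub> y = z then f x * g y else 0)"
proof -
  have "(f \<otimes>\<^bsub>group_algebra G\<^esub> g) z = (\<Sum>p\<in>{(x, y). f x \<noteq> 0 \<and> g y \<noteq> 0 \<and> x \<otimes>\<^bsub>G\<^esub> y = z}.
      if fst p \<otimes>\<^bsub>G\<^esub> snd p = z then f (fst p) * g (snd p) else 0)"
    unfolding ga_mult by (rule sum.cong) auto
  also have "\<dots> = (\<Sum>p\<in>A \<times> B. if fst p \<otimes>\<^bsub>G\<^esub> snd p = z then f (fst p) * g (snd p) else 0)"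
    by (rule sum.mono_neutral_left) (use assms in auto)
  finally show ?thesis by (simp add: sum.cartesian_product case_prod_unfold)
qed

lemma ga_mult_supp: "supp (f \<otimes>\<^bsub>group_algebra G\<^esub> g) \<subseteq> (\<lambda>(x, y). x \<otimes>\<^bsub>G\<^esub> y) ` (supp f \<times> supp g)"
proof
  fix z assume "z \<in> supp (f \<otimes>\<^bsub>group_algebra G\<^esub> g)"
  then have "{(x, y). f x \<noteq> 0 \<and> g y \<noteq> 0 \<and> x \<otimes>\<^bsub>G\<^esub> y = z} \<noteq> {}"
    unfolding ga_mult by (metis (mono_tags, lifting) mem_Collect_eq sum.empty)
  then show "z \<in> (\<lambda>(x, y). x \<otimes>\<^bsub>G\<^esub> y) ` (supp f \<times> supp g)" by force
qed

text \<open>The form in which convolution is used: it yields associativity and, with theta a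
  coordinate of a group element applied to a vector, the multiplicativity of
  \<open>Psi\<close>.\<close>

lemma ga_mult_sum:
  assumes "finite (supp f)" "finite (supp g)"
  shows "(\<Sum>z\<in>supp (f \<otimes>\<^bsub>group_algebra G\<^esub> g). (f \<otimes>\<^bsub>group_algebra G\<^esub> g) z * \<theta> z) =
    (\<Sum>x\<in>supp f. \<Sum>y\<in>supp g. f x * g y * \<theta> (x \<otimes>\<^bsub>G\<^esub> y))"
proof -
  let ?Z = "(\<lambda>(x, y). x \<otimes>\<^bsub>G\<^esub> y) ` (supp f \<times> supp g)"
  have fin: "finite ?Z" using assms by simp
  have "(\<Sum>z\<in>supp (f \<otimes>\<^bsub>group_algebra G\<^esub> g). (f \<otimes>\<^bsub>group_algebra G\<^esub> g) z * \<theta> z) =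
      (\<Sum>z\<in>?Z. (f \<otimes>\<^bsub>group_algebra G\<^esub> g) z * \<theta> z)"
    by (rule sum_supp[OF fin ga_mult_supp])
  also have "\<dots> = (\<Sum>z\<in>?Z. \<Sum>x\<in>supp f. \<Sum>y\<in>supp g. if z = x \<otimes>\<^bsub>G\<^esub> y then f x * g y * \<theta> z else 0)"
    unfolding ga_mult_alt[OF assms order_refl order_refl] sum_distrib_right
    by (intro sum.cong HOL.refl) auto
  also have "\<dots> = (\<Sum>x\<in>supp f. \<Sum>y\<in>supp g. \<Sum>z\<in>?Z. if z = x \<otimes>\<^bsub>G\<^esub> y then f x * g y * \<theta> z else 0)"
    by (subst sum.swap, rule sum.cong[OF HOL.refl sum.swap])
  also have "\<dots> = (\<Sum>x\<in>supp f. \<Sum>y\<in>supp g. f x * g y * \<theta> (x \<otimes>\<^bsub>G\<^esub> y))"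
    by (intro sum.cong HOL.refl, subst sum.delta[OF fin]) force
  finally show ?thesis .
qed

lemma ga_carrier: "f \<in> carrier (group_algebra G) \<longleftrightarrow> finite (supp f) \<and> supp f \<subseteq> carrier G"
  by (simp add: group_algebra_def)

lemma ga_simps:
  "(f \<oplus>\<^bsub>group_algebra G\<^esub> g) z = f z + g z" "\<zero>\<^bsub>group_algebra G\<^esub> z = 0"
  "(c \<odot>\<^bsub>group_algebra G\<^esub> f) z = c * f z" "\<one>\<^bsub>group_algebra G\<^esub> = delta \<one>\<^bsub>G\<^esub>"
  by (simp_all add: group_algebra_def delta_def)

lemma supp_delta: "supp (delta x) = {x}"
  by (auto simp: delta_def)

lemma ring_group_algebra:
  assumes "group G"
  shows "ring (group_algebra G)"
proof -
  interpret G: group G by fact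
  let ?A = "group_algebra G"
  have add_cl: "f \<oplus>\<^bsub>?A\<^esub> g \<in> carrier ?A" if "f \<in> carrier ?A" "g \<in> carrier ?A" for f g
  proof -
    have "supp (f \<oplus>\<^bsub>?A\<^esub> g) \<subseteq> supp f \<union> supp g" by (auto simp: ga_simps)
    then show ?thesis using that by (auto simp: ga_carrier ga_simps intro: finite_subset)
  qed
  have mult_cl: "f \<otimes>\<^bsub>?A\<^esub> g \<in> carrier ?A" if "f \<in> carrier ?A" "g \<in> carrier ?A" for f g
  proof -
    have "finite (supp (f \<otimes>\<^bsub>?A\<^esub> g))"
      by (rule finite_subset[OF ga_mult_supp]) (use that in \<open>auto simp: ga_carrier\<close>)
    moreover have "supp (f \<otimes>\<^bsub>?A\<^esub> g) \<subseteq> carrier G"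
      by (rule order_trans[OF ga_mult_supp]) (use that in \<open>auto simp: ga_carrier\<close>)
    ultimately show ?thesis by (simp add: ga_carrier)
  qed
  have ab: "abelian_group ?A"
  proof (rule abelian_groupI)
    fix f assume f: "f \<in> carrier ?A"
    have "supp (\<lambda>z. - f z) = supp f" by auto
    then have "(\<lambda>z. - f z) \<in> carrier ?A" using f by (simp add: ga_carrier)
    moreover have "(\<lambda>z. - f z) \<oplus>\<^bsub>?A\<^esub> f = \<zero>\<^bsub>?A\<^esub>" by (rule HOL.ext) (simp add: ga_simps)
    ultimately show "\<exists>g\<in>carrier ?A. g \<oplus>\<^bsub>?A\<^esub> f = \<zero>\<^bsub>?A\<^esub>" by blast
  qed (auto simp: add_cl fun_eq_iff ga_simps add_ac, simp add: ga_carrier ga_simps)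
  have mon: "monoid ?A"
  proof (rule monoidI)
    show "\<one>\<^bsub>?A\<^esub> \<in> carrier ?A" by (simp add: ga_carrier ga_simps supp_delta)
    fix f assume f: "f \<in> carrier ?A"
    then have fin: "finite (supp f)" and sub: "supp f \<subseteq> carrier G" by (auto simp: ga_carrier)
    show "\<one>\<^bsub>?A\<^esub> \<otimes>\<^bsub>?A\<^esub> f = f"
    proof
      fix z
      have "(\<one>\<^bsub>?A\<^esub> \<otimes>\<^bsub>?A\<^esub> f) z = (\<Sum>x\<in>{\<one>\<^bsub>G\<^esub>}. \<Sum>y\<in>supp f. if x \<otimes>\<^bsub>G\<^esub> y = z then \<one>\<^bsub>?A\<^esub> x * f y else 0)"
        by (rule ga_mult_alt) (use fin in \<open>auto simp: ga_simps supp_delta delta_def\<close>)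
      also have "\<dots> = (\<Sum>y\<in>supp f. if y = z then f y else 0)"
        using sub by (auto simp: ga_simps delta_def subset_iff intro!: sum.cong)
      also have "\<dots> = f z" using fin by simp
      finally show "(\<one>\<^bsub>?A\<^esub> \<otimes>\<^bsub>?A\<^esub> f) z = f z" .
    qed
    show "f \<otimes>\<^bsub>?A\<^esub> \<one>\<^bsub>?A\<^esub> = f"
    proof
      fix z
      have "(f \<otimes>\<^bsub>?A\<^esub> \<one>\<^bsub>?A\<^esub>) z = (\<Sum>x\<in>supp f. \<Sum>y\<in>{\<one>\<^bsub>G\<^esub>}. if x \<otimes>\<^bsub>G\<^esub> y = z then f x * \<one>\<^bsub>?A\<^esub> y else 0)"
        by (rule ga_mult_alt) (use fin in \<open>auto simp: ga_simps supp_delta delta_def\<close>)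
      also have "\<dots> = (\<Sum>y\<in>supp f. if y = z then f y else 0)"
        using sub by (auto simp: ga_simps delta_def subset_iff intro!: sum.cong)
      also have "\<dots> = f z" using fin by simp
      finally show "(f \<otimes>\<^bsub>?A\<^esub> \<one>\<^bsub>?A\<^esub>) z = f z" .
    qed
    fix g h assume g: "g \<in> carrier ?A" and h: "h \<in> carrier ?A"
    then have fin': "finite (supp g)" "finite (supp h)" and sub': "supp g \<subseteq> carrier G" "supp h \<subseteq> carrier G"
      by (auto simp: ga_carrier)
    have fin2: "finite (supp (f \<otimes>\<^bsub>?A\<^esub> g))" "finite (supp (g \<otimes>\<^bsub>?A\<^esub> h))"
      using mult_cl f g h by (auto simp: ga_carrier)
    show "f \<otimes>\<^bsub>?A\<^esub> g \<otimes>\<^bsub>?A\<^esub> h = f \<otimes>\<^bsub>?A\<^esub> (g \<otimes>\<^bsub>?A\<^esub> h)"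
    proof
      fix z
      have "(f \<otimes>\<^bsub>?A\<^esub> g \<otimes>\<^bsub>?A\<^esub> h) z = (\<Sum>w\<in>supp (f \<otimes>\<^bsub>?A\<^esub> g). (f \<otimes>\<^bsub>?A\<^esub> g) w * (\<Sum>c\<in>supp h. if w \<otimes>\<^bsub>G\<^esub> c = z then h c else 0))"
        by (subst ga_mult_alt[OF fin2(1) fin'(2) order_refl order_refl]) (auto simp: sum_distrib_left intro!: sum.cong)
      also have "\<dots> = (\<Sum>x\<in>supp f. \<Sum>y\<in>supp g. f x * g y * (\<Sum>c\<in>supp h. if x \<otimes>\<^bsub>G\<^esub> y \<otimes>\<^bsub>G\<^esub> c = z then h c else 0))"
        by (rule ga_mult_sum[OF fin fin'(1)])
      also have "\<dots> = (\<Sum>x\<in>supp f. f x * (\<Sum>y\<in>supp g. \<Sum>c\<in>supp h. g y * h c * (if x \<otimes>\<^bsub>G\<^esub> (y \<otimes>\<^bsub>G\<^esub> c) = z then 1 else 0)))"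
        using sub sub' by (auto simp: sum_distrib_left G.m_assoc subset_iff mult.assoc intro!: sum.cong)
      also have "\<dots> = (\<Sum>x\<in>supp f. f x * (\<Sum>w\<in>supp (g \<otimes>\<^bsub>?A\<^esub> h). (g \<otimes>\<^bsub>?A\<^esub> h) w * (if x \<otimes>\<^bsub>G\<^esub> w = z then 1 else 0)))"
        by (simp only: ga_mult_sum[OF fin'(1,2), where \<theta> = "\<lambda>w. if _ \<otimes>\<^bsub>G\<^esub> w = z then 1 else 0"])
      also have "\<dots> = (f \<otimes>\<^bsub>?A\<^esub> (g \<otimes>\<^bsub>?A\<^esub> h)) z"
        by (subst ga_mult_alt[OF fin fin2(2) order_refl order_refl]) (auto simp: sum_distrib_left intro!: sum.cong)
      finally show "(f \<otimes>\<^bsub>?A\<^esub> g \<otimes>\<^bsub>?A\<^esub> h) z = (f \<otimes>\<^bsub>?A\<^esub> (g \<otimes>\<^bsub>?A\<^esub> h)) z" .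
    qed
  qed (rule mult_cl)
  show ?thesis
  proof (rule ringI[OF ab mon])
    fix f g h assume a: "f \<in> carrier ?A" "g \<in> carrier ?A" "h \<in> carrier ?A"
    then have fin: "finite (supp f \<union> supp g)" "finite (supp h)" by (auto simp: ga_carrier)
    have sub: "supp (f \<oplus>\<^bsub>?A\<^esub> g) \<subseteq> supp f \<union> supp g" by (auto simp: ga_simps)
    show "(f \<oplus>\<^bsub>?A\<^esub> g) \<otimes>\<^bsub>?A\<^esub> h = f \<otimes>\<^bsub>?A\<^esub> h \<oplus>\<^bsub>?A\<^esub> g \<otimes>\<^bsub>?A\<^esub> h"
    proof
      fix z
      show "((f \<oplus>\<^bsub>?A\<^esub> g) \<otimes>\<^bsub>?A\<^esub> h) z = (f \<otimes>\<^bsub>?A\<^esub> h \<oplus>\<^bsub>?A\<^esub> g \<otimes>\<^bsub>?A\<^esub> h) z"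
        unfolding ga_simps ga_mult_alt[OF fin sub order_refl] ga_mult_alt[OF fin Un_upper1 order_refl]
          ga_mult_alt[OF fin Un_upper2 order_refl] sum.distrib[symmetric]
        by (intro sum.cong HOL.refl) (auto simp: ga_simps algebra_simps)
    qed
    show "h \<otimes>\<^bsub>?A\<^esub> (f \<oplus>\<^bsub>?A\<^esub> g) = h \<otimes>\<^bsub>?A\<^esub> f \<oplus>\<^bsub>?A\<^esub> h \<otimes>\<^bsub>?A\<^esub> g"
    proof
      fix z
      show "(h \<otimes>\<^bsub>?A\<^esub> (f \<oplus>\<^bsub>?A\<^esub> g)) z = (h \<otimes>\<^bsub>?A\<^esub> f \<oplus>\<^bsub>?A\<^esub> h \<otimes>\<^bsub>?A\<^esub> g) z"
        unfolding ga_simps ga_mult_alt[OF fin(2,1) order_refl sub] ga_mult_alt[OF fin(2,1) order_refl Un_upper1]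
          ga_mult_alt[OF fin(2,1) order_refl Un_upper2] sum.distrib[symmetric]
        by (intro sum.cong HOL.refl) (auto simp: ga_simps algebra_simps)
    qed
  qed
qed

subsection \<open>Quotient algebras\<close>

text \<open>The condition on the kernel is stated as invariance under translation by the ideal, so
  that it makes sense without ring axioms for the target C.\<close>

lemma quot_algebra_hom:
  assumes J: "ideal J A"
    and h: "h \<in> alg_hom A C"
    and smult: "\<And>c x. x \<in> carrier A \<Longrightarrow> c \<odot>\<^bsub>A\<^esub> x \<in> carrier A"
    and ker: "\<And>x y. x \<in> J \<Longrightarrow> y \<in> carrier A \<Longrightarrow> h (x \<oplus>\<^bsub>A\<^esub> y) = h y"
  obtains \<Phi> where "\<Phi> \<in> alg_hom (quot_algebra A J) C" "\<And>x. x \<in> carrier A \<Longrightarrow> \<Phi> (J +>\<^bsub>A\<^esub> x) = h x"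
proof -
  interpret J: ideal J A by fact
  define \<Phi> where "\<Phi> P = h (SOME x. x \<in> P)" for P
  have mem: "x \<in> J +>\<^bsub>A\<^esub> x" if "x \<in> carrier A" for x
    using that by (rule J.a_rcos_self)
  have \<Phi>: "\<Phi> (J +>\<^bsub>A\<^esub> x) = h x" if "x \<in> carrier A" for x
  proof -
    have "(SOME y. y \<in> J +>\<^bsub>A\<^esub> x) \<in> J +>\<^bsub>A\<^esub> x"
      using mem[OF that] by (rule someI)
    then show ?thesis
      unfolding \<Phi>_def using ker that by (auto simp: a_r_coset_def')
  qed
  have car: "carrier (quot_algebra A J) = {J +>\<^bsub>A\<^esub> x | x. x \<in> carrier A}"
    and mult: "P \<otimes>\<^bsub>quot_algebra A J\<^esub> Q = rcoset_mult A J P Q"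
    and add: "P \<oplus>\<^bsub>quot_algebra A J\<^esub> Q = P <+>\<^bsub>A\<^esub> Q"
    and one: "\<one>\<^bsub>quot_algebra A J\<^esub> = J +>\<^bsub>A\<^esub> \<one>\<^bsub>A\<^esub>"
    and sm: "c \<odot>\<^bsub>quot_algebra A J\<^esub> P = (\<Union>x\<in>P. J +>\<^bsub>A\<^esub> (c \<odot>\<^bsub>A\<^esub> x))" for P Q c
    by (auto simp: quot_algebra_def FactRing_def ring.defs A_RCOSETS_def')
  have hA: "h \<in> ring_hom A C" "h (c \<odot>\<^bsub>A\<^esub> x) = c \<odot>\<^bsub>C\<^esub> h x" if "x \<in> carrier A" for x c
    using h that by (auto simp: alg_hom_def)
  have h': "h \<in> ring_hom A C" using h by (simp add: alg_hom_def)
  have "\<Phi> \<in> ring_hom (quot_algebra A J) C"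
  proof (rule ring_hom_memI)
    fix P assume "P \<in> carrier (quot_algebra A J)"
    then obtain x where x: "x \<in> carrier A" "P = J +>\<^bsub>A\<^esub> x" by (auto simp: car)
    then show "\<Phi> P \<in> carrier C"
      using ring_hom_closed[OF h'] by (simp add: \<Phi>)
    fix Q assume "Q \<in> carrier (quot_algebra A J)"
    then obtain y where y: "y \<in> carrier A" "Q = J +>\<^bsub>A\<^esub> y" by (auto simp: car)
    show "\<Phi> (P \<otimes>\<^bsub>quot_algebra A J\<^esub> Q) = \<Phi> P \<otimes>\<^bsub>C\<^esub> \<Phi> Q"
      using x y ring_hom_mult[OF h'] by (simp add: mult J.rcoset_mult_add \<Phi>)
    show "\<Phi> (P \<oplus>\<^bsub>quot_algebra A J\<^esub> Q) = \<Phi> P \<oplus>\<^bsub>C\<^esub> \<Phi> Q"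
      using x y ring_hom_add[OF h'] by (simp add: add J.a_rcos_sum \<Phi>)
  next
    show "\<Phi> \<one>\<^bsub>quot_algebra A J\<^esub> = \<one>\<^bsub>C\<^esub>"
      using ring_hom_one[OF h'] by (simp add: one \<Phi>)
  qed
  moreover have "\<Phi> (c \<odot>\<^bsub>quot_algebra A J\<^esub> P) = c \<odot>\<^bsub>C\<^esub> \<Phi> P" if P: "P \<in> carrier (quot_algebra A J)" for c P
  proof -
    obtain x where x: "x \<in> carrier A" "P = J +>\<^bsub>A\<^esub> x" using P by (auto simp: car)
    have sub: "y \<in> carrier A \<and> h y = h x" if "y \<in> P" for y
      using that x ker J.a_Hcarr by (auto simp: a_r_coset_def')
    \<comment> \<open>A scalar multiple of a class is a union of cosets over all representatives. As
      h is constant on that union, the element chosen by Phi does not influence the value.\<close>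
    have "h y = c \<odot>\<^bsub>C\<^esub> h x" if "y \<in> c \<odot>\<^bsub>quot_algebra A J\<^esub> P" for y
    proof -
      obtain u where u: "u \<in> P" "y \<in> J +>\<^bsub>A\<^esub> (c \<odot>\<^bsub>A\<^esub> u)" using \<open>y \<in> _\<close> by (auto simp: sm)
      then have "h y = h (c \<odot>\<^bsub>A\<^esub> u)"
        using ker smult sub by (auto simp: a_r_coset_def')
      then show ?thesis using hA(2) sub u by simp
    qed
    moreover have "c \<odot>\<^bsub>A\<^esub> x \<in> c \<odot>\<^bsub>quot_algebra A J\<^esub> P"
      using x mem smult by (auto simp: sm)
    ultimately have "\<Phi> (c \<odot>\<^bsub>quot_algebra A J\<^esub> P) = c \<odot>\<^bsub>C\<^esub> h x"
      unfolding \<Phi>_def by (metis someI)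
    then show ?thesis using x by (simp add: \<Phi>)
  qed
  ultimately have "\<Phi> \<in> alg_hom (quot_algebra A J) C"
    by (simp add: alg_hom_def)
  then show ?thesis using \<Phi> that by blast
qed


section \<open>The endomorphism algebra and the representation\<close>

lemma linear_on_sum:
  assumes F: "linear_on B F" and u: "\<And>a. a \<in> A \<Longrightarrow> u a \<in> fsp B"
  shows "F (\<Sum>a\<in>A. scl (c a) (u a)) = (\<Sum>a\<in>A. scl (c a) (F (u a)))"
proof -
  have F0: "F 0 = 0"
    using F unfolding linear_on_def by (metis fsp_0 kvs.scale_zero_left)
  show ?thesis
    using u
  proof (induction A rule: infinite_finite_induct)
    case (insert a A)
    have "scl (c a) (u a) \<in> fsp B" "(\<Sum>a\<in>A. scl (c a) (u a)) \<in> fsp B" "u a \<in> fsp B"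
      using insert by auto
    with insert show ?case
      using F by (auto simp: linear_on_def)
  qed (simp_all add: F0)
qed

lemma of_nat_kk: "of_nat k = (0 :: kk) \<longleftrightarrow> k = 0"
  by (simp add: of_nat_fract Zero_fract_def eq_fract)

locale yh_action =
  fixes d n :: nat and N :: "nat \<Rightarrow> nat" and \<zeta> :: kk and B :: "nat \<Rightarrow> 'm set" and \<rho> :: "nat \<Rightarrow> uqgen \<Rightarrow> 'm oper"
  assumes d: "d \<ge> 1" and n: "n \<ge> 1" and prim: "primitive_root_of_unity d \<zeta>"
    and mod: "\<And>b. b \<in> {1..d} \<Longrightarrow> uq_module (N b) (B b) (\<rho> b)"
begin

abbreviation "X \<equiv> fsp (MV_basis d n N B)"
abbreviation "E \<equiv> End_A d n N B \<rho>"
abbreviation "H \<equiv> units_of E"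

text \<open>The double braiding of the extended module: it is linear on all vectors and satisfies
  the operator identities, and by \<open>agree_Kb\<close> it agrees with that of
  \<open>\<rho> b\<close> on the relevant space.\<close>

definition Kb :: "nat \<Rightarrow> ('m \<times> nat) oper" where
  "Kb b = K_check (N b) (\<lambda>g. app (ext (N b) (B b) (\<rho> b) g))"

definition opr :: "fbgen \<Rightarrow> 'm tbasis oper" where
  "opr x = (case x of S i \<Rightarrow> (case i of 0 \<Rightarrow> sig0 Kb | Suc j \<Rightarrow> sigi N j) | T i \<Rightarrow> tau_op \<zeta> i)"

lemma opr_simps [simp]: "opr (S 0) = sig0 Kb" "opr (S (Suc j)) = sigi N j" "opr (T i) = tau_op \<zeta> i"
  by (simp_all add: opr_def)

lemma E_carrier: "f \<in> carrier E \<longleftrightarrow> f \<in> extensional X \<and> linear_on (MV_basis d n N B) f \<and>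
    (\<forall>g\<in>A_gens d N. \<forall>v\<in>X. f (act_MV \<rho> n g v) = act_MV \<rho> n g (f v))"
  by (simp add: End_A_def Let_def)

lemma E_simps:
  "f \<otimes>\<^bsub>E\<^esub> g = compose X f g" "\<one>\<^bsub>E\<^esub> = (\<lambda>v\<in>X. v)"
  "f \<oplus>\<^bsub>E\<^esub> g = (\<lambda>v\<in>X. f v + g v)" "c \<odot>\<^bsub>E\<^esub> f = (\<lambda>v\<in>X. scl c (f v))"
  by (simp_all add: End_A_def Let_def)

lemma E_closed: "f \<in> carrier E \<Longrightarrow> v \<in> X \<Longrightarrow> f v \<in> X"
  by (simp add: E_carrier linear_on_def)

lemma zeta: "\<zeta> \<noteq> 0" "\<zeta> ^ d = 1"
  using prim d by (auto simp: primitive_root_of_unity_def power_0_left)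

lemma act_eq:
  assumes "g \<in> A_gens d N" "v \<in> X"
  shows "act_MV \<rho> n g v = app (AA N (ext (N (fst g)) (B (fst g)) (\<rho> (fst g))) (fst g) n (snd g)) v"
    and "act_MV \<rho> n g v \<in> X"
proof -
  have "fst g \<in> {1..d}" "snd g \<in> uq_gens (N (fst g))"
    using assms(1) by (auto simp: A_gens_def)
  then have "agree (MV_basis d n N B) (MV_basis d n N B) (act_MV \<rho> n (fst g, snd g))
      (app (AA N (ext (N (fst g)) (B (fst g)) (\<rho> (fst g))) (fst g) n (snd g)))"
    by (intro agree_act_MV mod)
  then show "act_MV \<rho> n g v = app (AA N (ext (N (fst g)) (B (fst g)) (\<rho> (fst g))) (fst g) n (snd g)) v"
    "act_MV \<rho> n g v \<in> X"
    using assms(2) by (simp_all add: agree_def)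
qed

lemma lin_act: "lin (act_MV \<rho> k g)"
  by (cases k) simp_all

lemma X_tb: "v \<in> X \<Longrightarrow> v \<in> fsp (tb d n)"
  by (rule fsp_mono[OF MV_basis_tb])

lemma restrict_in_E:
  assumes F: "lin F" "\<And>v. v \<in> X \<Longrightarrow> F v \<in> X"
    and c: "\<And>b. b \<in> {1..d} \<Longrightarrow> com (tb d n) (AA N (ext (N b) (B b) (\<rho> b)) b n) F"
  shows "restrict F X \<in> carrier E"
proof -
  have "linear_on (MV_basis d n N B) (restrict F X)"
    using F by (auto simp: linear_on_def lin_simps)
  moreover have "restrict F X (act_MV \<rho> n g v) = act_MV \<rho> n g (restrict F X v)"
    if "g \<in> A_gens d N" "v \<in> X" for g v
  proof -
    have "fst g \<in> {1..d}" using that by (auto simp: A_gens_def)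
    from c[OF this] show ?thesis
      using act_eq[OF that] act_eq[OF that(1) F(2)[OF that(2)]] that X_tb by (simp add: com_def)
  qed
  ultimately show ?thesis by (simp add: E_carrier)
qed

lemma monoid_E: "monoid E"
proof (rule monoidI)
  show "\<one>\<^bsub>E\<^esub> \<in> carrier E"
    using act_eq(2) by (auto simp: E_carrier E_simps linear_on_def)
  fix f assume f: "f \<in> carrier E"
  then have e: "f \<in> extensional X" by (simp add: E_carrier)
  show "\<one>\<^bsub>E\<^esub> \<otimes>\<^bsub>E\<^esub> f = f"
    by (rule extensionalityI[of _ X]) (use e f E_closed in \<open>auto simp: E_simps compose_def\<close>)
  show "f \<otimes>\<^bsub>E\<^esub> \<one>\<^bsub>E\<^esub> = f"
    by (rule extensionalityI[of _ X]) (use e in \<open>auto simp: E_simps compose_def\<close>)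
  fix g assume g: "g \<in> carrier E"
  show "f \<otimes>\<^bsub>E\<^esub> g \<in> carrier E"
    using f g act_eq(2) by (auto simp: E_carrier E_simps linear_on_def compose_def)
  fix h assume h: "h \<in> carrier E"
  show "f \<otimes>\<^bsub>E\<^esub> g \<otimes>\<^bsub>E\<^esub> h = f \<otimes>\<^bsub>E\<^esub> (g \<otimes>\<^bsub>E\<^esub> h)"
    by (rule extensionalityI[of _ X]) (use E_closed[OF h] in \<open>auto simp: E_simps compose_def\<close>)
qed

text \<open>The braid group has to land among the units of the endomorphism algebra. Linearity and
  commutation with A pass to the inverse map because f is injective.\<close>

lemma unit_E:
  assumes f: "f \<in> carrier E" and b: "bij_betw f X X"
  shows "f \<in> Units E"
proof -
  define g where "g = restrict (inv_into X f) X"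
  have fg: "f (g v) = v" "g v \<in> X" if "v \<in> X" for v
    using that b by (auto simp: g_def bij_betw_def f_inv_into_f inv_into_into)
  have gf: "g (f v) = v" if "v \<in> X" for v
    using that b E_closed[OF f] by (auto simp: g_def bij_betw_def)
  have lf: "f (v + w) = f v + f w" "f (scl c v) = scl c (f v)" if "v \<in> X" "w \<in> X" for v w c
    using f that by (auto simp: E_carrier linear_on_def)
  have cf: "f (act_MV \<rho> n a v) = act_MV \<rho> n a (f v)" if "a \<in> A_gens d N" "v \<in> X" for a v
    using f that by (auto simp: E_carrier)
  have "linear_on (MV_basis d n N B) g"
    unfolding linear_on_def
  proof (intro conjI ballI allI)
    show "g v \<in> X" if "v \<in> X" for v using fg that by blast
    show "g (v + w) = g v + g w" if "v \<in> X" "w \<in> X" for v w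
      using gf[of "g v + g w"] lf(1)[of "g v" "g w"] fg that by (simp add: fsp_add)
    show "g (scl c v) = scl c (g v)" if "v \<in> X" for v c
      using gf[of "scl c (g v)"] lf(2)[of "g v" "g v" c] fg that by (simp add: fsp_scl)
  qed
  moreover have "g (act_MV \<rho> n a v) = act_MV \<rho> n a (g v)" if "a \<in> A_gens d N" "v \<in> X" for a v
    using gf[of "act_MV \<rho> n a (g v)"] cf[of a "g v"] fg that act_eq(2) by simp
  ultimately have g: "g \<in> carrier E"
    by (simp add: E_carrier) (simp add: g_def)
  have "g \<otimes>\<^bsub>E\<^esub> f = \<one>\<^bsub>E\<^esub>" "f \<otimes>\<^bsub>E\<^esub> g = \<one>\<^bsub>E\<^esub>"
    by (rule extensionalityI[of _ X]; auto simp: E_simps compose_def fg gf)+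
  then show ?thesis using f g by (auto simp: Units_def)
qed

lemma
  assumes "b \<in> {1..d}"
  shows bij_Kb: "bij_fsp (B b \<times> {1..N b}) (B b \<times> {1..N b}) (Kb b)"
    and lin_Kb: "lin (Kb b)"
    and inter_Kb: "inter (tact (ext (N b) (B b) (\<rho> b)) (Vop (N b))) (tact (ext (N b) (B b) (\<rho> b)) (Vop (N b))) (Kb b)"
    and reflection_Kb: "op12 (Kb b) (op23 (R_check (N b)) (op12 (Kb b) (op23 (R_check (N b)) v)))
      = op23 (R_check (N b)) (op12 (Kb b) (op23 (R_check (N b)) (op12 (Kb b) v)))"
    and agree_Kb: "agree (B b \<times> {1..N b}) (B b \<times> {1..N b}) (K_check (N b) (\<rho> b)) (Kb b)"
proof -
  interpret uq_rep "N b" "ext (N b) (B b) (\<rho> b)"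
    by standard (rule uq_act_ext[OF mod[OF assms]])
  show "bij_fsp (B b \<times> {1..N b}) (B b \<times> {1..N b}) (Kb b)"
    unfolding Kb_def by (rule bij_K_check) (rule ext_stable[OF mod[OF assms]])
  then show "lin (Kb b)" by (simp add: bij_fsp_def)
  show "inter (tact (ext (N b) (B b) (\<rho> b)) (Vop (N b))) (tact (ext (N b) (B b) (\<rho> b)) (Vop (N b))) (Kb b)"
    unfolding Kb_def by (rule inter_K_check)
  show "op12 (Kb b) (op23 (R_check (N b)) (op12 (Kb b) (op23 (R_check (N b)) v)))
      = op23 (R_check (N b)) (op12 (Kb b) (op23 (R_check (N b)) (op12 (Kb b) v)))"
    unfolding Kb_def by (rule K_check_reflection)
  show "agree (B b \<times> {1..N b}) (B b \<times> {1..N b}) (K_check (N b) (\<rho> b)) (Kb b)"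
    unfolding Kb_def by (rule agree_K_check[OF mod[OF assms]])
qed

lemma tau_unit:
  assumes "\<xi> \<noteq> 0" "i \<in> {1..n}"
  shows "restrict (tau_op \<xi> i) X \<in> Units E"
proof (rule unit_E)
  show "restrict (tau_op \<xi> i) X \<in> carrier E"
    by (rule restrict_in_E[OF lin_tau_op tau_MV com_tau[OF assms(2)]])
  have "tau_op (inverse \<xi>) i (tau_op \<xi> i v) = v" for v :: "'m tbasis vec"
    using tau_op_inverse[of "inverse \<xi>" i v] assms(1) by simp
  then have "bij_betw (tau_op \<xi> i) X X"
    by (intro bij_betw_byWitness[where f' = "tau_op (inverse \<xi>) i"]) (auto simp: tau_op_inverse assms tau_MV)
  then show "bij_betw (restrict (tau_op \<xi> i) X) X X"
    by (simp cong: bij_betw_cong)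
qed

lemma opr_unit:
  assumes "x \<in> fb_gens n"
  shows "restrict (opr x) X \<in> Units E" and "lin (opr x)" and "v \<in> X \<Longrightarrow> opr x v \<in> X"
proof -
  consider "x = S 0" | j where "x = S (Suc j)" "Suc j < n" | i where "x = T i" "i \<in> {1..n}"
    using assms by (auto simp: fb_gens_def) (metis Suc_pred' not_gr0)
  then have "restrict (opr x) X \<in> Units E \<and> lin (opr x) \<and> (\<forall>v\<in>X. opr x v \<in> X)"
  proof cases
    case 1
    have M: "bij_betw (sig0 Kb) X X" "\<And>v. v \<in> X \<Longrightarrow> sig0 Kb v \<in> X"
      by (rule sig0_MV[OF bij_Kb n]; assumption)+
    have "restrict (opr x) X \<in> Units E"
    proof (rule unit_E)
      show "restrict (opr x) X \<in> carrier E"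
        using M n by (auto simp: 1 intro!: restrict_in_E com_sig0 lin_Kb inter_Kb)
      show "bij_betw (restrict (opr x) X) X X"
        using M by (simp add: 1 cong: bij_betw_cong)
    qed
    with M show ?thesis by (simp add: 1)
  next
    case 2
    have "restrict (opr x) X \<in> Units E"
    proof (rule unit_E)
      show "restrict (opr x) X \<in> carrier E"
        using 2 by (auto intro!: restrict_in_E com_sigi sigi_MV)
      show "bij_betw (restrict (opr x) X) X X"
        using bij_sigi[OF 2(2)] by (simp add: 2 cong: bij_betw_cong)
    qed
    with 2 show ?thesis by (auto intro: sigi_MV)
  next
    case 3
    then show ?thesis
      using tau_unit[OF zeta(1)] by (auto intro: tau_MV)
  qed
  then show "restrict (opr x) X \<in> Units E" "lin (opr x)" "v \<in> X \<Longrightarrow> opr x v \<in> X"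
    by auto
qed

lemma group_H: "group H"
  by (rule monoid.units_group[OF monoid_E])

lemma H_simps: "carrier H = Units E" "f \<otimes>\<^bsub>H\<^esub> g = compose X f g" "\<one>\<^bsub>H\<^esub> = (\<lambda>v\<in>X. v)"
  by (simp_all add: units_of_def E_simps)

abbreviation "prd xs \<equiv> foldr (\<lambda>x h. opr x \<circ> h) xs id"

text \<open>Both sides of every defining relation are positive words, so checking the relations
  amounts to comparing compositions of the operators, with no inverses to evaluate.\<close>

lemma eval_pos_word:
  "set xs \<subseteq> fb_gens n \<Longrightarrow> eval_word H (\<lambda>x. restrict (opr x) X) (pos_word xs) = restrict (prd xs) X \<and>
    (\<forall>v\<in>X. prd xs v \<in> X)"
proof (induction xs)
  case (Cons x xs)
  then show ?case
    using opr_unit(3)[of x] by (auto simp: H_simps compose_def restrict_def fun_eq_iff)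
qed (simp add: H_simps restrict_def fun_eq_iff)

lemma pos_word_words: "pos_word xs \<in> words Y \<longleftrightarrow> set xs \<subseteq> Y"
  by (induction xs) (auto simp: words_def)

lemma opr_far:
  assumes "Suc i < j" "j < n" "v \<in> X"
  shows "opr (S i) (opr (S j) v) = opr (S j) (opr (S i) v)"
proof (cases i)
  case 0
  then obtain j' where j: "j = Suc (Suc j')" using assms by (cases j; cases "j - 1") auto
  show ?thesis
    unfolding j 0 opr_simps by (rule sig0_far[OF X_tb[OF assms(3)] lin_Kb]) (use assms j in auto)
next
  case (Suc i')
  then obtain j' where j: "j = Suc j'" using assms by (cases j) auto
  show ?thesis
    unfolding j Suc opr_simps by (rule sigi_far[OF X_tb[OF assms(3)]]) (use assms j Suc in auto)
qed

lemma prd_replicate: "prd (replicate k x) = opr x ^^ k"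
  by (induction k) auto

lemma relations:
  assumes "(l, r) \<in> fb_rels d n" "l \<in> words (fb_gens n)" "r \<in> words (fb_gens n)"
  shows "eval_word H (\<lambda>x. restrict (opr x) X) l = eval_word H (\<lambda>x. restrict (opr x) X) r"
proof -
  have *: ?thesis if "l = pos_word xs" "r = pos_word ys" "\<And>v. v \<in> X \<Longrightarrow> prd xs v = prd ys v" for xs ys
  proof -
    have "set xs \<subseteq> fb_gens n" "set ys \<subseteq> fb_gens n"
      using assms that by (simp_all add: pos_word_words)
    then show ?thesis
      using eval_pos_word[of xs] eval_pos_word[of ys] that by (auto simp: restrict_def fun_eq_iff)
  qed
  from assms(1) consider "2 \<le> n" "l = pos_word [S 0, S 1, S 0, S 1]" "r = pos_word [S 1, S 0, S 1, S 0]"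
    | i j where "i < n" "j < n" "Suc i < j \<or> Suc j < i" "l = pos_word [S i, S j]" "r = pos_word [S j, S i]"
    | i where "1 \<le> i" "i + 2 \<le> n" "l = pos_word [S i, S (i + 1), S i]" "r = pos_word [S (i + 1), S i, S (i + 1)]"
    | j where "j \<in> {1..n}" "l = pos_word (replicate d (T j))" "r = pos_word []"
    | i j where "l = pos_word [T i, T j]" "r = pos_word [T j, T i]"
    | j where "j \<in> {1..n}" "l = pos_word [T j, S 0]" "r = pos_word [S 0, T j]"
    | i j where "1 \<le> i" "i < n" "j \<in> {1..n}" "l = pos_word [T j, S i]"
        "r = pos_word [S i, T (Transposition.transpose i (i + 1) j)]"
    unfolding fb_rels_def by (auto split: if_splits)
  then show ?thesis
  proof cases
    case 1
    show ?thesis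
      by (rule *[OF 1(2,3)]) (simp, intro sig0_reflection[OF X_tb lin_Kb 1(1) reflection_Kb]; assumption)
  next
    case 2
    show ?thesis
      by (rule *[OF 2(4,5)]) (use 2 opr_far[of i j] opr_far[of j i] in auto)
  next
    case 3
    then obtain i' where i: "i = Suc i'" by (cases i) auto
    show ?thesis
      by (rule *[OF 3(3,4)]) (use 3 sigi_braid[OF X_tb, of _ i' N] in \<open>simp add: i\<close>)
  next
    case 4
    show ?thesis
      by (rule *[OF 4(2,3)]) (simp add: prd_replicate tau_op_pow_d[OF zeta(2)] del: foldr_replicate)
  next
    case 5
    show ?thesis
      by (rule *[OF 5]) (simp add: tau_op_commute[of \<zeta> i \<zeta> j])
  next
    case 6
    show ?thesis
      by (rule *[OF 6(2,3)]) (simp add: tau_sig0[OF X_tb 6(1)])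
  next
    case 7
    then obtain i' where i: "i = Suc i'" by (cases i) auto
    show ?thesis
      by (rule *[OF 7(4,5)]) (use 7 tau_sigi[OF X_tb, of _ i' j \<zeta> N] in \<open>simp add: i\<close>)
  qed
qed

abbreviation "G \<equiv> FB_aff d n"

lemma group_G: "group G"
  unfolding FB_aff_def by (rule group_presented_group)

lemma fb_carrier: "x \<in> fb_gens n \<Longrightarrow> fb d n x \<in> carrier G"
  by (auto simp: FB_aff_def presented_group_def fb_def words_def)

section \<open>Linear extension to the group algebra and descent to the quotient\<close>

context
  fixes \<phi> :: "fbgen word set \<Rightarrow> 'm tbasis oper"
  assumes hom: "\<phi> \<in> hom G H" and gen: "\<And>x. x \<in> fb_gens n \<Longrightarrow> \<phi> (fb d n x) = restrict (opr x) X"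
begin

interpretation G: group G by (rule group_G)
interpretation \<phi>: group_hom G H \<phi>
  by (intro group_hom.intro group_hom_axioms.intro group_G group_H hom)
interpretation R: ring "kFB d n" by (rule ring_group_algebra[OF group_G])

definition Psi :: "(fbgen word set \<Rightarrow> kk) \<Rightarrow> 'm tbasis oper" where
  "Psi f = (\<lambda>v\<in>X. \<Sum>x\<in>supp f. scl (f x) (\<phi> x v))"

lemma phi_E: "x \<in> carrier G \<Longrightarrow> \<phi> x \<in> carrier E"
  using \<phi>.hom_closed[of x] by (simp add: H_simps Units_def)

lemma phi_facts:
  assumes "x \<in> carrier G" "v \<in> X"
  shows "\<phi> x v \<in> X" "w \<in> X \<Longrightarrow> \<phi> x (v + w) = \<phi> x v + \<phi> x w" "\<phi> x (scl c v) = scl c (\<phi> x v)"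
    "g \<in> A_gens d N \<Longrightarrow> \<phi> x (act_MV \<rho> n g v) = act_MV \<rho> n g (\<phi> x v)"
    "linear_on (MV_basis d n N B) (\<phi> x)"
  using phi_E[OF assms(1)] assms(2) by (auto simp: E_carrier linear_on_def)

lemma phi_mult: "x \<in> carrier G \<Longrightarrow> y \<in> carrier G \<Longrightarrow> v \<in> X \<Longrightarrow> \<phi> (x \<otimes>\<^bsub>G\<^esub> y) v = \<phi> x (\<phi> y v)"
  by (simp add: H_simps compose_def)

lemma Psi_superset:
  assumes "finite A" "supp f \<subseteq> A" "v \<in> X"
  shows "Psi f v = (\<Sum>x\<in>A. scl (f x) (\<phi> x v))"
  using assms by (auto simp: Psi_def intro!: sum.mono_neutral_left)

lemma Psi_alg_hom: "Psi \<in> alg_hom (kFB d n) E"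
proof -
  have ext: "Psi f \<in> extensional X" for f by (simp add: Psi_def)
  have eqI: "F = F'" if "F \<in> extensional X" "F' \<in> extensional X" "\<And>v. v \<in> X \<Longrightarrow> F v = F' v" for F F' :: "'m tbasis oper"
    by (rule extensionalityI[OF that(1,2)]) (use that in auto)
  have car: "Psi f \<in> carrier E" if f: "f \<in> carrier (kFB d n)" for f
  proof -
    have fin: "finite (supp f)" and x: "\<And>x. x \<in> supp f \<Longrightarrow> x \<in> carrier G" using f by (auto simp: ga_carrier)
    show ?thesis
      unfolding E_carrier linear_on_def
    proof (intro conjI ballI allI ext)
      fix v assume v: "v \<in> X"
      show "Psi f v \<in> X"
        using v x by (auto simp: Psi_def intro!: fsp_sum fsp_scl phi_facts(1))
      show "Psi f (v + w) = Psi f v + Psi f w" if w: "w \<in> X" for w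
        using v w x phi_facts(2)[OF x v w]
        by (simp add: Psi_def fsp_add kvs.scale_right_distrib sum.distrib)
      show "Psi f (scl c v) = scl c (Psi f v)" for c
        using v x phi_facts(3)[OF x v] by (simp add: Psi_def fsp_scl kvs.scale_sum_right mult.commute)
      show "Psi f (act_MV \<rho> n g v) = act_MV \<rho> n g (Psi f v)" if g: "g \<in> A_gens d N" for g
        using v x act_eq(2)[OF g v] phi_facts(4)[OF x v g]
        by (simp add: Psi_def lin_sum[OF lin_act] lin_scl[OF lin_act])
    qed
  qed
  have "Psi \<in> ring_hom (kFB d n) E"
  proof (rule ring_hom_memI)
    fix f assume f: "f \<in> carrier (kFB d n)"
    then show "Psi f \<in> carrier E" by (rule car)
    fix g assume g: "g \<in> carrier (kFB d n)"
    have fin: "finite (supp f)" "finite (supp g)" and x: "\<And>x. x \<in> supp f \<Longrightarrow> x \<in> carrier G"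
      "\<And>x. x \<in> supp g \<Longrightarrow> x \<in> carrier G" using f g by (auto simp: ga_carrier)
    show "Psi (f \<otimes>\<^bsub>kFB d n\<^esub> g) = Psi f \<otimes>\<^bsub>E\<^esub> Psi g"
    proof (rule eqI[OF ext])
      fix v assume v: "v \<in> X"
      have gv: "Psi g v \<in> X" using E_closed[OF car[OF g] v] .
      have "Psi f (Psi g v) = (\<Sum>x\<in>supp f. scl (f x) (\<phi> x (\<Sum>y\<in>supp g. scl (g y) (\<phi> y v))))"
        using v gv by (simp add: Psi_def)
      also have "\<dots> = (\<Sum>x\<in>supp f. scl (f x) (\<Sum>y\<in>supp g. scl (g y) (\<phi> x (\<phi> y v))))"
        using x v by (intro sum.cong HOL.refl arg_cong[where f = "scl _"] linear_on_sum[where B = "MV_basis d n N B"] phi_facts(5)[OF _ v] phi_facts(1)) auto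
      finally have *: "Psi f (Psi g v) = \<dots>" .
      \<comment> \<open>\<open>ga_mult_sum\<close> is a statement about scalars, hence the
        comparison of coefficients.\<close>
      have "Poly_Mapping.lookup (Psi (f \<otimes>\<^bsub>kFB d n\<^esub> g) v) k = Poly_Mapping.lookup (Psi f (Psi g v)) k" for k
      proof -
        have "Poly_Mapping.lookup (Psi (f \<otimes>\<^bsub>kFB d n\<^esub> g) v) k = (\<Sum>x\<in>supp f. \<Sum>y\<in>supp g. f x * g y * Poly_Mapping.lookup (\<phi> (x \<otimes>\<^bsub>G\<^esub> y) v) k)"
          using v ga_mult_sum[OF fin, of G "\<lambda>z. Poly_Mapping.lookup (\<phi> z v) k"] by (simp add: Psi_def lookup_sum_vec)
        also have "\<dots> = (\<Sum>x\<in>supp f. \<Sum>y\<in>supp g. f x * g y * Poly_Mapping.lookup (\<phi> x (\<phi> y v)) k)"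
          using x v by (intro sum.cong HOL.refl) (simp add: phi_mult del: \<phi>.hom_mult)
        finally show ?thesis by (simp add: * lookup_sum_vec sum_distrib_left mult.assoc)
      qed
      then show "Psi (f \<otimes>\<^bsub>kFB d n\<^esub> g) v = (Psi f \<otimes>\<^bsub>E\<^esub> Psi g) v"
        using v by (simp add: E_simps compose_def poly_mapping_eqI)
    qed (simp add: E_simps compose_def)
    show "Psi (f \<oplus>\<^bsub>kFB d n\<^esub> g) = Psi f \<oplus>\<^bsub>E\<^esub> Psi g"
    proof (rule eqI[OF ext])
      fix v assume v: "v \<in> X"
      have A: "finite (supp f \<union> supp g)" "supp (f \<oplus>\<^bsub>kFB d n\<^esub> g) \<subseteq> supp f \<union> supp g"
        using fin by (auto simp: ga_simps)
      show "Psi (f \<oplus>\<^bsub>kFB d n\<^esub> g) v = (Psi f \<oplus>\<^bsub>E\<^esub> Psi g) v"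
        using v by (simp add: E_simps Psi_superset[OF A v] Psi_superset[OF A(1) Un_upper1 v]
            Psi_superset[OF A(1) Un_upper2 v] ga_simps kvs.scale_left_distrib sum.distrib)
    qed (simp add: E_simps)
  next
    show "Psi \<one>\<^bsub>kFB d n\<^esub> = \<one>\<^bsub>E\<^esub>"
      by (rule eqI[OF ext]) (auto simp: E_simps Psi_def ga_simps supp_delta, simp add: delta_def \<phi>.hom_one H_simps)
  qed
  moreover have "Psi (c \<odot>\<^bsub>kFB d n\<^esub> f) = c \<odot>\<^bsub>E\<^esub> Psi f" if f: "f \<in> carrier (kFB d n)" for c f
  proof (rule eqI[OF ext])
    fix v assume v: "v \<in> X"
    have A: "finite (supp f)" "supp (c \<odot>\<^bsub>kFB d n\<^esub> f) \<subseteq> supp f"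
      using f by (auto simp: ga_simps ga_carrier)
    show "Psi (c \<odot>\<^bsub>kFB d n\<^esub> f) v = (c \<odot>\<^bsub>E\<^esub> Psi f) v"
      using v by (simp add: E_simps Psi_superset[OF A v] Psi_superset[OF A(1) order_refl v] ga_simps kvs.scale_sum_right)
  qed (simp add: E_simps)
  ultimately show ?thesis by (simp add: alg_hom_def)
qed

lemma Psi_hom: "Psi \<in> ring_hom (kFB d n) E"
  using Psi_alg_hom by (simp add: alg_hom_def)

lemma Psi_delta: "x \<in> carrier G \<Longrightarrow> Psi (delta x) = \<phi> x"
  by (rule extensionalityI[of _ X]) (use phi_E[of x] in \<open>auto simp: Psi_def supp_delta E_carrier\<close>, simp add: delta_def)

lemma delta_carrier: "x \<in> carrier G \<Longrightarrow> delta x \<in> carrier (kFB d n)"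
  by (simp add: ga_carrier supp_delta)

lemma Psi_add: "f \<in> carrier (kFB d n) \<Longrightarrow> g \<in> carrier (kFB d n) \<Longrightarrow> v \<in> X \<Longrightarrow> Psi (f \<oplus>\<^bsub>kFB d n\<^esub> g) v = Psi f v + Psi g v"
  using ring_hom_add[OF Psi_hom] by (simp add: E_simps)

lemma Psi_mult: "f \<in> carrier (kFB d n) \<Longrightarrow> g \<in> carrier (kFB d n) \<Longrightarrow> v \<in> X \<Longrightarrow> Psi (f \<otimes>\<^bsub>kFB d n\<^esub> g) v = Psi f (Psi g v)"
  using ring_hom_mult[OF Psi_hom] by (simp add: E_simps compose_def)

lemma Psi_closed: "f \<in> carrier (kFB d n) \<Longrightarrow> v \<in> X \<Longrightarrow> Psi f v \<in> X"
  by (rule E_closed[OF ring_hom_closed[OF Psi_hom]])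

lemma Psi_0: "Psi f 0 = 0" if "f \<in> carrier (kFB d n)"
  using ring_hom_closed[OF Psi_hom that] linear_on_sum[of "MV_basis d n N B" "Psi f" "{}" "\<lambda>_. 0" "\<lambda>_. 0"]
  by (simp add: E_carrier)

lemma Psi_zero: "v \<in> X \<Longrightarrow> Psi \<zero>\<^bsub>kFB d n\<^esub> v = 0"
  using Psi_add[of "\<zero>\<^bsub>kFB d n\<^esub>" "\<zero>\<^bsub>kFB d n\<^esub>" v] by simp

lemma Psi_minus: "f \<in> carrier (kFB d n) \<Longrightarrow> v \<in> X \<Longrightarrow> Psi (\<ominus>\<^bsub>kFB d n\<^esub> f) v = - Psi f v"
  using Psi_add[of "\<ominus>\<^bsub>kFB d n\<^esub> f" f v] Psi_zero[of v] by (simp add: R.l_neg eq_neg_iff_add_eq_0)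

lemma smult_carrier: "f \<in> carrier (kFB d n) \<Longrightarrow> c \<odot>\<^bsub>kFB d n\<^esub> f \<in> carrier (kFB d n)"
  unfolding ga_carrier by (auto simp: ga_simps intro: finite_subset[of _ "supp f"])

lemma tau_pow_H:
  assumes "i \<in> {1..n}" "\<xi> \<noteq> 0"
  shows "restrict (tau_op \<xi> i) X [^]\<^bsub>H\<^esub> (a :: nat) = restrict (tau_op \<xi> i ^^ a) X"
proof (induction a)
  case 0
  show ?case by (simp add: H_simps restrict_def)
next
  case (Suc a)
  have "restrict (tau_op \<xi> i) X [^]\<^bsub>H\<^esub> Suc a = compose X (restrict (tau_op \<xi> i ^^ a) X) (restrict (tau_op \<xi> i) X)"
    unfolding \<phi>.H.nat_pow_Suc Suc H_simps ..
  also have "\<dots> = restrict (tau_op \<xi> i ^^ Suc a) X"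
    by (rule extensionalityI[of _ X]) (auto simp: compose_def tau_MV funpow_swap1)
  finally show ?case .
qed

text \<open>The negative power becomes a positive power of the inverse, and inverting the framing
  operator means replacing \<open>\<zeta>\<close> by its inverse.\<close>

lemma phi_pow:
  assumes "Suc i < n" "v \<in> X"
  shows "\<phi> (fb d n (T (Suc i)) [^]\<^bsub>G\<^esub> int a \<otimes>\<^bsub>G\<^esub> fb d n (T (Suc (Suc i))) [^]\<^bsub>G\<^esub> (- int a)) v =
    (tau_op \<zeta> (Suc i) ^^ a) ((tau_op (inverse \<zeta>) (Suc (Suc i)) ^^ a) v)"
proof -
  have g: "T (Suc i) \<in> fb_gens n" "T (Suc (Suc i)) \<in> fb_gens n" and i: "Suc i \<in> {1..n}" "Suc (Suc i) \<in> {1..n}"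
    using assms by (auto simp: fb_gens_def)
  have c: "fb d n (T (Suc i)) \<in> carrier G" "fb d n (T (Suc (Suc i))) \<in> carrier G"
    by (rule fb_carrier[OF g(1)], rule fb_carrier[OF g(2)])
  have u: "restrict (tau_op \<zeta> (Suc (Suc i))) X \<in> carrier H" "restrict (tau_op (inverse \<zeta>) (Suc (Suc i))) X \<in> carrier H"
    using tau_unit[OF _ i(2)] zeta by (simp_all add: H_simps)
  have inv: "inv\<^bsub>H\<^esub> restrict (tau_op \<zeta> (Suc (Suc i))) X = restrict (tau_op (inverse \<zeta>) (Suc (Suc i))) X"
  proof (rule \<phi>.H.inv_equality[OF _ u])
    show "restrict (tau_op (inverse \<zeta>) (Suc (Suc i))) X \<otimes>\<^bsub>H\<^esub> restrict (tau_op \<zeta> (Suc (Suc i))) X = \<one>\<^bsub>H\<^esub>"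
      using tau_op_inverse[of "inverse \<zeta>" "Suc (Suc i)"] zeta
      by (auto simp: H_simps compose_def fun_eq_iff restrict_def tau_MV)
  qed
  have 1: "\<phi> (fb d n (T (Suc i)) [^]\<^bsub>G\<^esub> int a) = restrict (tau_op \<zeta> (Suc i) ^^ a) X"
    using c by (simp add: \<phi>.hom_nat_pow gen[OF g(1)] int_pow_int tau_pow_H[OF i(1)] zeta)
  have "\<phi> (fb d n (T (Suc (Suc i))) [^]\<^bsub>G\<^esub> (- int a)) = inv\<^bsub>H\<^esub> (restrict (tau_op \<zeta> (Suc (Suc i))) X [^]\<^bsub>H\<^esub> a)"
    using c u by (simp add: \<phi>.hom_int_pow gen[OF g(2)] \<phi>.H.int_pow_neg_int)
  also have "\<dots> = (inv\<^bsub>H\<^esub> restrict (tau_op \<zeta> (Suc (Suc i))) X) [^]\<^bsub>H\<^esub> a"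
    using u by (simp add: \<phi>.H.nat_pow_inv)
  finally have 2: "\<phi> (fb d n (T (Suc (Suc i))) [^]\<^bsub>G\<^esub> (- int a)) = restrict (tau_op (inverse \<zeta>) (Suc (Suc i)) ^^ a) X"
    unfolding inv using zeta by (simp add: tau_pow_H[OF i(2)])
  have "(tau_op (inverse \<zeta>) (Suc (Suc i)) ^^ a) v \<in> X"
    by (induction a) (auto simp: assms tau_MV)
  then show ?thesis
    using c assms by (subst phi_mult) (simp_all add: 1 2)
qed

lemma Psi_yh_E:
  assumes "Suc i < n" "v \<in> X"
  shows "yh_E d n (Suc i) \<in> carrier (kFB d n)" and "Psi (yh_E d n (Suc i)) v = EE i v"
proof -
  define gg where "gg a = fb d n (T (Suc i)) [^]\<^bsub>G\<^esub> int a \<otimes>\<^bsub>G\<^esub> fb d n (T (Suc (Suc i))) [^]\<^bsub>G\<^esub> (- int a)" for a :: nat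
  have g: "T (Suc i) \<in> fb_gens n" "T (Suc (Suc i)) \<in> fb_gens n"
    using assms by (auto simp: fb_gens_def)
  have gc: "gg a \<in> carrier G" for a
    unfolding gg_def using fb_carrier[OF g(1)] fb_carrier[OF g(2)] by simp
  have yE: "yh_E d n (Suc i) = (\<lambda>z. 1 / of_nat d * (\<Sum>a\<in>{1..d}. delta (gg a) z))"
    by (simp add: yh_E_def gg_def)
  let ?A = "gg ` {1..d}"
  have sub: "supp (yh_E d n (Suc i)) \<subseteq> ?A"
  proof
    fix z assume "z \<in> supp (yh_E d n (Suc i))"
    then have "(\<Sum>a\<in>{1..d}. delta (gg a) z) \<noteq> 0" by (simp add: yE)
    then obtain a where "a \<in> {1..d}" "delta (gg a) z \<noteq> 0" by (meson sum.not_neutral_contains_not_neutral)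
    then show "z \<in> ?A" by (auto simp: delta_def split: if_splits)
  qed
  show "yh_E d n (Suc i) \<in> carrier (kFB d n)"
    unfolding ga_carrier using sub gc by (auto intro: finite_subset[OF sub])
  have "Psi (yh_E d n (Suc i)) v = (\<Sum>x\<in>?A. scl (1 / of_nat d * (\<Sum>a\<in>{1..d}. delta (gg a) x)) (\<phi> x v))"
    by (subst Psi_superset[OF _ sub assms(2)]) (simp_all add: yE)
  \<comment> \<open>No injectivity of \<open>gg\<close> is assumed: exchanging the sums over its
    image and over a makes each exponent contribute exactly once.\<close>
  also have "\<dots> = scl (1 / of_nat d) (\<Sum>x\<in>?A. \<Sum>a\<in>{1..d}. if x = gg a then \<phi> x v else 0)"
    by (auto simp: kvs.scale_sum_right kvs.scale_sum_left sum_distrib_left delta_def intro!: sum.cong)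
  also have "(\<Sum>x\<in>?A. \<Sum>a\<in>{1..d}. if x = gg a then \<phi> x v else 0) = (\<Sum>a\<in>{1..d}. \<Sum>x\<in>?A. if x = gg a then \<phi> x v else 0)"
    by (rule sum.swap)
  also have "\<dots> = (\<Sum>a\<in>{1..d}. \<phi> (gg a) v)"
    by (intro sum.cong HOL.refl) (simp add: sum.delta)
  also have "\<dots> = scl (of_nat d) (EE i v)"
    unfolding gg_def phi_pow[OF assms] by (rule sum_tau_EE[OF X_tb[OF assms(2)] assms(1) prim])
  finally show "Psi (yh_E d n (Suc i)) v = EE i v"
    using d by (simp add: of_nat_kk)
qed

lemma Psi_yh_rel:
  assumes "i \<in> {1..<n}" "v \<in> X"
  shows "yh_rel d n i \<in> carrier (kFB d n)" and "Psi (yh_rel d n i) v = 0"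
proof -
  obtain j where i: "i = Suc j" and j: "Suc j < n" using assms by (cases i) auto
  have g: "S (Suc j) \<in> fb_gens n" using j by (simp add: fb_gens_def)
  let ?s = "delta (fb d n (S (Suc j)))"
  have s: "?s \<in> carrier (kFB d n)" by (rule delta_carrier[OF fb_carrier[OF g]])
  have Ps: "Psi ?s v = sigi N j v" if "v \<in> X" for v
    using that by (simp add: Psi_delta[OF fb_carrier[OF g]] gen[OF g])
  note E = Psi_yh_E(1)[OF j assms(2)]
  have sv: "sigi N j v \<in> X" by (rule sigi_MV(1)[OF j assms(2)])
  have Pm: "Psi (c \<odot>\<^bsub>kFB d n\<^esub> f) v = scl c (Psi f v)" if "f \<in> carrier (kFB d n)" for c f
    using Psi_alg_hom that assms(2) by (simp add: alg_hom_def E_simps)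
  have P1: "Psi \<one>\<^bsub>kFB d n\<^esub> v = v"
    using ring_hom_one[OF Psi_hom] assms(2) by (simp add: E_simps)
  show "yh_rel d n i \<in> carrier (kFB d n)"
    unfolding yh_rel_def i using s E smult_carrier by simp
  show "Psi (yh_rel d n i) v = 0"
    unfolding yh_rel_def i R.minus_eq
    using s E smult_carrier assms(2) sv sigi_MV(2)[OF j assms(2)]
    by (simp add: Psi_add Psi_minus Psi_mult Pm P1 Ps Psi_yh_E(2)[OF j sv] lam_def)
qed

text \<open>A product with the annihilating element on the right acts as an operator applied to 0,
  which \<open>Psi_0\<close> handles; with it on the left, stability of X is what counts. Since the
  relators lie in this ideal, so does the ideal they generate.\<close>

lemma Psi_ideal: "ideal {f \<in> carrier (kFB d n). \<forall>v\<in>X. Psi f v = 0} (kFB d n)" (is "ideal ?I _")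
proof (rule idealI[OF R.ring_axioms])
  show "subgroup ?I (add_monoid (kFB d n))"
  proof (rule group.subgroupI[OF R.a_group])
    show "?I \<noteq> {}" using Psi_zero by blast
    show "inv\<^bsub>add_monoid (kFB d n)\<^esub> a \<in> ?I" if "a \<in> ?I" for a
      using that Psi_minus[of a] R.a_inv_closed[of a] by (simp add: a_inv_def)
    show "a \<otimes>\<^bsub>add_monoid (kFB d n)\<^esub> b \<in> ?I" if "a \<in> ?I" "b \<in> ?I" for a b
      using that by (simp add: Psi_add)
  qed auto
  fix a x assume a: "a \<in> ?I" and x: "x \<in> carrier (kFB d n)"
  show "x \<otimes>\<^bsub>kFB d n\<^esub> a \<in> ?I" "a \<otimes>\<^bsub>kFB d n\<^esub> x \<in> ?I"
    using a x by (auto simp: Psi_mult Psi_0 Psi_closed)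
qed

lemma Psi_quotient:
  obtains \<Phi> where "\<Phi> \<in> alg_hom (YH_aff d n) E"
    "\<And>x. x \<in> fb_gens n \<Longrightarrow> \<Phi> (yh d n x) = restrict (opr x) X"
proof -
  \<comment> \<open>Membership of the relators in the carrier is stated relative to a vector of X;
    the zero vector supplies one.\<close>
  have rel: "yh_rel d n ` {1..<n} \<subseteq> {f \<in> carrier (kFB d n). \<forall>v\<in>X. Psi f v = 0}"
    using Psi_yh_rel Psi_yh_rel(1)[OF _ fsp_0] by blast
  then have J: "ideal (yh_ideal d n) (kFB d n)"
    unfolding yh_ideal_def by (intro R.genideal_ideal) auto
  have J0: "yh_ideal d n \<subseteq> {f \<in> carrier (kFB d n). \<forall>v\<in>X. Psi f v = 0}"
    unfolding yh_ideal_def by (rule R.genideal_minimal[OF Psi_ideal rel])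
  have ker: "Psi (x \<oplus>\<^bsub>kFB d n\<^esub> y) = Psi y" if "x \<in> yh_ideal d n" "y \<in> carrier (kFB d n)" for x y
  proof (rule extensionalityI[of _ X])
    show "Psi (x \<oplus>\<^bsub>kFB d n\<^esub> y) v = Psi y v" if "v \<in> X" for v
      using that \<open>x \<in> _\<close> \<open>y \<in> _\<close> J0 by (auto simp: Psi_add)
  qed (simp_all add: Psi_def)
  obtain \<Phi> where \<Phi>: "\<Phi> \<in> alg_hom (YH_aff d n) E"
      "\<And>x. x \<in> carrier (kFB d n) \<Longrightarrow> \<Phi> (yh_ideal d n +>\<^bsub>kFB d n\<^esub> x) = Psi x"
    unfolding YH_aff_def
    by (rule quot_algebra_hom[OF J Psi_alg_hom]) (erule smult_carrier, erule (1) ker, blast)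
  have "\<Phi> (yh d n x) = restrict (opr x) X" if "x \<in> fb_gens n" for x
    using that by (simp add: yh_def \<Phi>(2) delta_carrier fb_carrier Psi_delta gen)
  with \<Phi>(1) that show ?thesis by blast
qed

end

text \<open>Only i = 0 has content: there the double braiding of the given module is replaced by
  that of its extension.\<close>

lemma sigma_op_opr: "i < n \<Longrightarrow> restrict (sigma_op N \<rho> i) X = restrict (opr (S i)) X"
proof (cases i)
  case 0
  have "sigma_op N \<rho> 0 v = sig0 Kb v" if "v \<in> X" for v
    unfolding sigma_op_0 by (rule sig0_cong_MV[OF agree_Kb n that])
  then show ?thesis by (auto simp: 0 restrict_def fun_eq_iff)
qed (simp add: sigma_op_Suc)

lemma existence:
  "\<exists>\<Phi> \<in> alg_hom (YH_aff d n) (End_A d n N B \<rho>).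
     (\<forall>i\<in>{1..n}. \<Phi> (yh d n (T i)) = restrict (tau_op \<zeta> i) (fsp (MV_basis d n N B))) \<and>
     (\<forall>i\<in>{0..<n}. \<Phi> (yh d n (S i)) = restrict (sigma_op N \<rho> i) (fsp (MV_basis d n N B)))"
proof -
  have "restrict (opr x) X \<in> carrier H" if "x \<in> fb_gens n" for x
    using opr_unit(1)[OF that] by (simp add: H_simps)
  from presented_group_hom[OF group_H this relations]
  obtain \<phi> where \<phi>: "\<phi> \<in> hom G H" "\<And>x. x \<in> fb_gens n \<Longrightarrow> \<phi> (fb d n x) = restrict (opr x) X"
    unfolding FB_aff_def fb_def by blast
  from Psi_quotient[OF \<phi>] obtain \<Phi> where \<Phi>: "\<Phi> \<in> alg_hom (YH_aff d n) E"
    "\<And>x. x \<in> fb_gens n \<Longrightarrow> \<Phi> (yh d n x) = restrict (opr x) X" by blast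
  show ?thesis
  proof (intro bexI[OF _ \<Phi>(1)] conjI ballI)
    show "\<Phi> (yh d n (T i)) = restrict (tau_op \<zeta> i) X" if "i \<in> {1..n}" for i
      using \<Phi>(2)[of "T i"] that by (simp add: fb_gens_def)
    show "\<Phi> (yh d n (S i)) = restrict (sigma_op N \<rho> i) X" if "i \<in> {0..<n}" for i
      using \<Phi>(2)[of "S i"] that by (simp add: fb_gens_def sigma_op_opr)
  qed
qed

end

theorem theorem5p15:
  fixes d n :: nat
    and N :: "nat \<Rightarrow> nat"
    and \<zeta> :: kk
    and B :: "nat \<Rightarrow> 'm set"
    and \<rho> :: "nat \<Rightarrow> uqgen \<Rightarrow> 'm oper"
  assumes "d \<ge> 1" and "n \<ge> 1"
    and "\<And>b. b \<in> {1..d} \<Longrightarrow> N b > 1"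
    and "primitive_root_of_unity d \<zeta>"
    and "\<And>b. b \<in> {1..d} \<Longrightarrow> category_O (N b) (B b) (\<rho> b)"
  shows "\<exists>\<Phi> \<in> alg_hom (YH_aff d n) (End_A d n N B \<rho>).
           (\<forall>i\<in>{1..n}. \<Phi> (yh d n (T i)) = restrict (tau_op \<zeta> i) (fsp (MV_basis d n N B))) \<and>
           (\<forall>i\<in>{0..<n}. \<Phi> (yh d n (S i)) = restrict (sigma_op N \<rho> i) (fsp (MV_basis d n N B)))"
proof -
  interpret yh_action d n N \<zeta> B \<rho>
    by standard (use assms in \<open>auto simp: category_O_def\<close>)
  show ?thesis by (rule existence)
qed

end
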